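(* Let $A$ be an $\mathcal{O}$-algebra which is free of finite rank as an $\mathcal{O}$-module. Suppose that $k\otimes_{\mathcal{O}}A$ is split and has a symmetric positive definite Cartan matrix. Then for every invertible $A$-$A$-bimodule $M$ we have $\mathrm{rk}_{\mathcal{O}}(M)\leq\mathrm{rk}_{\mathcal{O}}(A)$. Moreover, we have $\mathrm{rk}_{\mathcal{O}}(M)=\mathrm{rk}_{\mathcal{O}}(A)$ if and only if $M\cong A_\alpha$ as $A$-$A$-bimodules for some $\mathcal{O}$-algebra automorphism $\alpha$ of $A$.
   Context: Let $p$ be a prime and $k$ a perfect field of characteristic $p$. $\mathcal{O}$ is either a complete discrete valuation ring with residue field $k$ and field of fractions of characteristic zero, or $\mathcal{O}=k$. An $A$-$A$-bimodule $M$ (with the left and right actions of $\mathcal{O}$ coinciding) is invertible if it is finitely generated projective as a left and as a right $A$-module and there is an $A$-$A$-bimodule $M'$, also finitely generated projective on each side, with $M\otimes_A M'\cong A\cong M'\otimes_A M$ as bimodules. A finite-dimensional $k$-algebra is split if the endomorphism algebra of each of its simple modules is $k$. The Cartan matrix of a split finite-dimensional $k$-algebra $\bar A$ is $(\dim_k(i\bar Aj))_{i,j}$, where $i,j$ run over a set of representatives of the conjugacy classes of primitive idempotents in $\bar A$. For $\alpha\in\mathrm{Aut}(A)$, $A_\alpha$ is the $A$-$A$-bimodule equal to $A$ as a left $A$-module, with $a\in A$ acting on the right as multiplication by $\alpha(a)$. *)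

theory Defs
  imports
    "HOL-Algebra.Free_Abelian_Groups"
    "HOL-Algebra.Ideal_Product"
    "HOL-Algebra.Ring_Divisibility"
    "HOL-Computational_Algebra.Primes"
    "Jordan_Normal_Form.Missing_VectorSpace"
begin

section \<open>Coefficient rings\<close>

definition has_char :: "('a, 'b) ring_scheme \<Rightarrow> nat \<Rightarrow> bool" where
  "has_char R n \<longleftrightarrow> (\<forall>m::nat. [m] \<cdot>\<^bsub>R\<^esub> \<one>\<^bsub>R\<^esub> = \<zero>\<^bsub>R\<^esub> \<longleftrightarrow> n dvd m)"

text \<open>In characteristic p, a field is perfect iff its Frobenius endomorphism is surjective.\<close>
definition perfect_field_of_char :: "('a, 'b) ring_scheme \<Rightarrow> nat \<Rightarrow> bool" where
  "perfect_field_of_char k p \<longleftrightarrow> field k \<and> has_char k p \<and>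
     (\<forall>x\<in>carrier k. \<exists>y\<in>carrier k. y [^]\<^bsub>k\<^esub> p = x)"

definition discrete_valuation_ring :: "('a, 'b) ring_scheme \<Rightarrow> bool" where
  "discrete_valuation_ring R \<longleftrightarrow>
     principal_domain R \<and> \<not> field R \<and> (\<exists>!\<mm>. maximalideal \<mm> R)"

definition adically_complete :: "('a, 'b) ring_scheme \<Rightarrow> 'a set \<Rightarrow> bool" where
  "adically_complete R \<mm> \<longleftrightarrow>
     (\<forall>x::nat \<Rightarrow> 'a. (\<forall>i. x i \<in> carrier R) \<longrightarrow>
        (\<forall>n::nat. \<exists>N. \<forall>i\<ge>N. \<forall>j\<ge>N. x i \<ominus>\<^bsub>R\<^esub> x j \<in> \<mm> [^]\<^bsub>ideals_set R\<^esub> n) \<longrightarrow>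
        (\<exists>y\<in>carrier R. \<forall>n::nat. \<exists>N. \<forall>i\<ge>N. x i \<ominus>\<^bsub>R\<^esub> y \<in> \<mm> [^]\<^bsub>ideals_set R\<^esub> n))"

definition complete_discrete_valuation_ring :: "('a, 'b) ring_scheme \<Rightarrow> bool" where
  "complete_discrete_valuation_ring R \<longleftrightarrow>
     discrete_valuation_ring R \<and> (\<forall>\<mm>. maximalideal \<mm> R \<longrightarrow> adically_complete R \<mm>)"

text \<open>
  The surjection \<open>\<pi>\<close> from \<open>R\<close> onto the field \<open>k\<close> identifies \<open>k\<close> with the residue field of \<open>R\<close>:
  its kernel is a maximal ideal, hence the only one if \<open>R\<close> is a discrete valuation ring.
  The second alternative is the case that \<open>R\<close> is \<open>k\<close> itself, \<open>\<pi>\<close> being the identification.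
  A domain and its field of fractions have the same characteristic.
\<close>
definition coefficient_ring ::
    "nat \<Rightarrow> 'k ring \<Rightarrow> 'r ring \<Rightarrow> ('r \<Rightarrow> 'k) \<Rightarrow> bool" where
  "coefficient_ring p k R \<pi> \<longleftrightarrow>
     perfect_field_of_char k p \<and>
     (complete_discrete_valuation_ring R \<and> has_char R 0 \<and>
        \<pi> \<in> ring_hom R k \<and> \<pi> ` carrier R = carrier k
      \<or> field R \<and> \<pi> \<in> ring_iso R k)"


section \<open>Algebras and modules over noncommutative rings\<close>

text \<open>The library's locale \<^locale>\<open>algebra\<close> is restricted to commutative algebras.\<close>
locale assoc_algebra = module R A + A?: ring A for R and A (structure) +
  assumes smult_mult_left:
      "\<lbrakk>r \<in> carrier R; a \<in> carrier A; b \<in> carrier A\<rbrakk> \<Longrightarrow> (r \<odot> a) \<otimes> b = r \<odot> (a \<otimes> b)"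
    and smult_mult_right:
      "\<lbrakk>r \<in> carrier R; a \<in> carrier A; b \<in> carrier A\<rbrakk> \<Longrightarrow> a \<otimes> (r \<odot> b) = r \<odot> (a \<otimes> b)"

text \<open>As in the library, modules live in a record extending that of rings, whose fields
  \<^const>\<open>monoid.mult\<close> and \<^const>\<open>monoid.one\<close> carry no meaning.\<close>
locale left_module = A?: ring A + M?: abelian_group M
  for A :: "('a, 'b) ring_scheme" and M :: "('a, 'm, 'c) module_scheme" (structure) +
  assumes act_closed: "\<lbrakk>a \<in> carrier A; x \<in> carrier M\<rbrakk> \<Longrightarrow> a \<odot> x \<in> carrier M"
    and act_l_distr: "\<lbrakk>a \<in> carrier A; b \<in> carrier A; x \<in> carrier M\<rbrakk> \<Longrightarrow>
          (a \<oplus>\<^bsub>A\<^esub> b) \<odot> x = a \<odot> x \<oplus> b \<odot> x"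
    and act_r_distr: "\<lbrakk>a \<in> carrier A; x \<in> carrier M; y \<in> carrier M\<rbrakk> \<Longrightarrow>
          a \<odot> (x \<oplus> y) = a \<odot> x \<oplus> a \<odot> y"
    and act_assoc: "\<lbrakk>a \<in> carrier A; b \<in> carrier A; x \<in> carrier M\<rbrakk> \<Longrightarrow>
          (a \<otimes>\<^bsub>A\<^esub> b) \<odot> x = a \<odot> (b \<odot> x)"
    and act_one: "x \<in> carrier M \<Longrightarrow> \<one>\<^bsub>A\<^esub> \<odot> x = x"

definition restrict_scalars :: "('r, 'a) module \<Rightarrow> ('a, 'm, 'c) module_scheme \<Rightarrow> ('r, 'm) module"
  where "restrict_scalars A M =
    \<lparr>carrier = carrier M, monoid.mult = monoid.mult M, monoid.one = monoid.one M,
     ring.zero = ring.zero M, ring.add = ring.add M,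
     smult = (\<lambda>r x. (r \<odot>\<^bsub>A\<^esub> \<one>\<^bsub>A\<^esub>) \<odot>\<^bsub>M\<^esub> x)\<rparr>"

definition opposite_ring :: "('a, 'b) ring_scheme \<Rightarrow> ('a, 'b) ring_scheme" where
  "opposite_ring A = A\<lparr>monoid.mult := (\<lambda>x y. y \<otimes>\<^bsub>A\<^esub> x)\<rparr>"

definition simple_module :: "('a, 'b) ring_scheme \<Rightarrow> ('a, 'm, 'c) module_scheme \<Rightarrow> bool" where
  "simple_module A S \<longleftrightarrow> left_module A S \<and> carrier S \<noteq> {\<zero>\<^bsub>S\<^esub>} \<and>
     (\<forall>U. Module.submodule U A S \<longrightarrow> U = {\<zero>\<^bsub>S\<^esub>} \<or> U = carrier S)"

text \<open>Isomorphic to a direct summand of the free left module \<open>A\<^sup>n\<close> for some \<open>n\<close>.\<close>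
definition fg_projective :: "('a, 'b) ring_scheme \<Rightarrow> ('a, 'm, 'c) module_scheme \<Rightarrow> bool" where
  "fg_projective A P \<longleftrightarrow>
     (\<exists>(n::nat) U V f. let F = ring.func_space A {..<n} in
        Module.submodule U A F \<and> Module.submodule V A F \<and>
        U \<inter> V = {\<zero>\<^bsub>F\<^esub>} \<and> U <+>\<^bsub>F\<^esub> V = carrier F \<and>
        f \<in> module_hom A P (F\<lparr>carrier := U\<rparr>) \<and> bij_betw f (carrier P) U)"

definition finite_basis :: "('r, 'b) ring_scheme \<Rightarrow> ('r, 'm, 'c) module_scheme \<Rightarrow> 'm set \<Rightarrow> bool"
  where "finite_basis R M B \<longleftrightarrow> finite B \<and> B \<subseteq> carrier M \<and>
    \<not> module.lin_dep R M B \<and> module.span R M B = carrier M"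

definition free_of_finite_rank :: "('r, 'b) ring_scheme \<Rightarrow> ('r, 'm, 'c) module_scheme \<Rightarrow> bool"
  where "free_of_finite_rank R M \<longleftrightarrow> module R M \<and> (\<exists>B. finite_basis R M B)"

definition rk :: "('r, 'b) ring_scheme \<Rightarrow> ('r, 'm, 'c) module_scheme \<Rightarrow> nat" where
  "rk R M = (THE n. \<exists>B. finite_basis R M B \<and> card B = n)"


section \<open>Tensor products\<close>

text \<open>The tensor product of a right \<open>A\<close>-module \<open>N\<close>, with action \<open>r\<close>, and a left \<open>A\<close>-module \<open>M\<close> is
  the free abelian group on pairs modulo the subgroup generated by the biadditivity and
  \<open>A\<close>-balancedness relators.\<close>

definition tensor_relators :: "('a, 'b) ring_scheme \<Rightarrow> ('n, 'c) ring_scheme \<Rightarrow> ('n \<Rightarrow> 'a \<Rightarrow> 'n) \<Rightarrow>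
    ('a, 'm, 'd) module_scheme \<Rightarrow> ('n \<times> 'm \<Rightarrow>\<^sub>0 int) set" where
  "tensor_relators A N r M =
     {frag_of (x \<oplus>\<^bsub>N\<^esub> y, m) - frag_of (x, m) - frag_of (y, m) | x y m.
        x \<in> carrier N \<and> y \<in> carrier N \<and> m \<in> carrier M} \<union>
     {frag_of (x, l \<oplus>\<^bsub>M\<^esub> m) - frag_of (x, l) - frag_of (x, m) | x l m.
        x \<in> carrier N \<and> l \<in> carrier M \<and> m \<in> carrier M} \<union>
     {frag_of (r x a, m) - frag_of (x, a \<odot>\<^bsub>M\<^esub> m) | x a m.
        x \<in> carrier N \<and> a \<in> carrier A \<and> m \<in> carrier M}"

definition tensor_kernel :: "('a, 'b) ring_scheme \<Rightarrow> ('n, 'c) ring_scheme \<Rightarrow> ('n \<Rightarrow> 'a \<Rightarrow> 'n) \<Rightarrow>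
    ('a, 'm, 'd) module_scheme \<Rightarrow> ('n \<times> 'm \<Rightarrow>\<^sub>0 int) set" where
  "tensor_kernel A N r M =
     generate (free_Abelian_group (carrier N \<times> carrier M)) (tensor_relators A N r M)"

text \<open>In the next two definitions, operations on cosets are given by the unions of the cosets of the
  values at all representatives; by well-definedness each such union is a single coset.\<close>

text \<open>The \<open>k\<close>-algebra \<open>k \<otimes>\<^sub>R A\<close>, with \<open>k\<close> an \<open>R\<close>-module via \<open>\<pi>\<close>.\<close>
definition scalar_extension :: "'k ring \<Rightarrow> 'r ring \<Rightarrow> ('r \<Rightarrow> 'k) \<Rightarrow> ('r, 'a) module \<Rightarrow>
    ('k, ('k \<times> 'a \<Rightarrow>\<^sub>0 int) set) module" where
  "scalar_extension k R \<pi> A =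
     (let F = free_Abelian_group (carrier k \<times> carrier A);
          K = tensor_kernel R k (\<lambda>c r. c \<otimes>\<^bsub>k\<^esub> \<pi> r) A
      in \<lparr>carrier = carrier (F Mod K),
          monoid.mult = (\<lambda>U V. \<Union>x\<in>U. \<Union>y\<in>V. K #>\<^bsub>F\<^esub>
            frag_extend (\<lambda>(c, a). frag_extend (\<lambda>(d, b). frag_of (c \<otimes>\<^bsub>k\<^esub> d, a \<otimes>\<^bsub>A\<^esub> b)) y) x),
          monoid.one = K #>\<^bsub>F\<^esub> frag_of (\<one>\<^bsub>k\<^esub>, \<one>\<^bsub>A\<^esub>),
          ring.zero = \<one>\<^bsub>F Mod K\<^esub>,
          ring.add = monoid.mult (F Mod K),
          smult = (\<lambda>c U. \<Union>x\<in>U. K #>\<^bsub>F\<^esub> frag_extend (\<lambda>(d, b). frag_of (c \<otimes>\<^bsub>k\<^esub> d, b)) x)\<rparr>)"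


section \<open>Bimodules\<close>

record ('a, 'm) bimodule = "('a, 'm) module" +
  rsmult :: "'m \<Rightarrow> 'a \<Rightarrow> 'm"

text \<open>Right \<open>A\<close>-modules are left modules over the opposite ring.\<close>
definition right_part :: "('a, 'm) bimodule \<Rightarrow> ('a, 'm) bimodule" where
  "right_part M = M\<lparr>smult := (\<lambda>a x. rsmult M x a)\<rparr>"

text \<open>\<open>A\<close>-\<open>A\<close>-bimodules on which the two actions of \<open>R\<close> coincide.\<close>
locale bimodule =
  fixes R :: "'r ring" and A :: "('r, 'a) module" and M :: "('a, 'm) bimodule"
  assumes left: "left_module A M"
    and right: "left_module (opposite_ring A) (right_part M)"
    and assoc: "\<lbrakk>a \<in> carrier A; b \<in> carrier A; x \<in> carrier M\<rbrakk> \<Longrightarrow>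
          rsmult M (a \<odot>\<^bsub>M\<^esub> x) b = a \<odot>\<^bsub>M\<^esub> rsmult M x b"
    and central: "\<lbrakk>r \<in> carrier R; x \<in> carrier M\<rbrakk> \<Longrightarrow>
          (r \<odot>\<^bsub>A\<^esub> \<one>\<^bsub>A\<^esub>) \<odot>\<^bsub>M\<^esub> x = rsmult M x (r \<odot>\<^bsub>A\<^esub> \<one>\<^bsub>A\<^esub>)"

definition bimodule_isomorphic ::
    "('r, 'a) module \<Rightarrow> ('a, 'm) bimodule \<Rightarrow> ('a, 'n) bimodule \<Rightarrow> bool" where
  "bimodule_isomorphic A M N \<longleftrightarrow>
     (\<exists>f \<in> module_hom A M N. bij_betw f (carrier M) (carrier N) \<and>
        (\<forall>x\<in>carrier M. \<forall>a\<in>carrier A. f (rsmult M x a) = rsmult N (f x) a))"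

definition twisted_bimodule :: "('r, 'a) module \<Rightarrow> ('a \<Rightarrow> 'a) \<Rightarrow> ('a, 'a) bimodule" where
  "twisted_bimodule A \<alpha> =
    \<lparr>carrier = carrier A, monoid.mult = monoid.mult A, monoid.one = monoid.one A,
     ring.zero = ring.zero A, ring.add = ring.add A,
     smult = (\<lambda>a x. a \<otimes>\<^bsub>A\<^esub> x), rsmult = (\<lambda>x a. x \<otimes>\<^bsub>A\<^esub> \<alpha> a)\<rparr>"

abbreviation regular_bimodule :: "('r, 'a) module \<Rightarrow> ('a, 'a) bimodule" where
  "regular_bimodule A \<equiv> twisted_bimodule A (\<lambda>a. a)"

definition tensor_bimodule :: "('r, 'a) module \<Rightarrow> ('a, 'n) bimodule \<Rightarrow> ('a, 'm) bimodule \<Rightarrow>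
    ('a, ('n \<times> 'm \<Rightarrow>\<^sub>0 int) set) bimodule" where
  "tensor_bimodule A N M =
     (let F = free_Abelian_group (carrier N \<times> carrier M);
          K = tensor_kernel A N (rsmult N) M
      in \<lparr>carrier = carrier (F Mod K), monoid.mult = undefined, monoid.one = undefined,
          ring.zero = \<one>\<^bsub>F Mod K\<^esub>,
          ring.add = monoid.mult (F Mod K),
          smult = (\<lambda>a U. \<Union>x\<in>U. K #>\<^bsub>F\<^esub> frag_extend (\<lambda>(n, m). frag_of (a \<odot>\<^bsub>N\<^esub> n, m)) x),
          rsmult = (\<lambda>U a. \<Union>x\<in>U. K #>\<^bsub>F\<^esub> frag_extend (\<lambda>(n, m). frag_of (n, rsmult M m a)) x)\<rparr>)"

definition biprojective_bimodule :: "'r ring \<Rightarrow> ('r, 'a) module \<Rightarrow> ('a, 'm) bimodule \<Rightarrow> bool" where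
  "biprojective_bimodule R A M \<longleftrightarrow> bimodule R A M \<and>
     fg_projective A M \<and> fg_projective (opposite_ring A) (right_part M)"

text \<open>The first argument fixes the type in which the elements of the inverse bimodule live.\<close>
definition invertible_bimodule ::
    "'n itself \<Rightarrow> 'r ring \<Rightarrow> ('r, 'a) module \<Rightarrow> ('a, 'm) bimodule \<Rightarrow> bool" where
  "invertible_bimodule (_ :: 'n itself) R A M \<longleftrightarrow> biprojective_bimodule R A M \<and>
     (\<exists>M' :: ('a, 'n) bimodule. biprojective_bimodule R A M' \<and>
        bimodule_isomorphic A (tensor_bimodule A M M') (regular_bimodule A) \<and>
        bimodule_isomorphic A (tensor_bimodule A M' M) (regular_bimodule A))"

definition algebra_automorphism :: "'r ring \<Rightarrow> ('r, 'a) module \<Rightarrow> ('a \<Rightarrow> 'a) \<Rightarrow> bool" where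
  "algebra_automorphism R A \<alpha> \<longleftrightarrow> \<alpha> \<in> ring_iso A A \<and>
     (\<forall>r\<in>carrier R. \<forall>a\<in>carrier A. \<alpha> (r \<odot>\<^bsub>A\<^esub> a) = r \<odot>\<^bsub>A\<^esub> \<alpha> a)"


section \<open>Split algebras and Cartan matrices\<close>

text \<open>The structural map from \<open>k\<close> to the endomorphism algebra of each simple module is bijective.
  Simple modules \<open>S\<close> with elements in \<^typ>\<open>'b set\<close> suffice, as every simple \<open>B\<close>-module is
  isomorphic to some \<open>B/L\<close>, whose elements are cosets.\<close>
definition split_algebra :: "'k ring \<Rightarrow> ('k, 'b) module \<Rightarrow> bool" where
  "split_algebra k B \<longleftrightarrow>
     (\<forall>S :: ('b, 'b set) module. simple_module B S \<longrightarrow>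
        bij_betw (\<lambda>c. \<lambda>s\<in>carrier S. c \<odot>\<^bsub>restrict_scalars B S\<^esub> s)
          (carrier k) (module_hom B S S \<inter> extensional (carrier S)))"

definition idempotent :: "('b, 'c) ring_scheme \<Rightarrow> 'b \<Rightarrow> bool" where
  "idempotent B i \<longleftrightarrow> i \<in> carrier B \<and> i \<otimes>\<^bsub>B\<^esub> i = i"

definition primitive_idempotent :: "('b, 'c) ring_scheme \<Rightarrow> 'b \<Rightarrow> bool" where
  "primitive_idempotent B i \<longleftrightarrow> idempotent B i \<and> i \<noteq> \<zero>\<^bsub>B\<^esub> \<and>
     \<not> (\<exists>e f. idempotent B e \<and> idempotent B f \<and> e \<noteq> \<zero>\<^bsub>B\<^esub> \<and> f \<noteq> \<zero>\<^bsub>B\<^esub> \<and>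
          e \<otimes>\<^bsub>B\<^esub> f = \<zero>\<^bsub>B\<^esub> \<and> f \<otimes>\<^bsub>B\<^esub> e = \<zero>\<^bsub>B\<^esub> \<and> i = e \<oplus>\<^bsub>B\<^esub> f)"

definition conjugate :: "('b, 'c) ring_scheme \<Rightarrow> 'b \<Rightarrow> 'b \<Rightarrow> bool" where
  "conjugate B i j \<longleftrightarrow> (\<exists>u\<in>Units B. j = u \<otimes>\<^bsub>B\<^esub> i \<otimes>\<^bsub>B\<^esub> inv\<^bsub>B\<^esub> u)"

definition primitive_idempotent_representatives :: "('b, 'c) ring_scheme \<Rightarrow> 'b set \<Rightarrow> bool" where
  "primitive_idempotent_representatives B I \<longleftrightarrow>
     (\<forall>i\<in>I. primitive_idempotent B i) \<and>
     (\<forall>j. primitive_idempotent B j \<longrightarrow> (\<exists>!i. i \<in> I \<and> conjugate B i j))"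

definition cartan_matrix :: "'k ring \<Rightarrow> ('k, 'b) module \<Rightarrow> 'b \<Rightarrow> 'b \<Rightarrow> nat" where
  "cartan_matrix k B i j =
     vectorspace.dim k (B\<lparr>carrier := {i \<otimes>\<^bsub>B\<^esub> b \<otimes>\<^bsub>B\<^esub> j | b. b \<in> carrier B}\<rparr>)"

definition symmetric_matrix :: "'i set \<Rightarrow> ('i \<Rightarrow> 'i \<Rightarrow> nat) \<Rightarrow> bool" where
  "symmetric_matrix I C \<longleftrightarrow> (\<forall>i\<in>I. \<forall>j\<in>I. C i j = C j i)"

definition positive_definite_matrix :: "'i set \<Rightarrow> ('i \<Rightarrow> 'i \<Rightarrow> nat) \<Rightarrow> bool" where
  "positive_definite_matrix I C \<longleftrightarrow> finite I \<and>
     (\<forall>x::'i \<Rightarrow> real. (\<exists>i\<in>I. x i \<noteq> 0) \<longrightarrow>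
        (\<Sum>i\<in>I. \<Sum>j\<in>I. x i * real (C i j) * x j) > 0)"

end

theory Submission
  imports Defs
begin

text \<open>
  Reduction modulo the maximal ideal turns \<open>A\<close> into a finite-dimensional \<open>k\<close>-algebra \<open>B\<close> and \<open>M\<close>
  into a bimodule \<open>N\<close> which is projective as a left module, and whose left endomorphisms are exactly
  the right multiplications by elements of \<open>B\<close>. Write \<open>1\<close> as a sum of orthogonal primitive idempotents
  \<open>e\<close>, and let \<open>\<epsilon> e\<close> be the representative conjugate to \<open>e\<close>. Every \<open>N e\<close> is an indecomposable
  projective left module, hence isomorphic to \<open>B (\<kappa> e)\<close> for some representative \<open>\<kappa> e\<close>, and
  \<open>e B a = Hom (N e, N a)\<close> has the dimension of \<open>(\<kappa> e) B (\<kappa> a)\<close>. If \<open>x\<close> and \<open>y\<close> count how often each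
  representative is a value of \<open>\<epsilon>\<close> and of \<open>\<kappa>\<close>, and \<open>C\<close> is the Cartan matrix, then
  \<open>dim B = x\<^sup>t C x = y\<^sup>t C y\<close> and \<open>dim N = x\<^sup>t C y\<close>, so that
  \<open>2 (dim B - dim N) = (x - y)\<^sup>t C (x - y) \<ge> 0\<close>. Equality forces \<open>x = y\<close>, which makes \<open>N\<close> isomorphic
  to \<open>B\<close> as a left module. By Nakayama's lemma a free generator of \<open>N\<close> lifts to a free generator \<open>z\<close>
  of \<open>M\<close>, and \<open>z a = \<alpha>(a) z\<close> defines the automorphism \<open>\<alpha>\<close>.
\<close>

section \<open>Coordinates and ranks\<close>

text \<open>All arguments with idempotents take place over \<open>k\<close>, where Fitting's lemma
  makes the corner \<open>e B e\<close> of a primitive idempotent local. This takes the place of the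
  Krull-Schmidt theorem: the identity of \<open>N e\<close> is a finite sum of endomorphisms, each
  factoring through some \<open>B e'\<close>; the endomorphism ring \<open>e B e\<close> is local,
  so one summand is invertible and \<open>N e\<close> is isomorphic to that \<open>B e'\<close>.
  That \<kappa> permutes the classes is never asserted. What enters is \<open>C (\<epsilon> e)
  (\<epsilon> a) = C (\<kappa> e) (\<kappa> a)\<close> for all \<open>e\<close> and
  \<open>a\<close>; summed up, it gives both multiplicity vectors the same value under the quadratic
  form, and positive definiteness does the rest. The obstacle is that invertibility is stated
  through tensor products, that is, through cosets in free abelian groups. It is converted over
  \<open>A\<close> into identities between elements and maps, because such identities can be reduced
  one by one. In the other direction only bases travel from \<open>k\<close> to \<open>R\<close>;
  this also gives \<open>M\<close>, a priori merely projective over \<open>R\<close>, the dimension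
  of \<open>N\<close> as its rank.\<close>

definition additive_map :: "('a, 'c) ring_scheme \<Rightarrow> ('b, 'd) ring_scheme \<Rightarrow> ('a \<Rightarrow> 'b) \<Rightarrow> bool" where
  "additive_map G H h \<longleftrightarrow> h \<in> carrier G \<rightarrow> carrier H \<and>
     (\<forall>x\<in>carrier G. \<forall>y\<in>carrier G. h (x \<oplus>\<^bsub>G\<^esub> y) = h x \<oplus>\<^bsub>H\<^esub> h y)"

lemma additive_mapI:
  assumes "\<And>x. x \<in> carrier G \<Longrightarrow> h x \<in> carrier H"
    and "\<And>x y. \<lbrakk>x \<in> carrier G; y \<in> carrier G\<rbrakk> \<Longrightarrow> h (x \<oplus>\<^bsub>G\<^esub> y) = h x \<oplus>\<^bsub>H\<^esub> h y"
  shows "additive_map G H h"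
  using assms by (auto simp: additive_map_def)

lemma additive_map_closed: "additive_map G H h \<Longrightarrow> x \<in> carrier G \<Longrightarrow> h x \<in> carrier H"
  by (auto simp: additive_map_def)

lemma additive_map_add:
  "\<lbrakk>additive_map G H h; x \<in> carrier G; y \<in> carrier G\<rbrakk> \<Longrightarrow> h (x \<oplus>\<^bsub>G\<^esub> y) = h x \<oplus>\<^bsub>H\<^esub> h y"
  by (auto simp: additive_map_def)

lemma additive_map_zero:
  assumes "abelian_group G" "abelian_group H" "additive_map G H h"
  shows "h \<zero>\<^bsub>G\<^esub> = \<zero>\<^bsub>H\<^esub>"
proof -
  interpret G: abelian_group G by fact
  interpret H: abelian_group H by fact
  have "h \<zero>\<^bsub>G\<^esub> \<oplus>\<^bsub>H\<^esub> h \<zero>\<^bsub>G\<^esub> = h \<zero>\<^bsub>G\<^esub>"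
    using additive_map_add[OF assms(3) G.zero_closed G.zero_closed] by simp
  then show ?thesis
    using additive_map_closed[OF assms(3) G.zero_closed] by (metis H.add.r_cancel_one')
qed

lemma additive_map_minus:
  assumes "abelian_group G" "abelian_group H" "additive_map G H h" "x \<in> carrier G"
  shows "h (\<ominus>\<^bsub>G\<^esub> x) = \<ominus>\<^bsub>H\<^esub> h x"
proof -
  interpret G: abelian_group G by fact
  interpret H: abelian_group H by fact
  have "h (\<ominus>\<^bsub>G\<^esub> x) \<oplus>\<^bsub>H\<^esub> h x = \<zero>\<^bsub>H\<^esub>"
    using additive_map_add[OF assms(3), of "\<ominus>\<^bsub>G\<^esub> x" x] assms(4)
      additive_map_zero[OF assms(1-3)] by (simp add: G.l_neg)
  then show ?thesis
    using additive_map_closed[OF assms(3)] assms(4) by (metis G.a_inv_closed H.minus_equality)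
qed

lemma additive_map_diff:
  assumes "abelian_group G" "abelian_group H" "additive_map G H h" "x \<in> carrier G" "y \<in> carrier G"
  shows "h (x \<ominus>\<^bsub>G\<^esub> y) = h x \<ominus>\<^bsub>H\<^esub> h y"
proof -
  interpret G: abelian_group G by fact
  interpret H: abelian_group H by fact
  show ?thesis
    using assms by (simp add: a_minus_def additive_map_add additive_map_minus)
qed

lemma additive_map_finsum:
  assumes "abelian_group G" "abelian_group H" "additive_map G H h" "\<And>s. s \<in> S \<Longrightarrow> f s \<in> carrier G"
  shows "h (\<Oplus>\<^bsub>G\<^esub>s\<in>S. f s) = (\<Oplus>\<^bsub>H\<^esub>s\<in>S. h (f s))"
proof -
  interpret G: abelian_group G by fact
  interpret H: abelian_group H by fact
  note hz = additive_map_zero[OF assms(1-3)]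
  show ?thesis using assms(4)
  proof (induction S rule: infinite_finite_induct)
    case (insert x F)
    then have "f \<in> F \<rightarrow> carrier G" "f x \<in> carrier G" by auto
    moreover have "(\<lambda>s. h (f s)) \<in> F \<rightarrow> carrier H" "h (f x) \<in> carrier H"
      using insert.prems additive_map_closed[OF assms(3)] by auto
    ultimately show ?case using insert additive_map_add[OF assms(3)] by simp
  qed (auto simp: hz)
qed

lemma (in abelian_group) finsum_delta:
  assumes "finite J" "j \<in> J" "f j \<in> carrier G"
  shows "(\<Oplus>i\<in>J. if i = j then f i else \<zero>) = f j"
proof -
  have "(\<Oplus>i\<in>J. if i = j then f i else \<zero>) = (\<Oplus>i\<in>J. if j = i then f j else \<zero>)"
    by (rule add.finprod_cong') (use assms in auto)
  also have "\<dots> = f j"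
    using add.finprod_singleton[OF assms(2,1), of "\<lambda>_. f j"] assms(3) by auto
  finally show ?thesis .
qed

lemma (in abelian_group) finsum_single:
  assumes "finite J" "j \<in> J" "f j \<in> carrier G" "\<And>i. i \<in> J \<Longrightarrow> i \<noteq> j \<Longrightarrow> f i = \<zero>"
  shows "(\<Oplus>i\<in>J. f i) = f j"
proof -
  have "(\<Oplus>i\<in>J. f i) = (\<Oplus>i\<in>J. if i = j then f i else \<zero>)"
    by (rule add.finprod_cong') (use assms in auto)
  then show ?thesis using finsum_delta assms by metis
qed

lemma (in abelian_group) finsum_reindex_bij:
  assumes "bij_betw s I J" "\<And>j. j \<in> J \<Longrightarrow> f j \<in> carrier G"
  shows "(\<Oplus>i\<in>I. f (s i)) = (\<Oplus>j\<in>J. f j)"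
proof -
  have "s ` I = J" "inj_on s I" using assms(1) by (auto simp: bij_betw_def)
  then show ?thesis using finsum_reindex[of f s I] assms(2) by auto
qed

lemma (in abelian_group) finsum_Sigma:
  assumes "finite T" "\<And>t. t \<in> T \<Longrightarrow> finite (J t)"
    and "\<And>t j. \<lbrakk>t \<in> T; j \<in> J t\<rbrakk> \<Longrightarrow> f t j \<in> carrier G"
  shows "(\<Oplus>t\<in>T. \<Oplus>j\<in>J t. f t j) = (\<Oplus>p\<in>Sigma T J. f (fst p) (snd p))"
  using assms
proof (induction T)
  case (insert t T)
  have S: "Sigma (insert t T) J = Pair t ` J t \<union> Sigma T J" by auto
  have d: "Pair t ` J t \<inter> Sigma T J = {}" using insert.hyps by auto
  have "(\<Oplus>p\<in>Sigma (insert t T) J. f (fst p) (snd p))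
      = (\<Oplus>p\<in>Pair t ` J t. f (fst p) (snd p)) \<oplus> (\<Oplus>p\<in>Sigma T J. f (fst p) (snd p))"
    unfolding S using insert d by (intro finsum_Un_disjoint) auto
  also have "(\<Oplus>p\<in>Pair t ` J t. f (fst p) (snd p)) = (\<Oplus>j\<in>J t. f t j)"
    by (subst finsum_reindex) (use insert.prems in \<open>auto simp: inj_on_def\<close>)
  finally show ?case using insert by simp
qed simp

section \<open>Linear forms and dual bases\<close>

definition linear_form :: "('r, 'c) ring_scheme \<Rightarrow> ('r, 'v, 'd) module_scheme \<Rightarrow> ('v \<Rightarrow> 'r) \<Rightarrow> bool"
  where "linear_form R V \<phi> \<longleftrightarrow> additive_map V R \<phi> \<and>
    (\<forall>r\<in>carrier R. \<forall>x\<in>carrier V. \<phi> (r \<odot>\<^bsub>V\<^esub> x) = r \<otimes>\<^bsub>R\<^esub> \<phi> x)"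

text \<open>The dual basis criterion: such finite data exist exactly for finitely generated
  projective modules. The \<open>z j\<close> may be linearly dependent; the \<open>\<phi> j\<close>
  are a linear choice of coefficients.\<close>

definition dual_basis :: "('r, 'c) ring_scheme \<Rightarrow> ('r, 'v, 'd) module_scheme \<Rightarrow>
    'j set \<Rightarrow> ('j \<Rightarrow> 'v) \<Rightarrow> ('j \<Rightarrow> 'v \<Rightarrow> 'r) \<Rightarrow> bool" where
  "dual_basis R V J z \<phi> \<longleftrightarrow> finite J \<and> z \<in> J \<rightarrow> carrier V \<and>
     (\<forall>j\<in>J. linear_form R V (\<phi> j)) \<and>
     (\<forall>x\<in>carrier V. (\<Oplus>\<^bsub>V\<^esub>j\<in>J. \<phi> j x \<odot>\<^bsub>V\<^esub> z j) = x)"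

text \<open>The forms are kept together with the basis, so that coefficients are read off by
  evaluation (\<open>coordinates_lincomb\<close>) and independence is a consequence. Indexed
  families, rather than sets of vectors, can be moved along maps before these are known to be
  injective.\<close>

definition coordinates :: "('r, 'c) ring_scheme \<Rightarrow> ('r, 'v, 'd) module_scheme \<Rightarrow>
    'j set \<Rightarrow> ('j \<Rightarrow> 'v) \<Rightarrow> ('j \<Rightarrow> 'v \<Rightarrow> 'r) \<Rightarrow> bool" where
  "coordinates R V J z \<phi> \<longleftrightarrow> dual_basis R V J z \<phi> \<and>
     (\<forall>i\<in>J. \<forall>j\<in>J. \<phi> i (z j) = (if j = i then \<one>\<^bsub>R\<^esub> else \<zero>\<^bsub>R\<^esub>))"

text \<open>Numbering the basis keeps the index type out of the notion;
  \<open>coordinates_has_rank\<close> brings any index set into this form.\<close>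

definition has_rank :: "('r, 'c) ring_scheme \<Rightarrow> ('r, 'v, 'd) module_scheme \<Rightarrow> nat \<Rightarrow> bool" where
  "has_rank R V n \<longleftrightarrow> (\<exists>z \<phi>. coordinates R V {..<n} z \<phi>)"

lemma linear_form_closed: "linear_form R V \<phi> \<Longrightarrow> x \<in> carrier V \<Longrightarrow> \<phi> x \<in> carrier R"
  by (auto simp: linear_form_def additive_map_def)

lemma dual_basis_closed:
  assumes "dual_basis R V J z \<phi>" "j \<in> J"
  shows "z j \<in> carrier V" "x \<in> carrier V \<Longrightarrow> \<phi> j x \<in> carrier R"
  using assms by (auto simp: dual_basis_def intro: linear_form_closed)

lemma dual_basis_form: "dual_basis R V J z \<phi> \<Longrightarrow> j \<in> J \<Longrightarrow> linear_form R V (\<phi> j)"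
  by (auto simp: dual_basis_def)

lemma dual_basis_eq: "dual_basis R V J z \<phi> \<Longrightarrow> x \<in> carrier V \<Longrightarrow> (\<Oplus>\<^bsub>V\<^esub>j\<in>J. \<phi> j x \<odot>\<^bsub>V\<^esub> z j) = x"
  by (auto simp: dual_basis_def)

lemma (in module) linear_form_lincomb:
  assumes "linear_form R M \<phi>" "\<And>j. j \<in> J \<Longrightarrow> c j \<in> carrier R" "\<And>j. j \<in> J \<Longrightarrow> z j \<in> carrier M"
  shows "\<phi> (\<Oplus>\<^bsub>M\<^esub>j\<in>J. c j \<odot>\<^bsub>M\<^esub> z j) = (\<Oplus>\<^bsub>R\<^esub>j\<in>J. c j \<otimes>\<^bsub>R\<^esub> \<phi> (z j))"
proof -
  have a: "additive_map M R \<phi>" using assms(1) by (simp add: linear_form_def)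
  have "\<phi> (\<Oplus>\<^bsub>M\<^esub>j\<in>J. c j \<odot>\<^bsub>M\<^esub> z j) = (\<Oplus>\<^bsub>R\<^esub>j\<in>J. \<phi> (c j \<odot>\<^bsub>M\<^esub> z j))"
    by (rule additive_map_finsum[OF _ _ a]) (use assms in \<open>auto intro: M.abelian_group_axioms R.abelian_group_axioms\<close>)
  also have "\<dots> = (\<Oplus>\<^bsub>R\<^esub>j\<in>J. c j \<otimes>\<^bsub>R\<^esub> \<phi> (z j))"
    by (rule R.finsum_cong') (use assms in \<open>auto simp: linear_form_def additive_map_def\<close>)
  finally show ?thesis .
qed

lemma (in module) coordinates_lincomb:
  assumes "coordinates R M J z \<phi>" "\<And>j. j \<in> J \<Longrightarrow> c j \<in> carrier R" "i \<in> J"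
  shows "\<phi> i (\<Oplus>\<^bsub>M\<^esub>j\<in>J. c j \<odot>\<^bsub>M\<^esub> z j) = c i"
proof -
  have d: "dual_basis R M J z \<phi>" and fin: "finite J"
    using assms(1) by (auto simp: coordinates_def dual_basis_def)
  have "\<phi> i (\<Oplus>\<^bsub>M\<^esub>j\<in>J. c j \<odot>\<^bsub>M\<^esub> z j) = (\<Oplus>\<^bsub>R\<^esub>j\<in>J. c j \<otimes>\<^bsub>R\<^esub> \<phi> i (z j))"
    using assms dual_basis_form[OF d] dual_basis_closed[OF d] by (intro linear_form_lincomb) auto
  also have "\<dots> = (\<Oplus>\<^bsub>R\<^esub>j\<in>J. if j = i then c j else \<zero>\<^bsub>R\<^esub>)"
    by (rule R.finsum_cong') (use assms in \<open>auto simp: coordinates_def\<close>)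
  also have "\<dots> = c i" using fin assms by (intro R.finsum_delta) auto
  finally show ?thesis .
qed

text \<open>Independence makes the coefficients of a vector unique, and uniqueness makes any choice
  of them linear in the vector. The chosen coefficients are the forms.\<close>

lemma (in module) coordinatesI:
  assumes fin: "finite J" and z: "\<And>j. j \<in> J \<Longrightarrow> z j \<in> carrier M"
    and gen: "\<And>x. x \<in> carrier M \<Longrightarrow> \<exists>c\<in>J \<rightarrow> carrier R. x = (\<Oplus>\<^bsub>M\<^esub>j\<in>J. c j \<odot>\<^bsub>M\<^esub> z j)"
    and indep: "\<And>c j. \<lbrakk>c \<in> J \<rightarrow> carrier R; (\<Oplus>\<^bsub>M\<^esub>j\<in>J. c j \<odot>\<^bsub>M\<^esub> z j) = \<zero>\<^bsub>M\<^esub>; j \<in> J\<rbrakk> \<Longrightarrow> c j = \<zero>\<^bsub>R\<^esub>"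
  shows "\<exists>\<phi>. coordinates R M J z \<phi>"
proof -
  have uniq: "c j = d j" if c: "c \<in> J \<rightarrow> carrier R" and d: "d \<in> J \<rightarrow> carrier R"
    and eq: "(\<Oplus>\<^bsub>M\<^esub>j\<in>J. c j \<odot>\<^bsub>M\<^esub> z j) = (\<Oplus>\<^bsub>M\<^esub>j\<in>J. d j \<odot>\<^bsub>M\<^esub> z j)" and j: "j \<in> J" for c d j
  proof -
    \<comment> \<open>The minus sign is written as the scalar minus one in front of
      \<open>d j\<close>, so that \<open>finsum_smult\<close> can pull it out of the second
      sum.\<close>
    have "(\<Oplus>\<^bsub>M\<^esub>j\<in>J. (c j \<oplus>\<^bsub>R\<^esub> \<ominus>\<^bsub>R\<^esub> \<one>\<^bsub>R\<^esub> \<otimes>\<^bsub>R\<^esub> d j) \<odot>\<^bsub>M\<^esub> z j)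
        = (\<Oplus>\<^bsub>M\<^esub>j\<in>J. c j \<odot>\<^bsub>M\<^esub> z j \<oplus>\<^bsub>M\<^esub> \<ominus>\<^bsub>R\<^esub> \<one>\<^bsub>R\<^esub> \<odot>\<^bsub>M\<^esub> (d j \<odot>\<^bsub>M\<^esub> z j))"
      by (rule M.finsum_cong') (use c d z in \<open>auto simp: smult_l_distr smult_assoc1 Pi_def\<close>)
    also have "\<dots> = (\<Oplus>\<^bsub>M\<^esub>j\<in>J. c j \<odot>\<^bsub>M\<^esub> z j) \<oplus>\<^bsub>M\<^esub> (\<Oplus>\<^bsub>M\<^esub>j\<in>J. \<ominus>\<^bsub>R\<^esub> \<one>\<^bsub>R\<^esub> \<odot>\<^bsub>M\<^esub> (d j \<odot>\<^bsub>M\<^esub> z j))"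
      by (rule M.finsum_addf) (use c d z in \<open>auto simp: Pi_def\<close>)
    also have "(\<Oplus>\<^bsub>M\<^esub>j\<in>J. \<ominus>\<^bsub>R\<^esub> \<one>\<^bsub>R\<^esub> \<odot>\<^bsub>M\<^esub> (d j \<odot>\<^bsub>M\<^esub> z j)) = \<ominus>\<^bsub>R\<^esub> \<one>\<^bsub>R\<^esub> \<odot>\<^bsub>M\<^esub> (\<Oplus>\<^bsub>M\<^esub>j\<in>J. c j \<odot>\<^bsub>M\<^esub> z j)"
      unfolding eq by (rule finsum_smult[symmetric]) (use d z in \<open>auto simp: Pi_def\<close>)
    also have "(\<Oplus>\<^bsub>M\<^esub>j\<in>J. c j \<odot>\<^bsub>M\<^esub> z j) \<oplus>\<^bsub>M\<^esub> \<ominus>\<^bsub>R\<^esub> \<one>\<^bsub>R\<^esub> \<odot>\<^bsub>M\<^esub> (\<Oplus>\<^bsub>M\<^esub>j\<in>J. c j \<odot>\<^bsub>M\<^esub> z j) = \<zero>\<^bsub>M\<^esub>"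
    proof -
      have "(\<Oplus>\<^bsub>M\<^esub>j\<in>J. c j \<odot>\<^bsub>M\<^esub> z j) \<in> carrier M"
        by (rule M.finsum_closed) (use c z in \<open>auto simp: Pi_def\<close>)
      then show ?thesis by (simp add: smult_l_minus M.r_neg)
    qed
    finally have "c j \<oplus>\<^bsub>R\<^esub> \<ominus>\<^bsub>R\<^esub> \<one>\<^bsub>R\<^esub> \<otimes>\<^bsub>R\<^esub> d j = \<zero>\<^bsub>R\<^esub>"
      by (rule indep[of "\<lambda>j. c j \<oplus>\<^bsub>R\<^esub> \<ominus>\<^bsub>R\<^esub> \<one>\<^bsub>R\<^esub> \<otimes>\<^bsub>R\<^esub> d j", rotated]) (use c d j in \<open>auto simp: Pi_def\<close>)
    moreover have "c j \<in> carrier R" "d j \<in> carrier R" using c d j by auto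
    ultimately show ?thesis by (simp add: R.l_minus flip: R.minus_eq)
  qed
  define C where "C x = (SOME c. c \<in> J \<rightarrow> carrier R \<and> x = (\<Oplus>\<^bsub>M\<^esub>j\<in>J. c j \<odot>\<^bsub>M\<^esub> z j))" for x
  have C: "C x \<in> J \<rightarrow> carrier R" "(\<Oplus>\<^bsub>M\<^esub>j\<in>J. C x j \<odot>\<^bsub>M\<^esub> z j) = x" if "x \<in> carrier M" for x
    using someI_ex[of "\<lambda>c. c \<in> J \<rightarrow> carrier R \<and> x = (\<Oplus>\<^bsub>M\<^esub>j\<in>J. c j \<odot>\<^bsub>M\<^esub> z j)"] gen[OF that]
    unfolding C_def by (blast, metis (mono_tags, lifting))
  \<comment> \<open>Any expansion of \<open>x\<close> has the chosen coefficients. Additivity,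
    homogeneity and duality below each exhibit an expansion and appeal to this.\<close>
  have Ceq: "C x j = c j" if "c \<in> J \<rightarrow> carrier R" "x = (\<Oplus>\<^bsub>M\<^esub>j\<in>J. c j \<odot>\<^bsub>M\<^esub> z j)" "j \<in> J" for x c j
  proof -
    have "x \<in> carrier M" unfolding that(2) using that(1) z by (intro M.finsum_closed) auto
    with uniq[OF C(1) that(1) _ that(3)] C(2) that(2) show ?thesis by metis
  qed
  have add: "C (x \<oplus>\<^bsub>M\<^esub> y) j = C x j \<oplus>\<^bsub>R\<^esub> C y j" if "x \<in> carrier M" "y \<in> carrier M" "j \<in> J" for x y j
  proof (rule Ceq)
    show "(\<lambda>j. C x j \<oplus>\<^bsub>R\<^esub> C y j) \<in> J \<rightarrow> carrier R" using C(1) that by (auto simp: Pi_def)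
    have "(\<Oplus>\<^bsub>M\<^esub>j\<in>J. (C x j \<oplus>\<^bsub>R\<^esub> C y j) \<odot>\<^bsub>M\<^esub> z j) = (\<Oplus>\<^bsub>M\<^esub>j\<in>J. C x j \<odot>\<^bsub>M\<^esub> z j \<oplus>\<^bsub>M\<^esub> C y j \<odot>\<^bsub>M\<^esub> z j)"
      by (rule M.finsum_cong') (use C(1)[OF that(1)] C(1)[OF that(2)] z in \<open>auto simp: smult_l_distr Pi_def\<close>)
    also have "\<dots> = (\<Oplus>\<^bsub>M\<^esub>j\<in>J. C x j \<odot>\<^bsub>M\<^esub> z j) \<oplus>\<^bsub>M\<^esub> (\<Oplus>\<^bsub>M\<^esub>j\<in>J. C y j \<odot>\<^bsub>M\<^esub> z j)"
      by (rule M.finsum_addf) (use C(1)[OF that(1)] C(1)[OF that(2)] z in \<open>auto simp: Pi_def\<close>)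
    finally show "x \<oplus>\<^bsub>M\<^esub> y = (\<Oplus>\<^bsub>M\<^esub>j\<in>J. (C x j \<oplus>\<^bsub>R\<^esub> C y j) \<odot>\<^bsub>M\<^esub> z j)"
      using C(2) that by simp
  qed (rule that)
  have scale: "C (r \<odot>\<^bsub>M\<^esub> x) j = r \<otimes>\<^bsub>R\<^esub> C x j" if "r \<in> carrier R" "x \<in> carrier M" "j \<in> J" for r x j
  proof (rule Ceq)
    show "(\<lambda>j. r \<otimes>\<^bsub>R\<^esub> C x j) \<in> J \<rightarrow> carrier R" using C(1) that by (auto simp: Pi_def)
    have "(\<Oplus>\<^bsub>M\<^esub>j\<in>J. (r \<otimes>\<^bsub>R\<^esub> C x j) \<odot>\<^bsub>M\<^esub> z j) = (\<Oplus>\<^bsub>M\<^esub>j\<in>J. r \<odot>\<^bsub>M\<^esub> (C x j \<odot>\<^bsub>M\<^esub> z j))"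
      by (rule M.finsum_cong') (use that C(1)[OF that(2)] z in \<open>auto simp: smult_assoc1 Pi_def\<close>)
    also have "\<dots> = r \<odot>\<^bsub>M\<^esub> (\<Oplus>\<^bsub>M\<^esub>j\<in>J. C x j \<odot>\<^bsub>M\<^esub> z j)"
      by (rule finsum_smult[symmetric]) (use that C(1)[OF that(2)] z in \<open>auto simp: Pi_def\<close>)
    finally show "r \<odot>\<^bsub>M\<^esub> x = (\<Oplus>\<^bsub>M\<^esub>j\<in>J. (r \<otimes>\<^bsub>R\<^esub> C x j) \<odot>\<^bsub>M\<^esub> z j)"
      using C(2) that by simp
  qed (rule that)
  have delta: "C (z j) i = (if j = i then \<one>\<^bsub>R\<^esub> else \<zero>\<^bsub>R\<^esub>)" if "i \<in> J" "j \<in> J" for i j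
  proof (rule Ceq[of "\<lambda>i. if j = i then \<one>\<^bsub>R\<^esub> else \<zero>\<^bsub>R\<^esub>"])
    have "(\<Oplus>\<^bsub>M\<^esub>i\<in>J. (if j = i then \<one>\<^bsub>R\<^esub> else \<zero>\<^bsub>R\<^esub>) \<odot>\<^bsub>M\<^esub> z i) = (\<Oplus>\<^bsub>M\<^esub>i\<in>J. if i = j then z i else \<zero>\<^bsub>M\<^esub>)"
      by (rule M.finsum_cong') (use z in auto)
    also have "\<dots> = z j" using M.finsum_delta[of J j z] fin that z by auto
    finally show "z j = (\<Oplus>\<^bsub>M\<^esub>i\<in>J. (if j = i then \<one>\<^bsub>R\<^esub> else \<zero>\<^bsub>R\<^esub>) \<odot>\<^bsub>M\<^esub> z i)" by simp
  qed (use that in auto)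
  have "coordinates R M J z (\<lambda>j x. C x j)"
    unfolding coordinates_def dual_basis_def linear_form_def additive_map_def
    using fin z C add scale delta by (auto simp: Pi_def)
  then show ?thesis by blast
qed

lemma (in module) coordinates_indep:
  assumes "coordinates R M J z \<phi>" "c \<in> J \<rightarrow> carrier R"
    "(\<Oplus>\<^bsub>M\<^esub>j\<in>J. c j \<odot>\<^bsub>M\<^esub> z j) = \<zero>\<^bsub>M\<^esub>" "j \<in> J"
  shows "c j = \<zero>\<^bsub>R\<^esub>"
proof -
  have f: "additive_map M R (\<phi> j)" using assms by (auto simp: coordinates_def dual_basis_def linear_form_def)
  have "c j = \<phi> j (\<Oplus>\<^bsub>M\<^esub>j\<in>J. c j \<odot>\<^bsub>M\<^esub> z j)"
    by (rule coordinates_lincomb[OF assms(1) _ assms(4), symmetric]) (use assms(2) in auto)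
  also have "\<dots> = \<zero>\<^bsub>R\<^esub>"
    using additive_map_zero[OF M.abelian_group_axioms R.abelian_group_axioms f] assms by simp
  finally show ?thesis .
qed

lemma module_homI:
  assumes "\<And>x. x \<in> carrier V \<Longrightarrow> f x \<in> carrier W"
    and "\<And>x y. \<lbrakk>x \<in> carrier V; y \<in> carrier V\<rbrakk> \<Longrightarrow> f (x \<oplus>\<^bsub>V\<^esub> y) = f x \<oplus>\<^bsub>W\<^esub> f y"
    and "\<And>r x. \<lbrakk>r \<in> carrier R; x \<in> carrier V\<rbrakk> \<Longrightarrow> f (r \<odot>\<^bsub>V\<^esub> x) = r \<odot>\<^bsub>W\<^esub> f x"
  shows "f \<in> module_hom R V W"
  using assms by (auto simp: module_hom_def)

lemma module_homD:
  assumes "f \<in> module_hom R V W"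
  shows "x \<in> carrier V \<Longrightarrow> f x \<in> carrier W" "additive_map V W f"
    and "\<lbrakk>r \<in> carrier R; x \<in> carrier V\<rbrakk> \<Longrightarrow> f (r \<odot>\<^bsub>V\<^esub> x) = r \<odot>\<^bsub>W\<^esub> f x"
  using assms by (auto simp: module_hom_def additive_map_def)

lemma linear_form_comp:
  assumes "linear_form R W \<phi>" "f \<in> module_hom R V W"
  shows "linear_form R V (\<lambda>x. \<phi> (f x))"
  using assms by (auto simp: linear_form_def additive_map_def module_hom_def Pi_def)

lemma module_hom_lincomb:
  assumes "module R V" "module R W" "f \<in> module_hom R V W"
    and "\<And>j. j \<in> J \<Longrightarrow> c j \<in> carrier R" "\<And>j. j \<in> J \<Longrightarrow> z j \<in> carrier V"
  shows "f (\<Oplus>\<^bsub>V\<^esub>j\<in>J. c j \<odot>\<^bsub>V\<^esub> z j) = (\<Oplus>\<^bsub>W\<^esub>j\<in>J. c j \<odot>\<^bsub>W\<^esub> f (z j))"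
proof -
  interpret V: module R V by fact
  interpret W: module R W by fact
  have "f (\<Oplus>\<^bsub>V\<^esub>j\<in>J. c j \<odot>\<^bsub>V\<^esub> z j) = (\<Oplus>\<^bsub>W\<^esub>j\<in>J. f (c j \<odot>\<^bsub>V\<^esub> z j))"
    by (rule additive_map_finsum[OF _ _ module_homD(2)[OF assms(3)]])
      (use assms in \<open>auto intro: V.M.abelian_group_axioms W.M.abelian_group_axioms\<close>)
  also have "\<dots> = (\<Oplus>\<^bsub>W\<^esub>j\<in>J. c j \<odot>\<^bsub>W\<^esub> f (z j))"
    by (rule W.finsum_cong') (use assms module_homD[OF assms(3)] in \<open>auto\<close>)
  finally show ?thesis .
qed

lemma coordinates_reindex:
  assumes "module R V" "coordinates R V J z \<phi>" "bij_betw h I J"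
  shows "coordinates R V I (\<lambda>i. z (h i)) (\<lambda>i. \<phi> (h i))"
proof -
  interpret module R V by fact
  have d: "dual_basis R V J z \<phi>" using assms(2) by (simp add: coordinates_def)
  have hI: "h i \<in> J" if "i \<in> I" for i using assms(3) that by (auto simp: bij_betw_def)
  have inj: "h i = h j \<longleftrightarrow> i = j" if "i \<in> I" "j \<in> I" for i j
    using assms(3) that by (auto simp: bij_betw_def inj_on_def)
  have "(\<Oplus>\<^bsub>V\<^esub>i\<in>I. \<phi> (h i) x \<odot>\<^bsub>V\<^esub> z (h i)) = x" if "x \<in> carrier V" for x
    using M.finsum_reindex_bij[OF assms(3), of "\<lambda>j. \<phi> j x \<odot>\<^bsub>V\<^esub> z j"] that
      dual_basis_closed[OF d] dual_basis_eq[OF d that] by auto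
  moreover have "finite I" using d assms(3) bij_betw_finite by (auto simp: dual_basis_def)
  ultimately show ?thesis
    using assms(2) hI inj d unfolding coordinates_def by (auto simp: dual_basis_def)
qed

lemma coordinates_has_rank:
  assumes "module R V" "coordinates R V J z \<phi>"
  shows "has_rank R V (card J)"
proof -
  have "finite J" using assms(2) by (simp add: coordinates_def dual_basis_def)
  then obtain h where "bij_betw h {..<card J} J"
    using ex_bij_betw_nat_finite atLeast0LessThan by metis
  then show ?thesis using coordinates_reindex[OF assms] unfolding has_rank_def by blast
qed

lemma coordinates_iso:
  assumes "module R V" "module R W" "f \<in> module_hom R V W" "bij_betw f (carrier V) (carrier W)"
    and "coordinates R V J z \<phi>"
  shows "coordinates R W J (\<lambda>j. f (z j)) (\<lambda>j y. \<phi> j (inv_into (carrier V) f y))"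
proof -
  interpret V: module R V by fact
  interpret W: module R W by fact
  let ?g = "inv_into (carrier V) f"
  have d: "dual_basis R V J z \<phi>" using assms(5) by (simp add: coordinates_def)
  note fD = module_homD[OF assms(3)]
  have gf: "?g (f x) = x" if "x \<in> carrier V" for x
    using assms(4) that by (simp add: bij_betw_def)
  have fg: "f (?g y) = y" "?g y \<in> carrier V" if "y \<in> carrier W" for y
    using assms(4) that by (auto simp: bij_betw_def f_inv_into_f inv_into_into)
  have inj: "x = y" if "f x = f y" "x \<in> carrier V" "y \<in> carrier V" for x y
    using that gf by metis
  have g: "?g \<in> module_hom R W V"
  proof (rule module_homI)
    show "?g (x \<oplus>\<^bsub>W\<^esub> y) = ?g x \<oplus>\<^bsub>V\<^esub> ?g y" if "x \<in> carrier W" "y \<in> carrier W" for x y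
      using that fg additive_map_add[OF fD(2)] by (intro inj) auto
    show "?g (r \<odot>\<^bsub>W\<^esub> y) = r \<odot>\<^bsub>V\<^esub> ?g y" if "r \<in> carrier R" "y \<in> carrier W" for r y
      using that fg fD(3) by (intro inj) auto
  qed (use fg in auto)
  have "(\<Oplus>\<^bsub>W\<^esub>j\<in>J. \<phi> j (?g y) \<odot>\<^bsub>W\<^esub> f (z j)) = y" if "y \<in> carrier W" for y
    using module_hom_lincomb[OF assms(1-3), of J "\<lambda>j. \<phi> j (?g y)" z] dual_basis_eq[OF d, of "?g y"]
      dual_basis_closed[OF d] fg[OF that] by auto
  then show ?thesis
    using assms(5) gf linear_form_comp[OF _ g] fD(1)
    unfolding coordinates_def dual_basis_def by (auto simp: Pi_def)
qed

lemma has_rank_iso: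
  assumes "module R V" "module R W" "f \<in> module_hom R V W" "bij_betw f (carrier V) (carrier W)"
    and "has_rank R V n"
  shows "has_rank R W n"
  using assms coordinates_iso unfolding has_rank_def by blast

text \<open>The bases of the summands, indexed by pairs, together form a basis of \<open>V\<close>;
  the form belonging to a pair is a form of the summand after the projection. Inclusions and
  projections are arbitrary linear maps, so the \<open>W t\<close> need not be subsets of
  \<open>V\<close>.\<close>

lemma has_rank_direct_sum:
  assumes V: "module R V" and W: "\<And>t. t \<in> T \<Longrightarrow> module R (W t)" and T: "finite T"
    and rank: "\<And>t. t \<in> T \<Longrightarrow> has_rank R (W t) (n t)"
    and inc: "\<And>t. t \<in> T \<Longrightarrow> \<iota> t \<in> module_hom R (W t) V"
    and pr: "\<And>t. t \<in> T \<Longrightarrow> p t \<in> module_hom R V (W t)"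
    and same: "\<And>t w. \<lbrakk>t \<in> T; w \<in> carrier (W t)\<rbrakk> \<Longrightarrow> p t (\<iota> t w) = w"
    and diff: "\<And>s t w. \<lbrakk>s \<in> T; t \<in> T; s \<noteq> t; w \<in> carrier (W t)\<rbrakk> \<Longrightarrow> p s (\<iota> t w) = \<zero>\<^bsub>W s\<^esub>"
    and all: "\<And>x. x \<in> carrier V \<Longrightarrow> (\<Oplus>\<^bsub>V\<^esub>t\<in>T. \<iota> t (p t x)) = x"
  shows "has_rank R V (\<Sum>t\<in>T. n t)"
proof -
  interpret V: module R V by fact
  obtain z \<phi> where z: "\<And>t. t \<in> T \<Longrightarrow> coordinates R (W t) {..<n t} (z t) (\<phi> t)"
    using rank unfolding has_rank_def by metis
  have d: "dual_basis R (W t) {..<n t} (z t) (\<phi> t)" if "t \<in> T" for t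
    using z[OF that] by (simp add: coordinates_def)
  let ?J = "Sigma T (\<lambda>t. {..<n t})"
  let ?z = "\<lambda>q. \<iota> (fst q) (z (fst q) (snd q))" and ?\<phi> = "\<lambda>q x. \<phi> (fst q) (snd q) (p (fst q) x)"
  have zc: "\<iota> t (z t j) \<in> carrier V" if "t \<in> T" "j < n t" for t j
    using module_homD(1)[OF inc] dual_basis_closed(1)[OF d] that by auto
  have \<phi>c: "\<phi> t j (p t x) \<in> carrier R" if "t \<in> T" "j < n t" "x \<in> carrier V" for t j x
    using module_homD(1)[OF pr] dual_basis_closed(2)[OF d] that by auto
  have "(\<Oplus>\<^bsub>V\<^esub>q\<in>?J. ?\<phi> q x \<odot>\<^bsub>V\<^esub> ?z q) = x" if x: "x \<in> carrier V" for x
  proof -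
    have "(\<Oplus>\<^bsub>V\<^esub>q\<in>?J. ?\<phi> q x \<odot>\<^bsub>V\<^esub> ?z q) = (\<Oplus>\<^bsub>V\<^esub>t\<in>T. \<Oplus>\<^bsub>V\<^esub>j\<in>{..<n t}. \<phi> t j (p t x) \<odot>\<^bsub>V\<^esub> \<iota> t (z t j))"
      by (rule V.M.finsum_Sigma[symmetric]) (use T zc \<phi>c x in auto)
    also have "\<dots> = (\<Oplus>\<^bsub>V\<^esub>t\<in>T. \<iota> t (p t x))"
    proof (rule V.finsum_cong')
      fix t assume t: "t \<in> T"
      have px: "p t x \<in> carrier (W t)" using module_homD(1)[OF pr[OF t] x] .
      have "\<iota> t (\<Oplus>\<^bsub>W t\<^esub>j\<in>{..<n t}. \<phi> t j (p t x) \<odot>\<^bsub>W t\<^esub> z t j)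
          = (\<Oplus>\<^bsub>V\<^esub>j\<in>{..<n t}. \<phi> t j (p t x) \<odot>\<^bsub>V\<^esub> \<iota> t (z t j))"
        using px dual_basis_closed[OF d[OF t]]
        by (intro module_hom_lincomb[OF W[OF t] V inc[OF t]]) auto
      then show "(\<Oplus>\<^bsub>V\<^esub>j\<in>{..<n t}. \<phi> t j (p t x) \<odot>\<^bsub>V\<^esub> \<iota> t (z t j)) = \<iota> t (p t x)"
        using dual_basis_eq[OF d[OF t] px] by simp
    qed (use module_homD(1)[OF inc] module_homD(1)[OF pr] x in auto)
    finally show ?thesis using all[OF x] by simp
  qed
  moreover have "linear_form R V (?\<phi> q)" if "q \<in> ?J" for q
    using that linear_form_comp[OF dual_basis_form[OF d] pr] by auto
  moreover have "?\<phi> q (?z r) = (if r = q then \<one>\<^bsub>R\<^esub> else \<zero>\<^bsub>R\<^esub>)" if "q \<in> ?J" "r \<in> ?J" for q r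
  proof (cases "fst r = fst q")
    case True
    then show ?thesis
      using that same dual_basis_closed(1)[OF d] z[of "fst q"]
      by (auto simp: coordinates_def prod_eq_iff)
  next
    case False
    have q: "fst q \<in> T" "snd q \<in> {..<n (fst q)}" and r: "fst r \<in> T" "snd r \<in> {..<n (fst r)}"
      using that by auto
    interpret Wq: module R "W (fst q)" using W q by blast
    have "additive_map (W (fst q)) R (\<phi> (fst q) (snd q))"
      using dual_basis_form[OF d[OF q(1)] q(2)] by (simp add: linear_form_def)
    then have "\<phi> (fst q) (snd q) \<zero>\<^bsub>W (fst q)\<^esub> = \<zero>\<^bsub>R\<^esub>"
      using additive_map_zero Wq.M.abelian_group_axioms V.R.abelian_group_axioms by blast
    then show ?thesis
      using False diff[of "fst q" "fst r"] q r dual_basis_closed(1)[OF d[OF r(1)]] by auto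
  qed
  ultimately have "coordinates R V ?J ?z ?\<phi>"
    unfolding coordinates_def dual_basis_def using T zc by auto
  moreover have "card ?J = (\<Sum>t\<in>T. n t)" using T by simp
  ultimately show ?thesis using coordinates_has_rank[OF V, of ?J ?z ?\<phi>] by simp
qed

section \<open>Comparison with bases as sets and with dimension\<close>

lemma finite_basis_coordinates:
  assumes "module R V" "finite_basis R V X"
  shows "\<exists>\<phi>. coordinates R V X (\<lambda>x. x) \<phi>"
proof -
  interpret module R V by fact
  have X: "finite X" "X \<subseteq> carrier V" "\<not> lin_dep X" "span X = carrier V"
    using assms(2) by (auto simp: finite_basis_def)
  show ?thesis
  proof (rule coordinatesI)
    show "\<exists>c\<in>X \<rightarrow> carrier R. x = (\<Oplus>\<^bsub>V\<^esub>j\<in>X. c j \<odot>\<^bsub>V\<^esub> j)" if "x \<in> carrier V" for x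
      using that finite_span[OF X(1,2)] X(4) unfolding lincomb_def by blast
    show "c j = \<zero>\<^bsub>R\<^esub>" if "c \<in> X \<rightarrow> carrier R" "(\<Oplus>\<^bsub>V\<^esub>j\<in>X. c j \<odot>\<^bsub>V\<^esub> j) = \<zero>\<^bsub>V\<^esub>" "j \<in> X" for c j
      using that X unfolding lin_dep_def lincomb_def by blast
  qed (use X in auto)
qed

text \<open>Nontriviality of \<open>R\<close> keeps \<open>z\<close> injective: if
  \<open>z i = z j\<close>, the form \<open>\<phi> i\<close> takes the value one at
  \<open>z j\<close>, which duality permits only for \<open>i = j\<close>. Hence passing from the
  family to its image loses no element.\<close>

lemma coordinates_finite_basis:
  assumes "module R V" "coordinates R V J z \<phi>" "\<one>\<^bsub>R\<^esub> \<noteq> \<zero>\<^bsub>R\<^esub>"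
  shows "finite_basis R V (z ` J)" "card (z ` J) = card J"
proof -
  interpret module R V by fact
  have d: "dual_basis R V J z \<phi>" and fin: "finite J"
    using assms(2) by (auto simp: coordinates_def dual_basis_def)
  have inj: "inj_on z J"
  proof (rule inj_onI)
    fix i j assume "i \<in> J" "j \<in> J" "z i = z j"
    then have "\<phi> i (z j) = \<one>\<^bsub>R\<^esub>" using assms(2) by (auto simp: coordinates_def) metis
    with \<open>i \<in> J\<close> \<open>j \<in> J\<close> show "i = j" using assms(2,3) by (auto simp: coordinates_def split: if_splits)
  qed
  then show "card (z ` J) = card J" by (rule card_image)
  have sub: "z ` J \<subseteq> carrier V" using dual_basis_closed[OF d] by auto
  have lin: "lincomb a (z ` J) = (\<Oplus>\<^bsub>V\<^esub>j\<in>J. a (z j) \<odot>\<^bsub>V\<^esub> z j)" if "a \<in> z ` J \<rightarrow> carrier R" for a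
    unfolding lincomb_def using that sub inj by (intro M.finsum_reindex) auto
  have "\<not> lin_dep (z ` J)"
  proof
    assume "lin_dep (z ` J)"
    then obtain a v where a: "a \<in> z ` J \<rightarrow> carrier R" "lincomb a (z ` J) = \<zero>\<^bsub>V\<^esub>" "v \<in> z ` J" "a v \<noteq> \<zero>\<^bsub>R\<^esub>"
      using finite_lin_dep[of "z ` J"] fin sub by auto
    then obtain j where "j \<in> J" "v = z j" by auto
    then show False
      using coordinates_indep[OF assms(2), of "\<lambda>j. a (z j)" j] a lin by auto
  qed
  moreover have "span (z ` J) = carrier V"
  proof
    show "span (z ` J) \<subseteq> carrier V" using sub by (rule span_is_subset2)
    show "carrier V \<subseteq> span (z ` J)"
    proof
      fix x assume x: "x \<in> carrier V"
      let ?a = "\<lambda>v. \<phi> (inv_into J z v) x"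
      have a: "?a (z j) = \<phi> j x" if "j \<in> J" for j using inj that by simp
      have a1: "?a \<in> z ` J \<rightarrow> carrier R" using a dual_basis_closed[OF d] x by auto
      have "lincomb ?a (z ` J) = (\<Oplus>\<^bsub>V\<^esub>j\<in>J. \<phi> j x \<odot>\<^bsub>V\<^esub> z j)"
        unfolding lin[OF a1] by (rule M.finsum_cong') (use a dual_basis_closed[OF d] x in auto)
      then have "x = lincomb ?a (z ` J)" using dual_basis_eq[OF d x] by simp
      then show "x \<in> span (z ` J)" using finite_span[OF _ sub] fin a1 by blast
    qed
  qed
  ultimately show "finite_basis R V (z ` J)" using fin sub by (simp add: finite_basis_def)
qed

lemma has_rank_dim:
  assumes "vectorspace k V" "has_rank k V n"
  shows "vectorspace.dim k V = n"
proof -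
  interpret vectorspace k V by fact
  obtain z \<phi> where "coordinates k V {..<n} z \<phi>" using assms(2) by (auto simp: has_rank_def)
  then have "finite_basis k V (z ` {..<n})" "card (z ` {..<n}) = n"
    using coordinates_finite_basis[OF module_axioms] by fastforce+
  then show ?thesis using dim_basis[of "z ` {..<n}"] by (auto simp: finite_basis_def basis_def)
qed

text \<open>A finitely generated space over a field has a finite basis. Through
  \<open>rank_reduction\<close> this is also where ranks over \<open>R\<close> come from.\<close>

lemma has_rank_exists:
  assumes "vectorspace k V" "finite J" "\<And>j. j \<in> J \<Longrightarrow> y j \<in> carrier V"
    and gen: "\<And>x. x \<in> carrier V \<Longrightarrow> \<exists>c\<in>J \<rightarrow> carrier k. x = (\<Oplus>\<^bsub>V\<^esub>j\<in>J. c j \<odot>\<^bsub>V\<^esub> y j)"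
  shows "\<exists>n. has_rank k V n"
proof -
  interpret vectorspace k V by fact
  have sub: "y ` J \<subseteq> carrier V" using assms(3) by auto
  have own: "y j \<in> span (y ` J)" if "j \<in> J" for j using in_own_span[OF sub] that by auto
  have sm: "submodule k (span (y ` J)) V" by (rule span_is_submodule[OF sub])
  have "(\<Oplus>\<^bsub>V\<^esub>j\<in>L. c j \<odot>\<^bsub>V\<^esub> y j) \<in> span (y ` J)" if "finite L" "L \<subseteq> J" "c \<in> J \<rightarrow> carrier k" for c L
    using that
  proof (induction L)
    case empty
    then show ?case using submodule.zero_closed[OF sm] by simp
  next
    case (insert j L)
    have "(\<lambda>j. c j \<odot>\<^bsub>V\<^esub> y j) \<in> L \<rightarrow> carrier V" "c j \<odot>\<^bsub>V\<^esub> y j \<in> carrier V" "c j \<in> carrier k"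
      using insert.prems assms(3) by (auto simp: Pi_def subset_iff)
    then show ?case using insert sm own by (auto simp: submodule_def)
  qed
  then have "carrier V \<subseteq> span (y ` J)" using gen assms(2) by blast
  then have "span (y ` J) = carrier V" using span_is_subset2[OF sub] by blast
  then have "fin_dim" unfolding fin_dim_def using assms(2) sub by blast
  then obtain X where "finite X" "basis X" using finite_basis_exists by blast
  then have "finite_basis k V X" by (simp add: basis_def finite_basis_def)
  then show ?thesis
    using finite_basis_coordinates[OF module_axioms] coordinates_has_rank[OF module_axioms] by blast
qed

section \<open>Tensor products\<close>

text \<open>Closure is all that is asked of the two actions, as biadditivity and balancing are
  imposed by the relators. The locale serves the scalar extension, where \<open>R\<close> acts on
  \<open>k\<close> through \<pi>, as well as tensor products of bimodules over
  \<open>A\<close>.\<close>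

locale tensor_factors =
  fixes A :: "('a, 'b) ring_scheme" and N :: "('n, 'c) ring_scheme" and r :: "'n \<Rightarrow> 'a \<Rightarrow> 'n"
    and M :: "('a, 'm, 'd) module_scheme"
  assumes N: "abelian_group N" and M: "abelian_group M"
    and r_closed: "\<lbrakk>x \<in> carrier N; a \<in> carrier A\<rbrakk> \<Longrightarrow> r x a \<in> carrier N"
    and l_closed: "\<lbrakk>a \<in> carrier A; m \<in> carrier M\<rbrakk> \<Longrightarrow> a \<odot>\<^bsub>M\<^esub> m \<in> carrier M"
begin

sublocale N: abelian_group N by (rule N)
sublocale M: abelian_group M by (rule M)

abbreviation F where "F \<equiv> free_Abelian_group (carrier N \<times> carrier M)"
abbreviation K where "K \<equiv> tensor_kernel A N r M"

definition pure_tensor :: "'n \<Rightarrow> 'm \<Rightarrow> ('n \<times> 'm \<Rightarrow>\<^sub>0 int) set" where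
  "pure_tensor x m = K #>\<^bsub>F\<^esub> frag_of (x, m)"

sublocale F: comm_group F by (rule abelian_free_Abelian_group)

lemma F_diff: "u \<in> carrier F \<Longrightarrow> v \<in> carrier F \<Longrightarrow> u - v \<in> carrier F"
  using keys_diff[of u v] by simp blast

lemma relators_subset: "tensor_relators A N r M \<subseteq> carrier F"
  unfolding tensor_relators_def
  by (auto intro!: F_diff simp: r_closed l_closed frag_of_in_free_Abelian_group
      simp del: carrier_free_Abelian_group_iff)

lemma K_subgroup: "subgroup K F"
  unfolding tensor_kernel_def by (rule F.generate_is_subgroup[OF relators_subset])

lemma K_normal: "K \<lhd> F"
  by (rule F.subgroup_imp_normal[OF K_subgroup])

sublocale K: normal K F by (rule K_normal)

sublocale Q: comm_group "F Mod K"
  by (rule F.abelian_FactGroup[OF K_subgroup])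

lemma K_zero: "0 \<in> K"
  using K.one_closed by simp

lemma K_add: "u \<in> K \<Longrightarrow> v \<in> K \<Longrightarrow> u + v \<in> K"
  using K.m_closed by simp

lemma K_keys: "u \<in> K \<Longrightarrow> Poly_Mapping.keys u \<subseteq> carrier N \<times> carrier M"
  using K.subset by fastforce

lemma K_diff: "u \<in> K \<Longrightarrow> v \<in> K \<Longrightarrow> u - v \<in> K"
  using K_add[of u "- v"] K.m_inv_closed[of v] K_keys[of v] by simp

lemma K_relator: "u \<in> tensor_relators A N r M \<Longrightarrow> u \<in> K"
  unfolding tensor_kernel_def by (rule generate.incl)

lemma K_relator_add_left:
  assumes "x \<in> carrier N" "y \<in> carrier N" "m \<in> carrier M"
  shows "frag_of (x \<oplus>\<^bsub>N\<^esub> y, m) - frag_of (x, m) - frag_of (y, m) \<in> K"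
  by (rule K_relator) (use assms in \<open>auto simp: tensor_relators_def\<close>)

lemma K_relator_add_right:
  assumes "x \<in> carrier N" "l \<in> carrier M" "m \<in> carrier M"
  shows "frag_of (x, l \<oplus>\<^bsub>M\<^esub> m) - frag_of (x, l) - frag_of (x, m) \<in> K"
  by (rule K_relator) (use assms in \<open>auto simp: tensor_relators_def\<close>)

lemma K_relator_balanced:
  assumes "x \<in> carrier N" "a \<in> carrier A" "m \<in> carrier M"
  shows "frag_of (r x a, m) - frag_of (x, a \<odot>\<^bsub>M\<^esub> m) \<in> K"
  by (rule K_relator) (use assms in \<open>auto simp: tensor_relators_def\<close>)

text \<open>One clause for differences replaces the clauses of \<open>generate\<close> for inverses
  and products, since \<open>- h = 0 - h\<close> and \<open>h1 + h2 = h1 - (0 - h2)\<close>. It fits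
  maps given by \<open>frag_extend\<close>, which respect differences.\<close>

lemma K_induct [consumes 1, case_names add_left add_right balanced zero diff]:
  assumes "u \<in> K"
    and "\<And>x y m. \<lbrakk>x \<in> carrier N; y \<in> carrier N; m \<in> carrier M\<rbrakk> \<Longrightarrow>
      P (frag_of (x \<oplus>\<^bsub>N\<^esub> y, m) - frag_of (x, m) - frag_of (y, m))"
    and "\<And>x l m. \<lbrakk>x \<in> carrier N; l \<in> carrier M; m \<in> carrier M\<rbrakk> \<Longrightarrow>
      P (frag_of (x, l \<oplus>\<^bsub>M\<^esub> m) - frag_of (x, l) - frag_of (x, m))"
    and "\<And>x a m. \<lbrakk>x \<in> carrier N; a \<in> carrier A; m \<in> carrier M\<rbrakk> \<Longrightarrow>
      P (frag_of (r x a, m) - frag_of (x, a \<odot>\<^bsub>M\<^esub> m))"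
    and zero: "P 0" and diff: "\<And>u v. \<lbrakk>u \<in> K; v \<in> K; P u; P v\<rbrakk> \<Longrightarrow> P (u - v)"
  shows "P u"
proof -
  have rel: "P u" if "u \<in> tensor_relators A N r M" for u
    using that unfolding tensor_relators_def by (elim UnE CollectE exE conjE) (simp_all add: assms(2-4))
  have "u \<in> generate F (tensor_relators A N r M)" using assms(1) by (simp add: tensor_kernel_def)
  then show ?thesis
  proof (induction u rule: generate.induct)
    case (inv h)
    have "P (0 - h)" by (rule diff[OF K_zero K_relator[OF inv] zero rel[OF inv]])
    moreover have "inv\<^bsub>F\<^esub> h = - h" using relators_subset inv by (intro inv_free_Abelian_group) fastforce
    ultimately show ?case by simp
  next
    case (eng h1 h2)
    have K: "h1 \<in> K" "h2 \<in> K" using eng by (auto simp: tensor_kernel_def)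
    have n: "P (0 - h2)" by (rule diff[OF K_zero K(2) zero eng.IH(2)])
    have "P (h1 - (0 - h2))" by (rule diff[OF K(1) K_diff[OF K_zero K(2)] eng.IH(1) n])
    then show ?case by simp
  qed (use zero rel in auto)
qed

lemma class_self: "u \<in> K #>\<^bsub>F\<^esub> u"
  unfolding r_coset_def using K_zero by (auto intro!: bexI[of _ 0])

lemma class_eq_iff:
  assumes "Poly_Mapping.keys u \<subseteq> carrier N \<times> carrier M" "Poly_Mapping.keys v \<subseteq> carrier N \<times> carrier M"
  shows "K #>\<^bsub>F\<^esub> u = K #>\<^bsub>F\<^esub> v \<longleftrightarrow> u - v \<in> K"
proof
  assume "K #>\<^bsub>F\<^esub> u = K #>\<^bsub>F\<^esub> v"
  then have "u \<in> K #>\<^bsub>F\<^esub> v" using class_self[of u] by simp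
  then show "u - v \<in> K" by (auto simp: r_coset_def)
next
  assume "u - v \<in> K"
  then have "u \<in> K #>\<^bsub>F\<^esub> v" unfolding r_coset_def by (auto intro!: bexI[of _ "u - v"])
  then show "K #>\<^bsub>F\<^esub> u = K #>\<^bsub>F\<^esub> v"
    using F.repr_independence[OF _ _ K_subgroup, of u v] assms by simp
qed

lemma class_closed:
  "Poly_Mapping.keys u \<subseteq> carrier N \<times> carrier M \<Longrightarrow> K #>\<^bsub>F\<^esub> u \<in> carrier (F Mod K)"
  by (auto simp: FactGroup_def RCOSETS_def)

lemma class_cases:
  assumes "U \<in> carrier (F Mod K)"
  obtains u where "Poly_Mapping.keys u \<subseteq> carrier N \<times> carrier M" "U = K #>\<^bsub>F\<^esub> u"
  using assms by (auto simp: FactGroup_def RCOSETS_def)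

lemma class_add:
  assumes "Poly_Mapping.keys u \<subseteq> carrier N \<times> carrier M" "Poly_Mapping.keys v \<subseteq> carrier N \<times> carrier M"
  shows "(K #>\<^bsub>F\<^esub> u) \<otimes>\<^bsub>F Mod K\<^esub> (K #>\<^bsub>F\<^esub> v) = K #>\<^bsub>F\<^esub> (u + v)"
  using K.rcos_sum[of u v] assms by (simp add: FactGroup_def)

lemma class_mem:
  assumes "x \<in> K #>\<^bsub>F\<^esub> u"
  obtains h where "h \<in> K" "x = h + u"
  using assms by (auto simp: r_coset_def)

lemma class_zero: "\<one>\<^bsub>F Mod K\<^esub> = K #>\<^bsub>F\<^esub> 0"
  using F.coset_mult_one[OF K.subset] by (simp add: FactGroup_def)

lemma pure_tensor_closed: "x \<in> carrier N \<Longrightarrow> m \<in> carrier M \<Longrightarrow> pure_tensor x m \<in> carrier (F Mod K)"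
  unfolding pure_tensor_def by (intro class_closed) simp

lemma pure_tensor_add_left:
  assumes "x \<in> carrier N" "y \<in> carrier N" "m \<in> carrier M"
  shows "pure_tensor (x \<oplus>\<^bsub>N\<^esub> y) m = pure_tensor x m \<otimes>\<^bsub>F Mod K\<^esub> pure_tensor y m"
proof -
  have k: "Poly_Mapping.keys (frag_of (x, m) + frag_of (y, m)) \<subseteq> carrier N \<times> carrier M"
    using keys_add[of "frag_of (x, m)" "frag_of (y, m)"] assms by (auto simp: subset_iff)
  show ?thesis
    unfolding pure_tensor_def using K_relator_add_left[OF assms] assms k
    by (subst class_add) (auto simp: class_eq_iff algebra_simps)
qed

lemma pure_tensor_add_right:
  assumes "x \<in> carrier N" "l \<in> carrier M" "m \<in> carrier M"
  shows "pure_tensor x (l \<oplus>\<^bsub>M\<^esub> m) = pure_tensor x l \<otimes>\<^bsub>F Mod K\<^esub> pure_tensor x m"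
proof -
  have k: "Poly_Mapping.keys (frag_of (x, l) + frag_of (x, m)) \<subseteq> carrier N \<times> carrier M"
    using keys_add[of "frag_of (x, l)" "frag_of (x, m)"] assms by (auto simp: subset_iff)
  show ?thesis
    unfolding pure_tensor_def using K_relator_add_right[OF assms] assms k
    by (subst class_add) (auto simp: class_eq_iff algebra_simps)
qed

lemma pure_tensor_balanced:
  assumes "x \<in> carrier N" "a \<in> carrier A" "m \<in> carrier M"
  shows "pure_tensor (r x a) m = pure_tensor x (a \<odot>\<^bsub>M\<^esub> m)"
  unfolding pure_tensor_def using K_relator_balanced[OF assms] assms
  by (subst class_eq_iff) (auto simp: r_closed l_closed)

text \<open>The additive extension of \<open>b\<close> to the free abelian group kills the relators
  by the hypotheses on \<open>b\<close>, hence all of \<open>K\<close>, and so depends on the coset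
  alone.\<close>

lemma universal:
  assumes G: "abelian_group G"
    and closed: "\<And>x m. \<lbrakk>x \<in> carrier N; m \<in> carrier M\<rbrakk> \<Longrightarrow> b x m \<in> carrier G"
    and add_left: "\<And>x y m. \<lbrakk>x \<in> carrier N; y \<in> carrier N; m \<in> carrier M\<rbrakk> \<Longrightarrow> b (x \<oplus>\<^bsub>N\<^esub> y) m = b x m \<oplus>\<^bsub>G\<^esub> b y m"
    and add_right: "\<And>x l m. \<lbrakk>x \<in> carrier N; l \<in> carrier M; m \<in> carrier M\<rbrakk> \<Longrightarrow> b x (l \<oplus>\<^bsub>M\<^esub> m) = b x l \<oplus>\<^bsub>G\<^esub> b x m"
    and balanced: "\<And>x a m. \<lbrakk>x \<in> carrier N; a \<in> carrier A; m \<in> carrier M\<rbrakk> \<Longrightarrow> b (r x a) m = b x (a \<odot>\<^bsub>M\<^esub> m)"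
  obtains h where "h \<in> carrier (F Mod K) \<rightarrow> carrier G"
    "\<And>U V. \<lbrakk>U \<in> carrier (F Mod K); V \<in> carrier (F Mod K)\<rbrakk> \<Longrightarrow> h (U \<otimes>\<^bsub>F Mod K\<^esub> V) = h U \<oplus>\<^bsub>G\<^esub> h V"
    "\<And>x m. \<lbrakk>x \<in> carrier N; m \<in> carrier M\<rbrakk> \<Longrightarrow> h (pure_tensor x m) = b x m"
proof -
  interpret G: abelian_group G by (rule G)
  obtain f where f: "f \<in> hom F (add_monoid G)" and fb: "\<And>p. p \<in> carrier N \<times> carrier M \<Longrightarrow> f (frag_of p) = b (fst p) (snd p)"
  proof -
    have "(\<lambda>p. b (fst p) (snd p)) ` (carrier N \<times> carrier M) \<subseteq> carrier (add_monoid G)"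
      using closed by auto
    from comm_group.free_Abelian_group_universal[OF G.a_comm_group this] show ?thesis using that by blast
  qed
  have fc: "f u \<in> carrier G" if "Poly_Mapping.keys u \<subseteq> carrier N \<times> carrier M" for u
    using f that by (auto simp: hom_def)
  have fadd: "f (u + v) = f u \<oplus>\<^bsub>G\<^esub> f v"
    if "Poly_Mapping.keys u \<subseteq> carrier N \<times> carrier M" "Poly_Mapping.keys v \<subseteq> carrier N \<times> carrier M" for u v
    using f that by (auto simp: hom_def)
  have fdiff: "f (u - v) = f u \<ominus>\<^bsub>G\<^esub> f v"
    if "Poly_Mapping.keys u \<subseteq> carrier N \<times> carrier M" "Poly_Mapping.keys v \<subseteq> carrier N \<times> carrier M" for u v
  proof -
    have k: "Poly_Mapping.keys (u - v) \<subseteq> carrier N \<times> carrier M" using keys_diff[of u v] that by blast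
    have "f u = f (u - v) \<oplus>\<^bsub>G\<^esub> f v" using fadd[OF k that(2)] by simp
    then show ?thesis using fc[OF k] fc[OF that(2)]
      by (simp add: a_minus_def G.a_assoc G.r_neg)
  qed
  have f0: "f 0 = \<zero>\<^bsub>G\<^esub>" using fdiff[of 0 0] fc[of 0] by (simp add: a_minus_def G.r_neg)
  have kd: "Poly_Mapping.keys (frag_of p - frag_of q) \<subseteq> carrier N \<times> carrier M"
    if "p \<in> carrier N \<times> carrier M" "q \<in> carrier N \<times> carrier M" for p q
    using keys_diff[of "frag_of p" "frag_of q"] that by (auto simp: subset_iff)
  have minus_cancel: "u \<oplus>\<^bsub>G\<^esub> v \<ominus>\<^bsub>G\<^esub> u \<ominus>\<^bsub>G\<^esub> v = \<zero>\<^bsub>G\<^esub>" if "u \<in> carrier G" "v \<in> carrier G" for u v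
  proof -
    have "u \<oplus>\<^bsub>G\<^esub> v \<ominus>\<^bsub>G\<^esub> u \<ominus>\<^bsub>G\<^esub> v = u \<oplus>\<^bsub>G\<^esub> v \<oplus>\<^bsub>G\<^esub> \<ominus>\<^bsub>G\<^esub> (u \<oplus>\<^bsub>G\<^esub> v)"
      using that by (simp add: a_minus_def G.minus_add G.a_assoc)
    then show ?thesis using that by (simp add: G.r_neg)
  qed
  have fK: "f u = \<zero>\<^bsub>G\<^esub>" if "u \<in> K" for u
    using that
  proof (induction rule: K_induct)
    case (add_left x y m)
    have "f (frag_of (x \<oplus>\<^bsub>N\<^esub> y, m) - frag_of (x, m) - frag_of (y, m)) = b x m \<oplus>\<^bsub>G\<^esub> b y m \<ominus>\<^bsub>G\<^esub> b x m \<ominus>\<^bsub>G\<^esub> b y m"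
      using add_left kd[of "(x \<oplus>\<^bsub>N\<^esub> y, m)" "(x, m)"] by (simp add: fdiff fb assms(3))
    then show ?case using add_left closed by (simp add: minus_cancel)
  next
    case (add_right x l m)
    have "f (frag_of (x, l \<oplus>\<^bsub>M\<^esub> m) - frag_of (x, l) - frag_of (x, m)) = b x l \<oplus>\<^bsub>G\<^esub> b x m \<ominus>\<^bsub>G\<^esub> b x l \<ominus>\<^bsub>G\<^esub> b x m"
      using add_right kd[of "(x, l \<oplus>\<^bsub>M\<^esub> m)" "(x, l)"] by (simp add: fdiff fb assms(4))
    then show ?case using add_right closed by (simp add: minus_cancel)
  next
    case (balanced x a m)
    then show ?case
      using closed[of "r x a" m]
      by (subst fdiff) (simp_all add: fb assms(5) r_closed l_closed a_minus_def G.r_neg)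
  next
    case (diff u v)
    then show ?case by (simp add: fdiff K_keys f0 a_minus_def)
  qed (rule f0)
  \<comment> \<open>The value at a coset is computed from a chosen representative; two
    representatives differ by an element of \<open>K\<close>, where \<open>f\<close>
    vanishes.\<close>
  define h where "h U = f (SOME u. Poly_Mapping.keys u \<subseteq> carrier N \<times> carrier M \<and> U = K #>\<^bsub>F\<^esub> u)" for U
  have h: "h (K #>\<^bsub>F\<^esub> u) = f u" if u: "Poly_Mapping.keys u \<subseteq> carrier N \<times> carrier M" for u
  proof -
    define v where "v = (SOME v. Poly_Mapping.keys v \<subseteq> carrier N \<times> carrier M \<and> K #>\<^bsub>F\<^esub> u = K #>\<^bsub>F\<^esub> v)"
    have v: "Poly_Mapping.keys v \<subseteq> carrier N \<times> carrier M" "K #>\<^bsub>F\<^esub> u = K #>\<^bsub>F\<^esub> v"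
      using someI[of "\<lambda>v. Poly_Mapping.keys v \<subseteq> carrier N \<times> carrier M \<and> K #>\<^bsub>F\<^esub> u = K #>\<^bsub>F\<^esub> v" u] u
      unfolding v_def by auto
    then have "v - u \<in> K" using class_eq_iff[OF v(1) u] by simp
    then have "f v \<ominus>\<^bsub>G\<^esub> f u = \<zero>\<^bsub>G\<^esub>" using fK fdiff[OF v(1) u] by metis
    then have "f v = f u" using fc u v by simp
    then show ?thesis unfolding h_def v_def .
  qed
  show thesis
  proof (rule that)
    show "h \<in> carrier (F Mod K) \<rightarrow> carrier G"
      using h fc by (auto elim!: class_cases)
    show "h (U \<otimes>\<^bsub>F Mod K\<^esub> V) = h U \<oplus>\<^bsub>G\<^esub> h V" if UV: "U \<in> carrier (F Mod K)" "V \<in> carrier (F Mod K)" for U V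
    proof -
      obtain u v where uv: "Poly_Mapping.keys u \<subseteq> carrier N \<times> carrier M" "U = K #>\<^bsub>F\<^esub> u"
        "Poly_Mapping.keys v \<subseteq> carrier N \<times> carrier M" "V = K #>\<^bsub>F\<^esub> v"
        using class_cases[OF UV(1)] class_cases[OF UV(2)] by metis
      have "Poly_Mapping.keys (u + v) \<subseteq> carrier N \<times> carrier M" using keys_add[of u v] uv by blast
      then show ?thesis using uv h fadd class_add by simp
    qed
    show "h (pure_tensor x m) = b x m" if "x \<in> carrier N" "m \<in> carrier M" for x m
      unfolding pure_tensor_def using that h fb by simp
  qed
qed

text \<open>The actions on tensor products are unions of cosets over all representatives. If the
  underlying map of the free group preserves \<open>K\<close>, the cosets in such a union coincide,
  and one representative suffices to compute it.\<close>

lemma class_map: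
  assumes K: "\<And>h. h \<in> K \<Longrightarrow> frag_extend g h \<in> K"
    and g: "\<And>p. p \<in> carrier N \<times> carrier M \<Longrightarrow> Poly_Mapping.keys (g p) \<subseteq> carrier N \<times> carrier M"
    and u: "Poly_Mapping.keys u \<subseteq> carrier N \<times> carrier M"
  shows "(\<Union>x\<in>K #>\<^bsub>F\<^esub> u. K #>\<^bsub>F\<^esub> frag_extend g x) = K #>\<^bsub>F\<^esub> frag_extend g u"
proof -
  have gk: "Poly_Mapping.keys (frag_extend g v) \<subseteq> carrier N \<times> carrier M"
    if "Poly_Mapping.keys v \<subseteq> carrier N \<times> carrier M" for v
    using keys_frag_extend[of g v] g that by blast
  have "K #>\<^bsub>F\<^esub> frag_extend g x = K #>\<^bsub>F\<^esub> frag_extend g u" if x: "x \<in> K #>\<^bsub>F\<^esub> u" for x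
  proof -
    obtain h where h: "h \<in> K" "x = h + u" using class_mem[OF x] by blast
    have xk: "Poly_Mapping.keys x \<subseteq> carrier N \<times> carrier M"
      using keys_add[of h u] K_keys[OF h(1)] u h(2) by blast
    have "frag_extend g x - frag_extend g u \<in> K" using K[OF h(1)] by (simp add: h(2) frag_extend_add)
    then show ?thesis using class_eq_iff[OF gk[OF xk] gk[OF u]] by blast
  qed
  then show ?thesis using class_self[of u] by blast
qed

end

section \<open>Scalar extension to the residue field\<close>

text \<open>The pure tensor of one with \<open>x\<close>. As \<pi> is onto, these tensors exhaust
  the scalar extension (\<open>red_surj\<close>), so this map is reduction modulo the kernel of
  \<pi>.\<close>

definition reduction :: "'k ring \<Rightarrow> 'r ring \<Rightarrow> ('r \<Rightarrow> 'k) \<Rightarrow> ('r, 'n) module \<Rightarrow> 'n \<Rightarrow>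
    ('k \<times> 'n \<Rightarrow>\<^sub>0 int) set" where
  "reduction k R \<pi> N x = tensor_kernel R k (\<lambda>c r. c \<otimes>\<^bsub>k\<^esub> \<pi> r) N
     #>\<^bsub>free_Abelian_group (carrier k \<times> carrier N)\<^esub> frag_of (\<one>\<^bsub>k\<^esub>, x)"

lemmas frag_induct = free_Abelian_group_induct[consumes 1, case_names zero diff gen]

text \<open>Together the assumptions say that \<open>R\<close> is local with residue field
  \<open>k\<close>: the nonunits are exactly the kernel of \<pi>. Both alternatives in
  \<open>coefficient_ring\<close> provide this.\<close>

locale local_base = R: cring R + k: field k
  for R :: "'r ring" and k :: "'k ring" +
  fixes \<pi> :: "'r \<Rightarrow> 'k"
  assumes \<pi>_hom: "\<pi> \<in> ring_hom R k"
    and \<pi>_surj: "\<pi> ` carrier R = carrier k"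
    and unit_if: "\<lbrakk>r \<in> carrier R; \<pi> r \<noteq> \<zero>\<^bsub>k\<^esub>\<rbrakk> \<Longrightarrow> r \<in> Units R"
begin

lemma \<pi>_closed: "r \<in> carrier R \<Longrightarrow> \<pi> r \<in> carrier k"
  using \<pi>_hom by (rule ring_hom_closed)

lemma \<pi>_add: "\<lbrakk>r \<in> carrier R; s \<in> carrier R\<rbrakk> \<Longrightarrow> \<pi> (r \<oplus>\<^bsub>R\<^esub> s) = \<pi> r \<oplus>\<^bsub>k\<^esub> \<pi> s"
  using \<pi>_hom by (rule ring_hom_add)

lemma \<pi>_mult: "\<lbrakk>r \<in> carrier R; s \<in> carrier R\<rbrakk> \<Longrightarrow> \<pi> (r \<otimes>\<^bsub>R\<^esub> s) = \<pi> r \<otimes>\<^bsub>k\<^esub> \<pi> s"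
  using \<pi>_hom by (rule ring_hom_mult)

lemma \<pi>_one: "\<pi> \<one>\<^bsub>R\<^esub> = \<one>\<^bsub>k\<^esub>"
  using \<pi>_hom by (rule ring_hom_one)

lemma \<pi>_additive: "additive_map R k \<pi>"
  by (auto simp: additive_map_def \<pi>_closed \<pi>_add)

lemma \<pi>_zero: "\<pi> \<zero>\<^bsub>R\<^esub> = \<zero>\<^bsub>k\<^esub>"
  using additive_map_zero[OF R.abelian_group_axioms k.abelian_group_axioms \<pi>_additive] .

lemma \<pi>_diff: "\<lbrakk>r \<in> carrier R; s \<in> carrier R\<rbrakk> \<Longrightarrow> \<pi> (r \<ominus>\<^bsub>R\<^esub> s) = \<pi> r \<ominus>\<^bsub>k\<^esub> \<pi> s"
  using additive_map_diff[OF R.abelian_group_axioms k.abelian_group_axioms \<pi>_additive] .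

lemma \<pi>_lift: "c \<in> carrier k \<Longrightarrow> \<exists>r\<in>carrier R. c = \<pi> r"
  using \<pi>_surj by blast

lemma R_nontrivial: "\<one>\<^bsub>R\<^esub> \<noteq> \<zero>\<^bsub>R\<^esub>"
  using \<pi>_one \<pi>_zero k.one_not_zero by metis

abbreviation bc where "bc N \<equiv> scalar_extension k R \<pi> N"
abbreviation red where "red N \<equiv> reduction k R \<pi> N"

lemma tensor_factors:
  assumes "module R N" shows "tensor_factors R k (\<lambda>c r. c \<otimes>\<^bsub>k\<^esub> \<pi> r) N"
proof -
  interpret module R N by fact
  show ?thesis
    by unfold_locales (auto simp: \<pi>_closed)
qed

lemma red_pure:
  assumes "module R N"
  shows "red N x = tensor_factors.pure_tensor R k (\<lambda>c r. c \<otimes>\<^bsub>k\<^esub> \<pi> r) N \<one>\<^bsub>k\<^esub> x"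
  by (simp add: reduction_def tensor_factors.pure_tensor_def[OF tensor_factors[OF assms]])

lemma bc_abelian_group:
  assumes "module R N" shows "abelian_group (bc N)"
proof -
  interpret tensor_factors R k "\<lambda>c r. c \<otimes>\<^bsub>k\<^esub> \<pi> r" N by (rule tensor_factors[OF assms])
  show ?thesis
  proof (rule abelian_groupI)
    show "\<exists>y\<in>carrier (bc N). y \<oplus>\<^bsub>bc N\<^esub> x = \<zero>\<^bsub>bc N\<^esub>" if "x \<in> carrier (bc N)" for x
      using that Q.l_inv_ex[of x]
      by (simp add: scalar_extension_def Let_def del: carrier_FactGroup mult_FactGroup one_FactGroup)
  qed (auto simp: scalar_extension_def Let_def Q.m_ac simp del: carrier_FactGroup mult_FactGroup one_FactGroup)
qed

lemma red_closed:
  assumes "module R N" "x \<in> carrier N" shows "red N x \<in> carrier (bc N)"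
proof -
  interpret tensor_factors R k "\<lambda>c r. c \<otimes>\<^bsub>k\<^esub> \<pi> r" N by (rule tensor_factors[OF assms(1)])
  show ?thesis using pure_tensor_closed[of "\<one>\<^bsub>k\<^esub>" x] assms
    by (simp add: red_pure scalar_extension_def Let_def)
qed

lemma red_add:
  assumes "module R N" "x \<in> carrier N" "y \<in> carrier N"
  shows "red N (x \<oplus>\<^bsub>N\<^esub> y) = red N x \<oplus>\<^bsub>bc N\<^esub> red N y"
proof -
  interpret tensor_factors R k "\<lambda>c r. c \<otimes>\<^bsub>k\<^esub> \<pi> r" N by (rule tensor_factors[OF assms(1)])
  show ?thesis using pure_tensor_add_right[of "\<one>\<^bsub>k\<^esub>" x y] assms
    by (simp add: red_pure scalar_extension_def Let_def)
qed

lemma red_additive: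
  assumes "module R N" shows "additive_map N (bc N) (red N)"
  using red_closed[OF assms] red_add[OF assms] by (rule additive_mapI)

lemma red_pure_smult:
  assumes "module R N" "x \<in> carrier N" "r \<in> carrier R"
  shows "tensor_factors.pure_tensor R k (\<lambda>c r. c \<otimes>\<^bsub>k\<^esub> \<pi> r) N (\<pi> r) x = red N (r \<odot>\<^bsub>N\<^esub> x)"
proof -
  interpret tensor_factors R k "\<lambda>c r. c \<otimes>\<^bsub>k\<^esub> \<pi> r" N by (rule tensor_factors[OF assms(1)])
  show ?thesis using pure_tensor_balanced[of "\<one>\<^bsub>k\<^esub>" r x] assms
    by (simp add: red_pure \<pi>_closed)
qed

lemma red_smult:
  assumes "module R N" "x \<in> carrier N" "r \<in> carrier R"
  shows "red N (r \<odot>\<^bsub>N\<^esub> x) = \<pi> r \<odot>\<^bsub>bc N\<^esub> red N x"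
proof -
  interpret tensor_factors R k "\<lambda>c r. c \<otimes>\<^bsub>k\<^esub> \<pi> r" N by (rule tensor_factors[OF assms(1)])
  interpret N: module R N by fact
  have c: "\<pi> r \<in> carrier k" using assms \<pi>_closed by blast
  \<comment> \<open>Scaling the first component sends every relator to a relator of the same kind,
    which is what \<open>class_map\<close> asks for.\<close>
  let ?g = "\<lambda>(d, b). frag_of (\<pi> r \<otimes>\<^bsub>k\<^esub> d, b)"
  have "frag_extend ?g h \<in> K" if "h \<in> K" for h
    using that
  proof (induction rule: K_induct)
    case (add_left x y m)
    then show ?case
      using K_relator_add_left[of "\<pi> r \<otimes>\<^bsub>k\<^esub> x" "\<pi> r \<otimes>\<^bsub>k\<^esub> y" m] c
      by (simp add: frag_extend_diff k.r_distr)
  next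
    case (add_right x l m)
    then show ?case
      using K_relator_add_right[of "\<pi> r \<otimes>\<^bsub>k\<^esub> x" l m] c by (simp add: frag_extend_diff)
  next
    case (balanced x a m)
    then show ?case
      using K_relator_balanced[of "\<pi> r \<otimes>\<^bsub>k\<^esub> x" a m] c by (simp add: frag_extend_diff k.m_assoc \<pi>_closed)
  next
    case (diff u v)
    then show ?case by (simp add: frag_extend_diff K_diff)
  qed (simp add: K_zero)
  then have "(\<Union>u\<in>red N x. K #>\<^bsub>F\<^esub> frag_extend ?g u) = K #>\<^bsub>F\<^esub> frag_extend ?g (frag_of (\<one>\<^bsub>k\<^esub>, x))"
    unfolding reduction_def using assms c by (intro class_map) auto
  also have "\<dots> = pure_tensor (\<pi> r) x" using c by (simp add: pure_tensor_def)
  also have "\<dots> = red N (r \<odot>\<^bsub>N\<^esub> x)" by (rule red_pure_smult[OF assms])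
  finally show ?thesis by (simp add: scalar_extension_def Let_def)
qed

lemma red_zero: "module R N \<Longrightarrow> red N \<zero>\<^bsub>N\<^esub> = \<zero>\<^bsub>bc N\<^esub>"
  by (rule additive_map_zero[OF _ bc_abelian_group red_additive]) (auto simp: module_def)

lemma red_diff:
  "\<lbrakk>module R N; x \<in> carrier N; y \<in> carrier N\<rbrakk> \<Longrightarrow> red N (x \<ominus>\<^bsub>N\<^esub> y) = red N x \<ominus>\<^bsub>bc N\<^esub> red N y"
  by (rule additive_map_diff[OF _ bc_abelian_group red_additive]) (auto simp: module_def)

text \<open>The tensor \<open>c \<otimes> x\<close> equals \<open>1 \<otimes> r x\<close> for any
  lift \<open>r\<close> of \<open>c\<close>, and sums of tensors of the latter form collapse to one.
  From here on, laws in a scalar extension are proved by writing every element as a reduction and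
  computing in \<open>N\<close>.\<close>

lemma red_surj:
  assumes "module R N" "U \<in> carrier (bc N)" shows "\<exists>x\<in>carrier N. U = red N x"
proof -
  interpret tensor_factors R k "\<lambda>c r. c \<otimes>\<^bsub>k\<^esub> \<pi> r" N by (rule tensor_factors[OF assms(1)])
  interpret N: module R N by fact
  interpret B: abelian_group "bc N" by (rule bc_abelian_group[OF assms(1)])
  have Q: "carrier (bc N) = carrier (F Mod K)" "\<And>U V. U \<oplus>\<^bsub>bc N\<^esub> V = U \<otimes>\<^bsub>F Mod K\<^esub> V"
    "\<zero>\<^bsub>bc N\<^esub> = \<one>\<^bsub>F Mod K\<^esub>"
    by (simp_all add: scalar_extension_def Let_def)
  obtain u where u: "Poly_Mapping.keys u \<subseteq> carrier k \<times> carrier N" "U = K #>\<^bsub>F\<^esub> u"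
    using assms(2) class_cases[of U] Q(1) by blast
  have "\<exists>x\<in>carrier N. K #>\<^bsub>F\<^esub> u = red N x" using u(1)
  proof (induction u rule: frag_induct)
    case zero
    show ?case using red_zero[OF assms(1)] Q(3) class_zero M.zero_closed by metis
  next
    case (diff u v)
    then obtain x y where xy: "x \<in> carrier N" "K #>\<^bsub>F\<^esub> u = red N x" "y \<in> carrier N" "K #>\<^bsub>F\<^esub> v = red N y"
      by blast
    have kd: "Poly_Mapping.keys (u - v) \<subseteq> carrier k \<times> carrier N" using keys_diff[of u v] diff by blast
    have "red N x = (K #>\<^bsub>F\<^esub> (u - v)) \<oplus>\<^bsub>bc N\<^esub> red N y"
      using class_add[OF kd diff(2)] xy Q(2) by simp
    moreover have "K #>\<^bsub>F\<^esub> (u - v) \<in> carrier (bc N)" using class_closed[OF kd] Q(1) by simp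
    ultimately have "red N x \<ominus>\<^bsub>bc N\<^esub> red N y = K #>\<^bsub>F\<^esub> (u - v)"
      using red_closed[OF assms(1) xy(3)] by (simp add: a_minus_def B.a_assoc B.r_neg)
    then show ?case using red_diff[OF assms(1) xy(1,3)] xy by (metis M.minus_closed)
  next
    case (gen p)
    obtain c x where p: "p = (c, x)" "c \<in> carrier k" "x \<in> carrier N" using gen by blast
    obtain r where r: "r \<in> carrier R" "c = \<pi> r" using \<pi>_lift p by blast
    have "K #>\<^bsub>F\<^esub> frag_of p = red N (r \<odot>\<^bsub>N\<^esub> x)"
      using red_pure_smult[OF assms(1) p(3) r(1)] p(1) r(2) by (simp add: pure_tensor_def)
    then show ?case using p r by auto
  qed
  then show ?thesis using u by simp
qed

text \<open>Sending \<open>(c, m)\<close> to \<open>c\<close> times the image of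
  \<open>\<psi> m\<close> under \<pi> is balanced, so it factors through the tensor product. Applied
  to the forms of a dual basis, this bounds the kernel of reduction: its elements have all their
  coefficients in the kernel of \<pi>.\<close>

lemma red_form:
  assumes "module R N" "linear_form R N \<psi>" "x \<in> carrier N" "red N x = \<zero>\<^bsub>bc N\<^esub>"
  shows "\<pi> (\<psi> x) = \<zero>\<^bsub>k\<^esub>"
proof -
  interpret tensor_factors R k "\<lambda>c r. c \<otimes>\<^bsub>k\<^esub> \<pi> r" N by (rule tensor_factors[OF assms(1)])
  interpret N: module R N by fact
  have \<psi>: "\<psi> y \<in> carrier R" if "y \<in> carrier N" for y using linear_form_closed[OF assms(2) that] .
  obtain h where h: "h \<in> carrier (F Mod K) \<rightarrow> carrier k"
    "\<And>U V. \<lbrakk>U \<in> carrier (F Mod K); V \<in> carrier (F Mod K)\<rbrakk> \<Longrightarrow> h (U \<otimes>\<^bsub>F Mod K\<^esub> V) = h U \<oplus>\<^bsub>k\<^esub> h V"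
    "\<And>c m. \<lbrakk>c \<in> carrier k; m \<in> carrier N\<rbrakk> \<Longrightarrow> h (pure_tensor c m) = c \<otimes>\<^bsub>k\<^esub> \<pi> (\<psi> m)"
  proof (rule universal[OF k.abelian_group_axioms, of "\<lambda>c m. c \<otimes>\<^bsub>k\<^esub> \<pi> (\<psi> m)"])
    show "c \<otimes>\<^bsub>k\<^esub> \<pi> (\<psi> (l \<oplus>\<^bsub>N\<^esub> m)) = c \<otimes>\<^bsub>k\<^esub> \<pi> (\<psi> l) \<oplus>\<^bsub>k\<^esub> c \<otimes>\<^bsub>k\<^esub> \<pi> (\<psi> m)"
      if "c \<in> carrier k" "l \<in> carrier N" "m \<in> carrier N" for c l m
      using assms(2) that \<psi> by (simp add: linear_form_def additive_map_def \<pi>_add \<pi>_closed k.r_distr)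
    show "c \<otimes>\<^bsub>k\<^esub> \<pi> r \<otimes>\<^bsub>k\<^esub> \<pi> (\<psi> m) = c \<otimes>\<^bsub>k\<^esub> \<pi> (\<psi> (r \<odot>\<^bsub>N\<^esub> m))"
      if "c \<in> carrier k" "r \<in> carrier R" "m \<in> carrier N" for c r m
      using assms(2) that \<psi> by (simp add: linear_form_def \<pi>_mult \<pi>_closed k.m_assoc)
  qed (use \<psi> \<pi>_closed in \<open>auto simp: k.l_distr\<close>)
  have "h \<one>\<^bsub>F Mod K\<^esub> \<oplus>\<^bsub>k\<^esub> h \<one>\<^bsub>F Mod K\<^esub> = h \<one>\<^bsub>F Mod K\<^esub>"
    using h(2)[OF Q.one_closed Q.one_closed] Q.l_one[OF Q.one_closed] by metis
  moreover have "h \<one>\<^bsub>F Mod K\<^esub> \<in> carrier k" using h(1) Q.one_closed by blast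
  ultimately have "h \<one>\<^bsub>F Mod K\<^esub> = \<zero>\<^bsub>k\<^esub>" by (metis k.add.r_cancel_one')
  moreover have "h (red N x) = \<pi> (\<psi> x)"
    using h(3)[of "\<one>\<^bsub>k\<^esub>" x] assms(3) \<pi>_closed[OF \<psi>[OF assms(3)]] by (simp add: red_pure[OF assms(1)])
  moreover have "\<zero>\<^bsub>bc N\<^esub> = \<one>\<^bsub>F Mod K\<^esub>" by (simp add: scalar_extension_def Let_def)
  ultimately show ?thesis using assms(4) by simp
qed

lemma bc_module:
  assumes "module R N" shows "module k (bc N)"
proof (rule moduleI)
  interpret N: module R N by fact
  note [simp] = \<pi>_closed red_closed[OF assms]
  note sm = red_smult[OF assms, symmetric] and ad = red_add[OF assms, symmetric]
  show "cring k" by (rule k.is_cring)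
  show "abelian_group (bc N)" by (rule bc_abelian_group[OF assms])
  show "c \<odot>\<^bsub>bc N\<^esub> U \<in> carrier (bc N)" if "c \<in> carrier k" "U \<in> carrier (bc N)" for c U
    using \<pi>_lift[OF that(1)] red_surj[OF assms that(2)] by (auto simp: sm)
  show "(c \<oplus>\<^bsub>k\<^esub> d) \<odot>\<^bsub>bc N\<^esub> U = c \<odot>\<^bsub>bc N\<^esub> U \<oplus>\<^bsub>bc N\<^esub> d \<odot>\<^bsub>bc N\<^esub> U"
    if "c \<in> carrier k" "d \<in> carrier k" "U \<in> carrier (bc N)" for c d U
    using \<pi>_lift[OF that(1)] \<pi>_lift[OF that(2)] red_surj[OF assms that(3)]
    by (auto simp: sm ad N.smult_l_distr simp flip: \<pi>_add)
  show "c \<odot>\<^bsub>bc N\<^esub> (U \<oplus>\<^bsub>bc N\<^esub> V) = c \<odot>\<^bsub>bc N\<^esub> U \<oplus>\<^bsub>bc N\<^esub> c \<odot>\<^bsub>bc N\<^esub> V"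
    if "c \<in> carrier k" "U \<in> carrier (bc N)" "V \<in> carrier (bc N)" for c U V
    using \<pi>_lift[OF that(1)] red_surj[OF assms that(2)] red_surj[OF assms that(3)]
    by (auto simp: sm ad N.smult_r_distr)
  show "(c \<otimes>\<^bsub>k\<^esub> d) \<odot>\<^bsub>bc N\<^esub> U = c \<odot>\<^bsub>bc N\<^esub> (d \<odot>\<^bsub>bc N\<^esub> U)"
    if "c \<in> carrier k" "d \<in> carrier k" "U \<in> carrier (bc N)" for c d U
    using \<pi>_lift[OF that(1)] \<pi>_lift[OF that(2)] red_surj[OF assms that(3)]
    by (auto simp: sm N.smult_assoc1 simp flip: \<pi>_mult)
  show "\<one>\<^bsub>k\<^esub> \<odot>\<^bsub>bc N\<^esub> U = U" if "U \<in> carrier (bc N)" for U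
    using red_surj[OF assms that] by (auto simp: sm simp flip: \<pi>_one)
qed

lemma bc_vectorspace: "module R N \<Longrightarrow> vectorspace k (bc N)"
  by (simp add: vectorspace_def bc_module k.field_axioms)

lemma red_lincomb:
  assumes "module R N" "\<And>j. j \<in> J \<Longrightarrow> c j \<in> carrier R" "\<And>j. j \<in> J \<Longrightarrow> z j \<in> carrier N"
  shows "red N (\<Oplus>\<^bsub>N\<^esub>j\<in>J. c j \<odot>\<^bsub>N\<^esub> z j) = (\<Oplus>\<^bsub>bc N\<^esub>j\<in>J. \<pi> (c j) \<odot>\<^bsub>bc N\<^esub> red N (z j))"
proof -
  interpret N: module R N by fact
  interpret B: module k "bc N" by (rule bc_module[OF assms(1)])
  have "red N (\<Oplus>\<^bsub>N\<^esub>j\<in>J. c j \<odot>\<^bsub>N\<^esub> z j) = (\<Oplus>\<^bsub>bc N\<^esub>j\<in>J. red N (c j \<odot>\<^bsub>N\<^esub> z j))"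
    by (rule additive_map_finsum[OF N.M.abelian_group_axioms B.M.abelian_group_axioms red_additive[OF assms(1)]])
      (use assms in auto)
  also have "\<dots> = (\<Oplus>\<^bsub>bc N\<^esub>j\<in>J. \<pi> (c j) \<odot>\<^bsub>bc N\<^esub> red N (z j))"
    by (rule B.M.finsum_cong') (use assms red_smult[OF assms(1)] red_closed[OF assms(1)] \<pi>_closed in auto)
  finally show ?thesis .
qed

text \<open>The product of two cosets is a double union, so it must be independent of both
  representatives: \<open>right\<close> alters the second factor when the first is a generator,
  \<open>left\<close> alters the first factor against an arbitrary second one.\<close>

lemma red_mult:
  assumes "assoc_algebra R A" "a \<in> carrier A" "b \<in> carrier A"
  shows "red A (a \<otimes>\<^bsub>A\<^esub> b) = red A a \<otimes>\<^bsub>bc A\<^esub> red A b"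
proof -
  interpret A: assoc_algebra R A by fact
  interpret tensor_factors R k "\<lambda>c r. c \<otimes>\<^bsub>k\<^esub> \<pi> r" A by (rule tensor_factors[OF A.module_axioms])
  let ?g = "\<lambda>(c, a) (d, b). frag_of (c \<otimes>\<^bsub>k\<^esub> d, a \<otimes>\<^bsub>A\<^esub> b)"
  let ?\<Phi> = "\<lambda>x y. frag_extend (\<lambda>(c, a). frag_extend (\<lambda>(d, b). frag_of (c \<otimes>\<^bsub>k\<^esub> d, a \<otimes>\<^bsub>A\<^esub> b)) y) x"
  have \<Phi>of: "?\<Phi> (frag_of p) y = frag_extend (?g p) y" for p y by (cases p) simp
  have right: "frag_extend (?g p) h \<in> K" if p: "p \<in> carrier k \<times> carrier A" and h: "h \<in> K" for p h
    using h
  proof (induction rule: K_induct)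
    case (add_left x y m)
    then show ?case
      using K_relator_add_left[of "fst p \<otimes>\<^bsub>k\<^esub> x" "fst p \<otimes>\<^bsub>k\<^esub> y" "snd p \<otimes>\<^bsub>A\<^esub> m"] p
      by (auto simp: frag_extend_diff k.r_distr)
  next
    case (add_right x l m)
    then show ?case
      using K_relator_add_right[of "fst p \<otimes>\<^bsub>k\<^esub> x" "snd p \<otimes>\<^bsub>A\<^esub> l" "snd p \<otimes>\<^bsub>A\<^esub> m"] p
      by (auto simp: frag_extend_diff A.r_distr)
  next
    case (balanced x r m)
    then show ?case
      using K_relator_balanced[of "fst p \<otimes>\<^bsub>k\<^esub> x" r "snd p \<otimes>\<^bsub>A\<^esub> m"] p
      by (auto simp: frag_extend_diff k.m_assoc \<pi>_closed A.smult_mult_right)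
  next
    case (diff u v)
    then show ?case by (simp add: frag_extend_diff K_diff)
  qed (simp add: K_zero)
  \<comment> \<open>For a relator in the first factor an inner induction over \<open>y\<close> is
    needed: only multiplication by a generator turns it into a relator again.\<close>
  have left: "?\<Phi> h y \<in> K" if h: "h \<in> K" and y: "Poly_Mapping.keys y \<subseteq> carrier k \<times> carrier A" for h y
    using h
  proof (induction rule: K_induct)
    case (add_left x x' m)
    show ?case using y
    proof (induction y rule: frag_induct)
      case (gen p)
      then show ?case
        using add_left K_relator_add_left[of "x \<otimes>\<^bsub>k\<^esub> fst p" "x' \<otimes>\<^bsub>k\<^esub> fst p" "m \<otimes>\<^bsub>A\<^esub> snd p"]
        by (auto simp: frag_extend_diff k.l_distr)
    next
      case (diff u v)
      show ?case using K_diff[OF diff(3,4)]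
        by (simp only: frag_extend_diff frag_extend_of prod.case) (simp add: algebra_simps)
    qed (simp add: frag_extend_diff K_zero)
  next
    case (add_right x l m)
    show ?case using y
    proof (induction y rule: frag_induct)
      case (gen p)
      then show ?case
        using add_right K_relator_add_right[of "x \<otimes>\<^bsub>k\<^esub> fst p" "l \<otimes>\<^bsub>A\<^esub> snd p" "m \<otimes>\<^bsub>A\<^esub> snd p"]
        by (auto simp: frag_extend_diff A.l_distr)
    next
      case (diff u v)
      show ?case using K_diff[OF diff(3,4)]
        by (simp only: frag_extend_diff frag_extend_of prod.case) (simp add: algebra_simps)
    qed (simp add: frag_extend_diff K_zero)
  next
    case (balanced x r m)
    show ?case using y
    proof (induction y rule: frag_induct)
      case (gen p)
      then have "x \<otimes>\<^bsub>k\<^esub> \<pi> r \<otimes>\<^bsub>k\<^esub> fst p = x \<otimes>\<^bsub>k\<^esub> fst p \<otimes>\<^bsub>k\<^esub> \<pi> r"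
        using balanced by (auto simp: k.m_ac \<pi>_closed)
      then show ?case
        using gen balanced K_relator_balanced[of "x \<otimes>\<^bsub>k\<^esub> fst p" r "m \<otimes>\<^bsub>A\<^esub> snd p"]
        by (auto simp: frag_extend_diff A.smult_mult_left)
    next
      case (diff u v)
      show ?case using K_diff[OF diff(3,4)]
        by (simp only: frag_extend_diff frag_extend_of prod.case) (simp add: algebra_simps)
    qed (simp add: frag_extend_diff K_zero)
  next
    case (diff u v)
    then show ?case by (simp add: frag_extend_diff K_diff)
  qed (simp add: K_zero)
  let ?a = "frag_of (\<one>\<^bsub>k\<^esub>, a)" and ?b = "frag_of (\<one>\<^bsub>k\<^esub>, b)" and ?ab = "frag_of (\<one>\<^bsub>k\<^esub>, a \<otimes>\<^bsub>A\<^esub> b)"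
  have ab: "?\<Phi> ?a ?b = ?ab" by simp
  have "K #>\<^bsub>F\<^esub> ?\<Phi> x y = K #>\<^bsub>F\<^esub> ?ab" if x: "x \<in> red A a" and y: "y \<in> red A b" for x y
  proof -
    obtain h where h: "h \<in> K" "x = h + ?a" using x class_mem unfolding reduction_def by blast
    obtain h' where h': "h' \<in> K" "y = h' + ?b" using y class_mem unfolding reduction_def by blast
    have yk: "Poly_Mapping.keys y \<subseteq> carrier k \<times> carrier A"
      using keys_add[of h' ?b] K_keys[OF h'(1)] h'(2) assms by (auto simp: subset_iff)
    \<comment> \<open>The error \<open>h\<close> of the first representative is multiplied by all of
      \<open>y\<close>, the error \<open>h'\<close> of the second only by the generator
      \<open>?a\<close>; thus \<open>left\<close> and \<open>right\<close> absorb one term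
      each.\<close>
    have "?\<Phi> x y = ?\<Phi> h y + ?\<Phi> ?a h' + ?\<Phi> ?a ?b"
      unfolding h(2) by (simp add: frag_extend_add) (simp add: h'(2) frag_extend_add)
    moreover have "?\<Phi> ?a h' \<in> K" using right[OF _ h'(1), of "(\<one>\<^bsub>k\<^esub>, a)"] assms by simp
    ultimately have d: "?\<Phi> x y - ?ab \<in> K"
      using left[OF h(1) yk] K_add ab by (simp add: algebra_simps)
    have kab: "Poly_Mapping.keys ?ab \<subseteq> carrier k \<times> carrier A" using assms by simp
    have "Poly_Mapping.keys (?\<Phi> x y - ?ab + ?ab) \<subseteq> carrier k \<times> carrier A"
      using K_keys[OF d] kab keys_add[of "?\<Phi> x y - ?ab" ?ab] by blast
    then have kxy: "Poly_Mapping.keys (?\<Phi> x y) \<subseteq> carrier k \<times> carrier A" by simp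
    show ?thesis using class_eq_iff[OF kxy kab] d by blast
  qed
  moreover have "?a \<in> red A a" "?b \<in> red A b" unfolding reduction_def using class_self by blast+
  ultimately have "(\<Union>x\<in>red A a. \<Union>y\<in>red A b. K #>\<^bsub>F\<^esub> ?\<Phi> x y) = K #>\<^bsub>F\<^esub> ?ab" by blast
  then show ?thesis by (simp add: scalar_extension_def Let_def reduction_def)
qed

lemma red_one: "red A \<one>\<^bsub>A\<^esub> = \<one>\<^bsub>bc A\<^esub>"
  by (simp add: scalar_extension_def Let_def reduction_def)

lemma bc_assoc_algebra:
  assumes "assoc_algebra R A" shows "assoc_algebra k (bc A)"
proof -
  interpret A: assoc_algebra R A by fact
  interpret B: module k "bc A" by (rule bc_module[OF A.module_axioms])
  note surj = red_surj[OF A.module_axioms]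
  note [simp] = red_closed[OF A.module_axioms] \<pi>_closed
  note mu = red_mult[OF assms, symmetric] and ad = red_add[OF A.module_axioms, symmetric]
    and sm = red_smult[OF A.module_axioms, symmetric] and on = red_one[symmetric]
  have "ring (bc A)"
  proof (rule ringI)
    show "abelian_group (bc A)" by (rule B.M.abelian_group_axioms)
    show "monoid (bc A)"
    proof (rule monoidI)
      show "x \<otimes>\<^bsub>bc A\<^esub> y \<in> carrier (bc A)" if "x \<in> carrier (bc A)" "y \<in> carrier (bc A)" for x y
        using surj[OF that(1)] surj[OF that(2)] by (auto simp: mu)
      show "x \<otimes>\<^bsub>bc A\<^esub> y \<otimes>\<^bsub>bc A\<^esub> z = x \<otimes>\<^bsub>bc A\<^esub> (y \<otimes>\<^bsub>bc A\<^esub> z)"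
        if "x \<in> carrier (bc A)" "y \<in> carrier (bc A)" "z \<in> carrier (bc A)" for x y z
        using surj[OF that(1)] surj[OF that(2)] surj[OF that(3)] by (auto simp: mu A.m_assoc)
    qed (auto simp: mu on dest!: surj)
    show "(x \<oplus>\<^bsub>bc A\<^esub> y) \<otimes>\<^bsub>bc A\<^esub> z = x \<otimes>\<^bsub>bc A\<^esub> z \<oplus>\<^bsub>bc A\<^esub> y \<otimes>\<^bsub>bc A\<^esub> z"
      if "x \<in> carrier (bc A)" "y \<in> carrier (bc A)" "z \<in> carrier (bc A)" for x y z
      using surj[OF that(1)] surj[OF that(2)] surj[OF that(3)] by (auto simp: mu ad A.l_distr)
    show "z \<otimes>\<^bsub>bc A\<^esub> (x \<oplus>\<^bsub>bc A\<^esub> y) = z \<otimes>\<^bsub>bc A\<^esub> x \<oplus>\<^bsub>bc A\<^esub> z \<otimes>\<^bsub>bc A\<^esub> y"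
      if "x \<in> carrier (bc A)" "y \<in> carrier (bc A)" "z \<in> carrier (bc A)" for x y z
      using surj[OF that(1)] surj[OF that(2)] surj[OF that(3)] by (auto simp: mu ad A.r_distr)
  qed
  moreover have "assoc_algebra_axioms k (bc A)"
  proof
    show "(c \<odot>\<^bsub>bc A\<^esub> x) \<otimes>\<^bsub>bc A\<^esub> y = c \<odot>\<^bsub>bc A\<^esub> (x \<otimes>\<^bsub>bc A\<^esub> y)"
      if "c \<in> carrier k" "x \<in> carrier (bc A)" "y \<in> carrier (bc A)" for c x y
      using \<pi>_lift[OF that(1)] surj[OF that(2)] surj[OF that(3)] by (auto simp: mu sm A.smult_mult_left)
    show "x \<otimes>\<^bsub>bc A\<^esub> (c \<odot>\<^bsub>bc A\<^esub> y) = c \<odot>\<^bsub>bc A\<^esub> (x \<otimes>\<^bsub>bc A\<^esub> y)"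
      if "c \<in> carrier k" "x \<in> carrier (bc A)" "y \<in> carrier (bc A)" for c x y
      using \<pi>_lift[OF that(1)] surj[OF that(2)] surj[OF that(3)] by (auto simp: mu sm A.smult_mult_right)
  qed
  ultimately show ?thesis by (simp add: assoc_algebra_def B.module_axioms)
qed

end

section \<open>Nakayama's lemma and ranks\<close>

text \<open>\<open>R\<close> as a module over itself, which lets \<open>nakayama\<close> act on a
  vector of scalars in \<open>lift_coordinates\<close>.\<close>

definition ring_module :: "('r, 'c) ring_scheme \<Rightarrow> ('r, 'r) module" where
  "ring_module R = \<lparr>carrier = carrier R, monoid.mult = monoid.mult R, monoid.one = monoid.one R,
     ring.zero = ring.zero R, ring.add = ring.add R, smult = monoid.mult R\<rparr>"

lemma finsum_ring_module: "finsum (ring_module R) f S = finsum R f S"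
  by (simp add: finsum_def ring_module_def finprod_def)

lemma (in cring) ring_module: "module R (ring_module R)"
proof (rule moduleI)
  show "cring R" by (rule is_cring)
  show "abelian_group (ring_module R)"
    by (rule abelian_groupI) (auto simp: ring_module_def a_ac intro: bexI[of _ "\<ominus> _"] l_neg)
qed (auto simp: ring_module_def l_distr r_distr m_assoc)

context local_base
begin

text \<open>Elimination in place of a determinant: in the relation for \<open>y q0\<close> the
  coefficient of \<open>y q0\<close> lies in the kernel of \<pi>, so one minus it is a unit and the
  relation can be solved for \<open>y q0\<close>. Substituting the solution into the other relations
  leaves a system of the same shape with one unknown fewer. The closure conditions make
  \<open>U\<close> a submodule.\<close>

lemma nakayama:
  assumes N: "module R N" and "finite P" and y: "\<And>p. p \<in> P \<Longrightarrow> y p \<in> carrier N"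
    and U: "U \<subseteq> carrier N" "\<zero>\<^bsub>N\<^esub> \<in> U" "\<And>u v. \<lbrakk>u \<in> U; v \<in> U\<rbrakk> \<Longrightarrow> u \<oplus>\<^bsub>N\<^esub> v \<in> U"
      "\<And>r u. \<lbrakk>r \<in> carrier R; u \<in> U\<rbrakk> \<Longrightarrow> r \<odot>\<^bsub>N\<^esub> u \<in> U"
    and rel: "\<And>q. q \<in> P \<Longrightarrow> \<exists>u\<in>U. \<exists>m\<in>P \<rightarrow> carrier R. (\<forall>p\<in>P. \<pi> (m p) = \<zero>\<^bsub>k\<^esub>) \<and>
      y q = u \<oplus>\<^bsub>N\<^esub> (\<Oplus>\<^bsub>N\<^esub>p\<in>P. m p \<odot>\<^bsub>N\<^esub> y p)"
  shows "\<forall>q\<in>P. y q \<in> U"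
  using assms(2) y rel
proof (induction P)
  case (insert q0 P)
  interpret N: module R N by (rule N)
  have UN: "u \<in> carrier N" if "u \<in> U" for u using U(1) that by blast
  have y0: "y q0 \<in> carrier N" and yP: "\<And>p. p \<in> P \<Longrightarrow> y p \<in> carrier N" using insert.prems(1) by auto
  have split: "(\<Oplus>\<^bsub>N\<^esub>p\<in>insert q0 P. m p \<odot>\<^bsub>N\<^esub> y p) = m q0 \<odot>\<^bsub>N\<^esub> y q0 \<oplus>\<^bsub>N\<^esub> (\<Oplus>\<^bsub>N\<^esub>p\<in>P. m p \<odot>\<^bsub>N\<^esub> y p)"
    if "m \<in> insert q0 P \<rightarrow> carrier R" for m
    using insert.hyps that y0 yP by (intro N.M.finsum_insert) (auto simp: Pi_def)
  have sumc: "(\<Oplus>\<^bsub>N\<^esub>p\<in>P. m p \<odot>\<^bsub>N\<^esub> y p) \<in> carrier N" if "m \<in> P \<rightarrow> carrier R" for m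
    using that yP by (intro N.M.finsum_closed) (auto simp: Pi_def)
  obtain u0 m0 where u0: "u0 \<in> U" and m0: "m0 \<in> insert q0 P \<rightarrow> carrier R"
    and m0\<pi>: "\<And>p. p \<in> insert q0 P \<Longrightarrow> \<pi> (m0 p) = \<zero>\<^bsub>k\<^esub>"
    and e0': "y q0 = u0 \<oplus>\<^bsub>N\<^esub> (\<Oplus>\<^bsub>N\<^esub>p\<in>insert q0 P. m0 p \<odot>\<^bsub>N\<^esub> y p)"
    using insert.prems(2)[OF insertI1] by blast
  note e0 = e0'[unfolded split[OF m0]]
  have m0q: "m0 q0 \<in> carrier R" and m0P: "m0 \<in> P \<rightarrow> carrier R" using m0 by auto
  let ?T = "\<Oplus>\<^bsub>N\<^esub>p\<in>P. m0 p \<odot>\<^bsub>N\<^esub> y p"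
  have S0: "?T \<in> carrier N" by (rule sumc[OF m0P])
  \<comment> \<open>The coefficient of \<open>y q0\<close> once all its occurrences are on the
    left-hand side. It reduces to one and is therefore invertible.\<close>
  define w where "w = \<one>\<^bsub>R\<^esub> \<ominus>\<^bsub>R\<^esub> m0 q0"
  have wc: "w \<in> carrier R" using m0q by (simp add: w_def)
  have "\<pi> w = \<pi> \<one>\<^bsub>R\<^esub> \<ominus>\<^bsub>k\<^esub> \<pi> (m0 q0)" unfolding w_def by (rule \<pi>_diff[OF R.one_closed m0q])
  then have "\<pi> w = \<one>\<^bsub>k\<^esub>" using m0\<pi>[of q0] by (simp add: \<pi>_one a_minus_def)
  then have "w \<in> Units R" using unit_if[OF wc] by simp
  then have vw: "inv\<^bsub>R\<^esub> w \<otimes>\<^bsub>R\<^esub> w = \<one>\<^bsub>R\<^esub>" "inv\<^bsub>R\<^esub> w \<in> carrier R" by simp_all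
  let ?v = "inv\<^bsub>R\<^esub> w"
  have "w \<odot>\<^bsub>N\<^esub> y q0 = u0 \<oplus>\<^bsub>N\<^esub> ?T"
  proof -
    have "w \<odot>\<^bsub>N\<^esub> y q0 \<oplus>\<^bsub>N\<^esub> m0 q0 \<odot>\<^bsub>N\<^esub> y q0 = (w \<oplus>\<^bsub>R\<^esub> m0 q0) \<odot>\<^bsub>N\<^esub> y q0"
      using wc m0q y0 by (simp add: N.smult_l_distr)
    also have "w \<oplus>\<^bsub>R\<^esub> m0 q0 = \<one>\<^bsub>R\<^esub>" using m0q by (simp add: w_def a_minus_def R.a_assoc R.l_neg)
    also have "\<one>\<^bsub>R\<^esub> \<odot>\<^bsub>N\<^esub> y q0 = y q0" using y0 by simp
    also have "\<dots> = (u0 \<oplus>\<^bsub>N\<^esub> ?T) \<oplus>\<^bsub>N\<^esub> m0 q0 \<odot>\<^bsub>N\<^esub> y q0"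
      by (subst e0) (use UN[OF u0] S0 m0q y0 in \<open>simp add: N.M.a_ac\<close>)
    finally show ?thesis
      using N.M.add.r_cancel[of "m0 q0 \<odot>\<^bsub>N\<^esub> y q0" "w \<odot>\<^bsub>N\<^esub> y q0" "u0 \<oplus>\<^bsub>N\<^esub> ?T"] wc m0q y0 UN[OF u0] S0 by simp
  qed
  then have "?v \<odot>\<^bsub>N\<^esub> (w \<odot>\<^bsub>N\<^esub> y q0) = ?v \<odot>\<^bsub>N\<^esub> (u0 \<oplus>\<^bsub>N\<^esub> ?T)" by simp
  then have e1: "y q0 = ?v \<odot>\<^bsub>N\<^esub> u0 \<oplus>\<^bsub>N\<^esub> ?v \<odot>\<^bsub>N\<^esub> ?T"
    using vw wc y0 UN[OF u0] S0 by (simp add: N.smult_r_distr flip: N.smult_assoc1)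
  have "\<forall>q\<in>P. y q \<in> U"
  proof (rule insert.IH)
    fix q assume q: "q \<in> P"
    obtain u m where u: "u \<in> U" and m: "m \<in> insert q0 P \<rightarrow> carrier R"
      and m\<pi>: "\<And>p. p \<in> insert q0 P \<Longrightarrow> \<pi> (m p) = \<zero>\<^bsub>k\<^esub>"
      and e': "y q = u \<oplus>\<^bsub>N\<^esub> (\<Oplus>\<^bsub>N\<^esub>p\<in>insert q0 P. m p \<odot>\<^bsub>N\<^esub> y p)"
      using insert.prems(2)[OF insertI2[OF q]] by blast
    note e = e'[unfolded split[OF m]]
    have mq: "m q0 \<in> carrier R" and mP: "m \<in> P \<rightarrow> carrier R" using m by auto
    let ?c = "m q0 \<otimes>\<^bsub>R\<^esub> ?v"
    \<comment> \<open>The coefficients after \<open>y q0\<close> is replaced by means of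
      \<open>e1\<close> in the relation for \<open>y q\<close>; both summands are killed by
      \<pi>.\<close>
    let ?m = "\<lambda>p. ?c \<otimes>\<^bsub>R\<^esub> m0 p \<oplus>\<^bsub>R\<^esub> m p" and ?S = "\<Oplus>\<^bsub>N\<^esub>p\<in>P. m p \<odot>\<^bsub>N\<^esub> y p"
    have c: "?c \<in> carrier R" using mq vw by simp
    have S: "?S \<in> carrier N" by (rule sumc[OF mP])
    have "(\<Oplus>\<^bsub>N\<^esub>p\<in>P. ?m p \<odot>\<^bsub>N\<^esub> y p) = (\<Oplus>\<^bsub>N\<^esub>p\<in>P. ?c \<odot>\<^bsub>N\<^esub> (m0 p \<odot>\<^bsub>N\<^esub> y p) \<oplus>\<^bsub>N\<^esub> m p \<odot>\<^bsub>N\<^esub> y p)"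
      by (rule N.M.finsum_cong') (use c m0P mP yP in \<open>auto simp: N.smult_l_distr N.smult_assoc1 Pi_def\<close>)
    also have "\<dots> = (\<Oplus>\<^bsub>N\<^esub>p\<in>P. ?c \<odot>\<^bsub>N\<^esub> (m0 p \<odot>\<^bsub>N\<^esub> y p)) \<oplus>\<^bsub>N\<^esub> ?S"
      by (rule N.M.finsum_addf) (use c m0P mP yP in \<open>auto simp: Pi_def\<close>)
    also have "(\<Oplus>\<^bsub>N\<^esub>p\<in>P. ?c \<odot>\<^bsub>N\<^esub> (m0 p \<odot>\<^bsub>N\<^esub> y p)) = ?c \<odot>\<^bsub>N\<^esub> ?T"
      by (rule N.finsum_smult[symmetric]) (use c m0P yP in \<open>auto simp: Pi_def\<close>)
    finally have sum: "(\<Oplus>\<^bsub>N\<^esub>p\<in>P. ?m p \<odot>\<^bsub>N\<^esub> y p) = ?c \<odot>\<^bsub>N\<^esub> ?T \<oplus>\<^bsub>N\<^esub> ?S" .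
    have "m q0 \<odot>\<^bsub>N\<^esub> y q0 = ?c \<odot>\<^bsub>N\<^esub> u0 \<oplus>\<^bsub>N\<^esub> ?c \<odot>\<^bsub>N\<^esub> ?T"
      by (subst e1) (use mq vw UN[OF u0] S0 in \<open>simp add: N.smult_r_distr N.smult_assoc1\<close>)
    then have a: "y q = (u \<oplus>\<^bsub>N\<^esub> ?c \<odot>\<^bsub>N\<^esub> u0) \<oplus>\<^bsub>N\<^esub> (\<Oplus>\<^bsub>N\<^esub>p\<in>P. ?m p \<odot>\<^bsub>N\<^esub> y p)"
      unfolding sum by (subst e) (use c S S0 UN[OF u] UN[OF u0] in \<open>simp add: N.M.a_assoc\<close>)
    have b: "?m \<in> P \<rightarrow> carrier R" using c m0P mP by auto
    have d: "\<forall>p\<in>P. \<pi> (?m p) = \<zero>\<^bsub>k\<^esub>"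
      using c m0P mP m\<pi> m0\<pi> by (auto simp: \<pi>_add \<pi>_mult \<pi>_closed Pi_def)
    have f: "u \<oplus>\<^bsub>N\<^esub> ?c \<odot>\<^bsub>N\<^esub> u0 \<in> U" using U(3,4) u u0 c by blast
    show "\<exists>u\<in>U. \<exists>m\<in>P \<rightarrow> carrier R. (\<forall>p\<in>P. \<pi> (m p) = \<zero>\<^bsub>k\<^esub>) \<and>
        y q = u \<oplus>\<^bsub>N\<^esub> (\<Oplus>\<^bsub>N\<^esub>p\<in>P. m p \<odot>\<^bsub>N\<^esub> y p)"
      by (intro bexI[of _ "u \<oplus>\<^bsub>N\<^esub> ?c \<odot>\<^bsub>N\<^esub> u0"] bexI[of _ ?m] conjI a b d f)
  qed (use yP in auto)
  moreover have "y q0 \<in> U"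
  proof -
    have "(\<Oplus>\<^bsub>N\<^esub>p\<in>L. m0 p \<odot>\<^bsub>N\<^esub> y p) \<in> U" if "finite L" "L \<subseteq> P" for L
      using that
    proof (induction L)
      case empty
      then show ?case using U(2) by simp
    next
      case (insert p L)
      then have "(\<lambda>p. m0 p \<odot>\<^bsub>N\<^esub> y p) \<in> L \<rightarrow> carrier N" "m0 p \<odot>\<^bsub>N\<^esub> y p \<in> carrier N" "m0 p \<odot>\<^bsub>N\<^esub> y p \<in> U"
        using m0P yP U(4) \<open>\<forall>q\<in>P. y q \<in> U\<close> by (auto simp: Pi_def subset_iff)
      then show ?case using insert U(3) by simp
    qed
    then have "?T \<in> U" using insert.hyps by blast
    then show ?thesis by (subst e1) (use U(3,4) u0 vw in blast)
  qed
  ultimately show ?case by blast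
qed simp

text \<open>For independence, a relation over \<open>k\<close> is lifted to coefficients in
  \<open>R\<close>. The lifted combination reduces to zero, so by \<open>red_form\<close> its
  coordinates, which are the lifted coefficients, vanish under \<pi>.\<close>

lemma reduce_coordinates:
  assumes N: "module R N" and c: "coordinates R N J z \<phi>"
  shows "\<exists>\<chi>. coordinates k (bc N) J (\<lambda>j. red N (z j)) \<chi>"
proof -
  interpret N: module R N by (rule N)
  interpret B: module k "bc N" by (rule bc_module[OF N])
  have d: "dual_basis R N J z \<phi>" and fin: "finite J" using c by (auto simp: coordinates_def dual_basis_def)
  note zc = dual_basis_closed(1)[OF d]
  show ?thesis
  proof (rule B.coordinatesI)
    show "\<exists>c\<in>J \<rightarrow> carrier k. X = (\<Oplus>\<^bsub>bc N\<^esub>j\<in>J. c j \<odot>\<^bsub>bc N\<^esub> red N (z j))" if X: "X \<in> carrier (bc N)" for X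
    proof -
      obtain x where x: "x \<in> carrier N" "X = red N x" using red_surj[OF N X] by blast
      have "red N (\<Oplus>\<^bsub>N\<^esub>j\<in>J. \<phi> j x \<odot>\<^bsub>N\<^esub> z j) = (\<Oplus>\<^bsub>bc N\<^esub>j\<in>J. \<pi> (\<phi> j x) \<odot>\<^bsub>bc N\<^esub> red N (z j))"
        using dual_basis_closed[OF d] x by (intro red_lincomb[OF N]) auto
      moreover have "(\<lambda>j. \<pi> (\<phi> j x)) \<in> J \<rightarrow> carrier k" using dual_basis_closed[OF d] x \<pi>_closed by auto
      ultimately show ?thesis using dual_basis_eq[OF d x(1)] x(2) by auto
    qed
    show "c j = \<zero>\<^bsub>k\<^esub>" if cJ: "c \<in> J \<rightarrow> carrier k" and z0: "(\<Oplus>\<^bsub>bc N\<^esub>j\<in>J. c j \<odot>\<^bsub>bc N\<^esub> red N (z j)) = \<zero>\<^bsub>bc N\<^esub>" and j: "j \<in> J" for c j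
    proof -
      have "\<forall>j. \<exists>r. j \<in> J \<longrightarrow> r \<in> carrier R \<and> c j = \<pi> r" using \<pi>_lift cJ by blast
      then obtain r where r: "\<And>j. j \<in> J \<Longrightarrow> r j \<in> carrier R" "\<And>j. j \<in> J \<Longrightarrow> c j = \<pi> (r j)" by metis
      let ?x = "\<Oplus>\<^bsub>N\<^esub>j\<in>J. r j \<odot>\<^bsub>N\<^esub> z j"
      have xc: "?x \<in> carrier N" using r zc by (intro N.M.finsum_closed) auto
      have "red N ?x = (\<Oplus>\<^bsub>bc N\<^esub>j\<in>J. \<pi> (r j) \<odot>\<^bsub>bc N\<^esub> red N (z j))"
        using r zc by (intro red_lincomb[OF N]) auto
      also have "\<dots> = (\<Oplus>\<^bsub>bc N\<^esub>j\<in>J. c j \<odot>\<^bsub>bc N\<^esub> red N (z j))"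
        by (rule B.M.finsum_cong') (use r zc cJ red_closed[OF N] in auto)
      finally have "red N ?x = \<zero>\<^bsub>bc N\<^esub>" using z0 by simp
      then have "\<pi> (\<phi> j ?x) = \<zero>\<^bsub>k\<^esub>" by (rule red_form[OF N dual_basis_form[OF d j] xc])
      then show ?thesis using N.coordinates_lincomb[OF c _ j, of r] r j by simp
    qed
  qed (use fin zc red_closed[OF N] in auto)
qed

text \<open>Over a local ring a finitely generated projective module is free, and any lift of a
  basis of its reduction is a basis. Nakayama's lemma is used twice: in \<open>N\<close> for
  generation, in \<open>R\<close> for independence.\<close>

lemma lift_coordinates:
  fixes J :: "'j set"
  assumes N: "module R N" and d: "dual_basis R N P y \<phi>"
    and z: "\<And>j. j \<in> J \<Longrightarrow> z j \<in> carrier N" and c: "coordinates k (bc N) J (\<lambda>j. red N (z j)) \<chi>"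
  shows "\<exists>\<psi>. coordinates R N J z \<psi>"
proof -
  interpret N: module R N by (rule N)
  interpret B: module k "bc N" by (rule bc_module[OF N])
  have dB: "dual_basis k (bc N) J (\<lambda>j. red N (z j)) \<chi>" and fin: "finite J" and finP: "finite P"
    using c d by (auto simp: coordinates_def dual_basis_def)
  note yc = dual_basis_closed[OF d]
  let ?U = "{(\<Oplus>\<^bsub>N\<^esub>j\<in>J. r j \<odot>\<^bsub>N\<^esub> z j) | r. r \<in> J \<rightarrow> carrier R}"
  have Uc: "(\<Oplus>\<^bsub>N\<^esub>j\<in>J. r j \<odot>\<^bsub>N\<^esub> z j) \<in> carrier N" if "r \<in> J \<rightarrow> carrier R" for r
    using that z by (intro N.M.finsum_closed) (auto simp: Pi_def)
  \<comment> \<open>Here \<open>U\<close> is the span of the \<open>z j\<close>. Each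
    \<open>y q\<close> differs from an element of it by something that reduces to zero, and the dual
    basis expands this remainder in the \<open>y p\<close> with coefficients killed by
    \<pi>.\<close>
  have yU: "\<forall>q\<in>P. y q \<in> ?U"
  proof (rule nakayama[OF N finP])
    show "?U \<subseteq> carrier N" using Uc by blast
    show "\<zero>\<^bsub>N\<^esub> \<in> ?U"
    proof -
      have "(\<Oplus>\<^bsub>N\<^esub>j\<in>J. \<zero>\<^bsub>R\<^esub> \<odot>\<^bsub>N\<^esub> z j) = \<zero>\<^bsub>N\<^esub>" using z by (intro N.M.add.finprod_one_eqI) auto
      then show ?thesis by (intro CollectI exI[of _ "\<lambda>_. \<zero>\<^bsub>R\<^esub>"]) auto
    qed
    show "u \<oplus>\<^bsub>N\<^esub> v \<in> ?U" if uv: "u \<in> ?U" "v \<in> ?U" for u v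
    proof -
      obtain r s where rs: "r \<in> J \<rightarrow> carrier R" "u = (\<Oplus>\<^bsub>N\<^esub>j\<in>J. r j \<odot>\<^bsub>N\<^esub> z j)"
        "s \<in> J \<rightarrow> carrier R" "v = (\<Oplus>\<^bsub>N\<^esub>j\<in>J. s j \<odot>\<^bsub>N\<^esub> z j)" using uv by blast
      have "(\<Oplus>\<^bsub>N\<^esub>j\<in>J. (r j \<oplus>\<^bsub>R\<^esub> s j) \<odot>\<^bsub>N\<^esub> z j) = (\<Oplus>\<^bsub>N\<^esub>j\<in>J. r j \<odot>\<^bsub>N\<^esub> z j \<oplus>\<^bsub>N\<^esub> s j \<odot>\<^bsub>N\<^esub> z j)"
        by (rule N.M.finsum_cong') (use rs z in \<open>auto simp: N.smult_l_distr Pi_def\<close>)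
      also have "\<dots> = u \<oplus>\<^bsub>N\<^esub> v"
        unfolding rs by (rule N.M.finsum_addf) (use rs z in \<open>auto simp: Pi_def\<close>)
      finally show ?thesis using rs by (intro CollectI exI[of _ "\<lambda>j. r j \<oplus>\<^bsub>R\<^esub> s j"]) auto
    qed
    show "t \<odot>\<^bsub>N\<^esub> u \<in> ?U" if t: "t \<in> carrier R" and u: "u \<in> ?U" for t u
    proof -
      obtain r where r: "r \<in> J \<rightarrow> carrier R" "u = (\<Oplus>\<^bsub>N\<^esub>j\<in>J. r j \<odot>\<^bsub>N\<^esub> z j)" using u by blast
      have "(\<Oplus>\<^bsub>N\<^esub>j\<in>J. (t \<otimes>\<^bsub>R\<^esub> r j) \<odot>\<^bsub>N\<^esub> z j) = (\<Oplus>\<^bsub>N\<^esub>j\<in>J. t \<odot>\<^bsub>N\<^esub> (r j \<odot>\<^bsub>N\<^esub> z j))"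
        by (rule N.M.finsum_cong') (use r z t in \<open>auto simp: N.smult_assoc1 Pi_def\<close>)
      also have "\<dots> = t \<odot>\<^bsub>N\<^esub> u"
        unfolding r by (rule N.finsum_smult[symmetric]) (use r z t in \<open>auto simp: Pi_def\<close>)
      finally show ?thesis using r t by (intro CollectI exI[of _ "\<lambda>j. t \<otimes>\<^bsub>R\<^esub> r j"]) auto
    qed
    show "\<exists>u\<in>?U. \<exists>m\<in>P \<rightarrow> carrier R. (\<forall>p\<in>P. \<pi> (m p) = \<zero>\<^bsub>k\<^esub>) \<and> y q = u \<oplus>\<^bsub>N\<^esub> (\<Oplus>\<^bsub>N\<^esub>p\<in>P. m p \<odot>\<^bsub>N\<^esub> y p)"
      if q: "q \<in> P" for q
    proof -
      have ry: "red N (y q) \<in> carrier (bc N)" using red_closed[OF N yc(1)[OF q]] .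
      have "\<forall>j. \<exists>r. j \<in> J \<longrightarrow> r \<in> carrier R \<and> \<chi> j (red N (y q)) = \<pi> r"
        using \<pi>_lift dual_basis_closed(2)[OF dB] ry by blast
      then obtain r where r: "\<And>j. j \<in> J \<Longrightarrow> r j \<in> carrier R" "\<And>j. j \<in> J \<Longrightarrow> \<chi> j (red N (y q)) = \<pi> (r j)" by metis
      let ?u = "\<Oplus>\<^bsub>N\<^esub>j\<in>J. r j \<odot>\<^bsub>N\<^esub> z j"
      have u: "?u \<in> carrier N" using Uc[of r] r by auto
      have "red N ?u = (\<Oplus>\<^bsub>bc N\<^esub>j\<in>J. \<pi> (r j) \<odot>\<^bsub>bc N\<^esub> red N (z j))"
        using r z by (intro red_lincomb[OF N]) auto
      also have "\<dots> = (\<Oplus>\<^bsub>bc N\<^esub>j\<in>J. \<chi> j (red N (y q)) \<odot>\<^bsub>bc N\<^esub> red N (z j))"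
        by (rule B.M.finsum_cong') (use r z ry dual_basis_closed[OF dB] \<pi>_closed in auto)
      also have "\<dots> = red N (y q)" by (rule dual_basis_eq[OF dB ry])
      finally have ru: "red N ?u = red N (y q)" .
      let ?x = "y q \<ominus>\<^bsub>N\<^esub> ?u"
      have x: "?x \<in> carrier N" using u yc(1)[OF q] by simp
      have x0: "red N ?x = \<zero>\<^bsub>bc N\<^esub>" using red_diff[OF N yc(1)[OF q] u] ru ry by (simp add: a_minus_def B.M.r_neg)
      have a: "?u \<oplus>\<^bsub>N\<^esub> (\<Oplus>\<^bsub>N\<^esub>p\<in>P. \<phi> p ?x \<odot>\<^bsub>N\<^esub> y p) = y q"
        using dual_basis_eq[OF d x] u yc(1)[OF q] by (simp add: a_minus_def N.M.a_lcomm N.M.r_neg)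
      have b: "\<forall>p\<in>P. \<pi> (\<phi> p ?x) = \<zero>\<^bsub>k\<^esub>" using red_form[OF N dual_basis_form[OF d] x x0] by blast
      have c: "(\<lambda>p. \<phi> p ?x) \<in> P \<rightarrow> carrier R" using yc(2) x by auto
      have d: "?u \<in> ?U" using r by auto
      show ?thesis by (intro bexI[of _ ?u] bexI[of _ "\<lambda>p. \<phi> p ?x"] conjI a[symmetric] b c d)
    qed
  qed (use yc in auto)
  have "\<forall>q. \<exists>r. q \<in> P \<longrightarrow> r \<in> J \<rightarrow> carrier R \<and> y q = (\<Oplus>\<^bsub>N\<^esub>j\<in>J. r j \<odot>\<^bsub>N\<^esub> z j)" using yU by blast
  then obtain C where C: "\<And>q. q \<in> P \<Longrightarrow> C q \<in> J \<rightarrow> carrier R"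
    "\<And>q. q \<in> P \<Longrightarrow> y q = (\<Oplus>\<^bsub>N\<^esub>j\<in>J. C q j \<odot>\<^bsub>N\<^esub> z j)" by metis
  have Cc: "C q j \<in> carrier R" if "q \<in> P" "j \<in> J" for q j using C(1) that by blast
  \<comment> \<open>Expanding along \<open>y\<close> and rewriting every \<open>y q\<close> through
    the \<open>z j\<close> gives coefficients that depend linearly on \<open>x\<close> before the
    \<open>z j\<close> are known to be independent.\<close>
  define \<psi> where "\<psi> j x = (\<Oplus>\<^bsub>R\<^esub>q\<in>P. \<phi> q x \<otimes>\<^bsub>R\<^esub> C q j)" for j x
  have \<psi>c: "\<psi> j x \<in> carrier R" if "j \<in> J" "x \<in> carrier N" for j x
    unfolding \<psi>_def using yc that Cc by (intro R.finsum_closed) auto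
  have \<psi>eq: "(\<Oplus>\<^bsub>N\<^esub>j\<in>J. \<psi> j x \<odot>\<^bsub>N\<^esub> z j) = x" if x: "x \<in> carrier N" for x
  proof -
    have "(\<Oplus>\<^bsub>N\<^esub>j\<in>J. \<psi> j x \<odot>\<^bsub>N\<^esub> z j) = (\<Oplus>\<^bsub>N\<^esub>j\<in>J. \<Oplus>\<^bsub>N\<^esub>q\<in>P. (\<phi> q x \<otimes>\<^bsub>R\<^esub> C q j) \<odot>\<^bsub>N\<^esub> z j)"
      unfolding \<psi>_def using z yc x Cc
      by (intro N.M.finsum_cong' N.finsum_smult_r refl) (auto intro!: N.M.finsum_closed)
    also have "\<dots> = (\<Oplus>\<^bsub>N\<^esub>q\<in>P. \<Oplus>\<^bsub>N\<^esub>j\<in>J. (\<phi> q x \<otimes>\<^bsub>R\<^esub> C q j) \<odot>\<^bsub>N\<^esub> z j)"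
      using N.M.add.finprod_finprod_swap[OF fin finP, of "\<lambda>j q. (\<phi> q x \<otimes>\<^bsub>R\<^esub> C q j) \<odot>\<^bsub>N\<^esub> z j"] z yc x Cc by simp
    also have "\<dots> = (\<Oplus>\<^bsub>N\<^esub>q\<in>P. \<phi> q x \<odot>\<^bsub>N\<^esub> y q)"
    proof (rule N.M.finsum_cong')
      fix q assume q: "q \<in> P"
      have "\<phi> q x \<odot>\<^bsub>N\<^esub> y q = (\<Oplus>\<^bsub>N\<^esub>j\<in>J. \<phi> q x \<odot>\<^bsub>N\<^esub> (C q j \<odot>\<^bsub>N\<^esub> z j))"
        by (subst C(2)[OF q]) (rule N.finsum_smult, use q yc x z Cc in auto)
      also have "\<dots> = (\<Oplus>\<^bsub>N\<^esub>j\<in>J. (\<phi> q x \<otimes>\<^bsub>R\<^esub> C q j) \<odot>\<^bsub>N\<^esub> z j)"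
        by (rule N.M.finsum_cong') (use q yc x z Cc in \<open>auto simp: N.smult_assoc1\<close>)
      finally show "(\<Oplus>\<^bsub>N\<^esub>j\<in>J. (\<phi> q x \<otimes>\<^bsub>R\<^esub> C q j) \<odot>\<^bsub>N\<^esub> z j) = \<phi> q x \<odot>\<^bsub>N\<^esub> y q" by simp
    qed (use yc x in auto)
    also have "\<dots> = x" by (rule dual_basis_eq[OF d x])
    finally show ?thesis .
  qed
  have \<psi>form: "linear_form R N (\<psi> j)" if j: "j \<in> J" for j
    unfolding linear_form_def
  proof (intro conjI ballI additive_mapI)
    note lf = dual_basis_form[OF d, unfolded linear_form_def]
    show "\<psi> j x \<in> carrier R" if "x \<in> carrier N" for x using \<psi>c j that .
    show "\<psi> j (x \<oplus>\<^bsub>N\<^esub> x') = \<psi> j x \<oplus>\<^bsub>R\<^esub> \<psi> j x'" if x: "x \<in> carrier N" "x' \<in> carrier N" for x x'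
    proof -
      have "\<psi> j (x \<oplus>\<^bsub>N\<^esub> x') = (\<Oplus>\<^bsub>R\<^esub>q\<in>P. \<phi> q x \<otimes>\<^bsub>R\<^esub> C q j \<oplus>\<^bsub>R\<^esub> \<phi> q x' \<otimes>\<^bsub>R\<^esub> C q j)"
        unfolding \<psi>_def by (rule R.finsum_cong') (use lf yc x Cc j in \<open>auto simp: additive_map_def R.l_distr\<close>)
      then show ?thesis unfolding \<psi>_def using R.finsum_addf[of "\<lambda>q. \<phi> q x \<otimes>\<^bsub>R\<^esub> C q j" P "\<lambda>q. \<phi> q x' \<otimes>\<^bsub>R\<^esub> C q j"] yc x Cc j by auto
    qed
    show "\<psi> j (r \<odot>\<^bsub>N\<^esub> x) = r \<otimes>\<^bsub>R\<^esub> \<psi> j x" if r: "r \<in> carrier R" and x: "x \<in> carrier N" for r x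
    proof -
      have "r \<otimes>\<^bsub>R\<^esub> \<psi> j x = (\<Oplus>\<^bsub>R\<^esub>q\<in>P. r \<otimes>\<^bsub>R\<^esub> (\<phi> q x \<otimes>\<^bsub>R\<^esub> C q j))"
        unfolding \<psi>_def by (rule R.finsum_rdistr) (use r finP yc x Cc j in auto)
      also have "\<dots> = \<psi> j (r \<odot>\<^bsub>N\<^esub> x)"
        unfolding \<psi>_def by (rule R.finsum_cong') (use lf r yc x Cc j in \<open>auto simp: R.m_assoc\<close>)
      finally show ?thesis by simp
    qed
  qed
  show ?thesis
  proof (rule N.coordinatesI)
    show "\<exists>c\<in>J \<rightarrow> carrier R. x = (\<Oplus>\<^bsub>N\<^esub>j\<in>J. c j \<odot>\<^bsub>N\<^esub> z j)" if "x \<in> carrier N" for x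
      using \<psi>eq[OF that] \<psi>c that by (intro bexI[of _ "\<lambda>j. \<psi> j x"]) auto
    show "r j0 = \<zero>\<^bsub>R\<^esub>" if r: "r \<in> J \<rightarrow> carrier R" and z0: "(\<Oplus>\<^bsub>N\<^esub>j\<in>J. r j \<odot>\<^bsub>N\<^esub> z j) = \<zero>\<^bsub>N\<^esub>" and j0: "j0 \<in> J" for r j0
    proof -
      have rc: "r j \<in> carrier R" if "j \<in> J" for j using r that by blast
      let ?R = "ring_module R"
      define \<delta> where "\<delta> i j = (if i = j then \<one>\<^bsub>R\<^esub> else \<zero>\<^bsub>R\<^esub>)" for i j :: 'j
      have \<delta>c: "\<delta> i j \<in> carrier R" for i j by (simp add: \<delta>_def)
      \<comment> \<open>The identity matrix minus the matrix of the \<open>\<psi> j (z i)\<close>.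
        It vanishes under \<pi> because the reduced \<open>z i\<close> are a basis, and it fixes the
        vector \<open>r\<close> because \<open>\<psi> j\<close> applied to the relation gives
        zero.\<close>
      let ?m = "\<lambda>j i. \<delta> i j \<ominus>\<^bsub>R\<^esub> \<psi> j (z i)"
      have \<pi>m: "\<pi> (?m j i) = \<zero>\<^bsub>k\<^esub>" if ij: "i \<in> J" "j \<in> J" for i j
      proof -
        have "red N (z i) = (\<Oplus>\<^bsub>bc N\<^esub>l\<in>J. \<pi> (\<psi> l (z i)) \<odot>\<^bsub>bc N\<^esub> red N (z l))"
          using red_lincomb[OF N, of J "\<lambda>l. \<psi> l (z i)" z] \<psi>eq[OF z[OF ij(1)]] \<psi>c z ij by simp
        then have "\<chi> j (red N (z i)) = \<pi> (\<psi> j (z i))"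
          using B.coordinates_lincomb[OF c, of "\<lambda>l. \<pi> (\<psi> l (z i))" j] \<psi>c z ij \<pi>_closed by simp
        moreover have "\<chi> j (red N (z i)) = \<pi> (\<delta> i j)"
          using c ij by (auto simp: coordinates_def \<delta>_def \<pi>_one \<pi>_zero)
        ultimately have "\<pi> (\<delta> i j) = \<pi> (\<psi> j (z i))" by simp
        moreover have "\<pi> (?m j i) = \<pi> (\<delta> i j) \<ominus>\<^bsub>k\<^esub> \<pi> (\<psi> j (z i))"
          using \<delta>c \<psi>c z ij by (intro \<pi>_diff) auto
        ultimately show ?thesis using \<psi>c z ij \<pi>_closed by (simp add: a_minus_def k.r_neg)
      qed
      have rj: "r j = (\<Oplus>\<^bsub>R\<^esub>i\<in>J. ?m j i \<otimes>\<^bsub>R\<^esub> r i)" if j: "j \<in> J" for j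
      proof -
        have "(\<Oplus>\<^bsub>R\<^esub>i\<in>J. r i \<otimes>\<^bsub>R\<^esub> \<psi> j (z i)) = \<psi> j \<zero>\<^bsub>N\<^esub>"
          using N.linear_form_lincomb[OF \<psi>form[OF j], of J r z] rc z z0 by simp
        also have "\<dots> = \<zero>\<^bsub>R\<^esub>"
          using \<psi>form[OF j] additive_map_zero[OF N.M.abelian_group_axioms R.abelian_group_axioms]
          by (auto simp: linear_form_def)
        finally have s0: "(\<Oplus>\<^bsub>R\<^esub>i\<in>J. r i \<otimes>\<^bsub>R\<^esub> \<psi> j (z i)) = \<zero>\<^bsub>R\<^esub>" .
        have sc: "(\<Oplus>\<^bsub>R\<^esub>i\<in>J. ?m j i \<otimes>\<^bsub>R\<^esub> r i) \<in> carrier R"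
          using rc \<delta>c \<psi>c z j by (intro R.finsum_closed) auto
        have "(\<Oplus>\<^bsub>R\<^esub>i\<in>J. if i = j then r i else \<zero>\<^bsub>R\<^esub>) = (\<Oplus>\<^bsub>R\<^esub>i\<in>J. ?m j i \<otimes>\<^bsub>R\<^esub> r i \<oplus>\<^bsub>R\<^esub> r i \<otimes>\<^bsub>R\<^esub> \<psi> j (z i))"
        proof (rule R.finsum_cong')
          fix i assume i: "i \<in> J"
          have "?m j i \<otimes>\<^bsub>R\<^esub> r i \<oplus>\<^bsub>R\<^esub> r i \<otimes>\<^bsub>R\<^esub> \<psi> j (z i) = (?m j i \<oplus>\<^bsub>R\<^esub> \<psi> j (z i)) \<otimes>\<^bsub>R\<^esub> r i"
            using rc \<delta>c \<psi>c z j i by (simp add: R.l_distr R.r_distr R.m_comm)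
          also have "?m j i \<oplus>\<^bsub>R\<^esub> \<psi> j (z i) = \<delta> i j"
            using \<delta>c \<psi>c z j i by (simp add: a_minus_def R.a_assoc R.l_neg)
          also have "\<delta> i j \<otimes>\<^bsub>R\<^esub> r i = (if i = j then r i else \<zero>\<^bsub>R\<^esub>)" using rc[OF i] by (auto simp: \<delta>_def)
          finally show "(if i = j then r i else \<zero>\<^bsub>R\<^esub>) = ?m j i \<otimes>\<^bsub>R\<^esub> r i \<oplus>\<^bsub>R\<^esub> r i \<otimes>\<^bsub>R\<^esub> \<psi> j (z i)" by simp
        qed (use rc \<delta>c \<psi>c z j in auto)
        also have "\<dots> = (\<Oplus>\<^bsub>R\<^esub>i\<in>J. ?m j i \<otimes>\<^bsub>R\<^esub> r i) \<oplus>\<^bsub>R\<^esub> (\<Oplus>\<^bsub>R\<^esub>i\<in>J. r i \<otimes>\<^bsub>R\<^esub> \<psi> j (z i))"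
          by (rule R.finsum_addf) (use rc \<delta>c \<psi>c z j in auto)
        finally show ?thesis using R.finsum_delta[OF fin j, of r] rc[OF j] s0 sc by simp
      qed
      \<comment> \<open>With \<open>U\<close> the zero submodule, Nakayama's lemma turns this fixed
        vector into zero.\<close>
      have "\<forall>j\<in>J. r j \<in> {\<zero>\<^bsub>R\<^esub>}"
      proof (rule nakayama[OF R.ring_module fin])
        show "\<exists>u\<in>{\<zero>\<^bsub>R\<^esub>}. \<exists>m\<in>J \<rightarrow> carrier R. (\<forall>p\<in>J. \<pi> (m p) = \<zero>\<^bsub>k\<^esub>) \<and>
            r j = u \<oplus>\<^bsub>?R\<^esub> (\<Oplus>\<^bsub>?R\<^esub>p\<in>J. m p \<odot>\<^bsub>?R\<^esub> r p)" if j: "j \<in> J" for j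
        proof (intro bexI conjI ballI)
          have "(\<Oplus>\<^bsub>R\<^esub>i\<in>J. ?m j i \<otimes>\<^bsub>R\<^esub> r i) \<in> carrier R"
            using rc \<delta>c \<psi>c z j by (intro R.finsum_closed) auto
          then show "r j = \<zero>\<^bsub>R\<^esub> \<oplus>\<^bsub>?R\<^esub> (\<Oplus>\<^bsub>?R\<^esub>p\<in>J. ?m j p \<odot>\<^bsub>?R\<^esub> r p)"
            unfolding finsum_ring_module using rj[OF j] by (simp add: ring_module_def)
          show "?m j \<in> J \<rightarrow> carrier R" using \<delta>c \<psi>c z j by auto
        qed (use \<pi>m j in auto)
      qed (use rc in \<open>auto simp: ring_module_def\<close>)
      then show ?thesis using j0 by blast
    qed
  qed (use fin z in auto)
qed

text \<open>As \<open>rk\<close> is a definite description, its value requires a basis of size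
  \<open>n\<close> and the uniqueness of \<open>n\<close>. Lifting a basis of the reduction gives
  the former; any finite basis of \<open>N\<close> reduces to a basis of a space of dimension
  \<open>n\<close>, which gives the latter.\<close>

lemma rank_reduction:
  assumes N: "module R N" and d: "dual_basis R N P y \<phi>"
  shows "\<exists>n. has_rank R N n \<and> has_rank k (bc N) n \<and> rk R N = n"
proof -
  interpret N: module R N by (rule N)
  interpret B: vectorspace k "bc N" by (rule bc_vectorspace[OF N])
  have "\<exists>n. has_rank k (bc N) n"
  proof (rule has_rank_exists[OF bc_vectorspace[OF N]])
    show "finite P" using d by (simp add: dual_basis_def)
    show "red N (y p) \<in> carrier (bc N)" if "p \<in> P" for p
      using red_closed[OF N dual_basis_closed(1)[OF d that]] .
    show "\<exists>c\<in>P \<rightarrow> carrier k. X = (\<Oplus>\<^bsub>bc N\<^esub>p\<in>P. c p \<odot>\<^bsub>bc N\<^esub> red N (y p))" if X: "X \<in> carrier (bc N)" for X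
    proof -
      obtain x where x: "x \<in> carrier N" "X = red N x" using red_surj[OF N X] by blast
      have "red N (\<Oplus>\<^bsub>N\<^esub>j\<in>P. \<phi> j x \<odot>\<^bsub>N\<^esub> y j) = (\<Oplus>\<^bsub>bc N\<^esub>j\<in>P. \<pi> (\<phi> j x) \<odot>\<^bsub>bc N\<^esub> red N (y j))"
        using dual_basis_closed[OF d] x by (intro red_lincomb[OF N]) auto
      moreover have "(\<lambda>j. \<pi> (\<phi> j x)) \<in> P \<rightarrow> carrier k" using dual_basis_closed[OF d] x \<pi>_closed by auto
      ultimately show ?thesis using dual_basis_eq[OF d x(1)] x(2) by auto
    qed
  qed
  then obtain n z' \<chi> where n: "has_rank k (bc N) n" and c: "coordinates k (bc N) {..<n} z' \<chi>"
    unfolding has_rank_def by blast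
  have "\<forall>j. \<exists>x. j < n \<longrightarrow> x \<in> carrier N \<and> z' j = red N x"
  proof (intro allI)
    fix j
    have "j < n \<longrightarrow> z' j \<in> carrier (bc N)" using c by (auto simp: coordinates_def dual_basis_def)
    then show "\<exists>x. j < n \<longrightarrow> x \<in> carrier N \<and> z' j = red N x" using red_surj[OF N] by blast
  qed
  then obtain z where z: "\<And>j. j < n \<Longrightarrow> z j \<in> carrier N" "\<And>j. j < n \<Longrightarrow> z' j = red N (z j)" by metis
  have "coordinates k (bc N) {..<n} (\<lambda>j. red N (z j)) \<chi>"
  proof -
    have "(\<Oplus>\<^bsub>bc N\<^esub>j\<in>{..<n}. \<chi> j x \<odot>\<^bsub>bc N\<^esub> red N (z j)) = (\<Oplus>\<^bsub>bc N\<^esub>j\<in>{..<n}. \<chi> j x \<odot>\<^bsub>bc N\<^esub> z' j)"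
      if "x \<in> carrier (bc N)" for x
      by (rule B.M.finsum_cong') (use z c that in \<open>auto simp: coordinates_def dual_basis_def linear_form_def additive_map_def Pi_def\<close>)
    then show ?thesis using c z red_closed[OF N] by (auto simp: coordinates_def dual_basis_def)
  qed
  then obtain \<psi> where \<psi>: "coordinates R N {..<n} z \<psi>"
    using lift_coordinates[OF N d, of "{..<n}" z \<chi>] z by auto
  have "rk R N = n"
    unfolding rk_def
  proof (rule the_equality)
    show "\<exists>X. finite_basis R N X \<and> card X = n"
      using coordinates_finite_basis[OF N \<psi> R_nontrivial] by auto
    show "m = n" if fb: "\<exists>X. finite_basis R N X \<and> card X = m" for m
    proof -
      obtain X \<xi> where X: "card X = m" "coordinates R N X (\<lambda>x. x) \<xi>"
        using fb finite_basis_coordinates[OF N] by blast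
      then obtain \<chi>' where "coordinates k (bc N) X (\<lambda>x. red N x) \<chi>'" using reduce_coordinates[OF N] by blast
      then have "has_rank k (bc N) m" using coordinates_has_rank[OF B.module_axioms] X(1) by blast
      then show ?thesis using has_rank_dim[OF B.vectorspace_axioms] n by blast
    qed
  qed
  then show ?thesis using n \<psi> unfolding has_rank_def by blast
qed

end

section \<open>Invertible bimodules\<close>

text \<open>The actions are plain functions rather than record fields, so that the reduction of
  \<open>M\<close>, whose record over \<open>k\<close> has no field for a right action, is an
  instance just as \<open>M\<close> is.\<close>

locale lr_module = A: ring A + M: abelian_group M
  for A :: "('a, 'c) ring_scheme" and M :: "('m, 'd) ring_scheme" +
  fixes l :: "'a \<Rightarrow> 'm \<Rightarrow> 'm" and r :: "'m \<Rightarrow> 'a \<Rightarrow> 'm"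
  assumes l_closed: "\<lbrakk>a \<in> carrier A; x \<in> carrier M\<rbrakk> \<Longrightarrow> l a x \<in> carrier M"
    and l_add_left: "\<lbrakk>a \<in> carrier A; b \<in> carrier A; x \<in> carrier M\<rbrakk> \<Longrightarrow> l (a \<oplus>\<^bsub>A\<^esub> b) x = l a x \<oplus>\<^bsub>M\<^esub> l b x"
    and l_add_right: "\<lbrakk>a \<in> carrier A; x \<in> carrier M; y \<in> carrier M\<rbrakk> \<Longrightarrow> l a (x \<oplus>\<^bsub>M\<^esub> y) = l a x \<oplus>\<^bsub>M\<^esub> l a y"
    and l_assoc: "\<lbrakk>a \<in> carrier A; b \<in> carrier A; x \<in> carrier M\<rbrakk> \<Longrightarrow> l (a \<otimes>\<^bsub>A\<^esub> b) x = l a (l b x)"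
    and l_one: "x \<in> carrier M \<Longrightarrow> l \<one>\<^bsub>A\<^esub> x = x"
    and r_closed: "\<lbrakk>x \<in> carrier M; a \<in> carrier A\<rbrakk> \<Longrightarrow> r x a \<in> carrier M"
    and r_add_right: "\<lbrakk>x \<in> carrier M; a \<in> carrier A; b \<in> carrier A\<rbrakk> \<Longrightarrow> r x (a \<oplus>\<^bsub>A\<^esub> b) = r x a \<oplus>\<^bsub>M\<^esub> r x b"
    and r_add_left: "\<lbrakk>x \<in> carrier M; y \<in> carrier M; a \<in> carrier A\<rbrakk> \<Longrightarrow> r (x \<oplus>\<^bsub>M\<^esub> y) a = r x a \<oplus>\<^bsub>M\<^esub> r y a"
    and r_assoc: "\<lbrakk>x \<in> carrier M; a \<in> carrier A; b \<in> carrier A\<rbrakk> \<Longrightarrow> r x (a \<otimes>\<^bsub>A\<^esub> b) = r (r x a) b"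
    and r_one: "x \<in> carrier M \<Longrightarrow> r x \<one>\<^bsub>A\<^esub> = x"
    and lr: "\<lbrakk>a \<in> carrier A; x \<in> carrier M; b \<in> carrier A\<rbrakk> \<Longrightarrow> r (l a x) b = l a (r x b)"
begin

lemma l_additive: "a \<in> carrier A \<Longrightarrow> additive_map M M (l a)"
  by (auto simp: additive_map_def l_closed l_add_right)

lemma l_additive_left: "x \<in> carrier M \<Longrightarrow> additive_map A M (\<lambda>a. l a x)"
  by (auto simp: additive_map_def l_closed l_add_left)

lemma r_additive: "a \<in> carrier A \<Longrightarrow> additive_map M M (\<lambda>x. r x a)"
  by (auto simp: additive_map_def r_closed r_add_left)

lemma r_additive_right: "x \<in> carrier M \<Longrightarrow> additive_map A M (r x)"
  by (auto simp: additive_map_def r_closed r_add_right)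

lemmas l_finsum = additive_map_finsum[OF M.abelian_group_axioms M.abelian_group_axioms l_additive]
lemmas l_finsum_left = additive_map_finsum[OF A.abelian_group_axioms M.abelian_group_axioms l_additive_left]
lemmas r_finsum = additive_map_finsum[OF M.abelian_group_axioms M.abelian_group_axioms r_additive]
lemmas r_finsum_right = additive_map_finsum[OF A.abelian_group_axioms M.abelian_group_axioms r_additive_right]
lemmas l_zero = additive_map_zero[OF M.abelian_group_axioms M.abelian_group_axioms l_additive]
lemmas l_zero_left = additive_map_zero[OF A.abelian_group_axioms M.abelian_group_axioms l_additive_left]
lemmas r_zero_right = additive_map_zero[OF A.abelian_group_axioms M.abelian_group_axioms r_additive_right]

end

text \<open>These consequences of invertibility, unlike isomorphisms of tensor products, pass directly to
  the reduction: a dual basis \<open>x\<close>, \<open>f\<close> of the left module, right linear maps \<open>n\<close> whose values generate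
  the ring, and the fact that all left endomorphisms are right multiplications.\<close>
locale morita_bimodule = lr_module A M l r
  for A :: "('a, 'c) ring_scheme" and M :: "('m, 'd) ring_scheme" and l r +
  fixes S :: "nat set" and x :: "nat \<Rightarrow> 'm" and f :: "nat \<Rightarrow> 'm \<Rightarrow> 'a"
    and T :: "nat set" and w :: "nat \<Rightarrow> 'm" and n :: "nat \<Rightarrow> 'm \<Rightarrow> 'a"
  assumes S: "finite S" and x: "s \<in> S \<Longrightarrow> x s \<in> carrier M"
    and f_additive: "s \<in> S \<Longrightarrow> additive_map M A (f s)"
    and f_linear: "\<lbrakk>s \<in> S; a \<in> carrier A; y \<in> carrier M\<rbrakk> \<Longrightarrow> f s (l a y) = a \<otimes>\<^bsub>A\<^esub> f s y"
    and f_dual: "y \<in> carrier M \<Longrightarrow> (\<Oplus>\<^bsub>M\<^esub>s\<in>S. l (f s y) (x s)) = y"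
    and T: "finite T" and w: "t \<in> T \<Longrightarrow> w t \<in> carrier M"
    and n_additive: "t \<in> T \<Longrightarrow> additive_map M A (n t)"
    and n_linear: "\<lbrakk>t \<in> T; a \<in> carrier A; y \<in> carrier M\<rbrakk> \<Longrightarrow> n t (r y a) = n t y \<otimes>\<^bsub>A\<^esub> a"
    and n_one: "(\<Oplus>\<^bsub>A\<^esub>t\<in>T. n t (w t)) = \<one>\<^bsub>A\<^esub>"
    and endo: "\<lbrakk>additive_map M M \<phi>; \<And>a y. \<lbrakk>a \<in> carrier A; y \<in> carrier M\<rbrakk> \<Longrightarrow> \<phi> (l a y) = l a (\<phi> y)\<rbrakk> \<Longrightarrow>
      \<exists>a\<in>carrier A. \<forall>y\<in>carrier M. \<phi> y = r y a"
begin

lemma f_closed: "s \<in> S \<Longrightarrow> y \<in> carrier M \<Longrightarrow> f s y \<in> carrier A"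
  using f_additive by (rule additive_map_closed)

lemma n_closed: "t \<in> T \<Longrightarrow> y \<in> carrier M \<Longrightarrow> n t y \<in> carrier A"
  using n_additive by (rule additive_map_closed)

text \<open>An element \<open>c\<close> is recovered from its right action as the sum of the
  \<open>n t (r (w t) c)\<close>, because the \<open>n t\<close> are right linear and the
  \<open>n t (w t)\<close> add up to one.\<close>

lemma faithful:
  assumes "a \<in> carrier A" "b \<in> carrier A" "\<And>y. y \<in> carrier M \<Longrightarrow> r y a = r y b"
  shows "a = b"
proof -
  have *: "c = (\<Oplus>\<^bsub>A\<^esub>t\<in>T. n t (r (w t) c))" if c: "c \<in> carrier A" for c
  proof -
    have "(\<Oplus>\<^bsub>A\<^esub>t\<in>T. n t (w t)) \<otimes>\<^bsub>A\<^esub> c = (\<Oplus>\<^bsub>A\<^esub>t\<in>T. n t (w t) \<otimes>\<^bsub>A\<^esub> c)"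
      by (rule A.finsum_ldistr) (use T c w n_closed in auto)
    also have "\<dots> = (\<Oplus>\<^bsub>A\<^esub>t\<in>T. n t (r (w t) c))"
      by (rule A.finsum_cong') (use c w n_closed n_linear r_closed in auto)
    finally show ?thesis using n_one c by simp
  qed
  have "(\<Oplus>\<^bsub>A\<^esub>t\<in>T. n t (r (w t) a)) = (\<Oplus>\<^bsub>A\<^esub>t\<in>T. n t (r (w t) b))"
    by (rule A.finsum_cong') (use assms w n_closed r_closed in auto)
  then show ?thesis using *[OF assms(1)] *[OF assms(2)] by simp
qed

end

lemma bimodule_lr_module:
  assumes "bimodule R A M"
  shows "lr_module A M (smult M) (rsmult M)"
proof -
  interpret b: bimodule R A M by fact
  interpret L: left_module A M by (rule b.left)
  interpret Q: left_module "opposite_ring A" "right_part M" by (rule b.right)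
  have [simp]: "carrier (opposite_ring A) = carrier A" "carrier (right_part M) = carrier M"
    "add (right_part M) = add M" "smult (right_part M) = (\<lambda>a x. rsmult M x a)"
    "add (opposite_ring A) = add A" "one (opposite_ring A) = one A"
    "monoid.mult (opposite_ring A) = (\<lambda>x y. y \<otimes>\<^bsub>A\<^esub> x)"
    by (simp_all add: opposite_ring_def right_part_def)
  show ?thesis
  proof
    show "rsmult M x (a \<otimes>\<^bsub>A\<^esub> b) = rsmult M (rsmult M x a) b"
      if "x \<in> carrier M" "a \<in> carrier A" "b \<in> carrier A" for x a b
      using Q.act_assoc[of b a x] that by simp
  qed (use L.act_closed L.act_l_distr L.act_r_distr L.act_assoc L.act_one Q.act_closed Q.act_l_distr
      Q.act_r_distr Q.act_one b.assoc in auto)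
qed

text \<open>The isomorphism \<open>h\<close> from the tensor product to \<open>A\<close> is traded
  for the pairing \<open>\<beta>\<close> with values in \<open>A\<close>. Its bilinearity,
  \<open>\<beta>_universal\<close> and \<open>\<beta>_span\<close> are all that later arguments use,
  so no coset appears in them.\<close>

locale tensor_pairing = N: lr_module A N "smult N" "rsmult N" + M: lr_module A M "smult M" "rsmult M"
  for A :: "('r, 'a) module" and N :: "('a, 'n) bimodule" and M :: "('a, 'm) bimodule" +
  fixes h :: "('n \<times> 'm \<Rightarrow>\<^sub>0 int) set \<Rightarrow> 'a"
  assumes h_hom: "h \<in> module_hom A (tensor_bimodule A N M) (regular_bimodule A)"
    and h_bij: "bij_betw h (carrier (tensor_bimodule A N M)) (carrier A)"
    and h_right: "\<lbrakk>U \<in> carrier (tensor_bimodule A N M); a \<in> carrier A\<rbrakk> \<Longrightarrow>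
      h (rsmult (tensor_bimodule A N M) U a) = h U \<otimes>\<^bsub>A\<^esub> a"
begin

sublocale t: tensor_factors A N "rsmult N" M
  by (unfold_locales) (use N.r_closed M.l_closed in auto)

abbreviation "pt \<equiv> t.pure_tensor"

lemma carrier_tensor: "carrier (tensor_bimodule A N M) = carrier (t.F Mod t.K)"
  and add_tensor: "U \<oplus>\<^bsub>tensor_bimodule A N M\<^esub> V = U \<otimes>\<^bsub>t.F Mod t.K\<^esub> V"
  by (simp_all add: tensor_bimodule_def Let_def)

lemma smult_pure:
  assumes "a \<in> carrier A" "x \<in> carrier N" "m \<in> carrier M"
  shows "a \<odot>\<^bsub>tensor_bimodule A N M\<^esub> pt x m = pt (a \<odot>\<^bsub>N\<^esub> x) m"
proof -
  let ?g = "\<lambda>(n, m). frag_of (a \<odot>\<^bsub>N\<^esub> n, m)"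
  have "frag_extend ?g u \<in> t.K" if "u \<in> t.K" for u
    using that
  proof (induction rule: t.K_induct)
    case (add_left x y m)
    then show ?case
      using t.K_relator_add_left[of "a \<odot>\<^bsub>N\<^esub> x" "a \<odot>\<^bsub>N\<^esub> y" m] assms(1) N.l_closed
      by (simp add: frag_extend_diff N.l_add_right)
  next
    case (add_right x y m)
    then show ?case
      using t.K_relator_add_right[of "a \<odot>\<^bsub>N\<^esub> x" y m] assms(1) N.l_closed by (simp add: frag_extend_diff)
  next
    case (balanced x b m)
    then show ?case
      using t.K_relator_balanced[of "a \<odot>\<^bsub>N\<^esub> x" b m] assms(1) N.l_closed by (simp add: frag_extend_diff N.lr)
  next
    case (diff u v)
    then show ?case by (simp add: frag_extend_diff t.K_diff)
  qed (simp add: t.K_zero)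
  then have "(\<Union>u\<in>pt x m. t.K #>\<^bsub>t.F\<^esub> frag_extend ?g u) = t.K #>\<^bsub>t.F\<^esub> frag_extend ?g (frag_of (x, m))"
    unfolding t.pure_tensor_def using assms N.l_closed by (intro t.class_map) auto
  then show ?thesis by (simp add: tensor_bimodule_def Let_def t.pure_tensor_def)
qed

lemma rsmult_pure:
  assumes "a \<in> carrier A" "x \<in> carrier N" "m \<in> carrier M"
  shows "rsmult (tensor_bimodule A N M) (pt x m) a = pt x (rsmult M m a)"
proof -
  let ?g = "\<lambda>(n, m). frag_of (n, rsmult M m a)"
  have "frag_extend ?g u \<in> t.K" if "u \<in> t.K" for u
    using that
  proof (induction rule: t.K_induct)
    case (add_left x y m)
    then show ?case
      using t.K_relator_add_left[of x y "rsmult M m a"] assms(1) M.r_closed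
      by (simp add: frag_extend_diff)
  next
    case (add_right x y m)
    then show ?case
      using t.K_relator_add_right[of x "rsmult M y a" "rsmult M m a"] assms(1) M.r_closed
      by (simp add: frag_extend_diff M.r_add_left)
  next
    case (balanced x b m)
    then show ?case
      using t.K_relator_balanced[of x b "rsmult M m a"] assms(1) M.r_closed by (simp add: frag_extend_diff M.lr)
  next
    case (diff u v)
    then show ?case by (simp add: frag_extend_diff t.K_diff)
  qed (simp add: t.K_zero)
  then have "(\<Union>u\<in>pt x m. t.K #>\<^bsub>t.F\<^esub> frag_extend ?g u) = t.K #>\<^bsub>t.F\<^esub> frag_extend ?g (frag_of (x, m))"
    unfolding t.pure_tensor_def using assms M.r_closed by (intro t.class_map) auto
  then show ?thesis by (simp add: tensor_bimodule_def Let_def t.pure_tensor_def)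
qed

lemma h_closed: "U \<in> carrier (t.F Mod t.K) \<Longrightarrow> h U \<in> carrier A"
  using h_bij carrier_tensor by (auto simp: bij_betw_def)

lemma h_add: "\<lbrakk>U \<in> carrier (t.F Mod t.K); V \<in> carrier (t.F Mod t.K)\<rbrakk> \<Longrightarrow>
    h (U \<otimes>\<^bsub>t.F Mod t.K\<^esub> V) = h U \<oplus>\<^bsub>A\<^esub> h V"
  using additive_map_add[OF module_homD(2)[OF h_hom], of U V] carrier_tensor add_tensor
  by (simp add: twisted_bimodule_def del: carrier_FactGroup mult_FactGroup)

definition \<beta> where "\<beta> x m = h (pt x m)"

lemma \<beta>_closed: "\<lbrakk>x \<in> carrier N; m \<in> carrier M\<rbrakk> \<Longrightarrow> \<beta> x m \<in> carrier A"
  unfolding \<beta>_def by (intro h_closed t.pure_tensor_closed)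

lemma \<beta>_add_left:
  "\<lbrakk>x \<in> carrier N; y \<in> carrier N; m \<in> carrier M\<rbrakk> \<Longrightarrow> \<beta> (x \<oplus>\<^bsub>N\<^esub> y) m = \<beta> x m \<oplus>\<^bsub>A\<^esub> \<beta> y m"
  unfolding \<beta>_def by (simp add: t.pure_tensor_add_left h_add t.pure_tensor_closed del: carrier_FactGroup mult_FactGroup)

lemma \<beta>_add_right:
  "\<lbrakk>x \<in> carrier N; y \<in> carrier M; m \<in> carrier M\<rbrakk> \<Longrightarrow> \<beta> x (y \<oplus>\<^bsub>M\<^esub> m) = \<beta> x y \<oplus>\<^bsub>A\<^esub> \<beta> x m"
  unfolding \<beta>_def by (simp add: t.pure_tensor_add_right h_add t.pure_tensor_closed del: carrier_FactGroup mult_FactGroup)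

lemma \<beta>_balanced:
  "\<lbrakk>x \<in> carrier N; a \<in> carrier A; m \<in> carrier M\<rbrakk> \<Longrightarrow> \<beta> (rsmult N x a) m = \<beta> x (a \<odot>\<^bsub>M\<^esub> m)"
  unfolding \<beta>_def by (simp add: t.pure_tensor_balanced)

lemma \<beta>_left:
  assumes "x \<in> carrier N" "a \<in> carrier A" "m \<in> carrier M"
  shows "\<beta> (a \<odot>\<^bsub>N\<^esub> x) m = a \<otimes>\<^bsub>A\<^esub> \<beta> x m"
proof -
  have "pt x m \<in> carrier (tensor_bimodule A N M)" using t.pure_tensor_closed assms carrier_tensor by blast
  then have "h (a \<odot>\<^bsub>tensor_bimodule A N M\<^esub> pt x m) = a \<odot>\<^bsub>regular_bimodule A\<^esub> h (pt x m)"
    by (rule module_homD(3)[OF h_hom assms(2)])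
  then show ?thesis using smult_pure assms by (simp add: \<beta>_def twisted_bimodule_def)
qed

lemma \<beta>_right:
  assumes "x \<in> carrier N" "a \<in> carrier A" "m \<in> carrier M"
  shows "\<beta> x (rsmult M m a) = \<beta> x m \<otimes>\<^bsub>A\<^esub> a"
proof -
  have "pt x m \<in> carrier (tensor_bimodule A N M)" using t.pure_tensor_closed assms carrier_tensor by blast
  then show ?thesis using h_right[of "pt x m" a] rsmult_pure assms by (simp add: \<beta>_def)
qed

text \<open>The universal property carried over along the bijection \<open>h\<close>: the ring
  \<open>A\<close> with the pairing \<open>\<beta>\<close> is itself a tensor product of
  \<open>N\<close> and \<open>M\<close>.\<close>

lemma \<beta>_universal:
  assumes G: "abelian_group G"
    and "\<And>x m. \<lbrakk>x \<in> carrier N; m \<in> carrier M\<rbrakk> \<Longrightarrow> b x m \<in> carrier G"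
    and "\<And>x y m. \<lbrakk>x \<in> carrier N; y \<in> carrier N; m \<in> carrier M\<rbrakk> \<Longrightarrow> b (x \<oplus>\<^bsub>N\<^esub> y) m = b x m \<oplus>\<^bsub>G\<^esub> b y m"
    and "\<And>x l m. \<lbrakk>x \<in> carrier N; l \<in> carrier M; m \<in> carrier M\<rbrakk> \<Longrightarrow> b x (l \<oplus>\<^bsub>M\<^esub> m) = b x l \<oplus>\<^bsub>G\<^esub> b x m"
    and "\<And>x a m. \<lbrakk>x \<in> carrier N; a \<in> carrier A; m \<in> carrier M\<rbrakk> \<Longrightarrow> b (rsmult N x a) m = b x (a \<odot>\<^bsub>M\<^esub> m)"
  shows "\<exists>\<Gamma>. additive_map A G \<Gamma> \<and> (\<forall>x\<in>carrier N. \<forall>m\<in>carrier M. \<Gamma> (\<beta> x m) = b x m)"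
proof -
  obtain g where g: "g \<in> carrier (t.F Mod t.K) \<rightarrow> carrier G"
    "\<And>U V. \<lbrakk>U \<in> carrier (t.F Mod t.K); V \<in> carrier (t.F Mod t.K)\<rbrakk> \<Longrightarrow> g (U \<otimes>\<^bsub>t.F Mod t.K\<^esub> V) = g U \<oplus>\<^bsub>G\<^esub> g V"
    "\<And>x m. \<lbrakk>x \<in> carrier N; m \<in> carrier M\<rbrakk> \<Longrightarrow> g (pt x m) = b x m"
    using t.universal[OF assms] by blast
  define k where "k = inv_into (carrier (t.F Mod t.K)) h"
  have hb: "bij_betw h (carrier (t.F Mod t.K)) (carrier A)" using h_bij carrier_tensor by simp
  have hk: "h (k a) = a" "k a \<in> carrier (t.F Mod t.K)" if "a \<in> carrier A" for a
    using hb that unfolding k_def by (auto simp: bij_betw_def f_inv_into_f inv_into_into simp del: carrier_FactGroup)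
  have kh: "k (h U) = U" if "U \<in> carrier (t.F Mod t.K)" for U
    using hb that unfolding k_def by (simp add: bij_betw_def)
  have kadd: "k (a \<oplus>\<^bsub>A\<^esub> c) = k a \<otimes>\<^bsub>t.F Mod t.K\<^esub> k c" if "a \<in> carrier A" "c \<in> carrier A" for a c
    using kh[of "k a \<otimes>\<^bsub>t.F Mod t.K\<^esub> k c"] h_add[of "k a" "k c"] hk that t.Q.m_closed by metis
  have "additive_map A G (\<lambda>a. g (k a))"
    by (rule additive_mapI) (use g(1,2) hk kadd in \<open>auto simp del: carrier_FactGroup mult_FactGroup\<close>)
  moreover have "\<forall>x\<in>carrier N. \<forall>m\<in>carrier M. g (k (\<beta> x m)) = b x m"
    unfolding \<beta>_def using kh t.pure_tensor_closed g(3) by simp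
  ultimately show ?thesis by blast
qed

text \<open>Pure tensors generate the tensor product, and a negative sign can be absorbed into the
  left factor, so sums without integer coefficients are enough.\<close>

lemma \<beta>_span:
  assumes "a \<in> carrier A"
  shows "\<exists>n x m. (\<forall>t<n::nat. x t \<in> carrier N \<and> m t \<in> carrier M) \<and> a = (\<Oplus>\<^bsub>A\<^esub>t\<in>{..<n}. \<beta> (x t) (m t))"
proof -
  define P where "P a \<longleftrightarrow> (\<exists>n x m. (\<forall>t<n::nat. x t \<in> carrier N \<and> m t \<in> carrier M) \<and> a = (\<Oplus>\<^bsub>A\<^esub>t\<in>{..<n}. \<beta> (x t) (m t)))" for a
  have add: "P (a \<oplus>\<^bsub>A\<^esub> b)" if ab: "P a" "P b" for a b
  proof -
    obtain n x m n' x' m' where *: "\<forall>t<n::nat. x t \<in> carrier N \<and> m t \<in> carrier M"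
      "a = (\<Oplus>\<^bsub>A\<^esub>t\<in>{..<n}. \<beta> (x t) (m t))" "\<forall>t<n'::nat. x' t \<in> carrier N \<and> m' t \<in> carrier M"
      "b = (\<Oplus>\<^bsub>A\<^esub>t\<in>{..<n'}. \<beta> (x' t) (m' t))" using ab unfolding P_def by blast
    let ?x = "\<lambda>t. if t < n then x t else x' (t - n)" and ?m = "\<lambda>t. if t < n then m t else m' (t - n)"
    have s: "{..<n + n'} = {..<n} \<union> (\<lambda>t. t + n) ` {..<n'}"
      using image_add_atLeastLessThan'[of n 0 n'] by (auto simp: atLeast0LessThan)
    have "(\<Oplus>\<^bsub>A\<^esub>t\<in>{..<n + n'}. \<beta> (?x t) (?m t))
        = (\<Oplus>\<^bsub>A\<^esub>t\<in>{..<n}. \<beta> (?x t) (?m t)) \<oplus>\<^bsub>A\<^esub> (\<Oplus>\<^bsub>A\<^esub>t\<in>(\<lambda>t. t + n) ` {..<n'}. \<beta> (?x t) (?m t))"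
      unfolding s by (rule N.A.finsum_Un_disjoint) (use * \<beta>_closed in auto)
    also have "(\<Oplus>\<^bsub>A\<^esub>t\<in>{..<n}. \<beta> (?x t) (?m t)) = a"
      unfolding *(2) by (rule N.A.finsum_cong') (use * \<beta>_closed in auto)
    also have "(\<Oplus>\<^bsub>A\<^esub>t\<in>(\<lambda>t. t + n) ` {..<n'}. \<beta> (?x t) (?m t)) = (\<Oplus>\<^bsub>A\<^esub>t\<in>{..<n'}. \<beta> (?x (t + n)) (?m (t + n)))"
      by (rule N.A.finsum_reindex) (use * \<beta>_closed in auto)
    also have "\<dots> = b" unfolding *(4) by (rule N.A.finsum_cong') (use * \<beta>_closed in auto)
    finally have "a \<oplus>\<^bsub>A\<^esub> b = (\<Oplus>\<^bsub>A\<^esub>t\<in>{..<n + n'}. \<beta> (?x t) (?m t))" by simp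
    moreover have "\<forall>t<n + n'. ?x t \<in> carrier N \<and> ?m t \<in> carrier M" using * by auto
    ultimately show ?thesis
      unfolding P_def by (intro exI[of _ "n + n'"] exI[of _ ?x] exI[of _ ?m] conjI)
  qed
  have neg: "P (\<ominus>\<^bsub>A\<^esub> a)" if a: "P a" for a
  proof -
    obtain n x m where *: "\<forall>t<n::nat. x t \<in> carrier N \<and> m t \<in> carrier M"
      "a = (\<Oplus>\<^bsub>A\<^esub>t\<in>{..<n}. \<beta> (x t) (m t))" using a unfolding P_def by blast
    have b: "\<beta> (\<ominus>\<^bsub>N\<^esub> x t) (m t) = \<ominus>\<^bsub>A\<^esub> \<beta> (x t) (m t)" if "t < n" for t
      by (rule additive_map_minus[OF N.M.abelian_group_axioms N.A.abelian_group_axioms,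
            of "\<lambda>x. \<beta> x (m t)"])
        (use * that \<beta>_closed \<beta>_add_left in \<open>auto simp: additive_map_def\<close>)
    have "additive_map A A (\<lambda>a. \<ominus>\<^bsub>A\<^esub> a)" by (auto simp: additive_map_def N.A.minus_add)
    then have "\<ominus>\<^bsub>A\<^esub> a = (\<Oplus>\<^bsub>A\<^esub>t\<in>{..<n}. \<ominus>\<^bsub>A\<^esub> \<beta> (x t) (m t))"
      unfolding *(2) by (intro additive_map_finsum[OF N.A.abelian_group_axioms N.A.abelian_group_axioms])
        (use * \<beta>_closed in auto)
    also have "\<dots> = (\<Oplus>\<^bsub>A\<^esub>t\<in>{..<n}. \<beta> (\<ominus>\<^bsub>N\<^esub> x t) (m t))"
      by (rule N.A.finsum_cong') (use * b \<beta>_closed in auto)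
    finally show ?thesis unfolding P_def using * by (intro exI[of _ n] exI[of _ "\<lambda>t. \<ominus>\<^bsub>N\<^esub> x t"] exI[of _ m]) auto
  qed
  have cl: "t.K #>\<^bsub>t.F\<^esub> u \<in> carrier (t.F Mod t.K) \<and> P (h (t.K #>\<^bsub>t.F\<^esub> u))"
    if "Poly_Mapping.keys u \<subseteq> carrier N \<times> carrier M" for u
    using that
  proof (induction u rule: frag_induct)
    case zero
    have z: "t.K #>\<^bsub>t.F\<^esub> 0 = \<one>\<^bsub>t.F Mod t.K\<^esub>" using t.class_zero by simp
    have "h \<one>\<^bsub>t.F Mod t.K\<^esub> \<oplus>\<^bsub>A\<^esub> h \<one>\<^bsub>t.F Mod t.K\<^esub> = h \<one>\<^bsub>t.F Mod t.K\<^esub>"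
      using h_add[OF t.Q.one_closed t.Q.one_closed] t.Q.l_one[OF t.Q.one_closed] by metis
    then have h0: "h \<one>\<^bsub>t.F Mod t.K\<^esub> = \<zero>\<^bsub>A\<^esub>"
      using h_closed[OF t.Q.one_closed] by (metis N.A.add.r_cancel_one')
    have "P \<zero>\<^bsub>A\<^esub>" unfolding P_def by (intro exI[of _ 0]) auto
    then show ?case using h0 z t.Q.one_closed by metis
  next
    case (diff u v)
    have kd: "Poly_Mapping.keys (u - v) \<subseteq> carrier N \<times> carrier M" using keys_diff[of u v] diff by blast
    let ?u = "t.K #>\<^bsub>t.F\<^esub> u" and ?v = "t.K #>\<^bsub>t.F\<^esub> v" and ?d = "t.K #>\<^bsub>t.F\<^esub> (u - v)"
    have dc: "?d \<in> carrier (t.F Mod t.K)" by (rule t.class_closed[OF kd])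
    have "?u = ?d \<otimes>\<^bsub>t.F Mod t.K\<^esub> ?v" using t.class_add[OF kd diff(2)] by simp
    then have hu: "h ?u = h ?d \<oplus>\<^bsub>A\<^esub> h ?v" using h_add[OF dc, of ?v] diff by metis
    have c: "h ?d \<in> carrier A" "h ?v \<in> carrier A" using h_closed dc diff by blast+
    have "h ?d = h ?u \<oplus>\<^bsub>A\<^esub> \<ominus>\<^bsub>A\<^esub> h ?v" unfolding hu using c by (simp add: N.A.a_assoc N.A.r_neg)
    then have "P (h ?d)" using add[of "h ?u" "\<ominus>\<^bsub>A\<^esub> h ?v"] neg[of "h ?v"] diff(3,4) by metis
    then show ?case using dc by blast
  next
    case (gen p)
    then obtain x m where p: "p = (x, m)" "x \<in> carrier N" "m \<in> carrier M" by auto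
    have "h (t.K #>\<^bsub>t.F\<^esub> frag_of p) = \<beta> x m" by (simp add: \<beta>_def t.pure_tensor_def p)
    moreover have "P (\<beta> x m)"
      unfolding P_def using p \<beta>_closed by (intro exI[of _ 1] exI[of _ "\<lambda>_. x"] exI[of _ "\<lambda>_. m"]) (auto simp: lessThan_Suc)
    moreover have "t.K #>\<^bsub>t.F\<^esub> frag_of p \<in> carrier (t.F Mod t.K)"
      using t.pure_tensor_closed[OF p(2,3)] by (simp add: t.pure_tensor_def p)
    ultimately show ?case by metis
  qed
  have "a \<in> h ` carrier (t.F Mod t.K)" using assms h_bij carrier_tensor by (auto simp: bij_betw_def)
  then obtain U where U: "U \<in> carrier (t.F Mod t.K)" "a = h U" by blast
  obtain u where "Poly_Mapping.keys u \<subseteq> carrier N \<times> carrier M" "U = t.K #>\<^bsub>t.F\<^esub> u" by (rule t.class_cases[OF U(1)])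
  then have "P a" using cl[of u] U(2) by simp
  then show ?thesis unfolding P_def .
qed

end

lemma tensor_pairing_exists:
  assumes "lr_module A X (smult X) (rsmult X)" "lr_module A Y (smult Y) (rsmult Y)"
    and "bimodule_isomorphic A (tensor_bimodule A X Y) (regular_bimodule A)"
  shows "\<exists>h. tensor_pairing A X Y h"
proof -
  obtain h where "h \<in> module_hom A (tensor_bimodule A X Y) (regular_bimodule A)"
    "bij_betw h (carrier (tensor_bimodule A X Y)) (carrier (regular_bimodule A))"
    "\<forall>U\<in>carrier (tensor_bimodule A X Y). \<forall>a\<in>carrier A.
      h (rsmult (tensor_bimodule A X Y) U a) = rsmult (regular_bimodule A) (h U) a"
    using assms(3) unfolding bimodule_isomorphic_def by blast
  then have "tensor_pairing_axioms A X Y h"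
    by unfold_locales (simp_all add: twisted_bimodule_def)
  then show ?thesis using assms(1,2) unfolding tensor_pairing_def by blast
qed

text \<open>The two isomorphisms are arbitrary, so \<open>\<beta> u v\<close> acting on
  \<open>m\<close> from the left and \<open>\<gamma> v m\<close> acting on \<open>u\<close> from the
  right need not give the same element. For this reason the left endomorphisms of \<open>M\<close>
  are determined before the dual basis: they provide the missing link between left multiplication by
  values of \<open>\<beta>\<close> and the right action.\<close>

lemma invertible_bimodule_morita:
  assumes "ring A" and inv: "invertible_bimodule TYPE('n) R A M"
  shows "\<exists>S x f T w n. morita_bimodule A M (smult M) (rsmult M) S x f T w n"
proof -
  interpret A: ring A by fact
  obtain M' :: "('a, 'n) bimodule" where bM: "bimodule R A M" and bM': "bimodule R A M'"
    and isoMM': "bimodule_isomorphic A (tensor_bimodule A M M') (regular_bimodule A)"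
    and isoM'M: "bimodule_isomorphic A (tensor_bimodule A M' M) (regular_bimodule A)"
    using inv by (auto simp: invertible_bimodule_def biprojective_bimodule_def)
  interpret M: lr_module A M "smult M" "rsmult M" by (rule bimodule_lr_module[OF bM])
  interpret M': lr_module A M' "smult M'" "rsmult M'" by (rule bimodule_lr_module[OF bM'])
  obtain h where "tensor_pairing A M M' h"
    using tensor_pairing_exists[OF M.lr_module_axioms M'.lr_module_axioms isoMM'] by blast
  then interpret b: tensor_pairing A M M' h .
  obtain h' where "tensor_pairing A M' M h'"
    using tensor_pairing_exists[OF M'.lr_module_axioms M.lr_module_axioms isoM'M] by blast
  then interpret c: tensor_pairing A M' M h' .
  let ?\<beta> = b.\<beta> and ?\<gamma> = c.\<beta>
  obtain p a' b' where ab: "\<And>t. t < (p::nat) \<Longrightarrow> a' t \<in> carrier M" "\<And>t. t < p \<Longrightarrow> b' t \<in> carrier M'"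
    and one\<beta>: "\<one>\<^bsub>A\<^esub> = (\<Oplus>\<^bsub>A\<^esub>t\<in>{..<p}. ?\<beta> (a' t) (b' t))"
    using b.\<beta>_span[OF A.one_closed] by blast
  obtain q y z where yz: "\<And>t. t < (q::nat) \<Longrightarrow> y t \<in> carrier M'" "\<And>t. t < q \<Longrightarrow> z t \<in> carrier M"
    and one\<gamma>: "\<one>\<^bsub>A\<^esub> = (\<Oplus>\<^bsub>A\<^esub>t\<in>{..<q}. ?\<gamma> (y t) (z t))"
    using c.\<beta>_span[OF A.one_closed] by blast
  have expand: "(\<Oplus>\<^bsub>M\<^esub>t\<in>{..<p}. ?\<beta> (a' t) (b' t) \<odot>\<^bsub>M\<^esub> m) = m" if m: "m \<in> carrier M" for m
    using M.l_finsum_left[OF m, of "{..<p}" "\<lambda>t. ?\<beta> (a' t) (b' t)"] one\<beta> M.l_one[OF m] b.\<beta>_closed ab by simp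
  have \<gamma>_additive: "additive_map M A (?\<gamma> v)" if "v \<in> carrier M'" for v
    using that by (intro additive_mapI) (auto simp: c.\<beta>_closed c.\<beta>_add_right)
  \<comment> \<open>For fixed \<open>u\<close>, the product of \<open>\<beta> u v\<close> with
    \<open>m\<close> is balanced in \<open>v\<close> and \<open>m\<close>, hence a function of
    \<open>\<gamma> v m\<close>. Taking \<open>u\<close> and \<open>v\<close> from the decomposition
    \<open>one\<beta>\<close> of one recovers \<open>m\<close> from these values.\<close>
  have cancel: "m1 = m2" if m: "m1 \<in> carrier M" "m2 \<in> carrier M"
    and eq: "\<And>v. v \<in> carrier M' \<Longrightarrow> ?\<gamma> v m1 = ?\<gamma> v m2" for m1 m2
  proof -
    have "?\<beta> u v \<odot>\<^bsub>M\<^esub> m1 = ?\<beta> u v \<odot>\<^bsub>M\<^esub> m2" if u: "u \<in> carrier M" and v: "v \<in> carrier M'" for u v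
    proof -
      have "\<exists>\<Gamma>. additive_map A M \<Gamma> \<and> (\<forall>v\<in>carrier M'. \<forall>m\<in>carrier M. \<Gamma> (?\<gamma> v m) = ?\<beta> u v \<odot>\<^bsub>M\<^esub> m)"
        by (rule c.\<beta>_universal[OF M.M.abelian_group_axioms])
          (use u in \<open>auto simp: b.\<beta>_closed b.\<beta>_add_right b.\<beta>_right M.l_closed M.l_add_left M.l_add_right M.l_assoc\<close>)
      then show ?thesis using eq[OF v] m v by metis
    qed
    then have "(\<Oplus>\<^bsub>M\<^esub>t\<in>{..<p}. ?\<beta> (a' t) (b' t) \<odot>\<^bsub>M\<^esub> m1) = (\<Oplus>\<^bsub>M\<^esub>t\<in>{..<p}. ?\<beta> (a' t) (b' t) \<odot>\<^bsub>M\<^esub> m2)"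
      using ab m b.\<beta>_closed M.l_closed by (intro M.M.finsum_cong') auto
    then show ?thesis using expand m by simp
  qed
  \<comment> \<open>The additive map \<open>\<Gamma>\<close> induced by
    \<open>\<gamma> v (\<phi> m)\<close> commutes with left multiplication, so it is right
    multiplication by its value \<open>?b\<close> at one. Hence \<open>\<phi> m\<close> and
    \<open>m\<close> times \<open>?b\<close> have the same values under all
    \<open>\<gamma> v\<close>.\<close>
  have endo: "\<exists>b\<in>carrier A. \<forall>m\<in>carrier M. \<phi> m = rsmult M m b"
    if \<phi>: "additive_map M M \<phi>" and lin: "\<And>a m. \<lbrakk>a \<in> carrier A; m \<in> carrier M\<rbrakk> \<Longrightarrow> \<phi> (a \<odot>\<^bsub>M\<^esub> m) = a \<odot>\<^bsub>M\<^esub> \<phi> m" for \<phi>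
  proof -
    note \<phi>c = additive_map_closed[OF \<phi>] and \<phi>add = additive_map_add[OF \<phi>]
    have "\<exists>\<Gamma>. additive_map A A \<Gamma> \<and> (\<forall>v\<in>carrier M'. \<forall>m\<in>carrier M. \<Gamma> (?\<gamma> v m) = ?\<gamma> v (\<phi> m))"
      by (rule c.\<beta>_universal[OF A.abelian_group_axioms])
        (auto simp: c.\<beta>_closed c.\<beta>_add_left c.\<beta>_add_right c.\<beta>_balanced \<phi>c \<phi>add lin)
    then obtain \<Gamma> where \<Gamma>: "additive_map A A \<Gamma>"
      and \<Gamma>\<gamma>: "\<And>v m. \<lbrakk>v \<in> carrier M'; m \<in> carrier M\<rbrakk> \<Longrightarrow> \<Gamma> (?\<gamma> v m) = ?\<gamma> v (\<phi> m)" by blast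
    let ?b = "\<Oplus>\<^bsub>A\<^esub>t\<in>{..<q}. ?\<gamma> (y t) (\<phi> (z t))"
    have bc: "?b \<in> carrier A" using yz \<phi>c c.\<beta>_closed by (intro A.finsum_closed) auto
    have \<Gamma>mult: "\<Gamma> a = a \<otimes>\<^bsub>A\<^esub> ?b" if a: "a \<in> carrier A" for a
    proof -
      have "a = (\<Oplus>\<^bsub>A\<^esub>t\<in>{..<q}. a \<otimes>\<^bsub>A\<^esub> ?\<gamma> (y t) (z t))"
        using A.finsum_rdistr[of "{..<q}" a "\<lambda>t. ?\<gamma> (y t) (z t)"] one\<gamma>[symmetric] a yz c.\<beta>_closed by auto
      also have "\<dots> = (\<Oplus>\<^bsub>A\<^esub>t\<in>{..<q}. ?\<gamma> (a \<odot>\<^bsub>M'\<^esub> y t) (z t))"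
        by (rule A.finsum_cong') (use a yz c.\<beta>_closed c.\<beta>_left M'.l_closed in auto)
      finally have "\<Gamma> a = \<Gamma> (\<Oplus>\<^bsub>A\<^esub>t\<in>{..<q}. ?\<gamma> (a \<odot>\<^bsub>M'\<^esub> y t) (z t))" by simp
      also have "\<dots> = (\<Oplus>\<^bsub>A\<^esub>t\<in>{..<q}. \<Gamma> (?\<gamma> (a \<odot>\<^bsub>M'\<^esub> y t) (z t)))"
        by (rule additive_map_finsum[OF A.abelian_group_axioms A.abelian_group_axioms \<Gamma>])
          (use a yz c.\<beta>_closed M'.l_closed in auto)
      also have "\<dots> = (\<Oplus>\<^bsub>A\<^esub>t\<in>{..<q}. ?\<gamma> (a \<odot>\<^bsub>M'\<^esub> y t) (\<phi> (z t)))"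
        by (rule A.finsum_cong') (use a yz \<phi>c c.\<beta>_closed M'.l_closed \<Gamma>\<gamma> in auto)
      also have "\<dots> = (\<Oplus>\<^bsub>A\<^esub>t\<in>{..<q}. a \<otimes>\<^bsub>A\<^esub> ?\<gamma> (y t) (\<phi> (z t)))"
        by (rule A.finsum_cong') (use a yz \<phi>c c.\<beta>_closed c.\<beta>_left in auto)
      also have "\<dots> = a \<otimes>\<^bsub>A\<^esub> ?b"
        by (rule A.finsum_rdistr[symmetric]) (use a yz \<phi>c c.\<beta>_closed in auto)
      finally show ?thesis .
    qed
    have "\<phi> m = rsmult M m ?b" if m: "m \<in> carrier M" for m
    proof (rule cancel)
      show "?\<gamma> v (\<phi> m) = ?\<gamma> v (rsmult M m ?b)" if v: "v \<in> carrier M'" for v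
        using \<Gamma>\<gamma>[OF v m] \<Gamma>mult[OF c.\<beta>_closed[OF v m]] c.\<beta>_right[OF v bc m] by simp
    qed (use m bc \<phi>c M.r_closed in auto)
    then show ?thesis using bc by blast
  qed
  \<comment> \<open>This form pairs \<open>m\<close> with the sum over \<open>u\<close> of the
    elements \<open>\<gamma> (y t) (a' u) b' u\<close>. For compatible pairings that sum would be
    \<open>y t\<close> itself; here it is the necessary correction of \<open>y t\<close>.\<close>
  define w where "w t m = (\<Oplus>\<^bsub>A\<^esub>u\<in>{..<p}. ?\<beta> m (?\<gamma> (y t) (a' u) \<odot>\<^bsub>M'\<^esub> b' u))" for t m
  have vc: "?\<gamma> (y t) (a' u) \<odot>\<^bsub>M'\<^esub> b' u \<in> carrier M'" if "t < q" "u < p" for t u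
    using that yz ab c.\<beta>_closed M'.l_closed by auto
  have wc: "w t m \<in> carrier A" if "t < q" "m \<in> carrier M" for t m
    unfolding w_def using that vc b.\<beta>_closed by (intro A.finsum_closed) auto
  have wt: "w t m \<odot>\<^bsub>M\<^esub> z t = rsmult M m (?\<gamma> (y t) (z t))" if t: "t < q" and m: "m \<in> carrier M" for t m
  proof -
    \<comment> \<open>Pairing with \<open>b' u\<close> and then acting on \<open>z t\<close> is a
      left endomorphism of \<open>M\<close>, hence right multiplication by some \<open>d u\<close>.
      Expanding one by \<open>one\<beta>\<close> writes \<open>z t\<close> as the sum of the
      \<open>a' u d u\<close>, and moving \<open>\<gamma> (y t) (a' u)\<close> across the balanced
      pairing gives the claim.\<close>
    have "\<exists>d\<in>carrier A. \<forall>m\<in>carrier M. ?\<beta> m (b' u) \<odot>\<^bsub>M\<^esub> z t = rsmult M m d" if u: "u < p" for u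
    proof (rule endo)
      show "additive_map M M (\<lambda>m. ?\<beta> m (b' u) \<odot>\<^bsub>M\<^esub> z t)"
        using t u yz ab by (intro additive_mapI) (auto simp: b.\<beta>_closed b.\<beta>_add_left M.l_closed M.l_add_left)
    qed (use t u yz ab in \<open>auto simp: b.\<beta>_left b.\<beta>_closed M.l_assoc\<close>)
    then obtain d where d: "\<And>u. u < p \<Longrightarrow> d u \<in> carrier A"
      and dm: "\<And>u m. \<lbrakk>u < p; m \<in> carrier M\<rbrakk> \<Longrightarrow> ?\<beta> m (b' u) \<odot>\<^bsub>M\<^esub> z t = rsmult M m (d u)" by metis
    have zt: "z t \<in> carrier M" and yt: "y t \<in> carrier M'" using t yz by auto
    have "?\<gamma> (y t) (z t) = ?\<gamma> (y t) (\<Oplus>\<^bsub>M\<^esub>u\<in>{..<p}. rsmult M (a' u) (d u))"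
    proof -
      have "(\<Oplus>\<^bsub>M\<^esub>u\<in>{..<p}. rsmult M (a' u) (d u)) = (\<Oplus>\<^bsub>M\<^esub>u\<in>{..<p}. ?\<beta> (a' u) (b' u) \<odot>\<^bsub>M\<^esub> z t)"
        by (rule M.M.finsum_cong') (use dm ab zt d b.\<beta>_closed M.l_closed M.r_closed in auto)
      then show ?thesis using expand[OF zt] by simp
    qed
    also have "\<dots> = (\<Oplus>\<^bsub>A\<^esub>u\<in>{..<p}. ?\<gamma> (y t) (rsmult M (a' u) (d u)))"
      by (rule additive_map_finsum[OF M.M.abelian_group_axioms A.abelian_group_axioms \<gamma>_additive[OF yt]])
        (use ab d M.r_closed in auto)
    also have "\<dots> = (\<Oplus>\<^bsub>A\<^esub>u\<in>{..<p}. ?\<gamma> (y t) (a' u) \<otimes>\<^bsub>A\<^esub> d u)"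
      by (rule A.finsum_cong') (use ab d yt c.\<beta>_closed c.\<beta>_right in auto)
    finally have "rsmult M m (?\<gamma> (y t) (z t)) = (\<Oplus>\<^bsub>M\<^esub>u\<in>{..<p}. rsmult M m (?\<gamma> (y t) (a' u) \<otimes>\<^bsub>A\<^esub> d u))"
      using M.r_finsum_right[OF m, of "{..<p}" "\<lambda>u. ?\<gamma> (y t) (a' u) \<otimes>\<^bsub>A\<^esub> d u"] ab d yt c.\<beta>_closed by auto
    also have "\<dots> = (\<Oplus>\<^bsub>M\<^esub>u\<in>{..<p}. ?\<beta> m (?\<gamma> (y t) (a' u) \<odot>\<^bsub>M'\<^esub> b' u) \<odot>\<^bsub>M\<^esub> z t)"
    proof (rule M.M.finsum_cong')
      fix u assume "u \<in> {..<p}"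
      then have u: "u < p" by simp
      have g: "?\<gamma> (y t) (a' u) \<in> carrier A" using yt ab u c.\<beta>_closed by auto
      show "rsmult M m (?\<gamma> (y t) (a' u) \<otimes>\<^bsub>A\<^esub> d u) = ?\<beta> m (?\<gamma> (y t) (a' u) \<odot>\<^bsub>M'\<^esub> b' u) \<odot>\<^bsub>M\<^esub> z t"
        using dm[OF u M.r_closed[OF m g]] M.r_assoc[OF m g d[OF u]] b.\<beta>_balanced[OF m g ab(2)[OF u]] by simp
    qed (use vc t m zt b.\<beta>_closed M.l_closed in auto)
    also have "\<dots> = w t m \<odot>\<^bsub>M\<^esub> z t"
      unfolding w_def using M.l_finsum_left[OF zt, of "{..<p}" "\<lambda>u. ?\<beta> m (?\<gamma> (y t) (a' u) \<odot>\<^bsub>M'\<^esub> b' u)"]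
        vc t m b.\<beta>_closed by auto
    finally show ?thesis by simp
  qed
  have "morita_bimodule A M (smult M) (rsmult M) {..<q} z w {..<q} z (\<lambda>t. ?\<gamma> (y t))"
  proof (unfold_locales)
    show "additive_map M A (w t)" if "t \<in> {..<q}" for t
    proof (rule additive_mapI)
      show "w t (m \<oplus>\<^bsub>M\<^esub> m') = w t m \<oplus>\<^bsub>A\<^esub> w t m'" if m: "m \<in> carrier M" "m' \<in> carrier M" for m m'
      proof -
        have "w t (m \<oplus>\<^bsub>M\<^esub> m') = (\<Oplus>\<^bsub>A\<^esub>u\<in>{..<p}. ?\<beta> m (?\<gamma> (y t) (a' u) \<odot>\<^bsub>M'\<^esub> b' u) \<oplus>\<^bsub>A\<^esub> ?\<beta> m' (?\<gamma> (y t) (a' u) \<odot>\<^bsub>M'\<^esub> b' u))"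
          unfolding w_def by (rule A.finsum_cong') (use m \<open>t \<in> {..<q}\<close> vc b.\<beta>_closed b.\<beta>_add_left in auto)
        then show ?thesis unfolding w_def
          using A.finsum_addf[of "\<lambda>u. ?\<beta> m (?\<gamma> (y t) (a' u) \<odot>\<^bsub>M'\<^esub> b' u)" "{..<p}" "\<lambda>u. ?\<beta> m' (?\<gamma> (y t) (a' u) \<odot>\<^bsub>M'\<^esub> b' u)"]
            m \<open>t \<in> {..<q}\<close> vc b.\<beta>_closed by auto
      qed
    qed (use that wc in auto)
    show "w t (a \<odot>\<^bsub>M\<^esub> m) = a \<otimes>\<^bsub>A\<^esub> w t m" if "t \<in> {..<q}" "a \<in> carrier A" "m \<in> carrier M" for t a m
    proof -
      have "a \<otimes>\<^bsub>A\<^esub> w t m = (\<Oplus>\<^bsub>A\<^esub>u\<in>{..<p}. a \<otimes>\<^bsub>A\<^esub> ?\<beta> m (?\<gamma> (y t) (a' u) \<odot>\<^bsub>M'\<^esub> b' u))"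
        unfolding w_def by (rule A.finsum_rdistr) (use that vc b.\<beta>_closed in auto)
      also have "\<dots> = w t (a \<odot>\<^bsub>M\<^esub> m)"
        unfolding w_def by (rule A.finsum_cong') (use that vc b.\<beta>_closed b.\<beta>_left M.l_closed in auto)
      finally show ?thesis by simp
    qed
    show "(\<Oplus>\<^bsub>M\<^esub>t\<in>{..<q}. w t m \<odot>\<^bsub>M\<^esub> z t) = m" if m: "m \<in> carrier M" for m
    proof -
      have "(\<Oplus>\<^bsub>M\<^esub>t\<in>{..<q}. w t m \<odot>\<^bsub>M\<^esub> z t) = (\<Oplus>\<^bsub>M\<^esub>t\<in>{..<q}. rsmult M m (?\<gamma> (y t) (z t)))"
        by (rule M.M.finsum_cong') (use wt m yz c.\<beta>_closed M.r_closed in auto)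
      also have "\<dots> = rsmult M m \<one>\<^bsub>A\<^esub>"
        unfolding one\<gamma> by (rule M.r_finsum_right[OF m, symmetric]) (use yz c.\<beta>_closed in auto)
      finally show ?thesis using M.r_one[OF m] by simp
    qed
    show "\<exists>a\<in>carrier A. \<forall>m\<in>carrier M. \<phi> m = rsmult M m a"
      if "additive_map M M \<phi>" "\<And>a m. \<lbrakk>a \<in> carrier A; m \<in> carrier M\<rbrakk> \<Longrightarrow> \<phi> (a \<odot>\<^bsub>M\<^esub> m) = a \<odot>\<^bsub>M\<^esub> \<phi> m" for \<phi>
      using endo that by blast
  qed (use yz \<gamma>_additive c.\<beta>_right one\<gamma>[symmetric] in auto)
  then show ?thesis by blast
qed

section \<open>Idempotents in finite-dimensional algebras\<close>

definition image_space :: "('k, 'v, 'c) module_scheme \<Rightarrow> ('v \<Rightarrow> 'v) \<Rightarrow> ('k, 'v, 'c) module_scheme" where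
  "image_space V P = V\<lparr>carrier := P ` carrier V\<rparr>"

definition image_dim :: "('k, 'b) ring_scheme \<Rightarrow> ('k, 'v, 'c) module_scheme \<Rightarrow> ('v \<Rightarrow> 'v) \<Rightarrow> nat" where
  "image_dim k V P = vectorspace.dim k (image_space V P)"

lemma image_space_simps:
  "carrier (image_space V P) = P ` carrier V" "add (image_space V P) = add V"
  "zero (image_space V P) = zero V" "smult (image_space V P) = smult V"
  by (simp_all add: image_space_def)

lemma image_space_vectorspace:
  assumes "vectorspace k V" "P \<in> module_hom k V V"
  shows "vectorspace k (image_space V P)"
proof -
  interpret V: vectorspace k V by fact
  interpret P: linear_map k V V P
    using assms(2) by unfold_locales simp
  show ?thesis
    using V.subspace_is_vs[OF P.imT_is_subspace] by (simp add: P.im_def image_space_def)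
qed

lemma image_space_hom: "P \<in> module_hom k V V \<Longrightarrow> P \<in> module_hom k V (image_space V P)"
  by (auto simp: module_hom_def image_space_simps)

lemma image_space_inclusion: "P \<in> module_hom k V V \<Longrightarrow> (\<lambda>x. x) \<in> module_hom k (image_space V P) V"
  by (auto simp: module_hom_def image_space_simps)

lemma has_rank_image_space:
  assumes V: "vectorspace k V" and P: "P \<in> module_hom k V V" and "has_rank k V n"
  shows "has_rank k (image_space V P) (image_dim k V P)"
proof -
  interpret V: vectorspace k V by fact
  interpret W: vectorspace k "image_space V P" by (rule image_space_vectorspace[OF V P])
  obtain z \<phi> where "coordinates k V {..<n} z \<phi>" using assms(3) by (auto simp: has_rank_def)
  then have d: "dual_basis k V {..<n} z \<phi>" by (simp add: coordinates_def)
  have "\<exists>m. has_rank k (image_space V P) m"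
  proof (rule has_rank_exists[OF W.vectorspace_axioms, of "{..<n}" "\<lambda>j. P (z j)"])
    show "P (z j) \<in> carrier (image_space V P)" if "j \<in> {..<n}" for j
      using dual_basis_closed(1)[OF d that] by (auto simp: image_space_simps)
    show "\<exists>c\<in>{..<n} \<rightarrow> carrier k. y = (\<Oplus>\<^bsub>image_space V P\<^esub>j\<in>{..<n}. c j \<odot>\<^bsub>image_space V P\<^esub> P (z j))"
      if y: "y \<in> carrier (image_space V P)" for y
    proof -
      obtain x where x: "x \<in> carrier V" "y = P x" using y by (auto simp: image_space_simps)
      have "P (\<Oplus>\<^bsub>V\<^esub>j\<in>{..<n}. \<phi> j x \<odot>\<^bsub>V\<^esub> z j) = (\<Oplus>\<^bsub>image_space V P\<^esub>j\<in>{..<n}. \<phi> j x \<odot>\<^bsub>image_space V P\<^esub> P (z j))"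
        using dual_basis_closed[OF d] x
        by (intro module_hom_lincomb[OF V.module_axioms W.module_axioms image_space_hom[OF P]]) auto
      then show ?thesis using dual_basis_eq[OF d x(1)] x dual_basis_closed(2)[OF d]
        by (intro bexI[of _ "\<lambda>j. \<phi> j x"]) auto
    qed
  qed simp
  then show ?thesis using has_rank_dim[OF W.vectorspace_axioms] unfolding image_dim_def by metis
qed

lemma rank_decomposition:
  assumes V: "vectorspace k V" and rank: "has_rank k V n" and T: "finite T"
    and P: "\<And>t. t \<in> T \<Longrightarrow> P t \<in> module_hom k V V"
    and idem: "\<And>t x. \<lbrakk>t \<in> T; x \<in> carrier V\<rbrakk> \<Longrightarrow> P t (P t x) = P t x"
    and orth: "\<And>s t x. \<lbrakk>s \<in> T; t \<in> T; s \<noteq> t; x \<in> carrier V\<rbrakk> \<Longrightarrow> P s (P t x) = \<zero>\<^bsub>V\<^esub>"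
    and all: "\<And>x. x \<in> carrier V \<Longrightarrow> (\<Oplus>\<^bsub>V\<^esub>t\<in>T. P t x) = x"
  shows "n = (\<Sum>t\<in>T. image_dim k V (P t))"
proof -
  interpret V: vectorspace k V by fact
  have "has_rank k V (\<Sum>t\<in>T. image_dim k V (P t))"
  proof (rule has_rank_direct_sum[OF V.module_axioms _ T, of "\<lambda>t. image_space V (P t)" _ "\<lambda>t x. x" P])
    show "module k (image_space V (P t))" if "t \<in> T" for t
      using image_space_vectorspace[OF V P[OF that]] by (simp add: vectorspace_def)
    show "(\<lambda>x. x) \<in> module_hom k (image_space V (P t)) V" "P t \<in> module_hom k V (image_space V (P t))" if "t \<in> T" for t
      using image_space_inclusion image_space_hom P[OF that] by blast+
  qed (use P idem orth all has_rank_image_space[OF V P rank] in \<open>auto simp: image_space_simps\<close>)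
  then show ?thesis using has_rank_dim[OF V] rank by metis
qed

text \<open>The conditions on \<open>g\<close> and \<open>g'\<close> concern the images only, and
  linearity is asked of \<open>g\<close> alone, so an inverse obtained by choice can be used, as in
  \<open>matched_image_dim_B\<close>.\<close>

lemma image_dim_cong:
  assumes V: "vectorspace k V" and P: "P \<in> module_hom k V V" and W: "vectorspace k W" and Q: "Q \<in> module_hom k W W"
    and rank: "has_rank k V n"
    and g: "\<And>x. x \<in> P ` carrier V \<Longrightarrow> g x \<in> Q ` carrier W"
    and g': "\<And>y. y \<in> Q ` carrier W \<Longrightarrow> g' y \<in> P ` carrier V"
    and g'g: "\<And>x. x \<in> P ` carrier V \<Longrightarrow> g' (g x) = x" and gg': "\<And>y. y \<in> Q ` carrier W \<Longrightarrow> g (g' y) = y"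
    and add: "\<And>x y. \<lbrakk>x \<in> P ` carrier V; y \<in> P ` carrier V\<rbrakk> \<Longrightarrow> g (x \<oplus>\<^bsub>V\<^esub> y) = g x \<oplus>\<^bsub>W\<^esub> g y"
    and scale: "\<And>c x. \<lbrakk>c \<in> carrier k; x \<in> P ` carrier V\<rbrakk> \<Longrightarrow> g (c \<odot>\<^bsub>V\<^esub> x) = c \<odot>\<^bsub>W\<^esub> g x"
  shows "image_dim k V P = image_dim k W Q"
proof -
  interpret PV: vectorspace k "image_space V P" by (rule image_space_vectorspace[OF V P])
  interpret QW: vectorspace k "image_space W Q" by (rule image_space_vectorspace[OF W Q])
  have "bij_betw g (P ` carrier V) (Q ` carrier W)"
    by (rule bij_betw_byWitness[of _ g']) (use g g' g'g gg' in auto)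
  moreover have "g \<in> module_hom k (image_space V P) (image_space W Q)"
    by (rule module_homI) (use g add scale in \<open>auto simp: image_space_simps\<close>)
  ultimately have "has_rank k (image_space W Q) (image_dim k V P)"
    using has_rank_iso[OF PV.module_axioms QW.module_axioms _ _ has_rank_image_space[OF V P rank]]
    by (simp add: image_space_simps)
  then show ?thesis using has_rank_dim[OF QW.vectorspace_axioms] by (simp add: image_dim_def)
qed

text \<open>The index set \<open>{..d}\<close> has one element more than the dimension. Dependence
  is meant for the family, whereas the dimension bound counts the set of its members; repetitions
  are therefore treated apart.\<close>

lemma has_rank_dependent:
  assumes V: "vectorspace k V" and rank: "has_rank k V d" and u: "\<And>j. j \<le> d \<Longrightarrow> u j \<in> carrier V"
  shows "\<exists>a\<in>{..d} \<rightarrow> carrier k. (\<Oplus>\<^bsub>V\<^esub>j\<in>{..d}. a j \<odot>\<^bsub>V\<^esub> u j) = \<zero>\<^bsub>V\<^esub> \<and> (\<exists>j\<le>d. a j \<noteq> \<zero>\<^bsub>k\<^esub>)"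
proof (rule ccontr)
  interpret V: vectorspace k V by fact
  assume "\<not> ?thesis"
  then have indep: "a j = \<zero>\<^bsub>k\<^esub>" if "a \<in> {..d} \<rightarrow> carrier k" "(\<Oplus>\<^bsub>V\<^esub>j\<in>{..d}. a j \<odot>\<^bsub>V\<^esub> u j) = \<zero>\<^bsub>V\<^esub>" "j \<le> d" for a j
    using that by blast
  obtain z \<phi> where c: "coordinates k V {..<d} z \<phi>" using rank by (auto simp: has_rank_def)
  have fd: "V.fin_dim"
    using coordinates_finite_basis(1)[OF V.module_axioms c V.field.one_not_zero]
    unfolding V.fin_dim_def finite_basis_def by blast
  \<comment> \<open>A repeated vector yields a relation by itself, with coefficients one and minus
    one.\<close>
  have inj: "inj_on u {..d}"
  proof (rule inj_onI, rule ccontr)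
    fix i j assume ij: "i \<in> {..d}" "j \<in> {..d}" "u i = u j" "i \<noteq> j"
    let ?a = "\<lambda>t. (if t = i then \<one>\<^bsub>k\<^esub> else \<zero>\<^bsub>k\<^esub>) \<oplus>\<^bsub>k\<^esub> (if t = j then \<ominus>\<^bsub>k\<^esub> \<one>\<^bsub>k\<^esub> else \<zero>\<^bsub>k\<^esub>)"
    have "(\<Oplus>\<^bsub>V\<^esub>t\<in>{..d}. ?a t \<odot>\<^bsub>V\<^esub> u t)
        = (\<Oplus>\<^bsub>V\<^esub>t\<in>{..d}. (if t = i then u t else \<zero>\<^bsub>V\<^esub>) \<oplus>\<^bsub>V\<^esub> (if t = j then \<ominus>\<^bsub>V\<^esub> u t else \<zero>\<^bsub>V\<^esub>))"
      by (rule V.M.finsum_cong') (use u in \<open>auto simp: V.smult_l_minus V.smult_l_distr\<close>)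
    also have "\<dots> = (\<Oplus>\<^bsub>V\<^esub>t\<in>{..d}. if t = i then u t else \<zero>\<^bsub>V\<^esub>) \<oplus>\<^bsub>V\<^esub> (\<Oplus>\<^bsub>V\<^esub>t\<in>{..d}. if t = j then \<ominus>\<^bsub>V\<^esub> u t else \<zero>\<^bsub>V\<^esub>)"
      by (rule V.M.finsum_addf) (use u in auto)
    also have "(\<Oplus>\<^bsub>V\<^esub>t\<in>{..d}. if t = i then u t else \<zero>\<^bsub>V\<^esub>) = u i"
      using V.M.finsum_delta[of "{..d}" i u] ij u by auto
    also have "(\<Oplus>\<^bsub>V\<^esub>t\<in>{..d}. if t = j then \<ominus>\<^bsub>V\<^esub> u t else \<zero>\<^bsub>V\<^esub>) = \<ominus>\<^bsub>V\<^esub> u j"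
      using V.M.finsum_delta[of "{..d}" j "\<lambda>t. \<ominus>\<^bsub>V\<^esub> u t"] ij u by auto
    finally have "(\<Oplus>\<^bsub>V\<^esub>t\<in>{..d}. ?a t \<odot>\<^bsub>V\<^esub> u t) = \<zero>\<^bsub>V\<^esub>" using ij u by (simp add: V.M.r_neg)
    then have "?a i = \<zero>\<^bsub>k\<^esub>" using indep[of ?a i] ij by auto
    then show False using ij by simp
  qed
  have uc: "u ` {..d} \<subseteq> carrier V" using u by auto
  have "\<not> V.lin_dep (u ` {..d})"
  proof
    assume "V.lin_dep (u ` {..d})"
    then obtain a v where a: "a \<in> u ` {..d} \<rightarrow> carrier k" "V.lincomb a (u ` {..d}) = \<zero>\<^bsub>V\<^esub>" "v \<in> u ` {..d}" "a v \<noteq> \<zero>\<^bsub>k\<^esub>"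
      using V.finite_lin_dep[of "u ` {..d}"] uc by auto
    have "V.lincomb a (u ` {..d}) = (\<Oplus>\<^bsub>V\<^esub>j\<in>{..d}. a (u j) \<odot>\<^bsub>V\<^esub> u j)"
      unfolding V.lincomb_def using a(1) u inj by (intro V.M.finsum_reindex) auto
    then have "a (u j) = \<zero>\<^bsub>k\<^esub>" if "j \<le> d" for j using indep[of "\<lambda>j. a (u j)" j] a(1,2) that by auto
    then show False using a(3,4) by auto
  qed
  then have "card (u ` {..d}) \<le> V.dim" using V.li_le_dim(2)[OF fd uc] by blast
  then show False using card_image[OF inj] has_rank_dim[OF V rank] by simp
qed

section \<open>Corner rings and Fitting's lemma\<close>

locale fd_algebra = assoc_algebra k B for k :: "'k ring" and B :: "('k, 'b) module" (structure) +
  fixes d :: nat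
  assumes field_k: "field k" and rank_B: "has_rank k B d"
begin

sublocale k: field k by (rule field_k)

lemma vs_B: "vectorspace k B"
  by (simp add: vectorspace_def module_axioms field_k)

text \<open>For idempotents this is the Peirce component \<open>i B j\<close>, described by fixed
  points instead of as an image; \<open>peirce_image\<close> identifies the two
  descriptions.\<close>

definition corner :: "'b \<Rightarrow> 'b \<Rightarrow> 'b set" where
  "corner i j = {b \<in> carrier B. i \<otimes> b = b \<and> b \<otimes> j = b}"

lemma idem: "idempotent B e \<Longrightarrow> e \<in> carrier B" "idempotent B e \<Longrightarrow> e \<otimes> e = e"
  by (auto simp: idempotent_def)

lemma cornerI: "\<lbrakk>idempotent B i; idempotent B j; b \<in> carrier B\<rbrakk> \<Longrightarrow> i \<otimes> b \<otimes> j \<in> corner i j"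
  unfolding corner_def idempotent_def by (auto simp: A.m_assoc[symmetric]) (simp add: A.m_assoc)

lemma corner_closed: "b \<in> corner i j \<Longrightarrow> b \<in> carrier B"
  by (simp add: corner_def)

lemma corner_left: "b \<in> corner i j \<Longrightarrow> i \<otimes> b = b" and corner_right: "b \<in> corner i j \<Longrightarrow> b \<otimes> j = b"
  by (simp_all add: corner_def)

lemma corner_mult:
  "\<lbrakk>i \<in> carrier B; m \<in> carrier B; b \<in> corner i j; c \<in> corner j m\<rbrakk> \<Longrightarrow> b \<otimes> c \<in> corner i m"
  unfolding corner_def by (auto simp: A.m_assoc[symmetric]) (simp add: A.m_assoc)

lemma corner_add:
  "\<lbrakk>i \<in> carrier B; j \<in> carrier B; b \<in> corner i j; c \<in> corner i j\<rbrakk> \<Longrightarrow> b \<oplus> c \<in> corner i j"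
  unfolding corner_def by (auto simp: A.r_distr A.l_distr)

lemma corner_zero: "\<lbrakk>i \<in> carrier B; j \<in> carrier B\<rbrakk> \<Longrightarrow> \<zero> \<in> corner i j"
  unfolding corner_def by auto

lemma corner_self: "idempotent B e \<Longrightarrow> e \<in> corner e e"
  unfolding corner_def idempotent_def by auto

lemma corner_finsum:
  assumes "i \<in> carrier B" "j \<in> carrier B" "\<And>s. s \<in> S \<Longrightarrow> c s \<in> corner i j"
  shows "(\<Oplus>s\<in>S. c s) \<in> corner i j"
  using assms(3)
proof (induction S rule: infinite_finite_induct)
  case (insert s S)
  then have "(\<Oplus>s\<in>insert s S. c s) = c s \<oplus> (\<Oplus>s\<in>S. c s)"
    by (intro M.finsum_insert) (auto intro: corner_closed)
  then show ?case using insert corner_add assms by simp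
qed (auto simp: corner_zero assms)

text \<open>Otherwise \<open>e - g\<close> would be a nonzero idempotent orthogonal to
  \<open>g\<close>, and \<open>e\<close> would split as \<open>g + (e - g)\<close>.\<close>

lemma primitive_corner:
  assumes e: "primitive_idempotent B e" and g: "idempotent B g" "g \<in> corner e e" "g \<noteq> \<zero>"
  shows "g = e"
proof (rule ccontr)
  assume "g \<noteq> e"
  have ei: "idempotent B e" using e by (simp add: primitive_idempotent_def)
  note c = idem(1)[OF ei] idem(1)[OF g(1)] and ee = idem(2)[OF ei] and gg = idem(2)[OF g(1)]
  note eg = corner_left[OF g(2)] corner_right[OF g(2)]
  let ?h = "e \<ominus> g"
  have h: "?h \<in> carrier B" using c by simp
  have gh: "g \<otimes> ?h = \<zero>" using c eg gg by (simp add: a_minus_def A.r_distr A.r_minus M.r_neg)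
  have hg: "?h \<otimes> g = \<zero>" using c eg gg by (simp add: a_minus_def A.l_distr A.l_minus M.r_neg)
  have "?h \<otimes> ?h = ?h \<otimes> e" using hg h c by (simp add: a_minus_def A.r_distr A.r_minus)
  also have "\<dots> = ?h" using c ee eg by (simp add: a_minus_def A.l_distr A.l_minus)
  finally have "idempotent B ?h" using h by (simp add: idempotent_def)
  moreover have "?h \<noteq> \<zero>" using \<open>g \<noteq> e\<close> c by simp
  moreover have "e = g \<oplus> ?h" using c by (simp add: a_minus_def M.a_lcomm M.r_neg)
  ultimately show False using e g gh hg unfolding primitive_idempotent_def by blast
qed

text \<open>Divide a linear relation between the powers of \<open>c\<close> by its lowest term.\<close>
lemma fitting_relation:
  assumes c: "c \<in> carrier B"
  shows "\<exists>n q. q \<in> carrier B \<and> q \<otimes> c = c \<otimes> q \<and> 0 < (n::nat) \<and> c [^] n = c [^] n \<otimes> (c \<otimes> q)"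
proof -
  have cp: "c [^] (j::nat) \<in> carrier B" for j using c by simp
  \<comment> \<open>The powers start at the first one, so the exponent \<open>Suc m\<close> found
    below is positive. In \<open>fitting\<close> this keeps the power of \<open>c\<close> inside the
    corner, whose identity is \<open>e\<close> and not \<open>c [^] 0\<close>.\<close>
  obtain a where a: "a \<in> {..d} \<rightarrow> carrier k" "(\<Oplus>j\<in>{..d}. a j \<odot> c [^] Suc j) = \<zero>" "\<exists>j\<le>d. a j \<noteq> \<zero>\<^bsub>k\<^esub>"
    using has_rank_dependent[OF vs_B rank_B, of "\<lambda>j. c [^] Suc j"] cp by blast
  define m where "m = (LEAST j. j \<le> d \<and> a j \<noteq> \<zero>\<^bsub>k\<^esub>)"
  have m: "m \<le> d" "a m \<noteq> \<zero>\<^bsub>k\<^esub>" using LeastI_ex[of "\<lambda>j. j \<le> d \<and> a j \<noteq> \<zero>\<^bsub>k\<^esub>"] a(3) unfolding m_def by blast+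
  have less: "a j = \<zero>\<^bsub>k\<^esub>" if "j < m" for j
    using not_less_Least[of j "\<lambda>j. j \<le> d \<and> a j \<noteq> \<zero>\<^bsub>k\<^esub>"] that m unfolding m_def by auto
  have ac: "a j \<in> carrier k" if "j \<le> d" for j using a(1) that by auto
  let ?v = "inv\<^bsub>k\<^esub> a m"
  have v: "?v \<in> carrier k" "?v \<otimes>\<^bsub>k\<^esub> a m = \<one>\<^bsub>k\<^esub>"
    using m ac[OF m(1)] k.field_Units by (auto simp: R.Units_l_inv)
  let ?b = "\<lambda>j. \<ominus>\<^bsub>k\<^esub> (?v \<otimes>\<^bsub>k\<^esub> a j)"
  let ?J = "{m<..d}"
  \<comment> \<open>A polynomial in \<open>c\<close>, hence commuting with it. After division by the
    lowest coefficient the relation reads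
    \<open>c [^] Suc m = c [^] Suc (Suc m) \<otimes> q\<close>.\<close>
  define q where "q = (\<Oplus>j\<in>?J. ?b j \<odot> c [^] (j - Suc m))"
  have bc: "?b j \<in> carrier k" if "j \<le> d" for j using v ac[OF that] by simp
  have qc: "q \<in> carrier B" unfolding q_def using bc cp by (intro M.finsum_closed) auto
  have qcomm: "q \<otimes> c = c \<otimes> q"
  proof -
    have comm: "c [^] (j::nat) \<otimes> c = c \<otimes> c [^] j" for j using A.nat_pow_Suc2[OF c, of j] by simp
    have "q \<otimes> c = (\<Oplus>j\<in>?J. ?b j \<odot> c [^] (j - Suc m) \<otimes> c)"
      unfolding q_def by (rule A.finsum_ldistr) (use bc cp c in auto)
    also have "\<dots> = (\<Oplus>j\<in>?J. c \<otimes> (?b j \<odot> c [^] (j - Suc m)))"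
      by (rule M.finsum_cong') (use bc cp c in \<open>auto simp: smult_mult_left smult_mult_right comm\<close>)
    also have "\<dots> = c \<otimes> q"
      unfolding q_def by (rule A.finsum_rdistr[symmetric]) (use bc cp c in auto)
    finally show ?thesis .
  qed
  have split: "(\<Oplus>j\<in>{..d}. a j \<odot> c [^] Suc j) = a m \<odot> c [^] Suc m \<oplus> (\<Oplus>j\<in>?J. a j \<odot> c [^] Suc j)"
  proof -
    have "(\<Oplus>j\<in>{..d}. a j \<odot> c [^] Suc j) = (\<Oplus>j\<in>insert m ?J. a j \<odot> c [^] Suc j)"
    proof (rule M.add.finprod_mono_neutral_cong_right)
      show "insert m ?J \<subseteq> {..d}" using m by auto
      show "a j \<odot> c [^] Suc j = \<zero>" if "j \<in> {..d} - insert m ?J" for j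
      proof -
        from that have "a j = \<zero>\<^bsub>k\<^esub>" using less[of j] by auto
        then show "a j \<odot> c [^] Suc j = \<zero>" using cp[of "Suc j"] by simp
      qed
    qed (use ac cp[of "Suc _"] in auto)
    also have "\<dots> = a m \<odot> c [^] Suc m \<oplus> (\<Oplus>j\<in>?J. a j \<odot> c [^] Suc j)"
      by (rule M.finsum_insert) (use ac m cp[of "Suc _"] in auto)
    finally show ?thesis .
  qed
  have Jc: "(\<Oplus>j\<in>?J. a j \<odot> c [^] Suc j) \<in> carrier B"
    using ac cp[of "Suc _"] by (intro M.finsum_closed) auto
  have mc: "a m \<odot> c [^] Suc m \<in> carrier B" using ac[OF m(1)] cp[of "Suc m"] by simp
  have "a m \<odot> c [^] Suc m = \<ominus> (\<Oplus>j\<in>?J. a j \<odot> c [^] Suc j)"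
    using split a(2) M.minus_equality[OF _ Jc mc] by simp
  then have "?v \<odot> (a m \<odot> c [^] Suc m) = ?v \<odot> (\<ominus> (\<Oplus>j\<in>?J. a j \<odot> c [^] Suc j))" by simp
  moreover have "?v \<odot> (a m \<odot> c [^] Suc m) = c [^] Suc m"
    using v ac[OF m(1)] cp[of "Suc m"] by (simp flip: smult_assoc1)
  moreover have "?v \<odot> (\<ominus> (\<Oplus>j\<in>?J. a j \<odot> c [^] Suc j)) = (\<ominus>\<^bsub>k\<^esub> ?v) \<odot> (\<Oplus>j\<in>?J. a j \<odot> c [^] Suc j)"
    using v Jc by (simp add: smult_r_minus smult_l_minus)
  ultimately have "c [^] Suc m = (\<ominus>\<^bsub>k\<^esub> ?v) \<odot> (\<Oplus>j\<in>?J. a j \<odot> c [^] Suc j)" by simp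
  also have "\<dots> = (\<Oplus>j\<in>?J. (\<ominus>\<^bsub>k\<^esub> ?v) \<odot> (a j \<odot> c [^] Suc j))"
    by (rule finsum_smult) (use v ac cp[of "Suc _"] in auto)
  also have "\<dots> = (\<Oplus>j\<in>?J. c [^] Suc (Suc m) \<otimes> (?b j \<odot> c [^] (j - Suc m)))"
  proof (rule M.finsum_cong')
    fix j assume j: "j \<in> ?J"
    have "c [^] Suc j = c [^] Suc (Suc m) \<otimes> c [^] (j - Suc m)"
      using j c A.nat_pow_mult[of c "Suc (Suc m)" "j - Suc m"] by simp
    moreover have "(\<ominus>\<^bsub>k\<^esub> ?v) \<odot> (a j \<odot> (y \<otimes> z)) = y \<otimes> (?b j \<odot> z)" if "y \<in> carrier B" "z \<in> carrier B" for y z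
      using bc[of j] ac[of j] v j that by (simp add: smult_mult_right R.l_minus flip: smult_assoc1)
    ultimately show "(\<ominus>\<^bsub>k\<^esub> ?v) \<odot> (a j \<odot> c [^] Suc j) = c [^] Suc (Suc m) \<otimes> (?b j \<odot> c [^] (j - Suc m))"
      using cp by metis
  qed (use bc cp cp[of "Suc (Suc m)"] in auto)
  also have "\<dots> = c [^] Suc (Suc m) \<otimes> q"
    unfolding q_def by (rule A.finsum_rdistr[symmetric]) (use bc cp cp[of "Suc (Suc m)"] in auto)
  finally have "c [^] Suc m = c [^] Suc (Suc m) \<otimes> q" .
  moreover have "c [^] Suc (Suc m) \<otimes> q = c [^] Suc m \<otimes> (c \<otimes> q)"
    using c qc cp[of "Suc m"] by (simp add: A.m_assoc)
  ultimately have "c [^] Suc m = c [^] Suc m \<otimes> (c \<otimes> q)" by (rule trans)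
  then show ?thesis using qc qcomm by blast
qed

text \<open>Invertibility in the ring \<open>e B e\<close> with identity \<open>e\<close>; for
  \<open>e\<close> other than one such an element is never a unit of \<open>B\<close>.\<close>

definition corner_unit :: "'b \<Rightarrow> 'b \<Rightarrow> bool" where
  "corner_unit e c \<longleftrightarrow> c \<in> corner e e \<and> (\<exists>v\<in>corner e e. c \<otimes> v = e \<and> v \<otimes> c = e)"

text \<open>The relation \<open>c^n = c^n (c q)\<close> makes \<open>g = c^n q^n\<close> an
  idempotent of \<open>e B e\<close>. By primitivity either \<open>g\<close> is zero, and then so is
  \<open>c^n = c^n g\<close>, or \<open>g\<close> is \<open>e\<close>, and then splitting off one
  factor \<open>c\<close> from \<open>g\<close> exhibits an inverse.\<close>

lemma fitting:
  assumes e: "primitive_idempotent B e" and c: "c \<in> corner e e"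
  shows "corner_unit e c \<or> (\<exists>n::nat. c [^] n = \<zero> \<and> 0 < n)"
proof -
  have ei: "idempotent B e" using e by (simp add: primitive_idempotent_def)
  note ec = idem(1)[OF ei] and ee = idem(2)[OF ei]
  note cc = corner_closed[OF c] and ecl = corner_left[OF c] and ecr = corner_right[OF c]
  obtain n q where q: "q \<in> carrier B" "q \<otimes> c = c \<otimes> q" and n: "0 < (n::nat)" and rel: "c [^] n = c [^] n \<otimes> (c \<otimes> q)"
    using fitting_relation[OF cc] by blast
  obtain m where m: "n = Suc m" using n by (cases n) auto
  have pc: "c [^] (j::nat) \<in> carrier B" "(c \<otimes> q) [^] (j::nat) \<in> carrier B" "q [^] (j::nat) \<in> carrier B" for j
    using cc q by auto
  \<comment> \<open>Iterating \<open>n\<close> times collects enough factors \<open>c q\<close> to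
    give \<open>c^n = c^n g\<close>.\<close>
  have rel': "c [^] n = c [^] n \<otimes> (c \<otimes> q) [^] (j::nat)" for j
  proof (induction j)
    case (Suc j)
    have "c [^] n \<otimes> (c \<otimes> q) [^] Suc j = (c [^] n \<otimes> (c \<otimes> q) [^] j) \<otimes> (c \<otimes> q)"
      using cc q pc by (simp add: A.m_assoc)
    then show ?case using Suc rel by metis
  qed (use pc in simp)
  have dist: "(c \<otimes> q) [^] (j::nat) = c [^] j \<otimes> q [^] j" for j
    by (rule A.pow_mult_distrib) (use cc q in auto)
  let ?g = "c [^] n \<otimes> q [^] n"
  have qn: "q [^] (j::nat) \<otimes> c [^] (i::nat) = c [^] i \<otimes> q [^] j" for i j
  proof -
    have "c \<otimes> q [^] (j::nat) = q [^] j \<otimes> c" for j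
      by (rule A.group_commutes_pow[symmetric]) (use cc q in auto)
    then show ?thesis
      using A.group_commutes_pow[of c "q [^] j" i] cc pc by simp
  qed
  have gc: "?g \<in> carrier B" using pc by simp
  have cg: "c [^] n \<otimes> ?g = c [^] n" using rel'[of n] dist[of n] by simp
  have "?g \<otimes> ?g = c [^] n \<otimes> (q [^] n \<otimes> c [^] n) \<otimes> q [^] n" using pc by (simp add: A.m_assoc)
  also have "\<dots> = (c [^] n \<otimes> ?g) \<otimes> q [^] n" using pc by (simp add: qn A.m_assoc)
  finally have gg: "?g \<otimes> ?g = ?g" using cg by simp
  have cm: "c [^] n = c \<otimes> c [^] m" "c [^] n = c [^] m \<otimes> c"
    using cc m A.nat_pow_Suc2[of c m] by auto
  have "e \<otimes> ?g = (e \<otimes> c) \<otimes> (c [^] m \<otimes> q [^] n)" unfolding cm(1) using ec cc pc by (simp add: A.m_assoc)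
  also have "\<dots> = ?g" unfolding ecl cm(1) using cc pc by (simp add: A.m_assoc)
  finally have eg: "e \<otimes> ?g = ?g" .
  have cne: "c [^] n \<otimes> e = c [^] n" unfolding cm(2) using ec cc pc ecr by (simp add: A.m_assoc)
  have "?g \<otimes> e = q [^] n \<otimes> c [^] n \<otimes> e" using qn[of n n] by simp
  also have "\<dots> = q [^] n \<otimes> (c [^] n \<otimes> e)" using pc ec by (simp add: A.m_assoc)
  also have "\<dots> = ?g" unfolding cne by (rule qn)
  finally have ge: "?g \<otimes> e = ?g" .
  show ?thesis
  proof (cases "?g = \<zero>")
    case True
    then have "c [^] n = \<zero>" using cg pc by simp
    then show ?thesis using n by blast
  next
    case False
    have "?g = e"
      by (rule primitive_corner[OF e _ _ False]) (use gg gc eg ge in \<open>auto simp: idempotent_def corner_def\<close>)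
    \<comment> \<open>The product of \<open>c\<close> with \<open>?w\<close> is
      \<open>g = e\<close>; multiplying \<open>?w\<close> by \<open>e\<close> on both sides moves it
      into the corner.\<close>
    let ?w = "c [^] m \<otimes> q [^] n"
    let ?v = "e \<otimes> ?w \<otimes> e"
    have w: "?w \<in> carrier B" using pc by simp
    have v: "?v \<in> corner e e" by (rule cornerI[OF ei ei w])
    have "c \<otimes> ?v = (c \<otimes> e) \<otimes> ?w \<otimes> e" using cc ec w by (simp add: A.m_assoc)
    also have "\<dots> = (c \<otimes> c [^] m \<otimes> q [^] n) \<otimes> e" unfolding ecr using cc pc ec by (simp add: A.m_assoc)
    also have "\<dots> = e" using \<open>?g = e\<close> cm(1) ee by simp
    finally have cv: "c \<otimes> ?v = e" .
    have "?v \<otimes> c = e \<otimes> (?w \<otimes> (e \<otimes> c))" using cc ec w by (simp add: A.m_assoc)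
    also have "\<dots> = e \<otimes> (q [^] n \<otimes> c [^] m \<otimes> c)" unfolding ecl qn ..
    also have "q [^] n \<otimes> c [^] m \<otimes> c = q [^] n \<otimes> c [^] n" unfolding cm(2) using cc pc by (simp add: A.m_assoc)
    also have "e \<otimes> (q [^] n \<otimes> c [^] n) = e" unfolding qn using \<open>?g = e\<close> ee by simp
    finally have "?v \<otimes> c = e" .
    then show ?thesis using cv v c unfolding corner_unit_def by blast
  qed
qed

text \<open>By Fitting's lemma \<open>b\<close> would otherwise be nilpotent as well. The last
  nonzero power \<open>w\<close> of \<open>a\<close> satisfies \<open>w a = 0\<close>, so
  \<open>w = w (a + b) = w b\<close>, and iteration gives \<open>w = w b^m = 0\<close>.\<close>

lemma nilpotent_complement:
  assumes e: "primitive_idempotent B e" and a: "a \<in> corner e e" and b: "b \<in> corner e e" and ab: "a \<oplus> b = e"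
    and nil: "a [^] (n::nat) = \<zero>"
  shows "corner_unit e b"
proof (rule ccontr)
  assume "\<not> corner_unit e b"
  then obtain m :: nat where bm: "b [^] m = \<zero>" using fitting[OF e b] by blast
  have ei: "idempotent B e" and e0: "e \<noteq> \<zero>" using e by (auto simp: primitive_idempotent_def)
  note ec = idem(1)[OF ei] and ac = corner_closed[OF a] and bc = corner_closed[OF b]
  \<comment> \<open>The factor \<open>e\<close> turns the zeroth power into the identity of the
    corner, which is nonzero by primitivity; hence the least such \<open>t\<close> is positive and
    has a predecessor.\<close>
  define t where "t = (LEAST t. e \<otimes> a [^] (t::nat) = \<zero>)"
  have t: "e \<otimes> a [^] t = \<zero>" unfolding t_def by (rule LeastI[of _ n]) (use nil ec in simp)
  have "t \<noteq> 0" using t e0 ec by (metis A.nat_pow_0 A.r_one)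
  then obtain s where s: "t = Suc s" by (cases t) auto
  let ?w = "e \<otimes> a [^] s"
  have w0: "?w \<noteq> \<zero>" using not_less_Least[of s "\<lambda>t. e \<otimes> a [^] t = \<zero>"] s unfolding t_def by auto
  have wc: "?w \<in> carrier B" using ec ac by simp
  have wa: "?w \<otimes> a = \<zero>" using t s ec ac by (simp add: A.m_assoc)
  have we: "?w \<otimes> e = ?w"
  proof (cases s)
    case 0
    then show ?thesis using ec idem(2)[OF ei] by simp
  next
    case (Suc i)
    then show ?thesis using ec ac corner_right[OF a] by (simp add: A.m_assoc)
  qed
  have "?w = ?w \<otimes> (a \<oplus> b)" unfolding ab we ..
  also have "\<dots> = ?w \<otimes> b" using wa wc ac bc by (simp add: A.r_distr)
  finally have wb: "?w = ?w \<otimes> b" .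
  have "?w = ?w \<otimes> b [^] (j::nat)" for j
  proof (induction j)
    case (Suc j)
    have "?w \<otimes> b [^] Suc j = (?w \<otimes> b [^] j) \<otimes> b" using wc bc by (simp add: A.m_assoc del: A.m_assoc[symmetric])
    then show ?case using Suc wb by metis
  qed (use wc in simp)
  from this[of m] show False using bm w0 wc by simp
qed

lemma corner_unit_cancel_left:
  assumes "idempotent B e" "v \<in> corner e e" "u \<in> corner e e" "u \<otimes> v = e" "v \<otimes> u = e" "c \<in> corner e e" "corner_unit e (v \<otimes> c)"
  shows "corner_unit e c"
proof -
  obtain y where y: "y \<in> corner e e" "v \<otimes> c \<otimes> y = e" "y \<otimes> (v \<otimes> c) = e" using assms(7) by (auto simp: corner_unit_def)
  note cl = idem(1)[OF assms(1)] corner_closed[OF assms(2)] corner_closed[OF assms(3)] corner_closed[OF assms(6)] corner_closed[OF y(1)]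
  have "c \<otimes> (y \<otimes> v) = (e \<otimes> c) \<otimes> (y \<otimes> v)" by (simp add: corner_left[OF assms(6)])
  also have "\<dots> = u \<otimes> ((v \<otimes> c \<otimes> y) \<otimes> v)" unfolding assms(4)[symmetric] using cl by (simp add: A.m_assoc)
  also have "\<dots> = e" unfolding y(2) corner_left[OF assms(2)] by (rule assms(4))
  finally have "c \<otimes> (y \<otimes> v) = e" .
  moreover have "y \<otimes> v \<otimes> c = e" using y(3) cl by (simp add: A.m_assoc)
  moreover have "y \<otimes> v \<in> corner e e" using corner_mult cl(1) y(1) assms(2) by blast
  ultimately show ?thesis using assms(6) unfolding corner_unit_def by blast
qed

text \<open>The local ring property of \<open>e B e\<close>. Multiplication by the inverse
  \<open>v\<close> of the sum makes the sum equal to \<open>e\<close>. Then \<open>v c s\<close> is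
  a unit, or it is nilpotent and the remaining sum is a unit, to which the induction hypothesis
  applies.\<close>

lemma corner_unit_summand:
  assumes e: "primitive_idempotent B e" and "finite S" "\<And>s. s \<in> S \<Longrightarrow> c s \<in> corner e e" "corner_unit e (\<Oplus>s\<in>S. c s)"
  shows "\<exists>s\<in>S. corner_unit e (c s)"
  using assms(2-4)
proof (induction S)
  case empty
  have ei: "idempotent B e" and e0: "e \<noteq> \<zero>" using e by (auto simp: primitive_idempotent_def)
  obtain v where "v \<in> carrier B" "\<zero> \<otimes> v = e" using empty by (auto simp: corner_unit_def dest: corner_closed)
  then show ?case using e0 by simp
next
  case (insert s S)
  have ei: "idempotent B e" using e by (simp add: primitive_idempotent_def)
  note ec = idem(1)[OF ei]
  let ?R = "\<Oplus>s\<in>S. c s"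
  have cs: "c s \<in> corner e e" and R: "?R \<in> corner e e" using insert.prems corner_finsum[OF ec ec, of S c] by auto
  have sum: "(\<Oplus>s\<in>insert s S. c s) = c s \<oplus> ?R"
    using insert by (intro M.finsum_insert) (auto intro: corner_closed)
  let ?u = "c s \<oplus> ?R"
  have u: "?u \<in> corner e e" using corner_add[OF ec ec cs R] .
  obtain v where v: "v \<in> corner e e" "?u \<otimes> v = e" "v \<otimes> ?u = e"
    using insert.prems(2) unfolding sum corner_unit_def by blast
  have a: "v \<otimes> c s \<in> corner e e" and b: "v \<otimes> ?R \<in> corner e e" using corner_mult[OF ec ec v(1)] cs R by auto
  have ab: "v \<otimes> c s \<oplus> v \<otimes> ?R = e"
    using v(3) corner_closed[OF v(1)] corner_closed[OF cs] corner_closed[OF R] by (simp add: A.r_distr)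
  from fitting[OF e a] show ?case
  proof
    assume "corner_unit e (v \<otimes> c s)"
    then have "corner_unit e (c s)" by (rule corner_unit_cancel_left[OF ei v(1) u v(2,3) cs])
    then show ?thesis by blast
  next
    assume "\<exists>n::nat. (v \<otimes> c s) [^] n = \<zero> \<and> 0 < n"
    then have "corner_unit e (v \<otimes> ?R)" using nilpotent_complement[OF e a b ab] by blast
    then have "corner_unit e ?R" by (rule corner_unit_cancel_left[OF ei v(1) u v(2,3) R])
    then show ?thesis using insert by auto
  qed
qed

end

lemma image_dim_pos:
  assumes V: "vectorspace k V" and P: "P \<in> module_hom k V V" and "has_rank k V n"
    and "y \<in> P ` carrier V" "y \<noteq> \<zero>\<^bsub>V\<^esub>"
  shows "0 < image_dim k V P"
proof (rule ccontr)
  assume "\<not> 0 < image_dim k V P"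
  then have "has_rank k (image_space V P) 0" using has_rank_image_space[OF assms(1-3)] by simp
  then obtain z \<phi> where d: "dual_basis k (image_space V P) {..<0::nat} z \<phi>"
    unfolding has_rank_def coordinates_def by blast
  interpret W: vectorspace k "image_space V P" by (rule image_space_vectorspace[OF V P])
  have "y = \<zero>\<^bsub>image_space V P\<^esub>" using dual_basis_eq[OF d, of y] assms(4) by (simp add: image_space_simps)
  then show False using assms(5) by (simp add: image_space_simps)
qed

section \<open>Multiplicities and the quadratic form of the Cartan matrix\<close>

lemma sum_fibres:
  fixes h :: "'i \<Rightarrow> real"
  assumes "finite E" "finite I" "\<And>e. e \<in> E \<Longrightarrow> \<epsilon> e \<in> I"
  shows "(\<Sum>e\<in>E. h (\<epsilon> e)) = (\<Sum>i\<in>I. real (card {e \<in> E. \<epsilon> e = i}) * h i)"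
proof -
  have "(\<Sum>e\<in>E. h (\<epsilon> e)) = (\<Sum>i\<in>I. \<Sum>e | e \<in> E \<and> \<epsilon> e = i. h (\<epsilon> e))"
    using assms by (intro sum.group[symmetric]) auto
  also have "\<dots> = (\<Sum>i\<in>I. real (card {e \<in> E. \<epsilon> e = i}) * h i)"
    by (intro sum.cong) auto
  finally show ?thesis .
qed

text \<open>If \<open>x\<close> and \<open>y\<close> are the multiplicity vectors of \<open>\<epsilon>\<close> and \<open>\<kappa>\<close>, then
  \<open>(x - y)\<^sup>t C (x - y) = 2 (x\<^sup>t C x - x\<^sup>t C y)\<close>.\<close>
lemma positive_definite_multiplicities:
  assumes E: "finite E" and \<epsilon>: "\<And>e. e \<in> E \<Longrightarrow> \<epsilon> e \<in> I" and \<kappa>: "\<And>e. e \<in> E \<Longrightarrow> \<kappa> e \<in> I"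
    and sym: "symmetric_matrix I C" and pos: "positive_definite_matrix I C"
    and eq: "(\<Sum>e\<in>E. \<Sum>a\<in>E. C (\<epsilon> e) (\<epsilon> a)) = (\<Sum>e\<in>E. \<Sum>a\<in>E. C (\<kappa> e) (\<kappa> a))"
  shows "(\<Sum>e\<in>E. \<Sum>a\<in>E. C (\<epsilon> e) (\<kappa> a)) \<le> (\<Sum>e\<in>E. \<Sum>a\<in>E. C (\<epsilon> e) (\<epsilon> a))"
    and "(\<Sum>e\<in>E. \<Sum>a\<in>E. C (\<epsilon> e) (\<kappa> a)) = (\<Sum>e\<in>E. \<Sum>a\<in>E. C (\<epsilon> e) (\<epsilon> a)) \<Longrightarrow> i \<in> I \<Longrightarrow>
      card {e \<in> E. \<epsilon> e = i} = card {e \<in> E. \<kappa> e = i}"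
proof -
  have I: "finite I" using pos by (simp add: positive_definite_matrix_def)
  define q :: "('b \<Rightarrow> real) \<Rightarrow> ('b \<Rightarrow> real) \<Rightarrow> real"
    where "q x y = (\<Sum>i\<in>I. \<Sum>j\<in>I. x i * real (C i j) * y j)" for x y
  define cnt :: "('a \<Rightarrow> 'b) \<Rightarrow> 'b \<Rightarrow> real" where "cnt f i = real (card {e \<in> E. f e = i})" for f i
  \<comment> \<open>Grouping the indices by their images turns a double sum over \<open>E\<close>
    into the bilinear form of \<open>C\<close> at two multiplicity vectors.\<close>
  have form: "real (\<Sum>e\<in>E. \<Sum>a\<in>E. C (f e) (g a)) = q (cnt f) (cnt g)"
    if f: "\<And>e. e \<in> E \<Longrightarrow> f e \<in> I" and g: "\<And>e. e \<in> E \<Longrightarrow> g e \<in> I" for f g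
  proof -
    have sf: "(\<Sum>e\<in>E. h (f e)) = (\<Sum>i\<in>I. cnt f i * h i)" for h
      unfolding cnt_def by (rule sum_fibres[OF E I f])
    have sg: "(\<Sum>e\<in>E. h (g e)) = (\<Sum>i\<in>I. cnt g i * h i)" for h
      unfolding cnt_def by (rule sum_fibres[OF E I g])
    have "real (\<Sum>e\<in>E. \<Sum>a\<in>E. C (f e) (g a)) = (\<Sum>e\<in>E. \<Sum>j\<in>I. cnt g j * real (C (f e) j))"
      unfolding of_nat_sum by (intro sum.cong refl) (rule sg[of "\<lambda>j. real (C (f _) j)"])
    also have "\<dots> = (\<Sum>i\<in>I. cnt f i * (\<Sum>j\<in>I. cnt g j * real (C i j)))"
      by (rule sf)
    also have "\<dots> = q (cnt f) (cnt g)"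
      unfolding q_def by (intro sum.cong refl) (simp add: sum_distrib_left mult_ac)
    finally show ?thesis .
  qed
  have qsym: "q x y = q y x" for x y
  proof -
    have "q x y = (\<Sum>j\<in>I. \<Sum>i\<in>I. x i * real (C i j) * y j)" unfolding q_def by (rule sum.swap)
    also have "\<dots> = q y x"
      unfolding q_def using sym by (intro sum.cong refl) (simp add: symmetric_matrix_def mult_ac)
    finally show ?thesis .
  qed
  let ?x = "cnt \<epsilon>" and ?y = "cnt \<kappa>"
  have xx: "real (\<Sum>e\<in>E. \<Sum>a\<in>E. C (\<epsilon> e) (\<epsilon> a)) = q ?x ?x" by (rule form) (use \<epsilon> in auto)
  have yy: "real (\<Sum>e\<in>E. \<Sum>a\<in>E. C (\<kappa> e) (\<kappa> a)) = q ?y ?y" by (rule form) (use \<kappa> in auto)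
  have xy: "real (\<Sum>e\<in>E. \<Sum>a\<in>E. C (\<epsilon> e) (\<kappa> a)) = q ?x ?y" by (rule form) (use \<epsilon> \<kappa> in auto)
  have "q (\<lambda>i. ?x i - ?y i) (\<lambda>i. ?x i - ?y i) = q ?x ?x - q ?x ?y - q ?y ?x + q ?y ?y"
    unfolding q_def by (simp add: sum_subtractf[symmetric] sum.distrib[symmetric] algebra_simps)
  moreover have "q ?y ?y = q ?x ?x" using xx yy eq by simp
  ultimately have diff: "q (\<lambda>i. ?x i - ?y i) (\<lambda>i. ?x i - ?y i) = 2 * (q ?x ?x - q ?x ?y)"
    using qsym[of ?y ?x] by simp
  have pd: "q z z > 0" if "\<exists>i\<in>I. z i \<noteq> 0" for z
    using pos that unfolding positive_definite_matrix_def q_def by blast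
  have "q ?x ?y \<le> q ?x ?x"
  proof (cases "\<exists>i\<in>I. ?x i - ?y i \<noteq> 0")
    case True
    then show ?thesis using pd[OF True] diff by simp
  next
    case False
    then have "q ?x ?y = q ?x ?x" unfolding q_def by (intro sum.cong refl) auto
    then show ?thesis by simp
  qed
  then show "(\<Sum>e\<in>E. \<Sum>a\<in>E. C (\<epsilon> e) (\<kappa> a)) \<le> (\<Sum>e\<in>E. \<Sum>a\<in>E. C (\<epsilon> e) (\<epsilon> a))"
    unfolding of_nat_le_iff[where ?'a = real, symmetric] xx xy .
  assume "(\<Sum>e\<in>E. \<Sum>a\<in>E. C (\<epsilon> e) (\<kappa> a)) = (\<Sum>e\<in>E. \<Sum>a\<in>E. C (\<epsilon> e) (\<epsilon> a))" "i \<in> I"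
  then have "q ?x ?x = q ?x ?y" using xx xy by simp
  then have "\<not> (\<exists>i\<in>I. ?x i - ?y i \<noteq> 0)" using pd[of "\<lambda>i. ?x i - ?y i"] diff by auto
  then show "card {e \<in> E. \<epsilon> e = i} = card {e \<in> E. \<kappa> e = i}" using \<open>i \<in> I\<close> by (simp add: cnt_def)
qed

text \<open>Bijections between corresponding fibres of \<open>\<epsilon>\<close> and
  \<open>\<kappa>\<close> glue to a permutation of \<open>E\<close>. It will match every
  \<open>B e\<close> with a summand \<open>N (s e)\<close> of the same isomorphism type.\<close>

lemma fibre_bijection:
  assumes E: "finite E" and \<epsilon>: "\<And>e. e \<in> E \<Longrightarrow> \<epsilon> e \<in> I" and \<kappa>: "\<And>e. e \<in> E \<Longrightarrow> \<kappa> e \<in> I"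
    and card: "\<And>i. i \<in> I \<Longrightarrow> card {e \<in> E. \<epsilon> e = i} = card {e \<in> E. \<kappa> e = i}"
  shows "\<exists>s. bij_betw s E E \<and> (\<forall>e\<in>E. \<kappa> (s e) = \<epsilon> e)"
proof -
  have "\<exists>s. bij_betw s {e \<in> E. \<epsilon> e = i} {e \<in> E. \<kappa> e = i}" if "i \<in> I" for i
    using card[OF that] E by (intro finite_same_card_bij) auto
  then obtain s where s: "\<And>i. i \<in> I \<Longrightarrow> bij_betw (s i) {e \<in> E. \<epsilon> e = i} {e \<in> E. \<kappa> e = i}" by metis
  let ?s = "\<lambda>e. s (\<epsilon> e) e"
  have mem: "?s e \<in> E" "\<kappa> (?s e) = \<epsilon> e" if "e \<in> E" for e
    using s[OF \<epsilon>[OF that]] that by (auto simp: bij_betw_def)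
  have "inj_on ?s E"
  proof (rule inj_onI)
    fix e a assume *: "e \<in> E" "a \<in> E" "?s e = ?s a"
    then have "\<epsilon> e = \<epsilon> a" using mem by metis
    then show "e = a" using * s[OF \<epsilon>[OF *(1)]] by (auto simp: bij_betw_def inj_on_def)
  qed
  moreover have "?s ` E \<subseteq> E" using mem by auto
  ultimately have "bij_betw ?s E E" using E by (simp add: bij_betw_def endo_inj_surj)
  then show ?thesis using mem by blast
qed

section \<open>Primitive decompositions and conjugation\<close>

context fd_algebra
begin

lemma mult_hom: "i \<in> carrier B \<Longrightarrow> (\<lambda>b. i \<otimes> b) \<in> module_hom k B B"
  by (rule module_homI) (auto simp: A.r_distr smult_mult_right)

lemma peirce_hom: "\<lbrakk>i \<in> carrier B; j \<in> carrier B\<rbrakk> \<Longrightarrow> (\<lambda>b. i \<otimes> b \<otimes> j) \<in> module_hom k B B"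
  by (rule module_homI) (auto simp: A.r_distr A.l_distr smult_mult_right smult_mult_left)

lemma peirce_image:
  assumes "idempotent B i" "idempotent B j"
  shows "(\<lambda>b. i \<otimes> b \<otimes> j) ` carrier B = corner i j"
proof
  show "(\<lambda>b. i \<otimes> b \<otimes> j) ` carrier B \<subseteq> corner i j" using cornerI[OF assms] by blast
  show "corner i j \<subseteq> (\<lambda>b. i \<otimes> b \<otimes> j) ` carrier B"
  proof
    fix b assume b: "b \<in> corner i j"
    then have "b = i \<otimes> b \<otimes> j" by (simp add: corner_def)
    then show "b \<in> (\<lambda>b. i \<otimes> b \<otimes> j) ` carrier B" using corner_closed[OF b] by blast
  qed
qed

lemma cartan_matrix_eq: "cartan_matrix k B i j = image_dim k B (\<lambda>b. i \<otimes> b \<otimes> j)"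
proof -
  have "{i \<otimes> b \<otimes> j |b. b \<in> carrier B} = (\<lambda>b. i \<otimes> b \<otimes> j) ` carrier B" by auto
  then show ?thesis by (simp add: cartan_matrix_def image_dim_def image_space_def)
qed

text \<open>A set suffices, since nonzero orthogonal idempotents are distinct. Excluding zero bounds
  the size by the dimension.\<close>

definition orthogonal_decomposition :: "'b set \<Rightarrow> bool" where
  "orthogonal_decomposition E \<longleftrightarrow> finite E \<and> (\<forall>e\<in>E. idempotent B e \<and> e \<noteq> \<zero>) \<and>
     (\<forall>e\<in>E. \<forall>a\<in>E. e \<noteq> a \<longrightarrow> e \<otimes> a = \<zero>) \<and> (\<Oplus>e\<in>E. e) = \<one>"

text \<open>\<open>B\<close> is the direct sum of the right ideals \<open>e B\<close>, and each has
  positive dimension because it contains \<open>e\<close>.\<close>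

lemma decomposition_card:
  assumes "orthogonal_decomposition E" shows "card E \<le> d"
proof -
  have E: "finite E" "\<And>e. e \<in> E \<Longrightarrow> idempotent B e" "\<And>e. e \<in> E \<Longrightarrow> e \<noteq> \<zero>"
    "\<And>e a. \<lbrakk>e \<in> E; a \<in> E; e \<noteq> a\<rbrakk> \<Longrightarrow> e \<otimes> a = \<zero>" "(\<Oplus>e\<in>E. e) = \<one>"
    using assms by (auto simp: orthogonal_decomposition_def)
  have Ec: "e \<in> carrier B" if "e \<in> E" for e using idem(1)[OF E(2)[OF that]] .
  have "d = (\<Sum>e\<in>E. image_dim k B (\<lambda>b. e \<otimes> b))"
  proof (rule rank_decomposition[OF vs_B rank_B E(1)])
    show "(\<Oplus>e\<in>E. e \<otimes> b) = b" if b: "b \<in> carrier B" for b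
      using A.finsum_ldistr[OF E(1) b, of "\<lambda>e. e"] E(5) Ec b by auto
    show "e \<otimes> (e \<otimes> b) = e \<otimes> b" if "e \<in> E" "b \<in> carrier B" for e b
      using idem(2)[OF E(2)[OF that(1)]] Ec that by (simp flip: A.m_assoc)
    show "e \<otimes> (a \<otimes> b) = \<zero>" if "e \<in> E" "a \<in> E" "e \<noteq> a" "b \<in> carrier B" for e a b
      using E(4)[OF that(1-3)] Ec that by (simp flip: A.m_assoc)
  qed (use mult_hom Ec in auto)
  also have "\<dots> \<ge> (\<Sum>e\<in>E. 1)"
  proof (rule sum_mono)
    fix e assume e: "e \<in> E"
    have "e \<in> (\<lambda>b. e \<otimes> b) ` carrier B" using idem[OF E(2)[OF e]] by force
    then show "1 \<le> image_dim k B (\<lambda>b. e \<otimes> b)"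
      using image_dim_pos[OF vs_B mult_hom[OF Ec[OF e]] rank_B _ E(3)[OF e]] by simp
  qed
  finally show ?thesis by simp
qed

lemma decomposition_split:
  assumes E: "orthogonal_decomposition E" and e: "e \<in> E" and "\<not> primitive_idempotent B e"
  shows "\<exists>E'. orthogonal_decomposition E' \<and> card E' = Suc (card E)"
proof -
  have D: "finite E" "\<And>e. e \<in> E \<Longrightarrow> idempotent B e" "\<And>e. e \<in> E \<Longrightarrow> e \<noteq> \<zero>"
    "\<And>e a. \<lbrakk>e \<in> E; a \<in> E; e \<noteq> a\<rbrakk> \<Longrightarrow> e \<otimes> a = \<zero>" "(\<Oplus>e\<in>E. e) = \<one>"
    using E by (auto simp: orthogonal_decomposition_def)
  have Ec: "e \<in> carrier B" if "e \<in> E" for e using idem(1)[OF D(2)[OF that]] .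
  obtain f g where fg: "idempotent B f" "idempotent B g" "f \<noteq> \<zero>" "g \<noteq> \<zero>" "f \<otimes> g = \<zero>" "g \<otimes> f = \<zero>" "e = f \<oplus> g"
    using assms(3) D(2,3)[OF e] unfolding primitive_idempotent_def by blast
  note fc = idem(1)[OF fg(1)] and gc = idem(1)[OF fg(2)] and ff = idem(2)[OF fg(1)] and gg = idem(2)[OF fg(2)]
  have ef: "e \<otimes> f = f" "f \<otimes> e = f" "e \<otimes> g = g" "g \<otimes> e = g"
    unfolding fg(7) using fg fc gc ff gg by (simp_all add: A.l_distr A.r_distr)
  have orth: "a \<otimes> f = \<zero>" "f \<otimes> a = \<zero>" "a \<otimes> g = \<zero>" "g \<otimes> a = \<zero>" if a: "a \<in> E - {e}" for a
  proof -
    have z: "a \<otimes> e = \<zero>" "e \<otimes> a = \<zero>" and ac: "a \<in> carrier B" using D(4) e a Ec by auto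
    have "a \<otimes> f = (a \<otimes> e) \<otimes> f" "f \<otimes> a = f \<otimes> (e \<otimes> a)" "a \<otimes> g = (a \<otimes> e) \<otimes> g" "g \<otimes> a = g \<otimes> (e \<otimes> a)"
      using ef ac fc gc Ec[OF e] by (simp_all add: A.m_assoc) (simp_all flip: A.m_assoc)
    then show "a \<otimes> f = \<zero>" "f \<otimes> a = \<zero>" "a \<otimes> g = \<zero>" "g \<otimes> a = \<zero>" using z fc gc by simp_all
  qed
  \<comment> \<open>An idempotent orthogonal to every element of a set can belong to it only if it
    is zero. So nothing collapses, and the refined set has exactly one element more.\<close>
  have notin: "f \<notin> E - {e}" "g \<notin> E - {e}" "f \<noteq> g"
    using orth(1)[of f] orth(3)[of g] fg ff gg by auto
  let ?E = "insert f (insert g (E - {e}))"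
  have Rc: "(\<Oplus>a\<in>E - {e}. a) \<in> carrier B" using Ec by (intro M.finsum_closed) auto
  have "(\<Oplus>a\<in>insert g (E - {e}). a) = g \<oplus> (\<Oplus>a\<in>E - {e}. a)"
    by (rule M.finsum_insert) (use notin D(1) gc Ec in auto)
  moreover have "(\<Oplus>a\<in>?E. a) = f \<oplus> (\<Oplus>a\<in>insert g (E - {e}). a)"
    by (rule M.finsum_insert) (use notin D(1) fc gc Ec in auto)
  ultimately have "(\<Oplus>a\<in>?E. a) = f \<oplus> (g \<oplus> (\<Oplus>a\<in>E - {e}. a))" by simp
  also have "\<dots> = f \<oplus> g \<oplus> (\<Oplus>a\<in>E - {e}. a)" by (rule M.a_assoc[OF fc gc Rc, symmetric])
  also have "\<dots> = e \<oplus> (\<Oplus>a\<in>E - {e}. a)" by (simp only: fg(7)[symmetric])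
  also have "\<dots> = (\<Oplus>a\<in>insert e (E - {e}). a)"
    using D(1) Ec e by (intro M.finsum_insert[symmetric]) auto
  also have "\<dots> = \<one>" using D(5) e by (simp add: insert_absorb)
  finally have "orthogonal_decomposition ?E"
    unfolding orthogonal_decomposition_def using D fg(1-6) orth by auto
  moreover have "card ?E = Suc (card E)"
    using notin D(1) e card_Suc_Diff1[OF D(1) e] by simp
  ultimately show ?thesis by blast
qed

text \<open>A decomposition of maximal size admits no refinement, so its members are primitive. That
  there is any decomposition is seen from the identity alone, or from the empty set if
  \<open>B\<close> is zero.\<close>

lemma primitive_decomposition:
  "\<exists>E. orthogonal_decomposition E \<and> (\<forall>e\<in>E. primitive_idempotent B e)"
proof -
  have "\<exists>E. orthogonal_decomposition E"
  proof (cases "\<one> = \<zero>")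
    case True
    then have "orthogonal_decomposition {}" by (simp add: orthogonal_decomposition_def)
    then show ?thesis by blast
  next
    case False
    then have "orthogonal_decomposition {\<one>}" by (simp add: orthogonal_decomposition_def idempotent_def)
    then show ?thesis by blast
  qed
  then obtain E where E: "orthogonal_decomposition E"
    and max: "\<And>E'. orthogonal_decomposition E' \<Longrightarrow> card E' \<le> card E"
    using ex_has_greatest_nat[of orthogonal_decomposition _ card "Suc d"] decomposition_card by (metis less_Suc_eq_le)
  have "primitive_idempotent B e" if "e \<in> E" for e
    using decomposition_split[OF E that] max by fastforce
  then show ?thesis using E by blast
qed

text \<open>Sending \<open>b\<close> to \<open>inv u \<otimes> b \<otimes> v\<close> carries
  \<open>i' B j'\<close> onto \<open>i B j\<close>. Both sides are conjugated independently, so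
  Cartan numbers may be computed with any conjugates of the representatives.\<close>

lemma conjugate_image_dim:
  assumes "idempotent B i" "idempotent B j" "u \<in> Units B" "v \<in> Units B"
    and "i' = u \<otimes> i \<otimes> inv u" "j' = v \<otimes> j \<otimes> inv v"
  shows "idempotent B i'" and "image_dim k B (\<lambda>b. i' \<otimes> b \<otimes> j') = image_dim k B (\<lambda>b. i \<otimes> b \<otimes> j)"
proof -
  have conj_idem: "idempotent B (u \<otimes> i \<otimes> inv u)" if "u \<in> Units B" "idempotent B i" for u i
  proof -
    have c: "u \<in> carrier B" "inv u \<in> carrier B" "i \<in> carrier B" using that idem(1) by auto
    have "(u \<otimes> i \<otimes> inv u) \<otimes> (u \<otimes> i \<otimes> inv u) = u \<otimes> i \<otimes> (inv u \<otimes> u) \<otimes> i \<otimes> inv u"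
      using c by (simp add: A.m_assoc)
    also have "\<dots> = u \<otimes> (i \<otimes> i) \<otimes> inv u" using c that by (simp add: A.m_assoc)
    finally show ?thesis using c idem(2)[OF that(2)] by (simp add: idempotent_def)
  qed
  show i': "idempotent B i'" unfolding assms(5) by (rule conj_idem) (use assms in auto)
  have j': "idempotent B j'" unfolding assms(6) by (rule conj_idem) (use assms in auto)
  have c: "u \<in> carrier B" "inv u \<in> carrier B" "v \<in> carrier B" "inv v \<in> carrier B" "i \<in> carrier B" "j \<in> carrier B"
    "i' \<in> carrier B" "j' \<in> carrier B"
    using assms idem(1) i' j' by auto
  have inv: "inv u \<otimes> u = \<one>" "u \<otimes> inv u = \<one>" "inv v \<otimes> v = \<one>" "v \<otimes> inv v = \<one>" using assms(3,4) by auto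
  have ui: "inv u \<otimes> i' = i \<otimes> inv u"
  proof -
    have "inv u \<otimes> i' = (inv u \<otimes> u) \<otimes> i \<otimes> inv u" unfolding assms(5) using c by (simp add: A.m_assoc)
    then show ?thesis using inv c by simp
  qed
  have jv: "j' \<otimes> v = v \<otimes> j"
  proof -
    have "j' \<otimes> v = v \<otimes> j \<otimes> (inv v \<otimes> v)" unfolding assms(6) using c by (simp add: A.m_assoc)
    then show ?thesis using inv c by simp
  qed
  have iu: "i' \<otimes> u = u \<otimes> i"
  proof -
    have "i' \<otimes> u = u \<otimes> i \<otimes> (inv u \<otimes> u)" unfolding assms(5) using c by (simp add: A.m_assoc)
    then show ?thesis using inv c by simp
  qed
  have vj: "inv v \<otimes> j' = j \<otimes> inv v"
  proof -
    have "inv v \<otimes> j' = (inv v \<otimes> v) \<otimes> j \<otimes> inv v" unfolding assms(6) using c by (simp add: A.m_assoc)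
    then show ?thesis using inv c by simp
  qed
  show "image_dim k B (\<lambda>b. i' \<otimes> b \<otimes> j') = image_dim k B (\<lambda>b. i \<otimes> b \<otimes> j)"
  proof (rule image_dim_cong[OF vs_B peirce_hom vs_B peirce_hom rank_B, of _ _ _ _ "\<lambda>b. inv u \<otimes> b \<otimes> v" "\<lambda>b. u \<otimes> b \<otimes> inv v"],
      unfold peirce_image[OF i' j'] peirce_image[OF assms(1,2)])
    fix b assume b: "b \<in> corner i' j'"
    note bc = corner_closed[OF b]
    have "i \<otimes> (inv u \<otimes> b \<otimes> v) = (i \<otimes> inv u) \<otimes> b \<otimes> v" using c bc by (simp add: A.m_assoc)
    also have "\<dots> = inv u \<otimes> (i' \<otimes> b) \<otimes> v" unfolding ui[symmetric] using c bc by (simp add: A.m_assoc)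
    finally have 1: "i \<otimes> (inv u \<otimes> b \<otimes> v) = inv u \<otimes> b \<otimes> v" using corner_left[OF b] by simp
    have "(inv u \<otimes> b \<otimes> v) \<otimes> j = inv u \<otimes> b \<otimes> (v \<otimes> j)" using c bc by (simp add: A.m_assoc)
    also have "\<dots> = inv u \<otimes> (b \<otimes> j') \<otimes> v" unfolding jv[symmetric] using c bc by (simp add: A.m_assoc)
    finally have 2: "(inv u \<otimes> b \<otimes> v) \<otimes> j = inv u \<otimes> b \<otimes> v" using corner_right[OF b] by simp
    show "inv u \<otimes> b \<otimes> v \<in> corner i j" using 1 2 c bc by (simp add: corner_def)
    have "u \<otimes> (inv u \<otimes> b \<otimes> v) \<otimes> inv v = (u \<otimes> inv u) \<otimes> b \<otimes> (v \<otimes> inv v)" using c bc by (simp add: A.m_assoc)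
    then show "u \<otimes> (inv u \<otimes> b \<otimes> v) \<otimes> inv v = b" using inv bc by simp
  next
    fix b assume b: "b \<in> corner i j"
    note bc = corner_closed[OF b]
    have "i' \<otimes> (u \<otimes> b \<otimes> inv v) = (i' \<otimes> u) \<otimes> b \<otimes> inv v" using c bc by (simp add: A.m_assoc)
    also have "\<dots> = u \<otimes> (i \<otimes> b) \<otimes> inv v" unfolding iu using c bc by (simp add: A.m_assoc)
    finally have 1: "i' \<otimes> (u \<otimes> b \<otimes> inv v) = u \<otimes> b \<otimes> inv v" using corner_left[OF b] by simp
    have "(u \<otimes> b \<otimes> inv v) \<otimes> j' = u \<otimes> b \<otimes> (inv v \<otimes> j')" using c bc by (simp add: A.m_assoc)
    also have "\<dots> = u \<otimes> (b \<otimes> j) \<otimes> inv v" unfolding vj using c bc by (simp add: A.m_assoc)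
    finally have 2: "(u \<otimes> b \<otimes> inv v) \<otimes> j' = u \<otimes> b \<otimes> inv v" using corner_right[OF b] by simp
    show "u \<otimes> b \<otimes> inv v \<in> corner i' j'" using 1 2 c bc by (simp add: corner_def)
    have "inv u \<otimes> (u \<otimes> b \<otimes> inv v) \<otimes> v = (inv u \<otimes> u) \<otimes> b \<otimes> (inv v \<otimes> v)" using c bc by (simp add: A.m_assoc)
    then show "inv u \<otimes> (u \<otimes> b \<otimes> inv v) \<otimes> v = b" using inv bc by simp
  qed (use c in \<open>auto dest!: corner_closed simp: A.r_distr A.l_distr smult_mult_right smult_mult_left\<close>)
qed

end

section \<open>The bound over a field\<close>

text \<open>The actions of a \<open>morita_bimodule\<close> are merely biadditive. The last four
  assumptions make them bilinear over \<open>k\<close>, so that Peirce components of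
  \<open>N\<close> are subspaces with dimensions.\<close>

locale fd_morita = fd_algebra k B d + Q: morita_bimodule B N l r S\<^sub>0 x\<^sub>0 f\<^sub>0 T\<^sub>0 w\<^sub>0 n\<^sub>0
  for k :: "'k ring" and B :: "('k, 'b) module" (structure) and d
    and N :: "('k, 'v) module" and l r S\<^sub>0 x\<^sub>0 f\<^sub>0 T\<^sub>0 w\<^sub>0 n\<^sub>0 +
  fixes m :: nat
  assumes vs_N: "vectorspace k N" and rank_N: "has_rank k N m"
    and l_smult: "\<lbrakk>c \<in> carrier k; b \<in> carrier B; y \<in> carrier N\<rbrakk> \<Longrightarrow> l (c \<odot> b) y = c \<odot>\<^bsub>N\<^esub> l b y"
    and l_smult_right: "\<lbrakk>c \<in> carrier k; b \<in> carrier B; y \<in> carrier N\<rbrakk> \<Longrightarrow> l b (c \<odot>\<^bsub>N\<^esub> y) = c \<odot>\<^bsub>N\<^esub> l b y"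
    and r_smult: "\<lbrakk>c \<in> carrier k; b \<in> carrier B; y \<in> carrier N\<rbrakk> \<Longrightarrow> r y (c \<odot> b) = c \<odot>\<^bsub>N\<^esub> r y b"
    and r_smult_left: "\<lbrakk>c \<in> carrier k; b \<in> carrier B; y \<in> carrier N\<rbrakk> \<Longrightarrow> r (c \<odot>\<^bsub>N\<^esub> y) b = c \<odot>\<^bsub>N\<^esub> r y b"
begin

lemmas l_closed = Q.l_closed and l_add_left = Q.l_add_left and l_add_right = Q.l_add_right
  and l_assoc = Q.l_assoc and l_one = Q.l_one and r_closed = Q.r_closed
  and r_add_right = Q.r_add_right and r_add_left = Q.r_add_left and r_assoc = Q.r_assoc
  and r_one = Q.r_one and lr = Q.lr and l_finsum = Q.l_finsum
  and l_finsum_left = Q.l_finsum_left and r_finsum = Q.r_finsum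
  and r_finsum_right = Q.r_finsum_right and l_zero = Q.l_zero and l_zero_left = Q.l_zero_left
  and r_zero_right = Q.r_zero_right and S = Q.S and x = Q.x and f_additive = Q.f_additive
  and f_linear = Q.f_linear and f_dual = Q.f_dual and f_closed = Q.f_closed
  and faithful = Q.faithful and endo = Q.endo

sublocale N: vectorspace k N by (rule vs_N)

lemma N_group: "abelian_group N"
  by (rule Q.M.abelian_group_axioms)

lemma B_group: "abelian_group B"
  by (rule M.abelian_group_axioms)

text \<open>The pair \<open>u\<close>, \<open>g\<close> is an isomorphism between the left modules \<open>N a\<close> and \<open>B e\<close>.\<close>
definition matched :: "'b \<Rightarrow> 'b \<Rightarrow> 'v \<Rightarrow> ('v \<Rightarrow> 'b) \<Rightarrow> bool" where
  "matched a e u g \<longleftrightarrow> idempotent B a \<and> idempotent B e \<and> u \<in> carrier N \<and> l e u = u \<and> r u a = u \<and>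
     additive_map N B g \<and> (\<forall>b\<in>carrier B. \<forall>y\<in>carrier N. g (l b y) = b \<otimes> g y) \<and>
     (\<forall>y\<in>carrier N. g (r y a) = g y \<and> g y \<otimes> e = g y \<and> l (g y) u = r y a) \<and> g u = e"

lemma matchedD:
  assumes "matched a e u g"
  shows "idempotent B a" "idempotent B e" "u \<in> carrier N" "l e u = u" "r u a = u" "additive_map N B g"
    "\<lbrakk>b \<in> carrier B; y \<in> carrier N\<rbrakk> \<Longrightarrow> g (l b y) = b \<otimes> g y"
    "y \<in> carrier N \<Longrightarrow> g (r y a) = g y" "y \<in> carrier N \<Longrightarrow> g y \<otimes> e = g y"
    "y \<in> carrier N \<Longrightarrow> l (g y) u = r y a" "g u = e" "y \<in> carrier N \<Longrightarrow> g y \<in> carrier B"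
    "a \<in> carrier B" "e \<in> carrier B"
  using assms by (auto simp: matched_def idempotent_def intro: additive_map_closed)

text \<open>A scalar acts on \<open>N\<close> like the element \<open>c \<odot> \<one>\<close> of
  \<open>B\<close>, so linearity over \<open>B\<close> includes linearity over
  \<open>k\<close>.\<close>

lemma matched_smult:
  assumes "matched a e u g" "c \<in> carrier k" "y \<in> carrier N"
  shows "g (c \<odot>\<^bsub>N\<^esub> y) = c \<odot> g y"
proof -
  note D = matchedD[OF assms(1)]
  have "c \<odot>\<^bsub>N\<^esub> y = l (c \<odot> \<one>) y" using assms by (simp add: l_smult l_one)
  then have "g (c \<odot>\<^bsub>N\<^esub> y) = (c \<odot> \<one>) \<otimes> g y" using D(7)[of "c \<odot> \<one>" y] assms by simp
  then show ?thesis using assms D(12) by (simp add: smult_mult_left)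
qed

text \<open>A left homomorphism from \<open>N a\<close> to \<open>N a'\<close> is an endomorphism of
  \<open>N\<close> that absorbs \<open>a\<close> at its source and \<open>a'\<close> at its target.
  The element inducing it can be cut down to \<open>a \<otimes> c \<otimes> a'\<close>, which
  identifies these homomorphisms with the corner \<open>a B a'\<close>.\<close>

lemma endo_corner:
  assumes a: "idempotent B a" "idempotent B a'" and \<phi>: "additive_map N N \<phi>"
    and lin: "\<And>b y. \<lbrakk>b \<in> carrier B; y \<in> carrier N\<rbrakk> \<Longrightarrow> \<phi> (l b y) = l b (\<phi> y)"
    and left: "\<And>y. y \<in> carrier N \<Longrightarrow> \<phi> (r y a) = \<phi> y" and right: "\<And>y. y \<in> carrier N \<Longrightarrow> r (\<phi> y) a' = \<phi> y"
  shows "\<exists>c\<in>corner a a'. \<forall>y\<in>carrier N. \<phi> y = r y c"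
proof -
  obtain c where c: "c \<in> carrier B" "\<And>y. y \<in> carrier N \<Longrightarrow> \<phi> y = r y c" using endo[OF \<phi> lin] by blast
  note ac = idem(1)[OF a(1)] idem(1)[OF a(2)]
  have "\<phi> y = r y (a \<otimes> c \<otimes> a')" if y: "y \<in> carrier N" for y
  proof -
    have "r y (a \<otimes> c \<otimes> a') = r (r (r y a) c) a'" using y c ac by (simp add: r_assoc r_closed)
    also have "\<dots> = r (\<phi> (r y a)) a'" using c(2)[of "r y a"] y ac r_closed by simp
    finally show ?thesis using left right y by simp
  qed
  then show ?thesis using cornerI[OF a c(1)] by blast
qed

text \<open>Expanding by the dual basis of \<open>N\<close> and by the decomposition
  \<open>E\<close> of one writes the identity of \<open>N a\<close> as a sum of endomorphisms that
  factor through the \<open>B e\<close>. They are right multiplications by elements of the local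
  ring \<open>a B a\<close>, so one of them is invertible. This makes \<open>N a\<close> a direct
  summand of \<open>B e\<close>, and primitivity of \<open>e\<close> makes it all of
  \<open>B e\<close>.\<close>

lemma matched_exists:
  assumes a: "primitive_idempotent B a"
    and E: "orthogonal_decomposition E" "\<And>e. e \<in> E \<Longrightarrow> primitive_idempotent B e"
  shows "\<exists>e\<in>E. \<exists>u g. matched a e u g"
proof -
  have ai: "idempotent B a" and a0: "a \<noteq> \<zero>" using a by (auto simp: primitive_idempotent_def)
  note ac = idem(1)[OF ai] and aa = idem(2)[OF ai]
  have ei: "idempotent B e" and ec: "e \<in> carrier B" and ee: "e \<otimes> e = e" if "e \<in> E" for e
    using E(2)[OF that] idem by (auto simp: primitive_idempotent_def)
  have finE: "finite E" and sumE: "(\<Oplus>e\<in>E. e) = \<one>" using E(1) by (auto simp: orthogonal_decomposition_def)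
  \<comment> \<open>For \<open>p = (s, e)\<close> this is the map from \<open>N a\<close> to
    \<open>B e\<close> given by \<open>f\<^sub>0 s\<close> and right multiplication by
    \<open>e\<close>, followed by the map back to \<open>N a\<close> that sends \<open>e\<close> to
    \<open>e x\<^sub>0 s a\<close>.\<close>
  define \<phi> where "\<phi> p y = r (l (f\<^sub>0 (fst p) (r y a) \<otimes> snd p) (x\<^sub>0 (fst p))) a" for p y
  have raa: "r (r y a) a = r y a" if "y \<in> carrier N" for y using r_assoc[OF that ac ac] aa by simp
  have "\<exists>c\<in>corner a a. \<forall>y\<in>carrier N. \<phi> p y = r y c" if p: "p \<in> S\<^sub>0 \<times> E" for p
  proof -
    have s: "fst p \<in> S\<^sub>0" and e: "snd p \<in> E" using p by auto
    have fc: "f\<^sub>0 (fst p) (r y a) \<in> carrier B" if "y \<in> carrier N" for y using f_closed s r_closed ac that by blast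
    show ?thesis
    proof (rule endo_corner[OF ai ai])
      show "additive_map N N (\<phi> p)"
      proof (rule additive_mapI)
        show "\<phi> p (y \<oplus>\<^bsub>N\<^esub> y') = \<phi> p y \<oplus>\<^bsub>N\<^esub> \<phi> p y'" if y: "y \<in> carrier N" "y' \<in> carrier N" for y y'
          unfolding \<phi>_def using y s e fc ec ac x additive_map_add[OF f_additive[OF s]]
          by (simp add: r_add_left r_closed A.l_distr l_add_left l_closed)
      qed (use s e fc ec ac x in \<open>auto simp: \<phi>_def r_closed l_closed\<close>)
      show "\<phi> p (l b y) = l b (\<phi> p y)" if b: "b \<in> carrier B" "y \<in> carrier N" for b y
      proof -
        have "f\<^sub>0 (fst p) (r (l b y) a) = b \<otimes> f\<^sub>0 (fst p) (r y a)"
          using lr[OF b(1,2) ac] f_linear[OF s b(1) r_closed[OF b(2) ac]] by simp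
        then show ?thesis
          unfolding \<phi>_def using b s e fc[OF b(2)] ec[OF e] ac x[OF s] by (simp add: A.m_assoc l_assoc lr l_closed)
      qed
      show "\<phi> p (r y a) = \<phi> p y" if "y \<in> carrier N" for y unfolding \<phi>_def raa[OF that] ..
      show "r (\<phi> p y) a = \<phi> p y" if "y \<in> carrier N" for y
        unfolding \<phi>_def using raa[OF l_closed[OF _ x[OF s]]] fc[OF that] ec[OF e] by simp
    qed
  qed
  then obtain C where C: "\<And>p. p \<in> S\<^sub>0 \<times> E \<Longrightarrow> C p \<in> corner a a"
    and C\<phi>: "\<And>p y. \<lbrakk>p \<in> S\<^sub>0 \<times> E; y \<in> carrier N\<rbrakk> \<Longrightarrow> \<phi> p y = r y (C p)" by metis
  have fin: "finite (S\<^sub>0 \<times> E)" using S finE by simp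
  have Cc: "C p \<in> carrier B" if "p \<in> S\<^sub>0 \<times> E" for p using corner_closed[OF C[OF that]] .
  \<comment> \<open>By faithfulness it is enough to compare right multiplications: the sum over
    \<open>E\<close> removes the factor \<open>e\<close>, and the sum over \<open>S\<^sub>0\<close>
    is the dual basis expansion.\<close>
  have "(\<Oplus>p\<in>S\<^sub>0 \<times> E. C p) = a"
  proof (rule faithful)
    show "(\<Oplus>p\<in>S\<^sub>0 \<times> E. C p) \<in> carrier B" using Cc by (intro M.finsum_closed) auto
    show "r y (\<Oplus>p\<in>S\<^sub>0 \<times> E. C p) = r y a" if y: "y \<in> carrier N" for y
    proof -
      have fc: "f\<^sub>0 s (r y a) \<in> carrier B" if "s \<in> S\<^sub>0" for s using f_closed that r_closed ac y by blast
      have tc: "l (f\<^sub>0 s (r y a) \<otimes> e) (x\<^sub>0 s) \<in> carrier N" if "s \<in> S\<^sub>0" "e \<in> E" for s e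
        using fc ec x that l_closed by simp
      have "r y (\<Oplus>p\<in>S\<^sub>0 \<times> E. C p) = (\<Oplus>\<^bsub>N\<^esub>p\<in>S\<^sub>0 \<times> E. r y (C p))"
        by (rule r_finsum_right[OF y]) (use Cc in auto)
      also have "\<dots> = (\<Oplus>\<^bsub>N\<^esub>p\<in>S\<^sub>0 \<times> E. r (l (f\<^sub>0 (fst p) (r y a) \<otimes> snd p) (x\<^sub>0 (fst p))) a)"
        by (rule Q.M.finsum_cong') (use C\<phi> Cc y tc ac r_closed in \<open>auto simp: \<phi>_def\<close>)
      also have "\<dots> = r (\<Oplus>\<^bsub>N\<^esub>p\<in>S\<^sub>0 \<times> E. l (f\<^sub>0 (fst p) (r y a) \<otimes> snd p) (x\<^sub>0 (fst p))) a"
        by (rule r_finsum[OF ac, symmetric]) (use tc in auto)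
      also have "(\<Oplus>\<^bsub>N\<^esub>p\<in>S\<^sub>0 \<times> E. l (f\<^sub>0 (fst p) (r y a) \<otimes> snd p) (x\<^sub>0 (fst p)))
          = (\<Oplus>\<^bsub>N\<^esub>s\<in>S\<^sub>0. \<Oplus>\<^bsub>N\<^esub>e\<in>E. l (f\<^sub>0 s (r y a) \<otimes> e) (x\<^sub>0 s))"
        by (rule abelian_group.finsum_Sigma[OF N_group, symmetric]) (use S finE tc in auto)
      also have "\<dots> = (\<Oplus>\<^bsub>N\<^esub>s\<in>S\<^sub>0. l (f\<^sub>0 s (r y a)) (x\<^sub>0 s))"
      proof (rule Q.M.finsum_cong')
        fix s assume s: "s \<in> S\<^sub>0"
        have "(\<Oplus>\<^bsub>N\<^esub>e\<in>E. l (f\<^sub>0 s (r y a) \<otimes> e) (x\<^sub>0 s)) = l (\<Oplus>e\<in>E. f\<^sub>0 s (r y a) \<otimes> e) (x\<^sub>0 s)"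
          by (rule l_finsum_left[OF x[OF s], symmetric]) (use fc[OF s] ec in auto)
        also have "(\<Oplus>e\<in>E. f\<^sub>0 s (r y a) \<otimes> e) = f\<^sub>0 s (r y a) \<otimes> (\<Oplus>e\<in>E. e)"
          by (rule A.finsum_rdistr[symmetric]) (use finE fc[OF s] ec in auto)
        finally show "(\<Oplus>\<^bsub>N\<^esub>e\<in>E. l (f\<^sub>0 s (r y a) \<otimes> e) (x\<^sub>0 s)) = l (f\<^sub>0 s (r y a)) (x\<^sub>0 s)"
          using sumE fc[OF s] by simp
      qed (use fc x l_closed in auto)
      also have "\<dots> = r y a" by (rule f_dual[OF r_closed[OF y ac]])
      finally show ?thesis using raa[OF y] by simp
    qed
  qed (rule ac)
  then have "corner_unit a (\<Oplus>p\<in>S\<^sub>0 \<times> E. C p)"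
    unfolding corner_unit_def using corner_self[OF ai] aa by auto
  then obtain p where p: "p \<in> S\<^sub>0 \<times> E" and unit: "corner_unit a (C p)"
    using corner_unit_summand[OF a fin, of C] C by blast
  obtain v where v: "v \<in> corner a a" "C p \<otimes> v = a" "v \<otimes> C p = a" using unit by (auto simp: corner_unit_def)
  define s e where "s = fst p" and "e = snd p"
  have s: "s \<in> S\<^sub>0" and e: "e \<in> E" using p by (auto simp: s_def e_def)
  note vc = corner_closed[OF v(1)] and eC = ec[OF e] and xs = x[OF s]
  have fc: "f\<^sub>0 s (r y a) \<in> carrier B" if "y \<in> carrier N" for y using f_closed s r_closed ac that by blast
  \<comment> \<open>\<open>?g\<close> is the first half of \<open>\<phi> p\<close>.
    \<open>?u\<close> is the image of \<open>e\<close> under the second half, corrected by the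
    inverse \<open>v\<close> of \<open>C p\<close> so that the way to \<open>B e\<close> and back is
    the identity of \<open>N a\<close>.\<close>
  let ?u = "r (l e (x\<^sub>0 s)) v" and ?g = "\<lambda>y. f\<^sub>0 s (r y a) \<otimes> e"
  have uc: "?u \<in> carrier N" using xs eC vc l_closed r_closed by simp
  have leu: "l e ?u = ?u"
    using lr[OF eC l_closed[OF eC xs] vc] l_assoc[OF eC eC xs] ee[OF e] by simp
  have rua: "r ?u a = ?u"
    using r_assoc[OF l_closed[OF eC xs] vc ac] corner_right[OF v(1)] by simp
  have glin: "?g (l b y) = b \<otimes> ?g y" if b: "b \<in> carrier B" "y \<in> carrier N" for b y
    using lr[OF b(1,2) ac] f_linear[OF s b(1) r_closed[OF b(2) ac]] fc[OF b(2)] b eC by (simp add: A.m_assoc)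
  have gadd: "additive_map N B ?g"
    by (rule additive_mapI)
      (use fc eC ac additive_map_add[OF f_additive[OF s]] in \<open>auto simp: r_add_left r_closed A.l_distr\<close>)
  have gu: "l (?g y) ?u = r y a" if y: "y \<in> carrier N" for y
  proof -
    have gc: "?g y \<in> carrier B" using fc[OF y] eC by simp
    have "l (?g y) ?u = r (l (?g y) (l e (x\<^sub>0 s))) v" using lr[OF gc l_closed[OF eC xs] vc] by simp
    also have "l (?g y) (l e (x\<^sub>0 s)) = l (?g y) (x\<^sub>0 s)"
      using l_assoc[OF gc eC xs] fc[OF y] eC ee[OF e] by (simp add: A.m_assoc)
    also have "r (l (?g y) (x\<^sub>0 s)) v = r (r (l (?g y) (x\<^sub>0 s)) a) v"
      using r_assoc[OF l_closed[OF gc xs] ac vc] corner_left[OF v(1)] by simp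
    also have "r (l (?g y) (x\<^sub>0 s)) a = r y (C p)" using C\<phi>[OF p y] by (simp add: \<phi>_def s_def e_def)
    also have "r (r y (C p)) v = r y a" using r_assoc[OF y Cc[OF p] vc] v(2) by simp
    finally show ?thesis .
  qed
  have gra: "?g (r y a) = ?g y" if "y \<in> carrier N" for y using raa[OF that] by simp
  have gc: "?g y \<in> carrier B" if "y \<in> carrier N" for y using fc[OF that] eC by simp
  have gye: "?g y \<otimes> e = ?g y" if "y \<in> carrier N" for y using fc[OF that] eC ee[OF e] by (simp add: A.m_assoc)
  \<comment> \<open>The composite in the other order is given by the idempotent \<open>?g ?u\<close>
    of \<open>e B e\<close>. If it were zero, \<open>?u\<close> and with it all of
    \<open>N a\<close> would vanish, against faithfulness; so primitivity of \<open>e\<close>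
    decides.\<close>
  have "?g ?u = e"
  proof (rule primitive_corner[OF E(2)[OF e]])
    have "e \<otimes> ?g ?u = ?g ?u" using glin[OF eC uc] leu by simp
    then show "?g ?u \<in> corner e e" unfolding corner_def using gc[OF uc] gye[OF uc] by simp
    have "?g ?u \<otimes> ?g ?u = ?g (l (?g ?u) ?u)" using glin[OF gc[OF uc] uc] by simp
    also have "\<dots> = ?g ?u" by (rule arg_cong[OF trans[OF gu[OF uc] rua], of ?g])
    finally show "idempotent B (?g ?u)" using gc[OF uc] by (simp add: idempotent_def)
    show "?g ?u \<noteq> \<zero>"
    proof
      assume "?g ?u = \<zero>"
      then have u0: "?u = \<zero>\<^bsub>N\<^esub>" using gu[OF uc] rua l_zero_left[OF uc] by simp
      have "a = \<zero>"
      proof (rule faithful[OF ac M.zero_closed])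
        fix y assume y: "y \<in> carrier N"
        have "r y a = l (?g y) \<zero>\<^bsub>N\<^esub>" using gu[OF y] unfolding u0 by simp
        then show "r y a = r y \<zero>" using l_zero[OF gc[OF y]] r_zero_right[OF y] by simp
      qed
      then show False using a0 by simp
    qed
  qed
  then have "matched a e ?u ?g"
    unfolding matched_def using ai ei[OF e] uc leu rua gadd glin gra gye gu by blast
  then show ?thesis using e by blast
qed

text \<open>Right multiplication by \<open>inv v\<close> is an isomorphism from \<open>B e\<close>
  onto the left ideal of the conjugate idempotent.\<close>

lemma matched_conjugate:
  assumes mt: "matched a e u g" and v: "v \<in> Units B"
  shows "matched a (v \<otimes> e \<otimes> inv v) (l v u) (\<lambda>y. g y \<otimes> inv v)"
proof -
  note D = matchedD[OF mt]
  have vc: "v \<in> carrier B" and ic: "inv v \<in> carrier B" and vv: "inv v \<otimes> v = \<one>" "v \<otimes> inv v = \<one>" using v by auto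
  have vi: "idempotent B (v \<otimes> e \<otimes> inv v)" by (rule conjugate_image_dim(1)[OF D(2) D(2) v v]) auto
  have "l (v \<otimes> e \<otimes> inv v) (l v u) = l (v \<otimes> e \<otimes> (inv v \<otimes> v)) u"
    using vc ic D(3,14) by (simp add: A.m_assoc flip: l_assoc)
  also have "\<dots> = l v u" using vc ic vv D(3,4,14) by (simp add: l_assoc)
  finally have 1: "l (v \<otimes> e \<otimes> inv v) (l v u) = l v u" .
  have 2: "g y \<otimes> inv v \<otimes> (v \<otimes> e \<otimes> inv v) = g y \<otimes> inv v" if y: "y \<in> carrier N" for y
  proof -
    have "g y \<otimes> inv v \<otimes> (v \<otimes> e \<otimes> inv v) = g y \<otimes> (inv v \<otimes> v) \<otimes> e \<otimes> inv v"
      using vc ic D(12)[OF y] D(14) by (simp add: A.m_assoc)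
    then show ?thesis using vv D(9)[OF y] D(12)[OF y] by simp
  qed
  have 3: "l (g y \<otimes> inv v) (l v u) = r y a" if y: "y \<in> carrier N" for y
  proof -
    have "l (g y \<otimes> inv v) (l v u) = l (g y \<otimes> (inv v \<otimes> v)) u"
      using vc ic D(3) D(12)[OF y] by (simp add: A.m_assoc flip: l_assoc)
    then show ?thesis using vv D(10)[OF y] D(12)[OF y] by simp
  qed
  have 4: "additive_map N B (\<lambda>y. g y \<otimes> inv v)"
    by (rule additive_mapI) (use ic D(12) additive_map_add[OF D(6)] in \<open>auto simp: A.l_distr\<close>)
  show ?thesis
    unfolding matched_def using D vi vc ic 1 2 3 4 by (auto simp: l_closed lr A.m_assoc)
qed

section \<open>Peirce components of the bimodule\<close>

lemma peirce_N_hom: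
  "\<lbrakk>i \<in> carrier B; j \<in> carrier B\<rbrakk> \<Longrightarrow> (\<lambda>y. l i (r y j)) \<in> module_hom k N N"
  by (rule module_homI) (auto simp: l_closed r_closed r_add_left l_add_right r_smult_left l_smult_right)

lemma peirce_N_image:
  assumes "idempotent B i" "idempotent B j"
  shows "(\<lambda>y. l i (r y j)) ` carrier N = {y \<in> carrier N. l i y = y \<and> r y j = y}"
proof -
  note c = idem[OF assms(1)] idem[OF assms(2)]
  have "l i (l i (r y j)) = l i (r y j)" "r (l i (r y j)) j = l i (r y j)" if "y \<in> carrier N" for y
    using l_assoc[of i i "r y j"] r_assoc[of y j j] lr[of i "r y j" j] c that r_closed by simp_all
  then show ?thesis using c l_closed r_closed by (auto simp: image_iff) metis
qed

text \<open>The left isomorphism from \<open>N a\<close> to \<open>B i\<close> restricts to one from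
  \<open>e N a\<close> to \<open>e B i\<close>.\<close>

lemma matched_image_dim_N:
  assumes mt: "matched a i u g" and e: "idempotent B e"
  shows "image_dim k N (\<lambda>y. l e (r y a)) = image_dim k B (\<lambda>b. e \<otimes> b \<otimes> i)"
proof (rule image_dim_cong[OF vs_N peirce_N_hom vs_B peirce_hom rank_N, of _ _ _ _ g "\<lambda>c. l c u"],
    unfold peirce_N_image[OF e matchedD(1)[OF mt]] peirce_image[OF e matchedD(2)[OF mt]])
  note D = matchedD[OF mt] and ec = idem(1)[OF e]
  fix y assume "y \<in> {y \<in> carrier N. l e y = y \<and> r y a = y}"
  then have y: "y \<in> carrier N" "l e y = y" "r y a = y" by auto
  show "g y \<in> corner e i" unfolding corner_def using D(7)[OF ec y(1)] D(9,12) y by simp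
  show "l (g y) u = y" using D(10) y by simp
next
  note D = matchedD[OF mt] and ec = idem(1)[OF e]
  fix c assume c: "c \<in> corner e i"
  note cc = corner_closed[OF c]
  show "l c u \<in> {y \<in> carrier N. l e y = y \<and> r y a = y}"
    using l_assoc[OF ec cc D(3)] corner_left[OF c] lr[OF cc D(3) D(13)] D(5) l_closed[OF cc D(3)] by simp
  show "g (l c u) = c" using D(7)[OF cc D(3)] D(11) corner_right[OF c] by simp
qed (use idem(1)[OF e] matchedD[OF mt] matched_smult[OF mt] additive_map_add in auto)

text \<open>Both sides are spaces of homomorphisms: \<open>a B a'\<close> from \<open>N a\<close> to
  \<open>N a'\<close> by \<open>endo_corner\<close>, and \<open>i B i'\<close> from
  \<open>B i\<close> to \<open>B i'\<close>. The isomorphisms at source and target identify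
  them.\<close>

lemma matched_image_dim_B:
  assumes mt: "matched a i u g" and mt': "matched a' i' u' g'"
  shows "image_dim k B (\<lambda>b. a \<otimes> b \<otimes> a') = image_dim k B (\<lambda>b. i \<otimes> b \<otimes> i')"
proof -
  note D = matchedD[OF mt] and D' = matchedD[OF mt']
  have ex: "\<exists>b\<in>corner a a'. \<forall>y\<in>carrier N. l (g y \<otimes> c) u' = r y b" if c: "c \<in> corner i i'" for c
  proof (rule endo_corner[OF D(1) D'(1)])
    note cc = corner_closed[OF c]
    show "additive_map N N (\<lambda>y. l (g y \<otimes> c) u')"
      by (rule additive_mapI) (use cc D D' additive_map_add[OF D(6)] in \<open>auto simp: l_closed A.l_distr l_add_left\<close>)
    show "l (g (l b y) \<otimes> c) u' = l b (l (g y \<otimes> c) u')" if b: "b \<in> carrier B" and y: "y \<in> carrier N" for b y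
      using D(7)[OF b y] D(12)[OF y] D'(3) b cc by (simp add: A.m_assoc l_assoc)
    show "r (l (g y \<otimes> c) u') a' = l (g y \<otimes> c) u'" if y: "y \<in> carrier N" for y
      using lr[OF _ D'(3) D'(13), of "g y \<otimes> c"] D'(5) D(12)[OF y] cc by simp
  qed (use D(8) in simp)
  \<comment> \<open>\<open>c\<close> is read as a homomorphism from \<open>B i\<close> to
    \<open>B i'\<close>. Transported to a map from \<open>N a\<close> to \<open>N a'\<close> it is
    right multiplication by an element of \<open>a B a'\<close>, unique by faithfulness.\<close>
  define G where "G c = (SOME b. b \<in> corner a a' \<and> (\<forall>y\<in>carrier N. l (g y \<otimes> c) u' = r y b))" for c
  have G: "G c \<in> corner a a'" "\<And>y. y \<in> carrier N \<Longrightarrow> l (g y \<otimes> c) u' = r y (G c)" if "c \<in> corner i i'" for c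
    using someI_ex[of "\<lambda>b. b \<in> corner a a' \<and> (\<forall>y\<in>carrier N. l (g y \<otimes> c) u' = r y b)"] ex[OF that]
    unfolding G_def by blast+
  have h: "g' (r u b) \<in> corner i i'" if b: "b \<in> corner a a'" for b
  proof -
    note bc = corner_closed[OF b]
    have "i \<otimes> g' (r u b) = g' (r (l i u) b)" using D'(7)[OF D(14) r_closed[OF D(3) bc]] lr[OF D(14) D(3) bc] by simp
    then show ?thesis unfolding corner_def using D(4) D'(9,12)[OF r_closed[OF D(3) bc]] by simp
  qed
  show ?thesis
  proof (rule image_dim_cong[OF vs_B peirce_hom vs_B peirce_hom rank_B, of _ _ _ _ "\<lambda>b. g' (r u b)" G],
      unfold peirce_image[OF D(1) D'(1)] peirce_image[OF D(2) D'(2)])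
    show "G (g' (r u b)) = b" if b: "b \<in> corner a a'" for b
    proof (rule faithful)
      note bc = corner_closed[OF b] and hb = h[OF b]
      show "G (g' (r u b)) \<in> carrier B" using corner_closed[OF G(1)[OF hb]] .
      show "b \<in> carrier B" by (rule bc)
      fix y assume y: "y \<in> carrier N"
      have "r y (G (g' (r u b))) = l (g y \<otimes> g' (r u b)) u'" using G(2)[OF hb y] by simp
      also have "\<dots> = l (g y) (l (g' (r u b)) u')"
        using l_assoc[OF D(12)[OF y] corner_closed[OF hb] D'(3)] .
      also have "l (g' (r u b)) u' = r (r u b) a'" by (rule D'(10)[OF r_closed[OF D(3) bc]])
      also have "r (r u b) a' = r u b" using r_assoc[OF D(3) bc D'(13)] corner_right[OF b] by simp
      also have "l (g y) (r u b) = r (l (g y) u) b" using lr[OF D(12)[OF y] D(3) bc] by simp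
      also have "l (g y) u = r y a" by (rule D(10)[OF y])
      also have "r (r y a) b = r y b" using r_assoc[OF y D(13) bc] corner_left[OF b] by simp
      finally show "r y (G (g' (r u b))) = r y b" .
    qed
    show "g' (r u (G c)) = c" if c: "c \<in> corner i i'" for c
    proof -
      note cc = corner_closed[OF c]
      have "r u (G c) = l (i \<otimes> c) u'" using G(2)[OF c D(3)] D(11) by simp
      also have "i \<otimes> c = c" by (rule corner_left[OF c])
      finally have "g' (r u (G c)) = c \<otimes> g' u'" using D'(7)[OF cc D'(3)] by simp
      then show ?thesis using D'(11) corner_right[OF c] by simp
    qed
  qed (use D D' G h in \<open>auto dest!: corner_closed simp: r_add_right r_smult r_closed additive_map_add[OF D'(6)] matched_smult[OF mt']\<close>)
qed

text \<open>The equality case yields a free generator instead of an abstract isomorphism, because a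
  single element is what can be lifted to \<open>M\<close>.\<close>

lemma rank_bound:
  assumes reps: "primitive_idempotent_representatives B I"
    and sym: "symmetric_matrix I (cartan_matrix k B)" and pos: "positive_definite_matrix I (cartan_matrix k B)"
  shows "m \<le> d" and "m = d \<Longrightarrow> \<exists>x\<in>carrier N. bij_betw (\<lambda>b. l b x) (carrier B) (carrier N)"
proof -
  obtain E where E: "orthogonal_decomposition E" and prim: "\<And>e. e \<in> E \<Longrightarrow> primitive_idempotent B e"
    using primitive_decomposition by blast
  have finE: "finite E" and sumE: "(\<Oplus>e\<in>E. e) = \<one>"
    and orth: "\<And>e a. \<lbrakk>e \<in> E; a \<in> E; e \<noteq> a\<rbrakk> \<Longrightarrow> e \<otimes> a = \<zero>"
    using E by (auto simp: orthogonal_decomposition_def)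
  have ei: "idempotent B e" if "e \<in> E" for e using prim[OF that] by (simp add: primitive_idempotent_def)
  note ec = idem(1)[OF ei] and ee = idem(2)[OF ei]
  have Ii: "idempotent B i" if "i \<in> I" for i
    using reps that by (simp add: primitive_idempotent_representatives_def primitive_idempotent_def)
  have "\<exists>i v. i \<in> I \<and> v \<in> Units B \<and> e = v \<otimes> i \<otimes> inv v" if "e \<in> E" for e
    using reps prim[OF that] unfolding primitive_idempotent_representatives_def conjugate_def by blast
  then obtain \<epsilon> v where \<epsilon>: "\<And>e. e \<in> E \<Longrightarrow> \<epsilon> e \<in> I" and v: "\<And>e. e \<in> E \<Longrightarrow> v e \<in> Units B"
    and ev: "\<And>e. e \<in> E \<Longrightarrow> e = v e \<otimes> \<epsilon> e \<otimes> inv (v e)" by metis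
  \<comment> \<open>\<open>matched_exists\<close> returns a member \<open>e\<close> of the
    decomposition; conjugation by \<open>inv (v e)\<close> moves it to the representative of its
    class.\<close>
  have "\<exists>i u g. i \<in> I \<and> matched a i u g" if a: "a \<in> E" for a
  proof -
    obtain e u g where e: "e \<in> E" and mt: "matched a e u g" using matched_exists[OF prim[OF a] E prim] by blast
    note c = idem(1)[OF Ii[OF \<epsilon>[OF e]]]
    have vc: "v e \<in> carrier B" "inv (v e) \<in> carrier B" "inv (v e) \<otimes> v e = \<one>" using v[OF e] by auto
    have "inv (v e) \<otimes> (v e \<otimes> \<epsilon> e \<otimes> inv (v e)) \<otimes> v e = (inv (v e) \<otimes> v e) \<otimes> \<epsilon> e \<otimes> (inv (v e) \<otimes> v e)"
      using vc(1,2) c by (simp add: A.m_assoc)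
    then have "inv (v e) \<otimes> e \<otimes> inv (inv (v e)) = \<epsilon> e" using ev[OF e] vc c v[OF e] by simp
    then show ?thesis using matched_conjugate[OF mt, of "inv (v e)"] v[OF e] \<epsilon>[OF e] by auto
  qed
  then obtain \<kappa> U G where \<kappa>: "\<And>a. a \<in> E \<Longrightarrow> \<kappa> a \<in> I" and mt: "\<And>a. a \<in> E \<Longrightarrow> matched a (\<kappa> a) (U a) (G a)" by metis
  let ?C = "cartan_matrix k B"
  have CE: "image_dim k B (\<lambda>b. e \<otimes> b \<otimes> a) = ?C (\<epsilon> e) (\<epsilon> a)" if "e \<in> E" "a \<in> E" for e a
    unfolding cartan_matrix_eq
    by (rule conjugate_image_dim(2)[OF Ii[OF \<epsilon>[OF that(1)]] Ii[OF \<epsilon>[OF that(2)]] v[OF that(1)] v[OF that(2)] ev[OF that(1)] ev[OF that(2)]])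
  have CM: "image_dim k N (\<lambda>y. l e (r y a)) = ?C (\<epsilon> e) (\<kappa> a)" if e: "e \<in> E" and a: "a \<in> E" for e a
  proof -
    have \<kappa>i: "idempotent B (\<kappa> a)" using Ii[OF \<kappa>[OF a]] .
    \<comment> \<open>Only the left idempotent has to be replaced by its representative; the right
      one already is one and is conjugated by the identity.\<close>
    have "image_dim k B (\<lambda>b. e \<otimes> b \<otimes> \<kappa> a) = image_dim k B (\<lambda>b. \<epsilon> e \<otimes> b \<otimes> \<kappa> a)"
      by (rule conjugate_image_dim(2)[OF Ii[OF \<epsilon>[OF e]] \<kappa>i v[OF e] A.Units_one_closed ev[OF e]]) (use idem(1)[OF \<kappa>i] in simp)
    then show ?thesis using matched_image_dim_N[OF mt[OF a] ei[OF e]] by (simp add: cartan_matrix_eq)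
  qed
  have C\<kappa>: "?C (\<epsilon> e) (\<epsilon> a) = ?C (\<kappa> e) (\<kappa> a)" if "e \<in> E" "a \<in> E" for e a
    using CE[OF that] matched_image_dim_B[OF mt[OF that(1)] mt[OF that(2)]] by (simp add: cartan_matrix_eq)
  have dB: "d = (\<Sum>e\<in>E. \<Sum>a\<in>E. ?C (\<epsilon> e) (\<epsilon> a))"
  proof -
    have "d = (\<Sum>p\<in>E \<times> E. image_dim k B (\<lambda>b. fst p \<otimes> b \<otimes> snd p))"
    proof (rule rank_decomposition[OF vs_B rank_B])
      show "(\<Oplus>p\<in>E \<times> E. fst p \<otimes> b \<otimes> snd p) = b" if b: "b \<in> carrier B" for b
      proof -
        have "(\<Oplus>p\<in>E \<times> E. fst p \<otimes> b \<otimes> snd p) = (\<Oplus>e\<in>E. \<Oplus>a\<in>E. e \<otimes> b \<otimes> a)"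
          by (rule M.finsum_Sigma[symmetric]) (use finE ec b in auto)
        also have "\<dots> = (\<Oplus>e\<in>E. e \<otimes> b)"
        proof (rule M.finsum_cong')
          show "(\<Oplus>a\<in>E. e \<otimes> b \<otimes> a) = e \<otimes> b" if e: "e \<in> E" for e
            using A.finsum_rdistr[OF finE, of "e \<otimes> b" "\<lambda>a. a"] sumE ec e b by auto
        qed (use ec b in auto)
        also have "\<dots> = b" using A.finsum_ldistr[OF finE b, of "\<lambda>e. e"] sumE ec b by auto
        finally show ?thesis .
      qed
      show "fst p \<otimes> (fst p \<otimes> b \<otimes> snd p) \<otimes> snd p = fst p \<otimes> b \<otimes> snd p" if "p \<in> E \<times> E" "b \<in> carrier B" for p b
      proof -
        have c: "fst p \<in> carrier B" "snd p \<in> carrier B" using that ec by auto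
        have "fst p \<otimes> (fst p \<otimes> b \<otimes> snd p) \<otimes> snd p = (fst p \<otimes> fst p) \<otimes> b \<otimes> (snd p \<otimes> snd p)"
          using c that by (simp add: A.m_assoc)
        then show ?thesis using ee that by auto
      qed
      show "fst p \<otimes> (fst q \<otimes> b \<otimes> snd q) \<otimes> snd p = \<zero>" if "p \<in> E \<times> E" "q \<in> E \<times> E" "p \<noteq> q" "b \<in> carrier B" for p q b
      proof -
        have c: "fst p \<in> carrier B" "snd p \<in> carrier B" "fst q \<in> carrier B" "snd q \<in> carrier B" using that ec by auto
        have "fst p \<otimes> (fst q \<otimes> b \<otimes> snd q) \<otimes> snd p = (fst p \<otimes> fst q) \<otimes> b \<otimes> (snd q \<otimes> snd p)"
          using c that by (simp add: A.m_assoc)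
        moreover have "fst p \<otimes> fst q = \<zero> \<or> snd q \<otimes> snd p = \<zero>" using that orth by (auto simp: prod_eq_iff)
        ultimately show ?thesis using c that by auto
      qed
    qed (use finE peirce_hom ec in auto)
    also have "\<dots> = (\<Sum>e\<in>E. \<Sum>a\<in>E. image_dim k B (\<lambda>b. e \<otimes> b \<otimes> a))"
      by (simp add: sum.cartesian_product case_prod_beta)
    also have "\<dots> = (\<Sum>e\<in>E. \<Sum>a\<in>E. ?C (\<epsilon> e) (\<epsilon> a))" using CE by (intro sum.cong refl) auto
    finally show ?thesis .
  qed
  have mN: "m = (\<Sum>e\<in>E. \<Sum>a\<in>E. ?C (\<epsilon> e) (\<kappa> a))"
  proof -
    have "m = (\<Sum>p\<in>E \<times> E. image_dim k N (\<lambda>y. l (fst p) (r y (snd p))))"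
    proof (rule rank_decomposition[OF vs_N rank_N])
      show "(\<Oplus>\<^bsub>N\<^esub>p\<in>E \<times> E. l (fst p) (r y (snd p))) = y" if y: "y \<in> carrier N" for y
      proof -
        have "(\<Oplus>\<^bsub>N\<^esub>p\<in>E \<times> E. l (fst p) (r y (snd p))) = (\<Oplus>\<^bsub>N\<^esub>e\<in>E. \<Oplus>\<^bsub>N\<^esub>a\<in>E. l e (r y a))"
          by (rule abelian_group.finsum_Sigma[OF N_group, symmetric]) (use finE ec y l_closed r_closed in auto)
        also have "\<dots> = (\<Oplus>\<^bsub>N\<^esub>e\<in>E. l e y)"
        proof (rule Q.M.finsum_cong')
          show "(\<Oplus>\<^bsub>N\<^esub>a\<in>E. l e (r y a)) = l e y" if e: "e \<in> E" for e
          proof -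
            have "(\<Oplus>\<^bsub>N\<^esub>a\<in>E. l e (r y a)) = l e (\<Oplus>\<^bsub>N\<^esub>a\<in>E. r y a)"
              by (rule l_finsum[OF ec[OF e], symmetric]) (use ec y r_closed in auto)
            also have "(\<Oplus>\<^bsub>N\<^esub>a\<in>E. r y a) = r y (\<Oplus>a\<in>E. a)"
              by (rule r_finsum_right[OF y, symmetric]) (use ec in auto)
            finally show ?thesis using sumE r_one[OF y] by simp
          qed
        qed (use ec y l_closed in auto)
        also have "\<dots> = l (\<Oplus>e\<in>E. e) y" by (rule l_finsum_left[OF y, symmetric]) (use ec in auto)
        finally show ?thesis using sumE l_one[OF y] by simp
      qed
      \<comment> \<open>Successive Peirce projections multiply the idempotents on either side, so
        these projections inherit idempotence and orthogonality from \<open>E\<close>.\<close>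
      have push: "l e (r (l e' (r y a')) a) = l (e \<otimes> e') (r y (a' \<otimes> a))"
        if "e \<in> E" "e' \<in> E" "a \<in> E" "a' \<in> E" "y \<in> carrier N" for e e' a a' y
        using that ec lr[of e' "r y a'" a] l_closed r_closed by (simp add: l_assoc r_assoc)
      show "l (fst p) (r (l (fst p) (r y (snd p))) (snd p)) = l (fst p) (r y (snd p))" if "p \<in> E \<times> E" "y \<in> carrier N" for p y
        using push[of "fst p" "fst p" "snd p" "snd p" y] ee that by auto
      show "l (fst p) (r (l (fst q) (r y (snd q))) (snd p)) = \<zero>\<^bsub>N\<^esub>" if "p \<in> E \<times> E" "q \<in> E \<times> E" "p \<noteq> q" "y \<in> carrier N" for p q y
      proof -
        have c: "fst p \<in> E" "snd p \<in> E" "fst q \<in> E" "snd q \<in> E" using that by auto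
        have "fst p \<otimes> fst q = \<zero> \<or> snd q \<otimes> snd p = \<zero>" using that orth by (auto simp: prod_eq_iff)
        moreover have "r y (snd q \<otimes> snd p) \<in> carrier N" "fst p \<otimes> fst q \<in> carrier B" using c ec that r_closed by auto
        ultimately show ?thesis
          using push[OF c(1,3,2,4) that(4)] l_zero_left l_zero r_zero_right[OF that(4)] by auto
      qed
    qed (use finE peirce_N_hom ec in auto)
    also have "\<dots> = (\<Sum>e\<in>E. \<Sum>a\<in>E. image_dim k N (\<lambda>y. l e (r y a)))"
      by (simp add: sum.cartesian_product case_prod_beta)
    also have "\<dots> = (\<Sum>e\<in>E. \<Sum>a\<in>E. ?C (\<epsilon> e) (\<kappa> a))" using CM by (intro sum.cong refl) auto
    finally show ?thesis .
  qed
  have eq: "(\<Sum>e\<in>E. \<Sum>a\<in>E. ?C (\<epsilon> e) (\<epsilon> a)) = (\<Sum>e\<in>E. \<Sum>a\<in>E. ?C (\<kappa> e) (\<kappa> a))"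
    using C\<kappa> by (intro sum.cong refl) auto
  note pdm = positive_definite_multiplicities[of E \<epsilon> I \<kappa>, OF finE \<epsilon> \<kappa> sym pos eq]
  show "m \<le> d" using pdm(1) dB mN by simp
  assume "m = d"
  then have "card {e \<in> E. \<epsilon> e = i} = card {e \<in> E. \<kappa> e = i}" if "i \<in> I" for i using pdm(2) dB mN that by simp
  then obtain s where s: "bij_betw s E E" and s\<epsilon>: "\<And>e. e \<in> E \<Longrightarrow> \<kappa> (s e) = \<epsilon> e"
    using fibre_bijection[of E \<epsilon> I \<kappa>] finE \<epsilon> \<kappa> by blast
  have sE: "s e \<in> E" if "e \<in> E" for e using s that by (auto simp: bij_betw_def)
  have sinj: "s e \<noteq> s e'" if "e \<in> E" "e' \<in> E" "e \<noteq> e'" for e e' using s that by (auto simp: bij_betw_def inj_on_def)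
  \<comment> \<open>Since \<open>\<kappa> (s e) = \<epsilon> e\<close>, conjugating the isomorphism
    for \<open>s e\<close> by \<open>v e\<close> ends in \<open>B e\<close> itself. Thus
    \<open>N (s e)\<close> is isomorphic to \<open>B e\<close>, and \<open>W e\<close> corresponds
    to \<open>e\<close>.\<close>
  define W H where "W e = l (v e) (U (s e))" and "H e = (\<lambda>y. G (s e) y \<otimes> inv (v e))" for e
  have mW: "matched (s e) e (W e) (H e)" if e: "e \<in> E" for e
    using matched_conjugate[OF mt[OF sE[OF e]] v[OF e]] unfolding W_def H_def s\<epsilon>[OF e] ev[OF e, symmetric] .
  note D = matchedD[OF mW]
  \<comment> \<open>The generator one of \<open>B\<close> is the sum of the \<open>e\<close>, so its
    counterpart in \<open>N\<close> is the sum of the \<open>W e\<close>.\<close>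
  define x where "x = (\<Oplus>\<^bsub>N\<^esub>e\<in>E. W e)"
  have xc: "x \<in> carrier N" unfolding x_def using D(3) by (intro Q.M.finsum_closed) auto
  have Hx: "H e x = e" if e: "e \<in> E" for e
  proof -
    have "H e x = (\<Oplus>e'\<in>E. H e (W e'))"
      unfolding x_def by (rule additive_map_finsum[OF N_group B_group D(6)[OF e]]) (use D(3) in auto)
    also have "\<dots> = H e (W e)"
    proof (rule M.finsum_single[OF finE e])
      show "H e (W e') = \<zero>" if e': "e' \<in> E" "e' \<noteq> e" for e'
      proof -
        \<comment> \<open>\<open>W e'\<close> lies in \<open>N (s e')\<close>, while
          \<open>H e\<close> sees only the component in \<open>N (s e)\<close>. As \<open>s\<close>
          is injective, these components are orthogonal.\<close>
        have "H e (W e') = H e (r (r (W e') (s e')) (s e))"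
          using D(8)[OF e D(3)[OF e'(1)]] D(5)[OF e'(1)] by simp
        also have "r (r (W e') (s e')) (s e) = r (W e') (s e' \<otimes> s e)"
          using r_assoc[OF D(3)[OF e'(1)] ec[OF sE[OF e'(1)]] ec[OF sE[OF e]]] by simp
        also have "s e' \<otimes> s e = \<zero>" using orth sE sinj e e' by blast
        also have "r (W e') \<zero> = \<zero>\<^bsub>N\<^esub>" by (rule r_zero_right[OF D(3)[OF e'(1)]])
        also have "H e \<zero>\<^bsub>N\<^esub> = \<zero>" by (rule additive_map_zero[OF N_group B_group D(6)[OF e]])
        finally show ?thesis .
      qed
    qed (use D(12)[OF e D(3)[OF e]] in auto)
    finally show ?thesis using D(11)[OF e] by simp
  qed
  have "bij_betw (\<lambda>b. l b x) (carrier B) (carrier N)"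
  proof (rule bij_betw_byWitness[of _ "\<lambda>y. \<Oplus>e\<in>E. H e y"])
    show "\<forall>b\<in>carrier B. (\<Oplus>e\<in>E. H e (l b x)) = b"
    proof
      fix b assume b: "b \<in> carrier B"
      have "(\<Oplus>e\<in>E. H e (l b x)) = (\<Oplus>e\<in>E. b \<otimes> e)"
        by (rule M.finsum_cong') (use D(7)[OF _ b xc] Hx b ec in auto)
      also have "\<dots> = b" using A.finsum_rdistr[OF finE b, of "\<lambda>e. e"] sumE ec b by auto
      finally show "(\<Oplus>e\<in>E. H e (l b x)) = b" .
    qed
    show "\<forall>y\<in>carrier N. l (\<Oplus>e\<in>E. H e y) x = y"
    proof
      fix y assume y: "y \<in> carrier N"
      have Hc: "H e y \<in> carrier B" if "e \<in> E" for e using D(12)[OF that y] .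
      have "l (\<Oplus>e\<in>E. H e y) x = (\<Oplus>\<^bsub>N\<^esub>e\<in>E. l (H e y) x)"
        by (rule l_finsum_left[OF xc]) (use Hc in auto)
      also have "\<dots> = (\<Oplus>\<^bsub>N\<^esub>e\<in>E. r y (s e))"
      proof (rule Q.M.finsum_cong')
        fix e assume e: "e \<in> E"
        have "l (H e y) x = (\<Oplus>\<^bsub>N\<^esub>e'\<in>E. l (H e y) (W e'))"
          unfolding x_def by (rule l_finsum[OF Hc[OF e]]) (use D(3) in auto)
        also have "\<dots> = l (H e y) (W e)"
        proof (rule abelian_group.finsum_single[OF N_group finE e])
          show "l (H e y) (W e') = \<zero>\<^bsub>N\<^esub>" if e': "e' \<in> E" "e' \<noteq> e" for e'
          proof -
            have "l (H e y) (W e') = l (H e y \<otimes> e) (l e' (W e'))" using D(4)[OF e'(1)] D(9)[OF e y] by simp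
            also have "\<dots> = l (H e y \<otimes> e \<otimes> e') (W e')"
              using l_assoc[of "H e y \<otimes> e" e' "W e'"] Hc[OF e] ec[OF e] ec[OF e'(1)] D(3)[OF e'(1)] by simp
            also have "H e y \<otimes> e \<otimes> e' = \<zero>"
              using Hc[OF e] ec[OF e] ec[OF e'(1)] orth[OF e e'(1)] e'(2) by (simp add: A.m_assoc)
            finally show ?thesis using l_zero_left[OF D(3)[OF e'(1)]] by simp
          qed
        qed (use l_closed[OF Hc[OF e] D(3)[OF e]] in auto)
        also have "\<dots> = r y (s e)" by (rule D(10)[OF e y])
        finally show "l (H e y) x = r y (s e)" .
      qed (use y ec sE r_closed in auto)
      \<comment> \<open>Because \<open>s\<close> is a permutation of \<open>E\<close>, every Peirce
        component of \<open>y\<close> occurs exactly once.\<close>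
      also have "\<dots> = (\<Oplus>\<^bsub>N\<^esub>a\<in>E. r y a)"
        by (rule abelian_group.finsum_reindex_bij[OF N_group s]) (use y ec r_closed in auto)
      also have "\<dots> = r y (\<Oplus>a\<in>E. a)" by (rule r_finsum_right[OF y, symmetric]) (use ec in auto)
      finally show "l (\<Oplus>e\<in>E. H e y) x = y" using sumE r_one[OF y] by simp
    qed
  qed (use l_closed xc D(12) in \<open>auto intro!: M.finsum_closed\<close>)
  then show "\<exists>x\<in>carrier N. bij_betw (\<lambda>b. l b x) (carrier B) (carrier N)" using xc by blast
qed

end

section \<open>Reduction and lifting\<close>

lemma coordinates_cong:
  assumes "module R V" "coordinates R V J z \<phi>" "\<And>j. j \<in> J \<Longrightarrow> z' j = z j"
  shows "coordinates R V J z' \<phi>"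
proof -
  interpret module R V by fact
  have d: "dual_basis R V J z \<phi>" using assms(2) by (simp add: coordinates_def)
  have "(\<Oplus>\<^bsub>V\<^esub>j\<in>J. \<phi> j x \<odot>\<^bsub>V\<^esub> z' j) = (\<Oplus>\<^bsub>V\<^esub>j\<in>J. \<phi> j x \<odot>\<^bsub>V\<^esub> z j)" if "x \<in> carrier V" for x
    by (rule M.finsum_cong') (use dual_basis_closed[OF d] assms(3) that in auto)
  then show ?thesis using assms(2,3) unfolding coordinates_def dual_basis_def by auto
qed

text \<open>For a valuation ring, a nonunit outside the kernel of \<pi> would have an irreducible
  divisor. In a principal domain this generates a maximal ideal, which by uniqueness is the kernel
  of \<pi>; then the element itself would be killed.\<close>

lemma coefficient_ring_local_base:
  assumes "coefficient_ring p k R \<pi>"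
  shows "local_base R k \<pi>"
proof -
  have fk: "field k" using assms by (auto simp: coefficient_ring_def perfect_field_of_char_def)
  interpret k: field k by (rule fk)
  show ?thesis
  proof (cases "field R \<and> \<pi> \<in> ring_iso R k")
    case True
    interpret R: field R using True by blast
    have h: "\<pi> \<in> ring_hom R k" and s: "\<pi> ` carrier R = carrier k"
      using True by (auto simp: ring_iso_def bij_betw_def)
    have "r \<in> Units R" if "r \<in> carrier R" "\<pi> r \<noteq> \<zero>\<^bsub>k\<^esub>" for r
    proof -
      have "r \<noteq> \<zero>\<^bsub>R\<^esub>" using that(2) ring_hom_zero[OF h R.ring_axioms k.ring_axioms] by auto
      then show ?thesis using that(1) R.field_Units by blast
    qed
    then show ?thesis using h s by unfold_locales auto
  next
    case False
    then have dvr: "discrete_valuation_ring R" and h: "\<pi> \<in> ring_hom R k" and s: "\<pi> ` carrier R = carrier k"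
      using assms by (auto simp: coefficient_ring_def complete_discrete_valuation_ring_def)
    interpret R: principal_domain R using dvr by (simp add: discrete_valuation_ring_def)
    interpret h: ring_hom_cring R k \<pi>
      by (intro ring_hom_cring.intro ring_hom_cring_axioms.intro R.is_cring k.is_cring h)
    let ?K = "a_kernel R k \<pi>"
    have K: "r \<in> ?K \<longleftrightarrow> r \<in> carrier R \<and> \<pi> r = \<zero>\<^bsub>k\<^esub>" for r unfolding a_kernel_def' by blast
    \<comment> \<open>An ideal \<open>J\<close> that contains the kernel and some \<open>x\<close>
      outside it also contains a multiple \<open>t \<otimes> x\<close> with image one. The
      difference of one and this multiple lies in the kernel, so \<open>J\<close> contains
      one.\<close>
    have "maximalideal ?K R"
    proof (rule maximalidealI)
      show "ideal ?K R" by (rule ring_hom_ring.kernel_is_ideal[OF ring_hom_ringI2[OF R.ring_axioms k.ring_axioms h]])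
      show "carrier R \<noteq> ?K" using K[of "\<one>\<^bsub>R\<^esub>"] k.one_not_zero by auto
      fix J assume J: "ideal J R" "?K \<subseteq> J" "J \<subseteq> carrier R"
      interpret J: ideal J R by fact
      show "J = ?K \<or> J = carrier R"
      proof (rule disjCI)
        assume "J \<noteq> carrier R"
        have "x \<in> ?K" if x: "x \<in> J" for x
        proof (rule ccontr)
          assume "x \<notin> ?K"
          then have x0: "\<pi> x \<in> carrier k" "\<pi> x \<noteq> \<zero>\<^bsub>k\<^esub>" and xc: "x \<in> carrier R" using K x J(3) by auto
          then have "inv\<^bsub>k\<^esub> \<pi> x \<in> carrier k" "inv\<^bsub>k\<^esub> \<pi> x \<otimes>\<^bsub>k\<^esub> \<pi> x = \<one>\<^bsub>k\<^esub>" using k.field_Units by auto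
          then obtain t where t: "t \<in> carrier R" "\<pi> t \<otimes>\<^bsub>k\<^esub> \<pi> x = \<one>\<^bsub>k\<^esub>" using s by (metis imageE)
          have tx: "t \<otimes>\<^bsub>R\<^esub> x \<in> J" using J.I_l_closed[OF x t(1)] .
          have "\<one>\<^bsub>R\<^esub> \<ominus>\<^bsub>R\<^esub> t \<otimes>\<^bsub>R\<^esub> x \<in> ?K" using t xc K by (simp add: a_minus_def k.r_neg)
          then have "(\<one>\<^bsub>R\<^esub> \<ominus>\<^bsub>R\<^esub> t \<otimes>\<^bsub>R\<^esub> x) \<oplus>\<^bsub>R\<^esub> t \<otimes>\<^bsub>R\<^esub> x \<in> J" using J(2) tx J.a_closed by blast
          then have "\<one>\<^bsub>R\<^esub> \<in> J" using t xc by (simp add: a_minus_def R.a_assoc R.l_neg)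
          then show False using J.one_imp_carrier \<open>J \<noteq> carrier R\<close> by blast
        qed
        then show "J = ?K" using J(2) by blast
      qed
    qed
    have "r \<in> Units R" if r: "r \<in> carrier R" "\<pi> r \<noteq> \<zero>\<^bsub>k\<^esub>" for r
    proof (rule ccontr)
      assume nu: "r \<notin> Units R"
      have r0: "r \<noteq> \<zero>\<^bsub>R\<^esub>" using r by auto
      obtain b where b: "b \<in> carrier R" "ring_irreducible\<^bsub>R\<^esub> b" "b divides\<^bsub>R\<^esub> r"
        using R.exists_irreducible_divisor[of r] r r0 nu by blast
      have "PIdl\<^bsub>R\<^esub> b = ?K"
        using R.irreducible_imp_maximalideal[OF b(1,2)] \<open>maximalideal ?K R\<close> dvr
        unfolding discrete_valuation_ring_def by blast
      moreover have "b \<in> PIdl\<^bsub>R\<^esub> b" by (rule R.cgenideal_self[OF b(1)])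
      ultimately have "\<pi> b = \<zero>\<^bsub>k\<^esub>" using K by blast
      then show False using b(1,3) r by (auto simp: factor_def)
    qed
    then show ?thesis using h s by unfold_locales auto
  qed
qed

section \<open>Reduction of the bimodule\<close>

lemma finsum_restrict_scalars: "finsum (restrict_scalars A M) g S = finsum M g S"
  by (simp add: finsum_def restrict_scalars_def finprod_def)

lemma restrict_scalars_simps:
  "carrier (restrict_scalars A M) = carrier M" "add (restrict_scalars A M) = add M"
  "zero (restrict_scalars A M) = zero M" "r \<odot>\<^bsub>restrict_scalars A M\<^esub> x = (r \<odot>\<^bsub>A\<^esub> \<one>\<^bsub>A\<^esub>) \<odot>\<^bsub>M\<^esub> x"
  by (simp_all add: restrict_scalars_def)

text \<open>\<open>X\<close> is a basis of \<open>A\<close> over \<open>R\<close> indexed by itself.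
  As \<open>restrict_scalars\<close> uses the left action, \<open>central\<close> enters where right
  linearity over \<open>A\<close> has to give linearity over \<open>R\<close>, as in
  \<open>n_hom\<close> and \<open>r_scalar\<close>.\<close>

locale local_morita = local_base R k \<pi> + A: assoc_algebra R A + Q: morita_bimodule A M "smult M" "rsmult M" S x f T w n
  for R :: "'r ring" and k :: "'k ring" and \<pi> :: "'r \<Rightarrow> 'k" and A :: "('r, 'a) module" and M :: "('a, 'm) bimodule"
    and S x f T w n +
  fixes X :: "'a set" and \<phi> :: "'a \<Rightarrow> 'a \<Rightarrow> 'r"
  assumes A_basis: "coordinates R A X (\<lambda>b. b) \<phi>"
    and central: "\<lbrakk>t \<in> carrier R; y \<in> carrier M\<rbrakk> \<Longrightarrow> (t \<odot>\<^bsub>A\<^esub> \<one>\<^bsub>A\<^esub>) \<odot>\<^bsub>M\<^esub> y = rsmult M y (t \<odot>\<^bsub>A\<^esub> \<one>\<^bsub>A\<^esub>)"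
begin

abbreviation "MR \<equiv> restrict_scalars A M"
abbreviation "Ab \<equiv> bc A"
abbreviation "Mb \<equiv> bc MR"

lemmas A_module = A.module_axioms

lemma unit_scalar: "t \<in> carrier R \<Longrightarrow> t \<odot>\<^bsub>A\<^esub> \<one>\<^bsub>A\<^esub> \<in> carrier A"
  by simp

lemma scalar_left: "\<lbrakk>t \<in> carrier R; a \<in> carrier A\<rbrakk> \<Longrightarrow> (t \<odot>\<^bsub>A\<^esub> \<one>\<^bsub>A\<^esub>) \<otimes>\<^bsub>A\<^esub> a = t \<odot>\<^bsub>A\<^esub> a"
  by (simp add: A.smult_mult_left)

lemma scalar_right: "\<lbrakk>t \<in> carrier R; a \<in> carrier A\<rbrakk> \<Longrightarrow> a \<otimes>\<^bsub>A\<^esub> (t \<odot>\<^bsub>A\<^esub> \<one>\<^bsub>A\<^esub>) = t \<odot>\<^bsub>A\<^esub> a"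
  by (simp add: A.smult_mult_right)

lemma MR_module: "module R MR"
proof (rule moduleI)
  show "cring R" by (rule R.is_cring)
  show "abelian_group MR"
  proof (rule abelian_groupI)
    show "\<exists>y\<in>carrier MR. y \<oplus>\<^bsub>MR\<^esub> z = \<zero>\<^bsub>MR\<^esub>" if "z \<in> carrier MR" for z
      using that Q.M.l_neg[of z] by (intro bexI[of _ "\<ominus>\<^bsub>M\<^esub> z"]) (auto simp: restrict_scalars_simps)
  qed (auto simp: restrict_scalars_simps Q.M.a_ac)
  show "(s \<otimes>\<^bsub>R\<^esub> t) \<odot>\<^bsub>MR\<^esub> y = s \<odot>\<^bsub>MR\<^esub> (t \<odot>\<^bsub>MR\<^esub> y)" if "s \<in> carrier R" "t \<in> carrier R" "y \<in> carrier MR" for s t y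
  proof -
    have "(s \<otimes>\<^bsub>R\<^esub> t) \<odot>\<^bsub>A\<^esub> \<one>\<^bsub>A\<^esub> = (s \<odot>\<^bsub>A\<^esub> \<one>\<^bsub>A\<^esub>) \<otimes>\<^bsub>A\<^esub> (t \<odot>\<^bsub>A\<^esub> \<one>\<^bsub>A\<^esub>)"
      using that by (simp add: scalar_left A.smult_assoc1)
    then show ?thesis using that by (simp add: restrict_scalars_simps Q.l_assoc)
  qed
qed (auto simp: restrict_scalars_simps Q.l_closed Q.l_one A.smult_l_distr Q.l_add_left Q.l_add_right)

lemma f_hom: "s \<in> S \<Longrightarrow> f s \<in> module_hom R MR A"
  by (rule module_homI)
    (auto simp: restrict_scalars_simps Q.f_closed additive_map_add[OF Q.f_additive] Q.f_linear scalar_left)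

lemma n_hom: "t \<in> T \<Longrightarrow> n t \<in> module_hom R MR A"
  by (rule module_homI)
    (auto simp: restrict_scalars_simps Q.n_closed additive_map_add[OF Q.n_additive] central Q.n_linear scalar_right)

lemma l_hom: "a \<in> carrier A \<Longrightarrow> (\<lambda>y. a \<odot>\<^bsub>M\<^esub> y) \<in> module_hom R MR MR"
  by (rule module_homI)
    (auto simp: restrict_scalars_simps Q.l_closed Q.l_add_right scalar_left scalar_right simp flip: Q.l_assoc)

lemma l_hom_left: "y \<in> carrier M \<Longrightarrow> (\<lambda>a. a \<odot>\<^bsub>M\<^esub> y) \<in> module_hom R A MR"
  by (rule module_homI)
    (auto simp: restrict_scalars_simps Q.l_closed Q.l_add_left scalar_left simp flip: Q.l_assoc)

lemma r_hom: "a \<in> carrier A \<Longrightarrow> (\<lambda>y. rsmult M y a) \<in> module_hom R MR MR"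
  by (rule module_homI) (auto simp: restrict_scalars_simps Q.r_closed Q.r_add_left Q.lr)

lemma r_scalar:
  assumes "t \<in> carrier R" "a \<in> carrier A" "y \<in> carrier M"
  shows "rsmult M y (t \<odot>\<^bsub>A\<^esub> a) = (t \<odot>\<^bsub>A\<^esub> \<one>\<^bsub>A\<^esub>) \<odot>\<^bsub>M\<^esub> rsmult M y a"
proof -
  have "rsmult M y (t \<odot>\<^bsub>A\<^esub> a) = rsmult M (rsmult M y (t \<odot>\<^bsub>A\<^esub> \<one>\<^bsub>A\<^esub>)) a"
    using Q.r_assoc[OF assms(3) unit_scalar[OF assms(1)] assms(2)] scalar_left[OF assms(1,2)] by simp
  then show ?thesis using central[OF assms(1,3)] Q.lr[OF unit_scalar[OF assms(1)] assms(3,2)] by simp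
qed

lemma r_hom_right: "y \<in> carrier M \<Longrightarrow> (\<lambda>a. rsmult M y a) \<in> module_hom R A MR"
  by (rule module_homI) (auto simp: restrict_scalars_simps Q.r_closed Q.r_add_right r_scalar)

lemma A_dual: "dual_basis R A X (\<lambda>b. b) \<phi>"
  using A_basis by (simp add: coordinates_def)

text \<open>Transitivity of projectivity: an element is expanded over \<open>A\<close> by the
  \<open>f s\<close>, and its coefficients are expanded in the basis \<open>X\<close>.\<close>

lemma MR_dual: "dual_basis R MR (S \<times> X) (\<lambda>p. snd p \<odot>\<^bsub>M\<^esub> x (fst p)) (\<lambda>p y. \<phi> (snd p) (f (fst p) y))"
proof -
  note bX = dual_basis_closed(1)[OF A_dual] and \<phi>c = dual_basis_closed(2)[OF A_dual]
  have finX: "finite X" using A_dual by (simp add: dual_basis_def)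
  have "(\<Oplus>\<^bsub>M\<^esub>p\<in>S \<times> X. \<phi> (snd p) (f (fst p) y) \<odot>\<^bsub>MR\<^esub> (snd p \<odot>\<^bsub>M\<^esub> x (fst p))) = y" if y: "y \<in> carrier M" for y
  proof -
    have fc: "f s y \<in> carrier A" if "s \<in> S" for s using Q.f_closed that y by blast
    have tc: "\<phi> b (f s y) \<odot>\<^bsub>MR\<^esub> (b \<odot>\<^bsub>M\<^esub> x s) = (\<phi> b (f s y) \<odot>\<^bsub>A\<^esub> b) \<odot>\<^bsub>M\<^esub> x s" if "s \<in> S" "b \<in> X" for s b
      using that \<phi>c fc bX Q.x by (simp add: restrict_scalars_simps scalar_left flip: Q.l_assoc)
    have tcc: "(\<phi> b (f s y) \<odot>\<^bsub>A\<^esub> b) \<odot>\<^bsub>M\<^esub> x s \<in> carrier M" if "s \<in> S" "b \<in> X" for s b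
      using that \<phi>c fc bX Q.x Q.l_closed by simp
    have "(\<Oplus>\<^bsub>M\<^esub>p\<in>S \<times> X. \<phi> (snd p) (f (fst p) y) \<odot>\<^bsub>MR\<^esub> (snd p \<odot>\<^bsub>M\<^esub> x (fst p)))
        = (\<Oplus>\<^bsub>M\<^esub>p\<in>S \<times> X. (\<phi> (snd p) (f (fst p) y) \<odot>\<^bsub>A\<^esub> snd p) \<odot>\<^bsub>M\<^esub> x (fst p))"
      by (rule Q.M.finsum_cong') (use tc tcc in auto)
    also have "\<dots> = (\<Oplus>\<^bsub>M\<^esub>s\<in>S. \<Oplus>\<^bsub>M\<^esub>b\<in>X. (\<phi> b (f s y) \<odot>\<^bsub>A\<^esub> b) \<odot>\<^bsub>M\<^esub> x s)"
      by (rule Q.M.finsum_Sigma[symmetric]) (use Q.S finX tcc in auto)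
    also have "\<dots> = (\<Oplus>\<^bsub>M\<^esub>s\<in>S. f s y \<odot>\<^bsub>M\<^esub> x s)"
    proof (rule Q.M.finsum_cong')
      fix s assume s: "s \<in> S"
      have "(\<Oplus>\<^bsub>M\<^esub>b\<in>X. (\<phi> b (f s y) \<odot>\<^bsub>A\<^esub> b) \<odot>\<^bsub>M\<^esub> x s) = (\<Oplus>\<^bsub>A\<^esub>b\<in>X. \<phi> b (f s y) \<odot>\<^bsub>A\<^esub> b) \<odot>\<^bsub>M\<^esub> x s"
        by (rule Q.l_finsum_left[OF Q.x[OF s], symmetric]) (use \<phi>c fc s bX in auto)
      then show "(\<Oplus>\<^bsub>M\<^esub>b\<in>X. (\<phi> b (f s y) \<odot>\<^bsub>A\<^esub> b) \<odot>\<^bsub>M\<^esub> x s) = f s y \<odot>\<^bsub>M\<^esub> x s"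
        using dual_basis_eq[OF A_dual fc[OF s]] by simp
    qed (use fc Q.x Q.l_closed in auto)
    also have "\<dots> = y" by (rule Q.f_dual[OF y])
    finally show ?thesis .
  qed
  moreover have "linear_form R MR (\<lambda>y. \<phi> (snd p) (f (fst p) y))" if "p \<in> S \<times> X" for p
    using that by (intro linear_form_comp[OF dual_basis_form[OF A_dual] f_hom]) auto
  ultimately show ?thesis
    unfolding dual_basis_def finsum_restrict_scalars
    using Q.S finX bX Q.x Q.l_closed by (auto simp: restrict_scalars_simps)
qed

text \<open>If two elements have the same reduction, the dual basis coefficients of their difference
  are killed by \<pi>, so its image under the \<open>R\<close>-linear map \<open>h\<close> reduces
  to zero. In this way maps descend without tensoring them with \<open>k\<close>.\<close>

lemma red_hom_cong:
  assumes N: "module R N" and N': "module R N'" and d: "dual_basis R N P y \<psi>" and h: "h \<in> module_hom R N N'"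
    and z: "z \<in> carrier N" "z' \<in> carrier N" "red N z = red N z'"
  shows "red N' (h z) = red N' (h z')"
proof -
  interpret N: module R N by (rule N)
  interpret N': module R N' by (rule N')
  interpret B: module k "bc N" by (rule bc_module[OF N])
  interpret B': module k "bc N'" by (rule bc_module[OF N'])
  note hD = module_homD[OF h]
  let ?u = "z \<ominus>\<^bsub>N\<^esub> z'"
  have u: "?u \<in> carrier N" using z by simp
  have "red N ?u = \<zero>\<^bsub>bc N\<^esub>"
    using red_diff[OF N z(1,2)] z(3) red_closed[OF N z(2)] by (simp add: a_minus_def B.M.r_neg)
  then have \<pi>0: "\<pi> (\<psi> p ?u) = \<zero>\<^bsub>k\<^esub>" if "p \<in> P" for p using red_form[OF N dual_basis_form[OF d that] u] by blast
  have "h ?u = (\<Oplus>\<^bsub>N'\<^esub>p\<in>P. \<psi> p ?u \<odot>\<^bsub>N'\<^esub> h (y p))"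
    using module_hom_lincomb[OF N N' h, of P "\<lambda>p. \<psi> p ?u" y] dual_basis_eq[OF d u] dual_basis_closed[OF d] u by auto
  then have "red N' (h ?u) = (\<Oplus>\<^bsub>bc N'\<^esub>p\<in>P. \<pi> (\<psi> p ?u) \<odot>\<^bsub>bc N'\<^esub> red N' (h (y p)))"
    using red_lincomb[OF N', of P "\<lambda>p. \<psi> p ?u" "\<lambda>p. h (y p)"] dual_basis_closed[OF d] u hD(1) by auto
  also have "\<dots> = \<zero>\<^bsub>bc N'\<^esub>"
    by (rule B'.M.add.finprod_one_eqI) (use \<pi>0 dual_basis_closed(1)[OF d] hD(1) red_closed[OF N'] in auto)
  finally have "red N' (h z) \<ominus>\<^bsub>bc N'\<^esub> red N' (h z') = \<zero>\<^bsub>bc N'\<^esub>"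
    using additive_map_diff[OF N.M.abelian_group_axioms N'.M.abelian_group_axioms hD(2) z(1,2)]
      red_diff[OF N' hD(1)[OF z(1)] hD(1)[OF z(2)]] by simp
  then show ?thesis using red_closed[OF N'] hD(1) z by simp
qed

text \<open>Arbitrary lifts. Each operation on the reductions is defined by lifting the arguments,
  computing there and reducing; \<open>red_hom_cong\<close> removes the dependence on the
  lifts.\<close>

definition lA :: "('k \<times> 'a \<Rightarrow>\<^sub>0 int) set \<Rightarrow> 'a" where "lA b = (SOME a. a \<in> carrier A \<and> b = red A a)"
definition lM :: "('k \<times> 'm \<Rightarrow>\<^sub>0 int) set \<Rightarrow> 'm" where "lM y = (SOME m. m \<in> carrier M \<and> y = red MR m)"

lemma MR_surj: "y \<in> carrier Mb \<Longrightarrow> \<exists>m\<in>carrier M. y = red MR m"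
  using red_surj[OF MR_module] by (simp add: restrict_scalars_simps)

lemma A_surj: "b \<in> carrier Ab \<Longrightarrow> \<exists>a\<in>carrier A. b = red A a"
  using red_surj[OF A_module] by simp

lemma lA: "b \<in> carrier Ab \<Longrightarrow> lA b \<in> carrier A \<and> b = red A (lA b)"
  unfolding lA_def by (rule someI_ex) (use A_surj in blast)

lemma lM: "y \<in> carrier Mb \<Longrightarrow> lM y \<in> carrier M \<and> y = red MR (lM y)"
  unfolding lM_def by (rule someI_ex) (use MR_surj in blast)

lemma redA_closed: "a \<in> carrier A \<Longrightarrow> red A a \<in> carrier Ab"
  using red_closed[OF A_module] .

lemma redM_closed: "m \<in> carrier M \<Longrightarrow> red MR m \<in> carrier Mb"
  using red_closed[OF MR_module] by (simp add: restrict_scalars_simps)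

lemma redM_add: "\<lbrakk>m \<in> carrier M; m' \<in> carrier M\<rbrakk> \<Longrightarrow> red MR (m \<oplus>\<^bsub>M\<^esub> m') = red MR m \<oplus>\<^bsub>Mb\<^esub> red MR m'"
  using red_add[OF MR_module] by (simp add: restrict_scalars_simps)

lemma redM_smult:
  "\<lbrakk>t \<in> carrier R; m \<in> carrier M\<rbrakk> \<Longrightarrow> red MR ((t \<odot>\<^bsub>A\<^esub> \<one>\<^bsub>A\<^esub>) \<odot>\<^bsub>M\<^esub> m) = \<pi> t \<odot>\<^bsub>Mb\<^esub> red MR m"
  using red_smult[OF MR_module] by (simp add: restrict_scalars_simps)

definition lb where "lb b y = red MR (lA b \<odot>\<^bsub>M\<^esub> lM y)"
definition rb where "rb y b = red MR (rsmult M (lM y) (lA b))"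

lemma lb_red: "\<lbrakk>a \<in> carrier A; m \<in> carrier M\<rbrakk> \<Longrightarrow> lb (red A a) (red MR m) = red MR (a \<odot>\<^bsub>M\<^esub> m)"
proof -
  assume a: "a \<in> carrier A" and m: "m \<in> carrier M"
  note la = lA[OF redA_closed[OF a]] and lm = lM[OF redM_closed[OF m]]
  have "lb (red A a) (red MR m) = red MR (a \<odot>\<^bsub>M\<^esub> lM (red MR m))"
    unfolding lb_def by (rule red_hom_cong[OF A_module MR_module A_dual l_hom_left]) (use la lm a in auto)
  also have "\<dots> = red MR (a \<odot>\<^bsub>M\<^esub> m)"
    by (rule red_hom_cong[OF MR_module MR_module MR_dual l_hom[OF a]]) (use lm m in \<open>auto simp: restrict_scalars_simps\<close>)
  finally show ?thesis .
qed

lemma rb_red: "\<lbrakk>a \<in> carrier A; m \<in> carrier M\<rbrakk> \<Longrightarrow> rb (red MR m) (red A a) = red MR (rsmult M m a)"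
proof -
  assume a: "a \<in> carrier A" and m: "m \<in> carrier M"
  note la = lA[OF redA_closed[OF a]] and lm = lM[OF redM_closed[OF m]]
  have "rb (red MR m) (red A a) = red MR (rsmult M (lM (red MR m)) a)"
    unfolding rb_def by (rule red_hom_cong[OF A_module MR_module A_dual r_hom_right]) (use la lm a in auto)
  also have "\<dots> = red MR (rsmult M m a)"
    by (rule red_hom_cong[OF MR_module MR_module MR_dual r_hom[OF a]]) (use lm m in \<open>auto simp: restrict_scalars_simps\<close>)
  finally show ?thesis .
qed

definition fb where "fb s y = red A (f s (lM y))"
definition nb where "nb t y = red A (n t (lM y))"

lemma fb_red: "\<lbrakk>s \<in> S; m \<in> carrier M\<rbrakk> \<Longrightarrow> fb s (red MR m) = red A (f s m)"
  unfolding fb_def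
  by (rule red_hom_cong[OF MR_module A_module MR_dual f_hom]) (use lM[OF redM_closed, of m] in \<open>auto simp: restrict_scalars_simps\<close>)

lemma nb_red: "\<lbrakk>t \<in> T; m \<in> carrier M\<rbrakk> \<Longrightarrow> nb t (red MR m) = red A (n t m)"
  unfolding nb_def
  by (rule red_hom_cong[OF MR_module A_module MR_dual n_hom]) (use lM[OF redM_closed, of m] in \<open>auto simp: restrict_scalars_simps\<close>)

lemma redM_finsum:
  "(\<And>s. s \<in> J \<Longrightarrow> g s \<in> carrier M) \<Longrightarrow> red MR (\<Oplus>\<^bsub>M\<^esub>s\<in>J. g s) = (\<Oplus>\<^bsub>Mb\<^esub>s\<in>J. red MR (g s))"
  using additive_map_finsum[OF _ bc_abelian_group[OF MR_module] red_additive[OF MR_module], of J g] MR_module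
  by (simp add: restrict_scalars_simps finsum_restrict_scalars module_def)

lemma fd_lr_module: "lr_module Ab Mb lb rb"
proof -
  interpret Ab: assoc_algebra k Ab by (rule bc_assoc_algebra[OF A.assoc_algebra_axioms])
  interpret Mb: module k Mb by (rule bc_module[OF MR_module])
  note ad = red_add[OF A_module, symmetric] and mu = red_mult[OF A.assoc_algebra_axioms, symmetric] and on = red_one[symmetric]
    and md = redM_add[symmetric]
  note [simp] = redA_closed redM_closed lb_red rb_red Q.l_closed Q.r_closed
  show ?thesis
  proof
    show "lb a y \<in> carrier Mb" if "a \<in> carrier Ab" "y \<in> carrier Mb" for a y
      using A_surj[OF that(1)] MR_surj[OF that(2)] by auto
    show "lb (a \<oplus>\<^bsub>Ab\<^esub> b) y = lb a y \<oplus>\<^bsub>Mb\<^esub> lb b y" if "a \<in> carrier Ab" "b \<in> carrier Ab" "y \<in> carrier Mb" for a b y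
      using A_surj[OF that(1)] A_surj[OF that(2)] MR_surj[OF that(3)] by (auto simp: ad md Q.l_add_left)
    show "lb a (y \<oplus>\<^bsub>Mb\<^esub> z) = lb a y \<oplus>\<^bsub>Mb\<^esub> lb a z" if "a \<in> carrier Ab" "y \<in> carrier Mb" "z \<in> carrier Mb" for a y z
      using A_surj[OF that(1)] MR_surj[OF that(2)] MR_surj[OF that(3)] by (auto simp: md Q.l_add_right)
    show "lb (a \<otimes>\<^bsub>Ab\<^esub> b) y = lb a (lb b y)" if "a \<in> carrier Ab" "b \<in> carrier Ab" "y \<in> carrier Mb" for a b y
      using A_surj[OF that(1)] A_surj[OF that(2)] MR_surj[OF that(3)] by (auto simp: mu Q.l_assoc)
    show "lb \<one>\<^bsub>Ab\<^esub> y = y" if "y \<in> carrier Mb" for y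
      using MR_surj[OF that] by (auto simp: on Q.l_one)
    show "rb y a \<in> carrier Mb" if "y \<in> carrier Mb" "a \<in> carrier Ab" for a y
      using A_surj[OF that(2)] MR_surj[OF that(1)] by auto
    show "rb y (a \<oplus>\<^bsub>Ab\<^esub> b) = rb y a \<oplus>\<^bsub>Mb\<^esub> rb y b" if "y \<in> carrier Mb" "a \<in> carrier Ab" "b \<in> carrier Ab" for a b y
      using A_surj[OF that(2)] A_surj[OF that(3)] MR_surj[OF that(1)] by (auto simp: ad md Q.r_add_right)
    show "rb (y \<oplus>\<^bsub>Mb\<^esub> z) a = rb y a \<oplus>\<^bsub>Mb\<^esub> rb z a" if "y \<in> carrier Mb" "z \<in> carrier Mb" "a \<in> carrier Ab" for a y z
      using A_surj[OF that(3)] MR_surj[OF that(1)] MR_surj[OF that(2)] by (auto simp: md Q.r_add_left)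
    show "rb y (a \<otimes>\<^bsub>Ab\<^esub> b) = rb (rb y a) b" if "y \<in> carrier Mb" "a \<in> carrier Ab" "b \<in> carrier Ab" for a b y
      using A_surj[OF that(2)] A_surj[OF that(3)] MR_surj[OF that(1)] by (auto simp: mu Q.r_assoc)
    show "rb y \<one>\<^bsub>Ab\<^esub> = y" if "y \<in> carrier Mb" for y
      using MR_surj[OF that] by (auto simp: on Q.r_one)
    show "rb (lb a y) b = lb a (rb y b)" if "a \<in> carrier Ab" "y \<in> carrier Mb" "b \<in> carrier Ab" for a b y
      using A_surj[OF that(1)] A_surj[OF that(3)] MR_surj[OF that(2)] by (auto simp: Q.lr)
  qed
qed

text \<open>Every axiom except \<open>endo\<close> is a closure property or an identity that is
  inherited from \<open>A\<close> and \<open>M\<close> by reduction. For \<open>endo\<close>, an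
  endomorphism of the reduction has to be lifted to \<open>M\<close>, which projectivity
  allows.\<close>

lemma fd_morita_bimodule: "morita_bimodule Ab Mb lb rb S (\<lambda>s. red MR (x s)) fb T (\<lambda>t. red MR (w t)) nb"
proof -
  interpret L: lr_module Ab Mb lb rb by (rule fd_lr_module)
  note ad = red_add[OF A_module, symmetric] and mu = red_mult[OF A.assoc_algebra_axioms, symmetric] and on = red_one[symmetric]
    and md = redM_add[symmetric]
  note [simp] = redA_closed redM_closed lb_red rb_red fb_red nb_red Q.l_closed Q.r_closed Q.f_closed Q.n_closed Q.x Q.w
  show ?thesis
  proof
    show "finite S" "finite T" by (rule Q.S) (rule Q.T)
    show "red MR (x s) \<in> carrier Mb" if "s \<in> S" for s using that by simp
    show "red MR (w t) \<in> carrier Mb" if "t \<in> T" for t using that by simp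
    show "additive_map Mb Ab (fb s)" if "s \<in> S" for s
    proof (rule additive_mapI)
      show "fb s y \<in> carrier Ab" if "y \<in> carrier Mb" for y using MR_surj[OF that] \<open>s \<in> S\<close> by auto
      show "fb s (y \<oplus>\<^bsub>Mb\<^esub> z) = fb s y \<oplus>\<^bsub>Ab\<^esub> fb s z" if "y \<in> carrier Mb" "z \<in> carrier Mb" for y z
        using MR_surj[OF that(1)] MR_surj[OF that(2)] \<open>s \<in> S\<close> by (auto simp: md ad additive_map_add[OF Q.f_additive])
    qed
    show "fb s (lb a y) = a \<otimes>\<^bsub>Ab\<^esub> fb s y" if "s \<in> S" "a \<in> carrier Ab" "y \<in> carrier Mb" for s a y
      using A_surj[OF that(2)] MR_surj[OF that(3)] that(1) by (auto simp: mu Q.f_linear)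
    show "additive_map Mb Ab (nb t)" if "t \<in> T" for t
    proof (rule additive_mapI)
      show "nb t y \<in> carrier Ab" if "y \<in> carrier Mb" for y using MR_surj[OF that] \<open>t \<in> T\<close> by auto
      show "nb t (y \<oplus>\<^bsub>Mb\<^esub> z) = nb t y \<oplus>\<^bsub>Ab\<^esub> nb t z" if "y \<in> carrier Mb" "z \<in> carrier Mb" for y z
        using MR_surj[OF that(1)] MR_surj[OF that(2)] \<open>t \<in> T\<close> by (auto simp: md ad additive_map_add[OF Q.n_additive])
    qed
    show "nb t (rb y a) = nb t y \<otimes>\<^bsub>Ab\<^esub> a" if "t \<in> T" "a \<in> carrier Ab" "y \<in> carrier Mb" for t a y
      using A_surj[OF that(2)] MR_surj[OF that(3)] that(1) by (auto simp: mu Q.n_linear)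
    show "(\<Oplus>\<^bsub>Mb\<^esub>s\<in>S. lb (fb s y) (red MR (x s))) = y" if y: "y \<in> carrier Mb" for y
    proof -
      obtain m where m: "m \<in> carrier M" "y = red MR m" using MR_surj[OF y] by blast
      have "(\<Oplus>\<^bsub>Mb\<^esub>s\<in>S. lb (fb s y) (red MR (x s))) = (\<Oplus>\<^bsub>Mb\<^esub>s\<in>S. red MR (f s m \<odot>\<^bsub>M\<^esub> x s))"
        by (rule L.M.finsum_cong') (use m in auto)
      also have "\<dots> = red MR (\<Oplus>\<^bsub>M\<^esub>s\<in>S. f s m \<odot>\<^bsub>M\<^esub> x s)"
        by (rule redM_finsum[symmetric]) (use m in auto)
      finally show ?thesis using Q.f_dual[OF m(1)] m(2) by simp
    qed
    show "(\<Oplus>\<^bsub>Ab\<^esub>t\<in>T. nb t (red MR (w t))) = \<one>\<^bsub>Ab\<^esub>"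
    proof -
      have "(\<Oplus>\<^bsub>Ab\<^esub>t\<in>T. nb t (red MR (w t))) = (\<Oplus>\<^bsub>Ab\<^esub>t\<in>T. red A (n t (w t)))"
        by (rule L.A.finsum_cong') auto
      also have "\<dots> = red A (\<Oplus>\<^bsub>A\<^esub>t\<in>T. n t (w t))"
        by (rule additive_map_finsum[OF A.M.abelian_group_axioms bc_abelian_group[OF A_module] red_additive[OF A_module], symmetric])
          auto
      finally show ?thesis using Q.n_one red_one[of A] by simp
    qed
    show "\<exists>b\<in>carrier Ab. \<forall>y\<in>carrier Mb. \<theta> y = rb y b"
      if \<theta>: "additive_map Mb Mb \<theta>" and lin: "\<And>a y. \<lbrakk>a \<in> carrier Ab; y \<in> carrier Mb\<rbrakk> \<Longrightarrow> \<theta> (lb a y) = lb a (\<theta> y)" for \<theta>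
    proof -
      note \<theta>c = additive_map_closed[OF \<theta>]
      \<comment> \<open>Lifts of the images of the reduced generators. Through the dual basis they
        define a left linear \<open>?\<phi>\<close> on \<open>M\<close> with no relations to be
        checked, and it reduces to \<open>\<theta>\<close>.\<close>
      define z where "z s = lM (\<theta> (red MR (x s)))" for s
      have z: "z s \<in> carrier M" "red MR (z s) = \<theta> (red MR (x s))" if "s \<in> S" for s
        using lM[OF \<theta>c[OF redM_closed[OF Q.x[OF that]]]] by (auto simp: z_def)
      let ?\<phi> = "\<lambda>m. \<Oplus>\<^bsub>M\<^esub>s\<in>S. f s m \<odot>\<^bsub>M\<^esub> z s"
      have "\<exists>a\<in>carrier A. \<forall>m\<in>carrier M. ?\<phi> m = rsmult M m a"
      proof (rule Q.endo)
        show "additive_map M M ?\<phi>"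
        proof (rule additive_mapI)
          show "?\<phi> m \<in> carrier M" if "m \<in> carrier M" for m using that z by (intro Q.M.finsum_closed) auto
          show "?\<phi> (m \<oplus>\<^bsub>M\<^esub> m') = ?\<phi> m \<oplus>\<^bsub>M\<^esub> ?\<phi> m'" if m: "m \<in> carrier M" "m' \<in> carrier M" for m m'
          proof -
            have "?\<phi> (m \<oplus>\<^bsub>M\<^esub> m') = (\<Oplus>\<^bsub>M\<^esub>s\<in>S. f s m \<odot>\<^bsub>M\<^esub> z s \<oplus>\<^bsub>M\<^esub> f s m' \<odot>\<^bsub>M\<^esub> z s)"
              by (rule Q.M.finsum_cong') (use m z in \<open>auto simp: additive_map_add[OF Q.f_additive] Q.l_add_left\<close>)
            then show ?thesis using Q.M.finsum_addf[of "\<lambda>s. f s m \<odot>\<^bsub>M\<^esub> z s" S "\<lambda>s. f s m' \<odot>\<^bsub>M\<^esub> z s"] m z by auto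
          qed
        qed
        show "?\<phi> (a \<odot>\<^bsub>M\<^esub> m) = a \<odot>\<^bsub>M\<^esub> ?\<phi> m" if a: "a \<in> carrier A" and m: "m \<in> carrier M" for a m
        proof -
          have "a \<odot>\<^bsub>M\<^esub> ?\<phi> m = (\<Oplus>\<^bsub>M\<^esub>s\<in>S. a \<odot>\<^bsub>M\<^esub> (f s m \<odot>\<^bsub>M\<^esub> z s))"
            by (rule Q.l_finsum[OF a]) (use m z in auto)
          also have "\<dots> = ?\<phi> (a \<odot>\<^bsub>M\<^esub> m)"
            by (rule Q.M.finsum_cong') (use a m z in \<open>auto simp: Q.f_linear Q.l_assoc\<close>)
          finally show ?thesis by simp
        qed
      qed
      then obtain a where a: "a \<in> carrier A" "\<And>m. m \<in> carrier M \<Longrightarrow> ?\<phi> m = rsmult M m a" by blast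
      have "\<theta> y = rb y (red A a)" if y: "y \<in> carrier Mb" for y
      proof -
        obtain m where m: "m \<in> carrier M" "y = red MR m" using MR_surj[OF y] by blast
        have "rb y (red A a) = red MR (?\<phi> m)" using m a by simp
        also have "\<dots> = (\<Oplus>\<^bsub>Mb\<^esub>s\<in>S. red MR (f s m \<odot>\<^bsub>M\<^esub> z s))" by (rule redM_finsum) (use m z in auto)
        also have "\<dots> = (\<Oplus>\<^bsub>Mb\<^esub>s\<in>S. \<theta> (red MR (f s m \<odot>\<^bsub>M\<^esub> x s)))"
        proof (rule L.M.finsum_cong')
          fix s assume s: "s \<in> S"
          have "red MR (f s m \<odot>\<^bsub>M\<^esub> z s) = lb (red A (f s m)) (\<theta> (red MR (x s)))" using lb_red[of "f s m" "z s"] s m z by simp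
          also have "\<dots> = \<theta> (lb (red A (f s m)) (red MR (x s)))" using lin[of "red A (f s m)" "red MR (x s)"] s m by simp
          finally show "red MR (f s m \<odot>\<^bsub>M\<^esub> z s) = \<theta> (red MR (f s m \<odot>\<^bsub>M\<^esub> x s))" using s m by simp
        qed (use m \<theta>c in auto)
        also have "\<dots> = \<theta> (\<Oplus>\<^bsub>Mb\<^esub>s\<in>S. red MR (f s m \<odot>\<^bsub>M\<^esub> x s))"
          by (rule additive_map_finsum[OF L.M.abelian_group_axioms L.M.abelian_group_axioms \<theta>, symmetric]) (use m in auto)
        also have "(\<Oplus>\<^bsub>Mb\<^esub>s\<in>S. red MR (f s m \<odot>\<^bsub>M\<^esub> x s)) = red MR (\<Oplus>\<^bsub>M\<^esub>s\<in>S. f s m \<odot>\<^bsub>M\<^esub> x s)"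
          by (rule redM_finsum[symmetric]) (use m in auto)
        finally show ?thesis using Q.f_dual[OF m(1)] m(2) by simp
      qed
      then show ?thesis using a(1) by auto
    qed
  qed
qed

lemma fd_morita:
  assumes "has_rank k Ab d" "has_rank k Mb m"
  shows "fd_morita k Ab d Mb lb rb S (\<lambda>s. red MR (x s)) fb T (\<lambda>t. red MR (w t)) nb m"
proof -
  interpret Ab: assoc_algebra k Ab by (rule bc_assoc_algebra[OF A.assoc_algebra_axioms])
  interpret Q': morita_bimodule Ab Mb lb rb S "\<lambda>s. red MR (x s)" fb T "\<lambda>t. red MR (w t)" nb
    by (rule fd_morita_bimodule)
  interpret D: fd_algebra k Ab d by unfold_locales (use assms k.field_axioms in auto)
  note sm = red_smult[OF A_module, symmetric] and ms = redM_smult[symmetric]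
  note [simp] = redA_closed redM_closed lb_red rb_red Q.l_closed Q.r_closed
  show ?thesis
  proof (intro fd_morita.intro fd_morita_axioms.intro)
    show "fd_algebra k Ab d" by (rule D.fd_algebra_axioms)
    show "morita_bimodule Ab Mb lb rb S (\<lambda>s. red MR (x s)) fb T (\<lambda>t. red MR (w t)) nb" by (rule fd_morita_bimodule)
    show "vectorspace k Mb" by (rule bc_vectorspace[OF MR_module])
    show "has_rank k Mb m" by fact
    fix c b y assume c: "c \<in> carrier k" and b: "b \<in> carrier Ab" and y: "y \<in> carrier Mb"
    obtain t where t: "t \<in> carrier R" "c = \<pi> t" using \<pi>_lift[OF c] by blast
    obtain a where a: "a \<in> carrier A" "b = red A a" using A_surj[OF b] by blast
    obtain u where u: "u \<in> carrier M" "y = red MR u" using MR_surj[OF y] by blast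
    have e1: "(t \<odot>\<^bsub>A\<^esub> a) \<odot>\<^bsub>M\<^esub> u = (t \<odot>\<^bsub>A\<^esub> \<one>\<^bsub>A\<^esub>) \<odot>\<^bsub>M\<^esub> (a \<odot>\<^bsub>M\<^esub> u)"
      using t a u by (simp add: scalar_left flip: Q.l_assoc)
    have e2: "a \<odot>\<^bsub>M\<^esub> ((t \<odot>\<^bsub>A\<^esub> \<one>\<^bsub>A\<^esub>) \<odot>\<^bsub>M\<^esub> u) = (t \<odot>\<^bsub>A\<^esub> \<one>\<^bsub>A\<^esub>) \<odot>\<^bsub>M\<^esub> (a \<odot>\<^bsub>M\<^esub> u)"
      using t a u by (simp add: scalar_left scalar_right flip: Q.l_assoc)
    show "lb (c \<odot>\<^bsub>Ab\<^esub> b) y = c \<odot>\<^bsub>Mb\<^esub> lb b y" using t a u e1 by (simp add: sm ms)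
    show "lb b (c \<odot>\<^bsub>Mb\<^esub> y) = c \<odot>\<^bsub>Mb\<^esub> lb b y" using t a u e2 by (simp add: sm ms)
    show "rb y (c \<odot>\<^bsub>Ab\<^esub> b) = c \<odot>\<^bsub>Mb\<^esub> rb y b" using t a u r_scalar by (simp add: sm ms)
    show "rb (c \<odot>\<^bsub>Mb\<^esub> y) b = c \<odot>\<^bsub>Mb\<^esub> rb y b" using t a u by (simp add: sm ms Q.lr)
  qed
qed

end

section \<open>Free generators and automorphisms\<close>

context local_morita
begin

text \<open>The products of the basis elements in \<open>X\<close> with \<open>y\<close> reduce to
  the image of a basis of the reduced algebra under the given bijection. By
  \<open>lift_coordinates\<close> they form a basis of \<open>M\<close>, and a linear map that takes
  a basis to a basis is bijective.\<close>

lemma lift_generator: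
  assumes y': "y' \<in> carrier Mb" and bij: "bij_betw (\<lambda>b. lb b y') (carrier Ab) (carrier Mb)"
  shows "\<exists>y\<in>carrier M. bij_betw (\<lambda>a. a \<odot>\<^bsub>M\<^esub> y) (carrier A) (carrier M)"
proof -
  interpret Ab: module k Ab by (rule bc_module[OF A_module])
  interpret Mb: module k Mb by (rule bc_module[OF MR_module])
  interpret MR: module R MR by (rule MR_module)
  interpret L: lr_module Ab Mb lb rb by (rule fd_lr_module)
  obtain y where y: "y \<in> carrier M" "y' = red MR y" using MR_surj[OF y'] by blast
  note bX = dual_basis_closed(1)[OF A_dual] and \<phi>c = dual_basis_closed(2)[OF A_dual]
  have finX: "finite X" using A_dual by (simp add: dual_basis_def)
  have hom: "(\<lambda>b. lb b y') \<in> module_hom k Ab Mb"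
  proof (rule module_homI)
    show "lb (c \<odot>\<^bsub>Ab\<^esub> b) y' = c \<odot>\<^bsub>Mb\<^esub> lb b y'" if c: "c \<in> carrier k" and b: "b \<in> carrier Ab" for c b
    proof -
      obtain t where t: "t \<in> carrier R" "c = \<pi> t" using \<pi>_lift[OF c] by blast
      obtain a where a: "a \<in> carrier A" "b = red A a" using A_surj[OF b] by blast
      have "(t \<odot>\<^bsub>A\<^esub> a) \<odot>\<^bsub>M\<^esub> y = (t \<odot>\<^bsub>A\<^esub> \<one>\<^bsub>A\<^esub>) \<odot>\<^bsub>M\<^esub> (a \<odot>\<^bsub>M\<^esub> y)"
        using t a y by (simp add: scalar_left flip: Q.l_assoc)
      then show ?thesis
        using t a y by (simp add: red_smult[OF A_module, symmetric] lb_red redM_smult[symmetric] Q.l_closed)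
    qed
  qed (use y' L.l_closed L.l_add_left in auto)
  obtain \<chi> where "coordinates k Ab X (\<lambda>b. red A b) \<chi>" using reduce_coordinates[OF A_module A_basis] by blast
  from coordinates_iso[OF Ab.module_axioms Mb.module_axioms hom bij this]
  have c: "coordinates k Mb X (\<lambda>b. red MR (b \<odot>\<^bsub>M\<^esub> y)) (\<lambda>b z. \<chi> b (inv_into (carrier Ab) (\<lambda>b. lb b y') z))"
    by (rule coordinates_cong[OF Mb.module_axioms]) (use bX y lb_red in auto)
  have "\<exists>\<psi>. coordinates R MR X (\<lambda>b. b \<odot>\<^bsub>M\<^esub> y) \<psi>"
    by (rule lift_coordinates[OF MR_module MR_dual _ c]) (use bX y Q.l_closed in \<open>auto simp: restrict_scalars_simps\<close>)
  then obtain \<psi> where \<psi>: "coordinates R MR X (\<lambda>b. b \<odot>\<^bsub>M\<^esub> y) \<psi>" by blast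
  then have d: "dual_basis R MR X (\<lambda>b. b \<odot>\<^bsub>M\<^esub> y) \<psi>" by (simp add: coordinates_def)
  have ly: "(\<lambda>a. a \<odot>\<^bsub>M\<^esub> y) \<in> module_hom R A MR" by (rule l_hom_left[OF y(1)])
  have expand: "(\<Oplus>\<^bsub>A\<^esub>b\<in>X. c b \<odot>\<^bsub>A\<^esub> b) \<odot>\<^bsub>M\<^esub> y = (\<Oplus>\<^bsub>MR\<^esub>b\<in>X. c b \<odot>\<^bsub>MR\<^esub> (b \<odot>\<^bsub>M\<^esub> y))" if "\<And>b. b \<in> X \<Longrightarrow> c b \<in> carrier R" for c
    using module_hom_lincomb[OF A_module MR_module ly, of X c "\<lambda>b. b"] that bX by auto
  have "bij_betw (\<lambda>a. a \<odot>\<^bsub>M\<^esub> y) (carrier A) (carrier M)"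
  proof (rule bij_betw_byWitness[of _ "\<lambda>z. \<Oplus>\<^bsub>A\<^esub>b\<in>X. \<psi> b z \<odot>\<^bsub>A\<^esub> b"])
    show "\<forall>a\<in>carrier A. (\<Oplus>\<^bsub>A\<^esub>b\<in>X. \<psi> b (a \<odot>\<^bsub>M\<^esub> y) \<odot>\<^bsub>A\<^esub> b) = a"
    proof
      fix a assume a: "a \<in> carrier A"
      have "\<psi> b (a \<odot>\<^bsub>M\<^esub> y) = \<phi> b a" if b: "b \<in> X" for b
        using MR.coordinates_lincomb[OF \<psi> _ b, of "\<lambda>b. \<phi> b a"] expand[of "\<lambda>b. \<phi> b a"] \<phi>c a dual_basis_eq[OF A_dual a] by simp
      then have "(\<Oplus>\<^bsub>A\<^esub>b\<in>X. \<psi> b (a \<odot>\<^bsub>M\<^esub> y) \<odot>\<^bsub>A\<^esub> b) = (\<Oplus>\<^bsub>A\<^esub>b\<in>X. \<phi> b a \<odot>\<^bsub>A\<^esub> b)"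
        using \<phi>c a bX by (intro A.M.finsum_cong') auto
      then show "(\<Oplus>\<^bsub>A\<^esub>b\<in>X. \<psi> b (a \<odot>\<^bsub>M\<^esub> y) \<odot>\<^bsub>A\<^esub> b) = a" using dual_basis_eq[OF A_dual a] by simp
    qed
    show "\<forall>z\<in>carrier M. (\<Oplus>\<^bsub>A\<^esub>b\<in>X. \<psi> b z \<odot>\<^bsub>A\<^esub> b) \<odot>\<^bsub>M\<^esub> y = z"
    proof
      fix z assume z: "z \<in> carrier M"
      then have z': "z \<in> carrier MR" by (simp add: restrict_scalars_simps)
      show "(\<Oplus>\<^bsub>A\<^esub>b\<in>X. \<psi> b z \<odot>\<^bsub>A\<^esub> b) \<odot>\<^bsub>M\<^esub> y = z"
        using expand[of "\<lambda>b. \<psi> b z"] dual_basis_closed(2)[OF d] dual_basis_eq[OF d z'] z' by simp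
    qed
    show "(\<lambda>a. a \<odot>\<^bsub>M\<^esub> y) ` carrier A \<subseteq> carrier M" using y Q.l_closed by auto
    show "(\<lambda>z. \<Oplus>\<^bsub>A\<^esub>b\<in>X. \<psi> b z \<odot>\<^bsub>A\<^esub> b) ` carrier M \<subseteq> carrier A"
      using dual_basis_closed(2)[OF d] bX by (auto simp: restrict_scalars_simps intro!: A.M.finsum_closed)
  qed
  then show ?thesis using y by blast
qed

text \<open>Elements of \<open>A\<close> with the same product with \<open>y\<close> are equal, so
  the laws for \<alpha>, and for the inverse \<open>h\<close> of multiplication by \<open>y\<close>,
  are obtained by applying both sides to \<open>y\<close>. Bijectivity of \<alpha> needs more:
  faithfulness and the description of left endomorphisms.\<close>

lemma generator_twist:
  assumes y: "y \<in> carrier M" and bij: "bij_betw (\<lambda>a. a \<odot>\<^bsub>M\<^esub> y) (carrier A) (carrier M)"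
  shows "\<exists>\<alpha>. algebra_automorphism R A \<alpha> \<and> bimodule_isomorphic A M (twisted_bimodule A \<alpha>)"
proof -
  define h where "h = inv_into (carrier A) (\<lambda>a. a \<odot>\<^bsub>M\<^esub> y)"
  have hc: "h m \<in> carrier A" and hy: "h m \<odot>\<^bsub>M\<^esub> y = m" if "m \<in> carrier M" for m
  proof -
    have "m \<in> (\<lambda>a. a \<odot>\<^bsub>M\<^esub> y) ` carrier A" using bij that by (simp add: bij_betw_def)
    then show "h m \<in> carrier A" "h m \<odot>\<^bsub>M\<^esub> y = m"
      unfolding h_def by (rule inv_into_into, rule f_inv_into_f)
  qed
  have cancel: "a = b" if "a \<odot>\<^bsub>M\<^esub> y = b \<odot>\<^bsub>M\<^esub> y" "a \<in> carrier A" "b \<in> carrier A" for a b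
    using bij that by (auto simp: bij_betw_def inj_on_def)
  define \<alpha> where "\<alpha> a = h (rsmult M y a)" for a
  have \<alpha>c: "\<alpha> a \<in> carrier A" and \<alpha>y: "\<alpha> a \<odot>\<^bsub>M\<^esub> y = rsmult M y a" if "a \<in> carrier A" for a
    unfolding \<alpha>_def using hc hy Q.r_closed[OF y that] by auto
  have mult: "\<alpha> (a \<otimes>\<^bsub>A\<^esub> b) = \<alpha> a \<otimes>\<^bsub>A\<^esub> \<alpha> b" if ab: "a \<in> carrier A" "b \<in> carrier A" for a b
  proof (rule cancel)
    have "\<alpha> (a \<otimes>\<^bsub>A\<^esub> b) \<odot>\<^bsub>M\<^esub> y = rsmult M (rsmult M y a) b" using \<alpha>y ab Q.r_assoc[OF y ab] by simp
    also have "\<dots> = \<alpha> a \<odot>\<^bsub>M\<^esub> rsmult M y b" using \<alpha>y[OF ab(1)] Q.lr[OF \<alpha>c[OF ab(1)] y ab(2)] by simp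
    also have "\<dots> = (\<alpha> a \<otimes>\<^bsub>A\<^esub> \<alpha> b) \<odot>\<^bsub>M\<^esub> y" using \<alpha>y[OF ab(2)] \<alpha>c ab y by (simp add: Q.l_assoc)
    finally show "\<alpha> (a \<otimes>\<^bsub>A\<^esub> b) \<odot>\<^bsub>M\<^esub> y = (\<alpha> a \<otimes>\<^bsub>A\<^esub> \<alpha> b) \<odot>\<^bsub>M\<^esub> y" .
  qed (use \<alpha>c ab in auto)
  have add: "\<alpha> (a \<oplus>\<^bsub>A\<^esub> b) = \<alpha> a \<oplus>\<^bsub>A\<^esub> \<alpha> b" if ab: "a \<in> carrier A" "b \<in> carrier A" for a b
    by (rule cancel) (use \<alpha>c \<alpha>y ab y in \<open>auto simp: Q.l_add_left Q.r_add_right\<close>)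
  have one: "\<alpha> \<one>\<^bsub>A\<^esub> = \<one>\<^bsub>A\<^esub>"
    by (rule cancel) (use \<alpha>c \<alpha>y y in \<open>auto simp: Q.l_one Q.r_one\<close>)
  have scale: "\<alpha> (t \<odot>\<^bsub>A\<^esub> a) = t \<odot>\<^bsub>A\<^esub> \<alpha> a" if ta: "t \<in> carrier R" "a \<in> carrier A" for t a
  proof (rule cancel)
    have "\<alpha> (t \<odot>\<^bsub>A\<^esub> a) \<odot>\<^bsub>M\<^esub> y = (t \<odot>\<^bsub>A\<^esub> \<one>\<^bsub>A\<^esub>) \<odot>\<^bsub>M\<^esub> (\<alpha> a \<odot>\<^bsub>M\<^esub> y)"
      using \<alpha>y ta r_scalar[OF ta y] by simp
    also have "\<dots> = (t \<odot>\<^bsub>A\<^esub> \<alpha> a) \<odot>\<^bsub>M\<^esub> y"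
      using Q.l_assoc[OF unit_scalar[OF ta(1)] \<alpha>c[OF ta(2)] y] scalar_left[OF ta(1) \<alpha>c[OF ta(2)]] by simp
    finally show "\<alpha> (t \<odot>\<^bsub>A\<^esub> a) \<odot>\<^bsub>M\<^esub> y = (t \<odot>\<^bsub>A\<^esub> \<alpha> a) \<odot>\<^bsub>M\<^esub> y" .
  qed (use \<alpha>c ta in auto)
  have hr: "h (rsmult M m a) = h m \<otimes>\<^bsub>A\<^esub> \<alpha> a" if m: "m \<in> carrier M" and a: "a \<in> carrier A" for m a
  proof (rule cancel)
    have "h (rsmult M m a) \<odot>\<^bsub>M\<^esub> y = rsmult M (h m \<odot>\<^bsub>M\<^esub> y) a" using hy m a Q.r_closed by simp
    also have "\<dots> = (h m \<otimes>\<^bsub>A\<^esub> \<alpha> a) \<odot>\<^bsub>M\<^esub> y"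
      using Q.lr[OF hc[OF m] y a] \<alpha>y[OF a] Q.l_assoc[OF hc[OF m] \<alpha>c[OF a] y] by simp
    finally show "h (rsmult M m a) \<odot>\<^bsub>M\<^esub> y = (h m \<otimes>\<^bsub>A\<^esub> \<alpha> a) \<odot>\<^bsub>M\<^esub> y" .
  qed (use m a hc \<alpha>c Q.r_closed in auto)
  have hl: "h (a \<odot>\<^bsub>M\<^esub> m) = a \<otimes>\<^bsub>A\<^esub> h m" if "a \<in> carrier A" "m \<in> carrier M" for a m
    by (rule cancel) (use that hc hy y in \<open>auto simp: Q.l_assoc Q.l_closed\<close>)
  have hadd: "h (m \<oplus>\<^bsub>M\<^esub> m') = h m \<oplus>\<^bsub>A\<^esub> h m'" if "m \<in> carrier M" "m' \<in> carrier M" for m m'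
    by (rule cancel) (use that hc hy y in \<open>auto simp: Q.l_add_left\<close>)
  \<comment> \<open>By \<open>hr\<close> the right action of \<open>a\<close> on \<open>M\<close> is
    determined by \<open>\<alpha> a\<close>, so faithfulness applies.\<close>
  have inj: "a = b" if ab: "a \<in> carrier A" "b \<in> carrier A" and eq: "\<alpha> a = \<alpha> b" for a b
  proof (rule Q.faithful[OF ab])
    fix m assume m: "m \<in> carrier M"
    have "h (rsmult M m a) = h (rsmult M m b)" using hr m ab eq by simp
    then show "rsmult M m a = rsmult M m b" using hy Q.r_closed m ab by metis
  qed
  \<comment> \<open>Taking \<open>c y\<close> to \<open>c b y\<close> is a left endomorphism, hence
    right multiplication by some \<open>a\<close>. At \<open>y\<close> itself this reads
    \<open>y a = b y\<close>, that is \<open>\<alpha> a = b\<close>.\<close>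
  have surj: "\<exists>a\<in>carrier A. \<alpha> a = b" if b: "b \<in> carrier A" for b
  proof -
    have "\<exists>a\<in>carrier A. \<forall>m\<in>carrier M. (h m \<otimes>\<^bsub>A\<^esub> b) \<odot>\<^bsub>M\<^esub> y = rsmult M m a"
    proof (rule Q.endo)
      show "additive_map M M (\<lambda>m. (h m \<otimes>\<^bsub>A\<^esub> b) \<odot>\<^bsub>M\<^esub> y)"
        by (rule additive_mapI) (use b hc y in \<open>auto simp: hadd A.l_distr Q.l_add_left Q.l_closed\<close>)
    qed (use b hc y in \<open>auto simp: hl A.m_assoc Q.l_assoc Q.l_closed\<close>)
    then obtain a where a: "a \<in> carrier A" "(h y \<otimes>\<^bsub>A\<^esub> b) \<odot>\<^bsub>M\<^esub> y = rsmult M y a" using y by blast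
    have "h y = \<one>\<^bsub>A\<^esub>" by (rule cancel) (use hc hy y in \<open>auto simp: Q.l_one\<close>)
    then have "\<alpha> a = b" using a \<alpha>y[OF a(1)] b \<alpha>c by (intro cancel) auto
    then show ?thesis using a by blast
  qed
  have "\<alpha> \<in> ring_iso A A"
    unfolding ring_iso_def bij_betw_def
  proof (intro CollectI conjI)
    show "\<alpha> \<in> ring_hom A A" by (rule ring_hom_memI) (use \<alpha>c mult add one in auto)
    show "inj_on \<alpha> (carrier A)" using inj by (auto simp: inj_on_def)
    show "\<alpha> ` carrier A = carrier A" using \<alpha>c surj by auto
  qed
  then have "algebra_automorphism R A \<alpha>" using scale by (simp add: algebra_automorphism_def)
  moreover have "bimodule_isomorphic A M (twisted_bimodule A \<alpha>)"
    unfolding bimodule_isomorphic_def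
  proof (intro bexI conjI ballI)
    show "bij_betw h (carrier M) (carrier (twisted_bimodule A \<alpha>))"
      unfolding h_def using bij_betw_inv_into[OF bij] by (simp add: twisted_bimodule_def)
    show "h \<in> module_hom A M (twisted_bimodule A \<alpha>)"
      by (rule module_homI) (auto simp: twisted_bimodule_def hc hadd hl)
  qed (use hr in \<open>simp add: twisted_bimodule_def\<close>)
  ultimately show ?thesis by blast
qed

text \<open>The twist changes the right action only, so the isomorphism moves a basis of
  \<open>M\<close> over \<open>R\<close> to one of \<open>A\<close>, whatever \<alpha> is. Its
  length is compared with \<open>rk R A\<close> through the dimension of the reduction.\<close>

lemma twist_rank:
  assumes "bimodule_isomorphic A M (twisted_bimodule A \<alpha>)"
  shows "rk R MR = rk R A"
proof -
  obtain h where h: "h \<in> module_hom A M (twisted_bimodule A \<alpha>)" "bij_betw h (carrier M) (carrier A)"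
    using assms by (auto simp: bimodule_isomorphic_def twisted_bimodule_def)
  have "h \<in> module_hom R MR A"
    by (rule module_homI)
      (use module_homD(1,3)[OF h(1)] additive_map_add[OF module_homD(2)[OF h(1)]] in
        \<open>auto simp: restrict_scalars_simps twisted_bimodule_def scalar_left\<close>)
  moreover obtain m where m: "has_rank R MR m" "rk R MR = m" using rank_reduction[OF MR_module MR_dual] by blast
  ultimately have "has_rank R A m"
    using has_rank_iso[OF MR_module A_module] h(2) by (simp add: restrict_scalars_simps)
  then obtain z \<psi> where "coordinates R A {..<m} z \<psi>" by (auto simp: has_rank_def)
  then obtain \<chi> where "coordinates k Ab {..<m} (\<lambda>j. red A (z j)) \<chi>" using reduce_coordinates[OF A_module] by blast
  then have "has_rank k Ab m" by (auto simp: has_rank_def)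
  moreover obtain d where "has_rank k Ab d" "rk R A = d" using rank_reduction[OF A_module A_dual] by blast
  ultimately show ?thesis using has_rank_dim[OF bc_vectorspace[OF A_module]] m(2) by metis
qed

lemma rank_theorem:
  assumes "primitive_idempotent_representatives Ab I"
    and "symmetric_matrix I (cartan_matrix k Ab)" and "positive_definite_matrix I (cartan_matrix k Ab)"
  shows "rk R MR \<le> rk R A \<and> (rk R MR = rk R A \<longleftrightarrow>
    (\<exists>\<alpha>. algebra_automorphism R A \<alpha> \<and> bimodule_isomorphic A M (twisted_bimodule A \<alpha>)))"
proof -
  obtain d where d: "has_rank k Ab d" "rk R A = d" using rank_reduction[OF A_module A_dual] by blast
  obtain m where m: "has_rank k Mb m" "rk R MR = m" using rank_reduction[OF MR_module MR_dual] by blast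
  note bound = fd_morita.rank_bound[OF fd_morita[OF d(1) m(1)] assms]
  have "\<exists>\<alpha>. algebra_automorphism R A \<alpha> \<and> bimodule_isomorphic A M (twisted_bimodule A \<alpha>)" if "m = d"
    using bound(2)[OF that] lift_generator generator_twist by blast
  then show ?thesis using bound(1) d(2) m(2) twist_rank by blast
qed

end

theorem theorem1p4:
  fixes p :: nat
    and k :: "'k ring" and R :: "'r ring" and \<pi> :: "'r \<Rightarrow> 'k"
    and A :: "('r, 'a) module"
    and I :: "('k \<times> 'a \<Rightarrow>\<^sub>0 int) set set"
    and M :: "('a, 'm) bimodule"
  assumes "prime p"
    and "coefficient_ring p k R \<pi>"
    and "assoc_algebra R A"
    and "free_of_finite_rank R A"
    and "split_algebra k (scalar_extension k R \<pi> A)"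
    and "primitive_idempotent_representatives (scalar_extension k R \<pi> A) I"
    and "symmetric_matrix I (cartan_matrix k (scalar_extension k R \<pi> A))"
    and "positive_definite_matrix I (cartan_matrix k (scalar_extension k R \<pi> A))"
    and "invertible_bimodule TYPE('n) R A M"
  shows "rk R (restrict_scalars A M) \<le> rk R A \<and>
    (rk R (restrict_scalars A M) = rk R A \<longleftrightarrow>
      (\<exists>\<alpha>. algebra_automorphism R A \<alpha> \<and> bimodule_isomorphic A M (twisted_bimodule A \<alpha>)))"
proof -
  have ring: "ring A" using assms(3) by (simp add: assoc_algebra_def)
  obtain S x f T w n where morita: "morita_bimodule A M (smult M) (rsmult M) S x f T w n"
    using invertible_bimodule_morita[OF ring assms(9)] by blast
  obtain X \<phi> where basis: "coordinates R A X (\<lambda>b. b) \<phi>"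
    using assms(4) finite_basis_coordinates unfolding free_of_finite_rank_def by blast
  interpret bimodule R A M using assms(9) by (simp add: invertible_bimodule_def biprojective_bimodule_def)
  have "local_morita R k \<pi> A M S x f T w n X \<phi>"
    by (intro local_morita.intro local_morita_axioms.intro coefficient_ring_local_base[OF assms(2)] assms(3) morita basis central)
  then show ?thesis by (rule local_morita.rank_theorem[OF _ assms(6-8)])
qed

end
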